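(* Fix $1<p<\infty$. For $n\ge 2$ let $j(n)\in\{0,\dots,n-1\}$ and let $X_n=(X_{1;n},\dots,X_{n;n})$ be a random point on $\partial\mathbb B_p^n$ distributed according to the normalized curvature measure $\Phi_{j(n)}(\mathbb B_p^n,\cdot)/V_{j(n)}(\mathbb B_p^n)$, i.e. $\mathbb P[X_n\in A]=\Phi_{j(n)}(\mathbb B_p^n,A)/V_{j(n)}(\mathbb B_p^n)$ for all Borel $A\subseteq\partial\mathbb B_p^n$. (i) (Bulk regime.) Suppose $j(n)/n\to\alpha\in(0,1)$ as $n\to\infty$. Then, for every $r\in\mathbb N$, as $n\to\infty$, $$ n^{1/p}(X_{1;n},\dots,X_{r;n})\ \longrightarrow\ (p/\alpha)^{1/p}\,(\xi_1^{(\alpha)},\dots,\xi_r^{(\alpha)})\quad\text{weakly}, $$ where $\xi_1^{(\alpha)},\dots,\xi_r^{(\alpha)}$ are independent and each has the density $$ f_{p,\alpha}(u)=\alpha\,\frac{e^{-|u|^p-\theta_{p,\alpha}|u|^{2p-2}}}{\mathcal I_p(\theta_{p,\alpha})}+(1-\alpha)\,\frac{|u|^{p-2}e^{-|u|^p-\theta_{p,\alpha}|u|^{2p-2}}}{\mathcal J_p(\theta_{p,\alpha})},\qquad u\in\mathbb R . $$ Here $\theta_{p,\alpha}$ is the unique solution in $(0,\infty)$ of $$ \theta_{p,\alpha}\,\frac{\mathcal J_p(\theta_{p,\alpha})}{\mathcal I_p(\theta_{p,\alpha})}=\frac{(1-\alpha)p}{2(p-1)\alpha}. $$ (ii) (Left-edge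 regime.) Let $j\in\mathbb N\cup\{0\}$ be constant and $j(n)=j$ for all sufficiently large $n$. Then, for every $r\in\mathbb N$, as $n\to\infty$, $$ n^{1/p}(X_{1;n},\dots,X_{r;n})\ \longrightarrow\ p^{1/p}(\eta_1,\dots,\eta_r)\quad\text{weakly}, $$ where $\eta_1,\dots,\eta_r$ are independent and each has the density $$ g_p(u)=\frac{(p-1)\sqrt{\lambda_0}}{\sqrt\pi}\,|u|^{p-2}e^{-\lambda_0|u|^{2p-2}},\quad u\in\mathbb R,\qquad \lambda_0:=\left(\frac{p\,\Gamma\!\left(\frac{2p-1}{2p-2}\right)}{\sqrt\pi}\right)^{\frac{2(p-1)}{p}} . $$ (iii) (Right-edge regime.) Let $m\in\mathbb N$ be fixed and $j(n)=n-m$ for all sufficiently large $n$. Then, for every $r\in\mathbb N$, as $n\to\infty$, $$ n^{1/p}(X_{1;n},\dots,X_{r;n})\ \longrightarrow\ p^{1/p}(\xi_1,\dots,\xi_r)\quad\text{weakly}, $$ where $\xi_1,\dots,\xi_r$ are independent and each has the $p$-Gaussian density $f_p(u)=\frac1{2\Gamma(1+\frac1p)}e^{-|u|^p}$, $u\in\mathbb R$.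
   Context: $\mathbb B_p^n=\{x\in\mathbb R^n:|x_1|^p+\cdots+|x_n|^p\le 1\}$; $\mathbb N=\{1,2,\dots\}$. For $\theta\ge 0$: $\mathcal I_p(\theta)=\int_{\mathbb R}e^{-|x|^p-\theta|x|^{2p-2}}dx$ and $\mathcal J_p(\theta)=\int_{\mathbb R}|x|^{p-2}e^{-|x|^p-\theta|x|^{2p-2}}dx$. Curvature measures: let $K\subseteq\mathbb R^n$ be a convex body, $p_K(y)$ the metric projection of $y$ onto $K$, and $\mathbb B_2^n$ the Euclidean unit ball. For Borel $B\subseteq\partial K$ and $\rho\ge 0$ put $A_\rho(K,B)=\{y\in(K+\rho\mathbb B_2^n)\setminus K:\ p_K(y)\in B\}$. The curvature measures $\Phi_0(K,\cdot),\dots,\Phi_{n-1}(K,\cdot)$ are the unique finite Borel measures on $\partial K$ satisfying $\mathrm{Vol}_n(A_\rho(K,B))=\sum_{j=0}^{n-1}\kappa_{n-j}\rho^{n-j}\Phi_j(K,B)$ for all $\rho\ge 0$ and all Borel $B\subseteq\partial K$, where $\kappa_m=\pi^{m/2}/\Gamma(1+\frac m2)$ is the volume of the $m$-dimensional Euclidean unit ball. The total mass $\Phi_j(K,\partial K)=V_j(K)$ is the $j$-th intrinsic volume of $K$. *)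

theory Defs
  imports "HOL-Probability.Probability" "HOL-Computational_Algebra.Polynomial"
begin

text \<open>
  Since the dimension \<open>n\<close> varies, \<open>\<real>\<^sup>n\<close> is modelled by \<open>PiE {..<n} (\<lambda>_. UNIV)\<close> (coordinates
  numbered from \<open>0\<close>), which is both the space of the measure \<open>lborel_n n\<close> and the
  \<open>topspace\<close> of \<open>euclidean_top n\<close>.
\<close>

abbreviation lborel_n :: "nat \<Rightarrow> (nat \<Rightarrow> real) measure" where
  "lborel_n n \<equiv> Pi\<^sub>M {..<n} (\<lambda>_. lborel)"

abbreviation euclidean_top :: "nat \<Rightarrow> (nat \<Rightarrow> real) topology" where
  "euclidean_top n \<equiv> product_topology (\<lambda>_. euclideanreal) {..<n}"

definition scale_n :: "nat \<Rightarrow> real \<Rightarrow> (nat \<Rightarrow> real) \<Rightarrow> nat \<Rightarrow> real" where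
  "scale_n n c x = (\<lambda>i\<in>{..<n}. c * x i)"

definition add_n :: "nat \<Rightarrow> (nat \<Rightarrow> real) \<Rightarrow> (nat \<Rightarrow> real) \<Rightarrow> nat \<Rightarrow> real" where
  "add_n n x y = (\<lambda>i\<in>{..<n}. x i + y i)"

definition dist_n :: "nat \<Rightarrow> (nat \<Rightarrow> real) \<Rightarrow> (nat \<Rightarrow> real) \<Rightarrow> real" where
  "dist_n n x y = L2_set (\<lambda>i. x i - y i) {..<n}"

definition lp_ball :: "real \<Rightarrow> nat \<Rightarrow> (nat \<Rightarrow> real) set" where
  "lp_ball p n = {x \<in> PiE {..<n} (\<lambda>_. UNIV). (\<Sum>i<n. \<bar>x i\<bar> powr p) \<le> 1}"

definition metric_proj :: "nat \<Rightarrow> (nat \<Rightarrow> real) set \<Rightarrow> (nat \<Rightarrow> real) \<Rightarrow> (nat \<Rightarrow> real)" where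
  "metric_proj n K y = (THE x. x \<in> K \<and> (\<forall>z\<in>K. dist_n n y x \<le> dist_n n y z))"

definition parallel_set :: "nat \<Rightarrow> real \<Rightarrow> (nat \<Rightarrow> real) set \<Rightarrow> (nat \<Rightarrow> real) set" where
  "parallel_set n \<rho> K = {add_n n x (scale_n n \<rho> z) | x z. x \<in> K \<and> z \<in> lp_ball 2 n}"

definition local_parallel_set ::
    "nat \<Rightarrow> real \<Rightarrow> (nat \<Rightarrow> real) set \<Rightarrow> (nat \<Rightarrow> real) set \<Rightarrow> (nat \<Rightarrow> real) set" where
  "local_parallel_set n \<rho> K B = {y \<in> parallel_set n \<rho> K - K. metric_proj n K y \<in> B}"

definition bdry_space :: "nat \<Rightarrow> (nat \<Rightarrow> real) set \<Rightarrow> (nat \<Rightarrow> real) measure" where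
  "bdry_space n K = restrict_space (lborel_n n) (euclidean_top n frontier_of K)"

text \<open>
  Only the measurable structure of \<open>bdry_space n K\<close> (the Borel sets of the boundary) is ever used.
\<close>

definition is_curvature_measures ::
    "nat \<Rightarrow> (nat \<Rightarrow> real) set \<Rightarrow> (nat \<Rightarrow> (nat \<Rightarrow> real) measure) \<Rightarrow> bool" where
  "is_curvature_measures n K \<Phi> \<longleftrightarrow>
     (\<forall>j<n. finite_measure (\<Phi> j) \<and> sets (\<Phi> j) = sets (bdry_space n K)) \<and>
     (\<forall>\<rho>\<ge>0. \<forall>B\<in>sets (bdry_space n K).
        measure (lborel_n n) (local_parallel_set n \<rho> K B) =
          (\<Sum>j<n. unit_ball_vol (real (n - j)) * \<rho> ^ (n - j) * measure (\<Phi> j) B))"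

text \<open>
  The family is unique only in its members with index below \<open>n\<close>, so the description is applied to
  the single measure rather than to the whole family.
\<close>

definition curvature_measure ::
    "nat \<Rightarrow> (nat \<Rightarrow> real) set \<Rightarrow> nat \<Rightarrow> (nat \<Rightarrow> real) measure" where
  "curvature_measure n K j = (THE \<mu>. \<exists>\<Phi>. is_curvature_measures n K \<Phi> \<and> \<mu> = \<Phi> j)"

definition intrinsic_volume :: "nat \<Rightarrow> (nat \<Rightarrow> real) set \<Rightarrow> nat \<Rightarrow> real" where
  "intrinsic_volume n K j = measure (curvature_measure n K j) (euclidean_top n frontier_of K)"

lemma is_curvature_measures_unique:
  assumes "is_curvature_measures n K \<Phi>" "is_curvature_measures n K \<Psi>" "j < n"
  shows "\<Phi> j = \<Psi> j"
proof (rule measure_eqI)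
  interpret P: finite_measure "\<Phi> j" using assms by (simp add: is_curvature_measures_def)
  interpret Q: finite_measure "\<Psi> j" using assms by (simp add: is_curvature_measures_def)
  show "sets (\<Phi> j) = sets (\<Psi> j)" using assms by (simp add: is_curvature_measures_def)
  fix B assume "B \<in> sets (\<Phi> j)"
  then have B: "B \<in> sets (bdry_space n K)" using assms by (simp add: is_curvature_measures_def)
  define c where "c k = unit_ball_vol (real (n - k)) * (measure (\<Phi> k) B - measure (\<Psi> k) B)" for k
  define q where "q = (\<Sum>k<n. monom (c k) (n - k))"
  have "poly q \<rho> = 0" if "\<rho> \<ge> 0" for \<rho>
  proof -
    have "(\<Sum>k<n. unit_ball_vol (real (n - k)) * \<rho> ^ (n - k) * measure (\<Phi> k) B) =
          (\<Sum>k<n. unit_ball_vol (real (n - k)) * \<rho> ^ (n - k) * measure (\<Psi> k) B)"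
      using assms(1,2) that B unfolding is_curvature_measures_def by (metis (no_types, lifting))
    then show ?thesis
      by (simp add: q_def c_def poly_sum poly_monom right_diff_distrib left_diff_distrib
          sum_subtractf mult_ac)
  qed
  then have "{0..} \<subseteq> {\<rho>. poly q \<rho> = 0}" by auto
  then have "q = 0" using poly_roots_finite[of q] infinite_Ici[of "0::real"] by (meson finite_subset)
  then have "0 = coeff q (n - j)" by simp
  also have "\<dots> = (\<Sum>k<n. if k = j then c k else 0)"
    unfolding q_def coeff_sum by (rule sum.cong) (use assms in auto)
  also have "\<dots> = c j" using assms by simp
  finally have "c j = 0" by simp
  moreover have "unit_ball_vol (real (n - j)) \<noteq> 0"
    using unit_ball_vol_pos[of "real (n - j)"] by linarith
  ultimately have "measure (\<Phi> j) B = measure (\<Psi> j) B" by (simp add: c_def)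
  then show "emeasure (\<Phi> j) B = emeasure (\<Psi> j) B"
    by (simp add: P.emeasure_eq_measure Q.emeasure_eq_measure)
qed

lemma curvature_measure_eq:
  assumes "is_curvature_measures n K \<Phi>" "j < n"
  shows "curvature_measure n K j = \<Phi> j"
  unfolding curvature_measure_def
  by (rule the_equality) (use assms is_curvature_measures_unique in blast)+

definition weakly_conv_n ::
    "nat \<Rightarrow> (nat \<Rightarrow> (nat \<Rightarrow> real) measure) \<Rightarrow> (nat \<Rightarrow> real) measure \<Rightarrow> bool" where
  "weakly_conv_n r \<mu> \<nu> \<longleftrightarrow>
     (\<forall>f. continuous_map (euclidean_top r) euclideanreal f \<and> bounded (f ` topspace (euclidean_top r)) \<longrightarrow>
        (\<lambda>n. LINT x|\<mu> n. f x) \<longlonglongrightarrow> (LINT x|\<nu>. f x))"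

text \<open>
  The law of \<open>c (\<xi>\<^sub>1, \<dots>, \<xi>\<^sub>r)\<close> for independent \<open>\<xi>\<^sub>i\<close> with common density \<open>f\<close>.
\<close>

definition scaled_iid_law :: "nat \<Rightarrow> real \<Rightarrow> (real \<Rightarrow> real) \<Rightarrow> (nat \<Rightarrow> real) measure" where
  "scaled_iid_law r c f =
     distr (Pi\<^sub>M {..<r} (\<lambda>_. density lborel (\<lambda>u. ennreal (f u)))) (lborel_n r) (scale_n r c)"

definition I_int :: "real \<Rightarrow> real \<Rightarrow> real" where
  "I_int p \<theta> = (LINT x|lborel. exp (- (\<bar>x\<bar> powr p) - \<theta> * \<bar>x\<bar> powr (2 * p - 2)))"

text \<open>
  Below, \<open>\<bar>x\<bar> powr (p - 2)\<close> takes the value \<open>0\<close> at \<open>x = 0\<close> for every \<open>p\<close>, including \<open>p \<le> 2\<close>; this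
  affects the integral and the densities only on a null set.
\<close>

definition J_int :: "real \<Rightarrow> real \<Rightarrow> real" where
  "J_int p \<theta> =
     (LINT x|lborel. \<bar>x\<bar> powr (p - 2) * exp (- (\<bar>x\<bar> powr p) - \<theta> * \<bar>x\<bar> powr (2 * p - 2)))"

definition is_theta :: "real \<Rightarrow> real \<Rightarrow> real \<Rightarrow> bool" where
  "is_theta p \<alpha> \<theta> \<longleftrightarrow>
     \<theta> > 0 \<and> \<theta> * (J_int p \<theta> / I_int p \<theta>) = (1 - \<alpha>) * p / (2 * (p - 1) * \<alpha>)"

definition bulk_density :: "real \<Rightarrow> real \<Rightarrow> real \<Rightarrow> real \<Rightarrow> real" where
  "bulk_density p \<alpha> \<theta> u =
     \<alpha> * (exp (- (\<bar>u\<bar> powr p) - \<theta> * \<bar>u\<bar> powr (2 * p - 2)) / I_int p \<theta>) +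
     (1 - \<alpha>) * (\<bar>u\<bar> powr (p - 2) * exp (- (\<bar>u\<bar> powr p) - \<theta> * \<bar>u\<bar> powr (2 * p - 2)) / J_int p \<theta>)"

definition lambda0 :: "real \<Rightarrow> real" where
  "lambda0 p = (p * Gamma ((2 * p - 1) / (2 * p - 2)) / sqrt pi) powr (2 * (p - 1) / p)"

definition left_density :: "real \<Rightarrow> real \<Rightarrow> real" where
  "left_density p u =
     (p - 1) * sqrt (lambda0 p) / sqrt pi *
       \<bar>u\<bar> powr (p - 2) * exp (- lambda0 p * \<bar>u\<bar> powr (2 * p - 2))"

definition p_gaussian_density :: "real \<Rightarrow> real \<Rightarrow> real" where
  "p_gaussian_density p u = 1 / (2 * Gamma (1 + 1 / p)) * exp (- (\<bar>u\<bar> powr p))"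

text \<open>
  The law of \<open>n\<^sup>1\<^sup>/\<^sup>p (X\<^sub>1, \<dots>, X\<^sub>r)\<close> for a random vector \<open>X\<close> in \<open>\<real>\<^sup>n\<close> on the probability space \<open>M\<close>;
  meaningful for \<open>r \<le> n\<close>.
\<close>

definition scaled_marginal_law ::
    "real \<Rightarrow> nat \<Rightarrow> 'a measure \<Rightarrow> nat \<Rightarrow> ('a \<Rightarrow> nat \<Rightarrow> real) \<Rightarrow> (nat \<Rightarrow> real) measure" where
  "scaled_marginal_law p r M n X = distr M (lborel_n r) (\<lambda>\<omega>. scale_n r (real n powr (1 / p)) (X \<omega>))"

end

theory Submission
  imports Defs
begin

text \<open>
  The outer normal of the ball at a boundary point \<open>x\<close> is proportional to the vector with entries
  \<open>phi (x i) = sgn (x i) * \<bar>x i\<bar> powr (p - 1)\<close>, so local parallel sets are swept out by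
  \<open>y i = x i + s * phi (x i)\<close>. Changing variables coordinatewise and using homogeneity yields the local
  Steiner formula, with \<open>q = n - j\<close>: the \<open>j\<close>-th curvature measure is the law of the direction of a
  vector with weight \<open>hsym n q\<close>, a sum of products in which one coordinate carries \<open>phi\<^sup>2\<close> and \<open>q - 1\<close>
  coordinates carry the derivative \<open>dphi\<close>, times a radial kernel that can be chosen freely.

  For a suitable kernel the weight is \<open>exp (- A) * B powr (- c) * hsym n q\<close> with \<open>A\<close> and \<open>B\<close> sums over the
  coordinates. Writing \<open>B powr (- c)\<close> as a Gamma integral over \<open>t\<close> exhibits the vector as a mixture of
  independent coordinates, with mixing density proportional to \<open>t powr (c - 1) * Q t * J t ^ (q - 1) * I t ^ j\<close>.
  This density concentrates at a point \<open>\<theta>\<close>: a saddle point given by the equation for \<open>\<theta>\<close> in the bulk, and \<open>0\<close>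
  at both edges. Each of the first \<open>r\<close> coordinates is independently of \<open>dphi\<close> type with asymptotic
  probability \<open>1 - \<alpha>\<close>, which gives the mixture density; the radius is controlled by two moments.
\<close>

section \<open>The normal map and parallel sets of the ball\<close>

text \<open>The boundary is never parametrized. Instead one double integral over points
  \<open>y\<close> and displacements \<open>s > 0\<close> is evaluated twice: for fixed
  \<open>y\<close> the level \<open>N = Spow n (Tinv n s y)\<close> replaces \<open>s\<close> and
  decouples from the local parallel set after scaling; for fixed \<open>s\<close> the substitution
  \<open>y = Tmap n s x\<close> has a polynomial Jacobian. The weight inserted into this integral is
  the free kernel. Since the curvature measure does not change with it, varying the kernel also
  yields moments of the radius.

  The saddle point needs no second derivatives. The derivatives of \<open>Imass t\<close> and
  \<open>sqrt t * Jmass t\<close> are multiples of the same function \<open>Qmass t\<close>, so the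
  increments of the two functions can be compared, and concavity of the logarithm does the rest.

  Only asymptotic lower bounds on expectations are proved. Applied to a bounded function and its
  negative, both shifted into \<open>[0, 1]\<close>, they give the limit. Hence index pairs and
  mixing parameters of small share are dropped without estimating the test function there.\<close>

locale lp_exponent =
  fixes p :: real
  assumes p_gt_1: "1 < p"
begin

section \<open>The scalar normal map and its inverse\<close>

definition phi :: "real \<Rightarrow> real" where "phi x = sgn x * \<bar>x\<bar> powr (p - 1)"

text \<open>At \<open>0\<close> the convention for \<open>powr\<close> gives the value
  \<open>0\<close>, whereas the true derivative of \<open>phi\<close> there is infinite for
  \<open>p < 2\<close> and equals \<open>1\<close> for \<open>p = 2\<close>. The derivative lemma
  therefore excludes \<open>0\<close>, and integrals do not notice the difference.\<close>

definition dphi :: "real \<Rightarrow> real" where "dphi x = (p - 1) * \<bar>x\<bar> powr (p - 2)"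

text \<open>
  Truncating \<open>s\<close> at \<open>0\<close> makes \<open>tau s\<close> a bijection for every real \<open>s\<close>.
\<close>

definition tau :: "real \<Rightarrow> real \<Rightarrow> real" where "tau s x = x + max 0 s * phi x"

definition tinv :: "real \<Rightarrow> real \<Rightarrow> real" where "tinv s = inv (tau s)"

lemma phi_0 [simp]: "phi 0 = 0" by (simp add: phi_def)

lemma phi_minus: "phi (- x) = - phi x" by (simp add: phi_def sgn_minus)

lemma abs_phi: "\<bar>phi x\<bar> = \<bar>x\<bar> powr (p - 1)"
  by (cases "x = 0") (auto simp: phi_def abs_mult sgn_if)

lemma phi_mult_self: "phi x * x = \<bar>x\<bar> powr p"
proof (cases "x = 0")
  case False
  have "phi x * x = \<bar>x\<bar> powr (p - 1) * \<bar>x\<bar> powr 1"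
    using False by (simp add: phi_def sgn_if)
  also have "\<dots> = \<bar>x\<bar> powr p" by (subst powr_add[symmetric]) simp
  finally show ?thesis .
qed simp

lemma phi_power2: "(phi x)\<^sup>2 = \<bar>x\<bar> powr (2 * p - 2)"
proof -
  have "(phi x)\<^sup>2 = \<bar>phi x\<bar>\<^sup>2" by simp
  also have "\<dots> = \<bar>x\<bar> powr (2 * p - 2)"
    unfolding abs_phi by (simp add: power2_eq_square powr_add[symmetric])
  finally show ?thesis .
qed

lemma phi_eq_0_iff [simp]: "phi x = 0 \<longleftrightarrow> x = 0"
  by (auto simp: phi_def sgn_if split: if_splits)

lemma phi_scale: "c > 0 \<Longrightarrow> phi (c * x) = c powr (p - 1) * phi x"
  by (simp add: phi_def sgn_mult abs_mult powr_mult)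

lemma phi_pos: "x > 0 \<Longrightarrow> phi x = x powr (p - 1)" by (simp add: phi_def)

lemma phi_strict_mono: "strict_mono phi"
proof (rule strict_monoI)
  fix x y :: real assume xy: "x < y"
  consider "0 \<le> x" | "y \<le> 0" | "x < 0" "0 < y" by linarith
  then show "phi x < phi y"
  proof cases
    case 1
    then show ?thesis using xy p_gt_1
      by (cases "x = 0") (auto simp: phi_pos powr_less_mono2)
  next
    case 2
    have "phi (-y) < phi (-x)"
      using 2 xy p_gt_1 by (cases "y = 0") (auto simp: phi_pos powr_less_mono2)
    then show ?thesis by (simp add: phi_minus)
  next
    case 3
    then show ?thesis using p_gt_1 
      by (smt (verit) phi_minus phi_pos powr_gt_zero)
  qed
qed

lemma dphi_nonneg [simp]: "0 \<le> dphi x" using p_gt_1 by (simp add: dphi_def)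

lemma phi_has_derivative:
  assumes "x \<noteq> 0" shows "(phi has_real_derivative dphi x) (at x)"
proof -
  have pos: "(phi has_real_derivative dphi x) (at x)" if "x > 0" for x
  proof -
    have "((\<lambda>x. x powr (p - 1)) has_real_derivative dphi x) (at x)"
      using that by (auto intro!: derivative_eq_intros simp: dphi_def algebra_simps)
    moreover have "\<forall>\<^sub>F y in nhds x. phi y = y powr (p - 1)"
      using eventually_nhds_in_open[of "{0<..}" x] that
      by (auto elim!: eventually_mono simp: phi_pos)
    ultimately show ?thesis
      using DERIV_cong_ev[of x x phi "\<lambda>x. x powr (p-1)"] by blast
  qed
  show ?thesis
  proof (cases "x > 0")
    case False
    then have "(phi has_real_derivative dphi (-x)) (at (-x))" using assms by (intro pos) auto
    then have "((\<lambda>x. - phi (- x)) has_real_derivative dphi (-x)) (at x)"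
      by (auto intro!: derivative_eq_intros DERIV_chain2[where f=phi])
    then show ?thesis by (simp add: phi_minus dphi_def)
  qed (rule pos)
qed

lemma continuous_phi [continuous_intros]: "continuous_on A phi"
proof -
  have "isCont phi x" for x
  proof (cases "x = 0")
    case True
    have "((\<lambda>x. \<bar>x\<bar> powr (p - 1)) \<longlongrightarrow> \<bar>0\<bar> powr (p - 1)) (at (0::real))"
      using p_gt_1 by (intro tendsto_powr2 tendsto_intros) auto
    then have "((\<lambda>x. \<bar>phi x\<bar>) \<longlongrightarrow> 0) (at 0)" by (simp add: abs_phi)
    then have "(phi \<longlongrightarrow> 0) (at 0)" by (simp add: tendsto_rabs_zero_iff)
    then show ?thesis using True by (simp add: isCont_def)
  next
    case False
    then show ?thesis using phi_has_derivative DERIV_isCont by blast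
  qed
  then show ?thesis by (simp add: continuous_at_imp_continuous_on)
qed

lemma measurable_phi [measurable]: "phi \<in> borel_measurable borel"
  by (rule borel_measurable_continuous_onI) (rule continuous_phi)

lemma measurable_dphi [measurable]: "dphi \<in> borel_measurable borel"
  unfolding dphi_def by measurable

lemma tau_strict_mono: "strict_mono (tau s)"
  using phi_strict_mono unfolding strict_mono_def tau_def
  by (smt (verit) mult_left_mono)

lemma tau_0 [simp]: "tau s 0 = 0" by (simp add: tau_def)

lemma tau_minus: "tau s (- x) = - tau s x" by (simp add: tau_def phi_minus)

lemma continuous_tau [continuous_intros]: "continuous_on A (tau s)"
  unfolding tau_def by (intro continuous_intros)

lemma surj_tau: "surj (tau s)"
proof -
  have "\<exists>x. tau s x = y" for y
  proof -
    have ge: "tau s x \<ge> x" if "x \<ge> 0" for x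
      using that by (auto simp: tau_def phi_def)
    have "tau s (- \<bar>y\<bar>) \<le> y" "y \<le> tau s \<bar>y\<bar>"
      using ge[of "\<bar>y\<bar>"] by (auto simp: tau_minus)
    then show ?thesis
      using IVT'[of "tau s" "-\<bar>y\<bar>" y "\<bar>y\<bar>"] continuous_tau by force
  qed
  then show ?thesis by (metis surjI)
qed

lemma tau_tinv [simp]: "tau s (tinv s y) = y"
  unfolding tinv_def by (simp add: surj_tau surj_f_inv_f)

lemma tinv_tau [simp]: "tinv s (tau s x) = x"
  unfolding tinv_def using tau_strict_mono by (simp add: strict_mono_imp_inj_on)

text \<open>The inverse has no closed form. These order equivalences reduce its measurability
  jointly in \<open>s\<close> and \<open>y\<close>, and its continuity in \<open>s\<close>, to the
  corresponding properties of the explicit function \<open>tau\<close>.\<close>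

lemma tinv_le_iff: "tinv s y \<le> a \<longleftrightarrow> y \<le> tau s a"
  using strict_mono_less_eq[OF tau_strict_mono, of s "tinv s y" a] by simp

lemma tinv_less_iff: "tinv s y < a \<longleftrightarrow> y < tau s a"
  using strict_mono_less[OF tau_strict_mono, of s "tinv s y" a] by simp

lemma less_tinv_iff: "a < tinv s y \<longleftrightarrow> tau s a < y"
  using strict_mono_less[OF tau_strict_mono, of s a "tinv s y"] by simp

lemma tinv_0 [simp]: "tinv s 0 = 0" using tinv_tau[of s 0] by simp

lemma tinv_eq_0_iff [simp]: "tinv s y = 0 \<longleftrightarrow> y = 0"
  by (metis tau_tinv tau_0 tinv_0)

lemma tinv_zero_left [simp]: "tinv 0 y = y"
  by (metis tau_tinv tau_def max.idem mult_zero_left add.right_neutral)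

lemma measurable_tinv [measurable]:
  assumes [measurable]: "f \<in> borel_measurable M" "g \<in> borel_measurable M"
  shows "(\<lambda>x. tinv (f x) (g x)) \<in> borel_measurable M"
  unfolding borel_measurable_iff_le tinv_le_iff tau_def
  by measurable

lemma measurable_tau [measurable]:
  assumes [measurable]: "f \<in> borel_measurable M" "g \<in> borel_measurable M"
  shows "(\<lambda>x. tau (f x) (g x)) \<in> borel_measurable M"
  unfolding tau_def by measurable

text \<open>It suffices to compare two measures on intervals, where the claim is the fundamental
  theorem of calculus for \<open>tau s\<close>. The exceptional point \<open>0\<close> is
  unavoidable for \<open>p < 2\<close>, because \<open>phi\<close> is not differentiable
  there.\<close>

lemma nn_integral_tinv:
  assumes [measurable]: "f \<in> borel_measurable borel"
  shows "(\<integral>\<^sup>+y. f (tinv s y) \<partial>lborel) = (\<integral>\<^sup>+x. f x * ennreal (1 + max 0 s * dphi x) \<partial>lborel)"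
proof -
  let ?M = "distr (density lborel (\<lambda>x. ennreal (1 + max 0 s * dphi x))) borel (tau s)"
  have "lborel = ?M"
  proof (rule lborel_eqI)
    fix l u :: real assume "\<And>b. b \<in> Basis \<Longrightarrow> l \<bullet> b \<le> u \<bullet> b"
    then have lu: "l \<le> u" by simp
    define a b where "a = tinv s l" and "b = tinv s u"
    have ab: "a \<le> b" using lu by (simp add: a_def b_def tinv_le_iff)
    have vim: "tau s -` box l u = {a<..<b}"
    proof (intro set_eqI)
      fix x
      have "l < tau s x \<longleftrightarrow> a < x" "tau s x < u \<longleftrightarrow> x < b"
        using tinv_less_iff[of s l x] less_tinv_iff[of x s u] by (simp_all add: a_def b_def)
      then show "x \<in> tau s -` box l u \<longleftrightarrow> x \<in> {a<..<b}" by simp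
    qed
    have "((\<lambda>x. 1 + max 0 s * dphi x) has_integral (tau s b - tau s a)) {a..b}"
    proof (rule fundamental_theorem_of_calculus_interior_strong[where S="{0}"])
      fix x assume "x \<in> {a<..<b} - {0}"
      then show "(tau s has_vector_derivative 1 + max 0 s * dphi x) (at x)"
        unfolding tau_def has_real_derivative_iff_has_vector_derivative[symmetric]
        by (auto intro!: derivative_eq_intros phi_has_derivative)
    qed (auto simp: ab intro: continuous_tau)
    then have "((\<lambda>x. 1 + max 0 s * dphi x) has_integral (u - l)) {a<..<b}"
      unfolding has_integral_Icc_iff_Ioo by (simp add: a_def b_def)
    then have I: "(\<integral>\<^sup>+x. ennreal (indicator {a<..<b} x * (1 + max 0 s * dphi x)) \<partial>lborel) = ennreal (u - l)"
      by (intro nn_integral_has_integral_lebesgue) auto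
    have "emeasure ?M (box l u) = (\<integral>\<^sup>+x. ennreal (1 + max 0 s * dphi x) * indicator {a<..<b} x \<partial>lborel)"
    proof (subst emeasure_distr)
      show "tau s \<in> borel_measurable (density lborel (\<lambda>x. ennreal (1 + max 0 s * dphi x)))" by measurable
    qed (simp_all only: vim space_density space_lborel space_borel Int_UNIV_right, simp_all add: emeasure_density)
    also have "\<dots> = (\<integral>\<^sup>+x. ennreal (indicator {a<..<b} x * (1 + max 0 s * dphi x)) \<partial>lborel)"
      by (intro nn_integral_cong) (auto split: split_indicator)
    finally show "emeasure ?M (box l u) = ennreal (\<Prod>b\<in>Basis. (u - l) \<bullet> b)"
      using I by simp
  qed simp
  then have "(\<integral>\<^sup>+y. f (tinv s y) \<partial>lborel) = (\<integral>\<^sup>+y. f (tinv s y) \<partial>?M)" by simp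
  also have "\<dots> = (\<integral>\<^sup>+x. f x * ennreal (1 + max 0 s * dphi x) \<partial>lborel)"
    by (simp add: nn_integral_distr nn_integral_density mult.commute)
  finally show ?thesis .
qed

lemma isCont_tinv_left: "isCont (\<lambda>s. tinv s y) s"
  unfolding isCont_def
proof (rule order_tendstoI)
  fix a assume "a < tinv s y"
  then have "tau s a < y" by (simp add: less_tinv_iff)
  moreover have "((\<lambda>s. tau s a) \<longlongrightarrow> tau s a) (at s)"
    unfolding tau_def by (intro tendsto_intros)
  ultimately show "\<forall>\<^sub>F x in at s. a < tinv x y"
    unfolding less_tinv_iff using order_tendstoD(2) by blast
next
  fix a assume "tinv s y < a"
  then have "y < tau s a" by (simp add: tinv_less_iff)
  moreover have "((\<lambda>s. tau s a) \<longlongrightarrow> tau s a) (at s)"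
    unfolding tau_def by (intro tendsto_intros)
  ultimately show "\<forall>\<^sub>F x in at s. tinv x y < a"
    unfolding tinv_less_iff using order_tendstoD(1) by blast
qed

text \<open>For fixed \<open>y\<close> the equation \<open>y = x + s * phi x\<close> can be solved
  explicitly for \<open>s\<close>, although not for \<open>x\<close>. Hence \<open>tinv\<close> in
  its first argument is the inverse of the elementary function \<open>f\<close>, and the
  one-dimensional inverse function rule replaces an implicit function theorem.\<close>

lemma tinv_has_derivative:
  assumes "s > 0" "y \<noteq> 0"
  shows "((\<lambda>s. tinv s y) has_real_derivative - phi (tinv s y) / (1 + s * dphi (tinv s y))) (at s)"
proof -
  let ?x = "tinv s y"
  define f where "f x = (y - x) / phi x" for x
  have x0: "?x \<noteq> 0" using assms by simp
  have pos: "1 + s * dphi ?x > 0" using assms by (simp add: add_pos_nonneg)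
  have eq: "f (tinv t y) = t" if "t > 0" for t
  proof -
    have "y = tinv t y + t * phi (tinv t y)" using tau_tinv[of t y] that by (simp add: tau_def)
    then show ?thesis using assms unfolding f_def
      by (metis add_diff_cancel_left' nonzero_mult_div_cancel_right phi_eq_0_iff tinv_eq_0_iff)
  qed
  have y: "y - ?x = s * phi ?x" using tau_tinv[of s y] assms by (simp add: tau_def)
  have "(f has_real_derivative ((0 - 1) * phi ?x - (y - ?x) * dphi ?x) / (phi ?x * phi ?x)) (at ?x)"
    unfolding f_def using x0
    by (intro derivative_intros phi_has_derivative) auto
  also have "((0 - 1) * phi ?x - (y - ?x) * dphi ?x) / (phi ?x * phi ?x) = - (1 + s * dphi ?x) / phi ?x"
    using x0 by (simp add: y field_simps)
  finally have "(f has_real_derivative - (1 + s * dphi ?x) / phi ?x) (at ?x)" .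
  \<comment> \<open>The open interval from \<open>0\<close> to \<open>s + 1\<close> stays in the
    region of positive parameters, where the truncation in \<open>tau\<close> is inactive.\<close>
  then have "((\<lambda>s. tinv s y) has_real_derivative inverse (- (1 + s * dphi ?x) / phi ?x)) (at s)"
    using assms x0 pos
    by (intro DERIV_inverse_function[where f=f and a=0 and b="s+1"] eq isCont_tinv_left) auto
  moreover have "inverse (- (1 + s * dphi ?x) / phi ?x) = - phi ?x / (1 + s * dphi ?x)"
    by (simp only: inverse_eq_divide divide_divide_eq_right minus_divide_left[symmetric]
        divide_minus_right mult_1)
  ultimately show ?thesis by simp
qed

text \<open>At \<open>0\<close> the difference quotient is \<open>phi\<close> itself, which is
  continuous; elsewhere \<open>\<bar>x\<bar> powr p\<close> is the product
  \<open>phi x * x\<close>.\<close>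

lemma abs_powr_has_derivative: "((\<lambda>x. \<bar>x\<bar> powr p) has_real_derivative p * phi x) (at x)"
proof (cases "x = 0")
  case True
  have "((\<lambda>h. (\<bar>0 + h\<bar> powr p - \<bar>0\<bar> powr p) / h) \<longlongrightarrow> 0) (at (0::real))"
  proof -
    have "(phi \<longlongrightarrow> 0) (at 0)" using continuous_phi[of UNIV] by (simp add: continuous_on_def) (metis phi_0)
    moreover have "\<forall>\<^sub>F h in at 0. phi h = (\<bar>0 + h\<bar> powr p - \<bar>0\<bar> powr p) / h"
      unfolding eventually_at_filter by (auto simp: phi_mult_self[symmetric])
    ultimately show ?thesis by (rule Lim_transform_eventually)
  qed
  then show ?thesis using True by (simp add: DERIV_def)
next
  case False
  have "((\<lambda>x. phi x * x) has_real_derivative p * phi x) (at x)"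
  proof -
    have "dphi x * x = (p - 1) * phi x"
    proof -
      have "\<bar>x\<bar> powr (p - 2) * \<bar>x\<bar> powr 1 = \<bar>x\<bar> powr (p - 1)" by (subst powr_add[symmetric]) simp
      then have "dphi x * \<bar>x\<bar> = (p - 1) * \<bar>x\<bar> powr (p - 1)" by (simp add: dphi_def)
      then show ?thesis by (cases "x > 0") (use False in \<open>auto simp: phi_def\<close>)
    qed
    then show ?thesis
      using DERIV_mult[OF phi_has_derivative[OF False] DERIV_ident] by (simp add: algebra_simps)
  qed
  then show ?thesis by (simp add: phi_mult_self)
qed

end

section \<open>Coordinatewise change of variables in finite products\<close>

lemma nn_integral_PiM_subst:
  fixes h :: "real \<Rightarrow> real" and w :: "real \<Rightarrow> ennreal"
  assumes [measurable]: "h \<in> borel_measurable borel" "w \<in> borel_measurable borel"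
    and sub: "\<And>f. f \<in> borel_measurable borel \<Longrightarrow>
      (\<integral>\<^sup>+y. f (h y) \<partial>lborel) = (\<integral>\<^sup>+x. f x * w x \<partial>lborel)"
    and "f \<in> borel_measurable (lborel_n n)"
  shows "(\<integral>\<^sup>+y. f (\<lambda>k\<in>{..<n}. h (y k)) \<partial>lborel_n n) =
         (\<integral>\<^sup>+x. f x * (\<Prod>k<n. w (x k)) \<partial>lborel_n n)"
  using assms(4)
proof (induction n arbitrary: f)
  case 0
  show ?case by (simp add: PiM_empty nn_integral_count_space_finite)
next
  case (Suc n)
  interpret product_sigma_finite "\<lambda>_::nat. lborel :: real measure" ..
  have [measurable]: "f \<in> borel_measurable (Pi\<^sub>M (insert n {..<n}) (\<lambda>_. lborel))"
    using Suc.prems by (simp add: lessThan_Suc)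
  have eq: "(\<lambda>k\<in>insert n {..<n}. h ((x(n := y)) k)) = (\<lambda>k\<in>{..<n}. h (x k))(n := h y)" for x y
    by (auto simp: restrict_def)
  have meas: "(\<lambda>y. f (z(n := y))) \<in> borel_measurable borel" if "z \<in> space (lborel_n n)" for z
  proof -
    have "(\<lambda>y. z(n := y)) \<in> measurable lborel (Pi\<^sub>M (insert n {..<n}) (\<lambda>_. lborel))"
      using measurable_component_update[OF that, of n] by simp
    then show ?thesis by measurable
  qed
  have [measurable]: "(\<lambda>x. \<integral>\<^sup>+y. f (x(n := y)) * w y \<partial>lborel) \<in> borel_measurable (lborel_n n)"
    by measurable
  have "(\<integral>\<^sup>+y. f (\<lambda>k\<in>{..<Suc n}. h (y k)) \<partial>lborel_n (Suc n)) =
        (\<integral>\<^sup>+x. \<integral>\<^sup>+y. f ((\<lambda>k\<in>{..<n}. h (x k))(n := h y)) \<partial>lborel \<partial>lborel_n n)"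
    unfolding lessThan_Suc
    by (subst product_nn_integral_insert) (auto simp only: eq finite_lessThan lessThan_iff less_irrefl, measurable)
  also have "\<dots> = (\<integral>\<^sup>+x. \<integral>\<^sup>+y. f ((\<lambda>k\<in>{..<n}. h (x k))(n := y)) * w y \<partial>lborel \<partial>lborel_n n)"
  proof (rule nn_integral_cong)
    fix x
    have "(\<lambda>k\<in>{..<n}. h (x k)) \<in> space (lborel_n n)" by (auto simp: space_PiM)
    from sub[OF meas[OF this]]
    show "(\<integral>\<^sup>+y. f ((\<lambda>k\<in>{..<n}. h (x k))(n := h y)) \<partial>lborel) =
          (\<integral>\<^sup>+y. f ((\<lambda>k\<in>{..<n}. h (x k))(n := y)) * w y \<partial>lborel)" .
  qed
  also have "\<dots> = (\<integral>\<^sup>+x. (\<integral>\<^sup>+y. f (x(n := y)) * w y \<partial>lborel) * (\<Prod>k<n. w (x k)) \<partial>lborel_n n)"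
    by (rule Suc.IH[where f="\<lambda>x. \<integral>\<^sup>+y. f (x(n := y)) * w y \<partial>lborel"]) measurable
  also have "\<dots> = (\<integral>\<^sup>+x. (\<integral>\<^sup>+y. f (x(n := y)) * (\<Prod>k<Suc n. w ((x(n := y)) k)) \<partial>lborel) \<partial>lborel_n n)"
  proof (intro nn_integral_cong)
    fix x assume x: "x \<in> space (lborel_n n)"
    have [measurable]: "(\<lambda>y. f (x(n := y))) \<in> borel_measurable borel" by (rule meas[OF x])
    show "(\<integral>\<^sup>+y. f (x(n := y)) * w y \<partial>lborel) * (\<Prod>k<n. w (x k)) =
          (\<integral>\<^sup>+y. f (x(n := y)) * (\<Prod>k<Suc n. w ((x(n := y)) k)) \<partial>lborel)"
      by (subst nn_integral_multc[symmetric]) (auto simp: mult_ac)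
  qed
  also have "\<dots> = (\<integral>\<^sup>+x. f x * (\<Prod>k<Suc n. w (x k)) \<partial>lborel_n (Suc n))"
    unfolding lessThan_Suc[of n]
    by (subst product_nn_integral_insert) auto
  finally show ?case .
qed

lemma measurable_coord:
  assumes "g \<in> measurable M (lborel_n n)" "k < n"
  shows "(\<lambda>x. g x k) \<in> borel_measurable M"
  using measurable_compose[OF assms(1) measurable_component_singleton[of k "{..<n}"]] assms(2) by simp

lemma nn_integral_scale_n:
  assumes c: "c > 0" and [measurable]: "f \<in> borel_measurable (lborel_n n)"
  shows "(\<integral>\<^sup>+y. f (scale_n n c y) \<partial>lborel_n n) = ennreal ((1 / c) ^ n) * (\<integral>\<^sup>+x. f x \<partial>lborel_n n)"
proof -
  have "(\<integral>\<^sup>+y. f (\<lambda>k\<in>{..<n}. c * y k) \<partial>lborel_n n) =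
        (\<integral>\<^sup>+x. f x * (\<Prod>k<n. ennreal (1 / c)) \<partial>lborel_n n)"
  proof (rule nn_integral_PiM_subst)
    fix f :: "real \<Rightarrow> ennreal" assume [measurable]: "f \<in> borel_measurable borel"
    have "(\<integral>\<^sup>+x. f x \<partial>lborel) = ennreal c * (\<integral>\<^sup>+x. f (0 + c * x) \<partial>lborel)"
      using nn_integral_real_affine[of f c 0] c by simp
    then have "(\<integral>\<^sup>+x. f x \<partial>lborel) * ennreal (1 / c) =
        (ennreal c * ennreal (1 / c)) * (\<integral>\<^sup>+x. f (c * x) \<partial>lborel)"
      by (simp add: mult_ac)
    then show "(\<integral>\<^sup>+y. f (c * y) \<partial>lborel) = (\<integral>\<^sup>+x. f x * ennreal (1 / c) \<partial>lborel)"
      using c by (subst nn_integral_multc) (auto simp: ennreal_mult[symmetric])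
  qed auto
  then show ?thesis
    using c unfolding scale_n_def
    by (simp add: nn_integral_multc prod_constant ennreal_power mult.commute)
qed

section \<open>The normal flow in dimension n and the level of the base point as a variable\<close>

context lp_exponent
begin

definition Tmap :: "nat \<Rightarrow> real \<Rightarrow> (nat \<Rightarrow> real) \<Rightarrow> nat \<Rightarrow> real"
  where "Tmap n s x = (\<lambda>k\<in>{..<n}. tau s (x k))"

definition Tinv :: "nat \<Rightarrow> real \<Rightarrow> (nat \<Rightarrow> real) \<Rightarrow> nat \<Rightarrow> real"
  where "Tinv n s y = (\<lambda>k\<in>{..<n}. tinv s (y k))"

definition Spow :: "nat \<Rightarrow> (nat \<Rightarrow> real) \<Rightarrow> real"
  where "Spow n x = (\<Sum>i<n. \<bar>x i\<bar> powr p)"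

definition Upow :: "nat \<Rightarrow> (nat \<Rightarrow> real) \<Rightarrow> real"
  where "Upow n x = (\<Sum>i<n. \<bar>x i\<bar> powr (2 * p - 2))"

text \<open>This is the rate at which the level \<open>Spow n (Tinv n s y)\<close> falls as
  \<open>s\<close> grows with \<open>y\<close> fixed. The denominators come from differentiating the
  inverse map \<open>tinv\<close>.\<close>

definition speed :: "nat \<Rightarrow> real \<Rightarrow> (nat \<Rightarrow> real) \<Rightarrow> real"
  where "speed n s x = p * (\<Sum>k<n. (phi (x k))\<^sup>2 / (1 + max 0 s * dphi (x k)))"

lemma measurable_Tmap [measurable]:
  assumes [measurable]: "f \<in> borel_measurable M" "g \<in> measurable M (lborel_n n)"
  shows "(\<lambda>x. Tmap n (f x) (g x)) \<in> measurable M (lborel_n n)"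
proof -
  have [measurable]: "(\<lambda>x. g x k) \<in> borel_measurable M" if "k \<in> {..<n}" for k
    using measurable_coord[OF assms(2)] that by simp
  show ?thesis unfolding Tmap_def by measurable
qed

lemma measurable_Tinv [measurable]:
  assumes [measurable]: "f \<in> borel_measurable M" "g \<in> measurable M (lborel_n n)"
  shows "(\<lambda>x. Tinv n (f x) (g x)) \<in> measurable M (lborel_n n)"
proof -
  have [measurable]: "(\<lambda>x. g x k) \<in> borel_measurable M" if "k \<in> {..<n}" for k
    using measurable_coord[OF assms(2)] that by simp
  show ?thesis unfolding Tinv_def by measurable
qed

lemma measurable_Spow [measurable]: "Spow n \<in> borel_measurable (lborel_n n)"
  unfolding Spow_def by measurable

lemma measurable_Upow [measurable]: "Upow n \<in> borel_measurable (lborel_n n)"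
  unfolding Upow_def by measurable

lemma measurable_speed [measurable]:
  assumes [measurable]: "f \<in> borel_measurable M" "g \<in> measurable M (lborel_n n)"
  shows "(\<lambda>x. speed n (f x) (g x)) \<in> borel_measurable M"
proof -
  have [measurable]: "(\<lambda>x. g x k) \<in> borel_measurable M" if "k \<in> {..<n}" for k
    using measurable_coord[OF assms(2)] that by simp
  show ?thesis unfolding speed_def by measurable
qed

lemma Spow_nonneg [simp]: "Spow n x \<ge> 0" by (simp add: Spow_def sum_nonneg)

lemma Upow_nonneg [simp]: "Upow n x \<ge> 0" by (simp add: Upow_def sum_nonneg)

lemma Spow_pos_iff: "Spow n x > 0 \<longleftrightarrow> (\<exists>k<n. x k \<noteq> 0)"
proof -
  have "Spow n x = 0 \<longleftrightarrow> (\<forall>k<n. x k = 0)"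
    unfolding Spow_def by (subst sum_nonneg_eq_0_iff) auto
  then show ?thesis using Spow_nonneg[of n x] by (metis less_eq_real_def order_less_irrefl)
qed

lemma Upow_pos_iff: "Upow n x > 0 \<longleftrightarrow> (\<exists>k<n. x k \<noteq> 0)"
proof -
  have "Upow n x = 0 \<longleftrightarrow> (\<forall>k<n. x k = 0)"
    unfolding Upow_def by (subst sum_nonneg_eq_0_iff) auto
  then show ?thesis using Upow_nonneg[of n x] by (metis less_eq_real_def order_less_irrefl)
qed

lemma Upow_eq: "Upow n x = (\<Sum>k<n. (phi (x k))\<^sup>2)"
  by (simp add: Upow_def phi_power2)

lemma speed_nonneg [simp]: "speed n s x \<ge> 0"
  unfolding speed_def using p_gt_1
  by (intro mult_nonneg_nonneg sum_nonneg divide_nonneg_nonneg add_nonneg_nonneg) auto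

lemma nn_integral_Tinv:
  assumes "f \<in> borel_measurable (lborel_n n)"
  shows "(\<integral>\<^sup>+y. f (Tinv n s y) \<partial>lborel_n n) =
         (\<integral>\<^sup>+x. f x * ennreal (\<Prod>k<n. 1 + max 0 s * dphi (x k)) \<partial>lborel_n n)"
  unfolding Tinv_def
  using nn_integral_PiM_subst[of "tinv s" "\<lambda>x. ennreal (1 + max 0 s * dphi x)" f n] assms
  by (simp add: nn_integral_tinv prod_ennreal del: ennreal_plus)

text \<open>For \<open>a > 0\<close> the value \<open>a + s * phi a\<close> eventually exceeds any
  given \<open>y\<close>, so \<open>tinv s y\<close> is squeezed into every neighbourhood of
  \<open>0\<close>.\<close>

lemma tinv_tendsto_0: "((\<lambda>s. tinv s y) \<longlongrightarrow> 0) at_top"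
proof -
  have ev: "\<forall>\<^sub>F s in at_top. y < tau s a" if "a > 0" for a y
  proof -
    have "phi a > 0" using that by (simp add: phi_pos)
    moreover have "filterlim (\<lambda>s::real. a + phi a * s) at_top at_top"
      using \<open>phi a > 0\<close> by (intro filterlim_tendsto_add_at_top[OF tendsto_const] 
         filterlim_tendsto_pos_mult_at_top[OF tendsto_const] filterlim_ident)
    ultimately have "\<forall>\<^sub>F s in at_top. y < a + phi a * s" by (simp add: filterlim_at_top_dense)
    then show ?thesis using eventually_ge_at_top[of 0]
      by eventually_elim (simp add: tau_def mult.commute)
  qed
  show ?thesis
  proof (rule order_tendstoI)
    fix a :: real assume "a < 0"
    then have "\<forall>\<^sub>F s in at_top. - y < tau s (- a)" by (intro ev) auto
    then show "\<forall>\<^sub>F s in at_top. a < tinv s y" by (simp add: less_tinv_iff tau_minus)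
  next
    fix a :: real assume "0 < a"
    then show "\<forall>\<^sub>F s in at_top. tinv s y < a" unfolding tinv_less_iff by (rule ev)
  qed
qed

lemma Spow_Tinv: "Spow n (Tinv n s y) = (\<Sum>k<n. \<bar>tinv s (y k)\<bar> powr p)"
  by (simp add: Spow_def Tinv_def)

lemma Spow_Tinv_has_derivative:
  assumes "s > 0"
  shows "((\<lambda>s. Spow n (Tinv n s y)) has_real_derivative - speed n s (Tinv n s y)) (at s)"
proof -
  have "((\<lambda>s. \<bar>tinv s (y k)\<bar> powr p) has_real_derivative
      p * phi (tinv s (y k)) * (- phi (tinv s (y k)) / (1 + s * dphi (tinv s (y k))))) (at s)" for k
  proof (cases "y k = 0")
    case False
    show ?thesis
      by (rule DERIV_chain2[OF abs_powr_has_derivative tinv_has_derivative[OF assms False]])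
  qed simp
  then have "((\<lambda>s. Spow n (Tinv n s y)) has_real_derivative
     (\<Sum>k<n. p * phi (tinv s (y k)) * (- phi (tinv s (y k)) / (1 + s * dphi (tinv s (y k)))))) (at s)"
    unfolding Spow_Tinv by (intro DERIV_sum)
  also have "(\<Sum>k<n. p * phi (tinv s (y k)) * (- phi (tinv s (y k)) / (1 + s * dphi (tinv s (y k)))))
    = - speed n s (Tinv n s y)"
    using assms unfolding speed_def Tinv_def
    by (simp add: sum_distrib_left sum_negf[symmetric] power2_eq_square mult.assoc)
  finally show ?thesis .
qed

lemma isCont_abs_powr: "isCont (\<lambda>x. \<bar>x\<bar> powr p) x"
  using abs_powr_has_derivative DERIV_isCont by blast

lemma isCont_Spow_Tinv: "isCont (\<lambda>s. Spow n (Tinv n s y)) s"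
  unfolding Spow_Tinv
  by (intro continuous_sum isCont_o2[OF isCont_tinv_left isCont_abs_powr])

lemma Spow_Tinv_tendsto_0: "((\<lambda>s. Spow n (Tinv n s y)) \<longlongrightarrow> 0) at_top"
proof -
  have "((\<lambda>s. \<bar>tinv s (y k)\<bar> powr p) \<longlongrightarrow> \<bar>0\<bar> powr p) at_top" for k
    by (rule isCont_tendsto_compose[OF isCont_abs_powr tinv_tendsto_0])
  then have "((\<lambda>s. \<Sum>k<n. \<bar>tinv s (y k)\<bar> powr p) \<longlongrightarrow> (\<Sum>k<n. \<bar>0\<bar> powr p)) at_top"
    by (intro tendsto_sum) auto
  then show ?thesis unfolding Spow_Tinv by simp
qed

lemma Spow_Tinv_0: "Spow n (Tinv n 0 y) = Spow n y"
  by (simp add: Spow_def Tinv_def)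

lemma Spow_Tinv_pos: "Spow n y > 0 \<Longrightarrow> Spow n (Tinv n s y) > 0"
  unfolding Spow_pos_iff by (auto simp: Tinv_def)

lemma speed_pos: "Spow n x > 0 \<Longrightarrow> speed n s x > 0"
proof -
  assume "Spow n x > 0"
  then obtain k where k: "k < n" "x k \<noteq> 0" unfolding Spow_pos_iff by blast
  have pos: "1 + max 0 s * dphi z > 0" for z by (simp add: add_pos_nonneg)
  have "(\<Sum>k<n. (phi (x k))\<^sup>2 / (1 + max 0 s * dphi (x k))) > 0"
    using k pos by (intro sum_pos2[of _ k]) (auto intro!: divide_pos_pos divide_nonneg_pos)
  then show ?thesis unfolding speed_def using p_gt_1 by simp
qed

lemma Spow_Tinv_decreasing:
  assumes "Spow n y > 0" "0 \<le> s" "s < t"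
  shows "Spow n (Tinv n t y) < Spow n (Tinv n s y)"
proof (rule DERIV_neg_imp_decreasing_open[OF assms(3)])
  fix u assume "s < u" "u < t"
  then show "\<exists>d. ((\<lambda>s. Spow n (Tinv n s y)) has_real_derivative d) (at u) \<and> d < 0"
    using assms Spow_Tinv_has_derivative[of u n y] speed_pos[OF Spow_Tinv_pos[OF assms(1)], of u u]
    by (intro exI[of _ "- speed n u (Tinv n u y)"]) auto
qed (simp add: isCont_Spow_Tinv continuous_at_imp_continuous_on)

lemma Spow_Tinv_level:
  assumes "0 < x" "x < Spow n y"
  obtains s where "s > 0" "Spow n (Tinv n s y) = x"
proof -
  have "\<forall>\<^sub>F s in at_top. Spow n (Tinv n s y) < x"
    using order_tendstoD(2)[OF Spow_Tinv_tendsto_0 assms(1)] .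
  then obtain b where b: "b \<ge> 0" "Spow n (Tinv n b y) < x"
    by (metis (mono_tags, lifting) eventually_at_top_linorder linorder_linear)
  have "\<exists>s\<ge>0. s \<le> b \<and> Spow n (Tinv n s y) = x"
    using assms b IVT2[of "\<lambda>s. Spow n (Tinv n s y)" b x 0]
    by (auto simp: Spow_Tinv_0 isCont_Spow_Tinv)
  then show ?thesis using assms Spow_Tinv_0 that by (metis less_eq_real_def order_less_irrefl)
qed

text \<open>For fixed \<open>y\<close> the level of the base point decreases strictly and
  continuously from \<open>Spow n y\<close> towards \<open>0\<close>, with derivative
  \<open>- speed\<close>, so it can replace \<open>s\<close> as the variable of integration. The two
  measures involved are compared on half-lines.\<close>

lemma nn_integral_level:
  fixes g :: "real \<Rightarrow> ennreal"
  assumes y: "y \<in> space (lborel_n n)" "Spow n y > 0" and [measurable]: "g \<in> borel_measurable borel"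
  shows "(\<integral>\<^sup>+s. g (Spow n (Tinv n s y)) * ennreal (speed n s (Tinv n s y)) * indicator {0<..} s \<partial>lborel) =
         (\<integral>\<^sup>+N. g N * indicator {0<..<Spow n y} N \<partial>lborel)"
proof -
  let ?N = "\<lambda>s. Spow n (Tinv n s y)"
  define D where "D s = ennreal (speed n s (Tinv n s y)) * indicator {0<..} s" for s
  have yc: "(\<lambda>x. y) \<in> measurable borel (lborel_n n)" using y(1) by simp
  note [measurable] = measurable_Tinv[OF _ yc]
  have [measurable]: "?N \<in> borel_measurable borel" "D \<in> borel_measurable borel"
    unfolding D_def by measurable
  let ?M1 = "distr (density lborel D) borel ?N"
  let ?M2 = "density lborel (indicator {0<..<Spow n y} :: real \<Rightarrow> ennreal)"
  have e1: "emeasure ?M1 {x<..} = (\<integral>\<^sup>+s. D s * indicator {s. x < ?N s} s \<partial>lborel)" for x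
    by (subst emeasure_distr) (auto simp: emeasure_density vimage_def)
  have e2: "emeasure ?M2 {x<..} = emeasure lborel ({0<..<Spow n y} \<inter> {x<..})" for x
    by (simp add: emeasure_density indicator_inter_arith[symmetric] del: greaterThanLessThan_iff)
  have mid: "emeasure ?M1 {x<..} = emeasure ?M2 {x<..}" if x: "0 < x" "x < Spow n y" for x
  proof -
    obtain c where c: "c > 0" "?N c = x" using Spow_Tinv_level[OF x] by blast
    have iff: "x < ?N s \<longleftrightarrow> s < c" if "s > 0" for s
      using Spow_Tinv_decreasing[OF y(2), of s c] Spow_Tinv_decreasing[OF y(2), of c s] c that
      by (metis less_eq_real_def linorder_neqE_linordered_idom order_less_asym)
    have "((\<lambda>s. speed n s (Tinv n s y)) has_integral ((- ?N c) - (- ?N 0))) {0..c}"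
    proof (rule fundamental_theorem_of_calculus_interior)
      fix s assume "s \<in> {0<..<c}"
      then have "((\<lambda>s. - ?N s) has_real_derivative - (- speed n s (Tinv n s y))) (at s)"
        by (intro DERIV_minus Spow_Tinv_has_derivative) auto
      then show "((\<lambda>s. - ?N s) has_vector_derivative speed n s (Tinv n s y)) (at s)"
        by (simp add: has_real_derivative_iff_has_vector_derivative)
    qed (use c in \<open>auto intro!: continuous_at_imp_continuous_on isCont_minus isCont_Spow_Tinv\<close>)
    then have "((\<lambda>s. speed n s (Tinv n s y)) has_integral (Spow n y - x)) {0<..<c}"
      unfolding has_integral_Icc_iff_Ioo by (simp add: Spow_Tinv_0 c)
    then have "(\<integral>\<^sup>+s. ennreal (speed n s (Tinv n s y)) * indicator {0<..<c} s \<partial>lborel) = ennreal (Spow n y - x)"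
      by (intro nn_integral_has_integral_lebesgue') auto
    moreover have "emeasure ?M1 {x<..} =
        (\<integral>\<^sup>+s. ennreal (speed n s (Tinv n s y)) * indicator {0<..<c} s \<partial>lborel)"
      unfolding e1 D_def by (intro nn_integral_cong) (auto simp: iff split: split_indicator)
    moreover have "{0<..<Spow n y} \<inter> {x<..} = {x<..<Spow n y}" using that by auto
    ultimately show ?thesis using that by (simp add: e2)
  qed
  have top: "emeasure ?M1 {x<..} = emeasure ?M2 {x<..}" if "x \<ge> Spow n y" for x
  proof -
    have "\<not> x < ?N s" if "s > 0" for s
      using Spow_Tinv_decreasing[OF y(2), of 0 s] \<open>x \<ge> Spow n y\<close> that by (simp add: Spow_Tinv_0)
    then have "D s * indicator {s. x < ?N s} s = 0" for s
      by (auto simp: D_def split: split_indicator)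
    then have "emeasure ?M1 {x<..} = 0" unfolding e1 by (simp only:) simp
    moreover have "{0<..<Spow n y} \<inter> {x<..} = {}" using that by auto
    ultimately show ?thesis by (simp only: e2 emeasure_empty)
  qed
  have bot: "emeasure ?M1 {x<..} = emeasure ?M2 {x<..}" if "x \<le> 0" for x
  proof -
    define a :: "nat \<Rightarrow> real" where "a k = inverse (of_nat (Suc k))" for k
    have a: "a k > 0" for k by (simp add: a_def)
    have un: "(\<Union>k. {a k<..}) = {0<..}"
    proof (intro equalityI subsetI)
      fix z :: real assume "z \<in> {0<..}"
      then show "z \<in> (\<Union>k. {a k<..})" using reals_Archimedean[of z] by (auto simp: a_def)
    qed (use a in \<open>auto intro: less_trans\<close>)
    have inc: "incseq (\<lambda>k. {a k<..})"
      by (intro incseq_SucI) (auto simp: a_def intro: le_less_trans[rotated] simp: field_simps)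
    have eqk: "emeasure ?M1 {a k<..} = emeasure ?M2 {a k<..}" for k
      using mid[of "a k"] top[of "a k"] a[of k] by linarith
    have "emeasure ?M1 {0<..} = (SUP k. emeasure ?M1 {a k<..})"
      unfolding un[symmetric] by (rule SUP_emeasure_incseq[symmetric]) (auto simp: inc)
    also have "\<dots> = (SUP k. emeasure ?M2 {a k<..})" unfolding eqk ..
    also have "\<dots> = emeasure ?M2 {0<..}"
      unfolding un[symmetric] by (rule SUP_emeasure_incseq) (auto simp: inc)
    finally have z: "emeasure ?M1 {0<..} = emeasure ?M2 {0<..}" .
    have "x < ?N s" "0 < ?N s" for s using Spow_Tinv_pos[OF y(2), of s] that by auto
    then have "emeasure ?M1 {x<..} = emeasure ?M1 {0<..}" unfolding e1 by simp
    moreover have "{0<..<Spow n y} \<inter> {x<..} = {0<..<Spow n y} \<inter> {0<..}" using that by auto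
    ultimately show ?thesis using z unfolding e2 by simp
  qed
  have "?M1 = ?M2"
  proof (rule measure_eqI_lessThan)
    fix x
    have "emeasure ?M1 {x<..} = emeasure ?M2 {x<..}" using mid top bot by (meson not_le_imp_less)
    then show "emeasure ?M1 {x<..} = emeasure ?M2 {x<..}" .
    also have "\<dots> \<le> emeasure lborel {0<..<Spow n y}" unfolding e2 by (intro emeasure_mono) auto
    also have "\<dots> < \<infinity>" using y by simp
    finally show "emeasure ?M1 {x<..} < \<infinity>" .
  qed auto
  then have "(\<integral>\<^sup>+N. g N \<partial>?M1) = (\<integral>\<^sup>+N. g N \<partial>?M2)" by simp
  then show ?thesis
    by (subst (asm) nn_integral_distr) (auto simp: nn_integral_density D_def mult_ac)
qed

section \<open>Outer normals, metric projection and local parallel sets\<close>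

lemma lp_ball_eq: "lp_ball p n = {x \<in> space (lborel_n n). Spow n x \<le> 1}"
  by (simp add: lp_ball_def Spow_def space_PiM)

lemma space_lborel_n: "space (lborel_n n) = PiE {..<n} (\<lambda>_. UNIV)"
  by (simp add: space_PiM)

lemma lborel_n_eqI:
  assumes "x \<in> space (lborel_n n)" "y \<in> space (lborel_n n)" "\<And>k. k < n \<Longrightarrow> x k = y k"
  shows "x = y"
  using assms by (intro PiE_ext[of x "{..<n}" "\<lambda>_. UNIV" y]) (auto simp: space_lborel_n)

lemma Tmap_space [simp]: "Tmap n s x \<in> space (lborel_n n)" by (simp add: Tmap_def space_lborel_n)
lemma Tinv_space [simp]: "Tinv n s x \<in> space (lborel_n n)" by (simp add: Tinv_def space_lborel_n)
lemma scale_n_space [simp]: "scale_n n c x \<in> space (lborel_n n)" by (simp add: scale_n_def space_lborel_n)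

lemma add_n_space [simp]: "add_n n x y \<in> space (lborel_n n)" by (simp add: add_n_def space_lborel_n)

lemma Tmap_Tinv: "y \<in> space (lborel_n n) \<Longrightarrow> Tmap n s (Tinv n s y) = y"
  by (rule lborel_n_eqI[OF Tmap_space]) (auto simp: Tmap_def Tinv_def)

lemma Tinv_Tmap: "x \<in> space (lborel_n n) \<Longrightarrow> Tinv n s (Tmap n s x) = x"
  by (rule lborel_n_eqI[OF Tinv_space]) (auto simp: Tmap_def Tinv_def)

text \<open>Young's inequality for the conjugate exponents \<open>p / (p - 1)\<close> and
  \<open>p\<close>. It is the source of the supporting hyperplanes of the ball.\<close>

lemma phi_mult_le: "phi w * z \<le> (1 - 1 / p) * \<bar>w\<bar> powr p + (1 / p) * \<bar>z\<bar> powr p"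
proof -
  have "phi w * z \<le> \<bar>phi w * z\<bar>" by simp
  also have "\<dots> = (\<bar>w\<bar> powr (p - 1)) * \<bar>z\<bar>" by (simp add: abs_mult abs_phi)
  also have "\<dots> \<le> (\<bar>w\<bar> powr (p - 1)) powr (p / (p - 1)) / (p / (p - 1)) + \<bar>z\<bar> powr p / p"
    using p_gt_1 by (intro Youngs_inequality) (auto simp: field_simps)
  also have "(\<bar>w\<bar> powr (p - 1)) powr (p / (p - 1)) = \<bar>w\<bar> powr p"
    using p_gt_1 by (simp add: powr_powr)
  finally show ?thesis using p_gt_1 by (simp add: field_simps)
qed

text \<open>The vector with entries \<open>phi (w k)\<close> is an outer normal at \<open>w\<close>:
  summing Young's inequality bounds its pairing with \<open>z\<close> by \<open>1\<close>, and
  \<open>1\<close> is its pairing with \<open>w\<close>.\<close>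

lemma normal_ineq:
  assumes "Spow n w = 1" "Spow n z \<le> 1"
  shows "(\<Sum>k<n. phi (w k) * (z k - w k)) \<le> 0"
proof -
  have "(\<Sum>k<n. phi (w k) * (z k - w k)) = (\<Sum>k<n. phi (w k) * z k) - Spow n w"
    by (simp add: Spow_def phi_mult_self[symmetric] sum_subtractf algebra_simps)
  also have "(\<Sum>k<n. phi (w k) * z k) \<le>
      (\<Sum>k<n. (1 - 1 / p) * \<bar>w k\<bar> powr p + (1 / p) * \<bar>z k\<bar> powr p)"
    by (intro sum_mono phi_mult_le)
  also have "\<dots> = (1 - 1 / p) * Spow n w + (1 / p) * Spow n z"
    by (simp add: Spow_def sum.distrib sum_distrib_left)
  also have "\<dots> \<le> 1" using assms p_gt_1 by (simp add: field_simps)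
  finally show ?thesis using assms by simp
qed

lemma dist_n_power2: "(dist_n n x y)\<^sup>2 = (\<Sum>k<n. (x k - y k)\<^sup>2)"
  by (simp add: dist_n_def L2_set_def sum_nonneg)

lemma dist_n_nonneg [simp]: "dist_n n x y \<ge> 0"
  by (simp add: dist_n_def L2_set_nonneg)

lemma dist_Tmap:
  assumes "s \<ge> 0" shows "(dist_n n (Tmap n s w) w)\<^sup>2 = s\<^sup>2 * Upow n w"
  using assms by (simp add: dist_n_power2 Upow_eq Tmap_def tau_def power_mult_distrib sum_distrib_left)

text \<open>Seen from \<open>w\<close>, the outer normal and the direction to \<open>z\<close>
  enclose at least a right angle, which gives a Pythagorean inequality. The extra term
  \<open>(dist_n n w z)\<^sup>2\<close> yields minimality and uniqueness of the projection
  together.\<close>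

lemma dist_Tmap_ge:
  assumes "s \<ge> 0" "Spow n w = 1" "Spow n z \<le> 1"
  shows "(dist_n n w z)\<^sup>2 + (dist_n n (Tmap n s w) w)\<^sup>2 \<le> (dist_n n (Tmap n s w) z)\<^sup>2"
proof -
  have "(dist_n n (Tmap n s w) z)\<^sup>2 = (\<Sum>k<n. (w k - z k)\<^sup>2 + s\<^sup>2 * (phi (w k))\<^sup>2 - 2 * s * (phi (w k) * (z k - w k)))"
    unfolding dist_n_power2
    by (intro sum.cong refl) (use assms in \<open>simp add: Tmap_def tau_def power2_eq_square algebra_simps\<close>)
  also have "\<dots> = (dist_n n w z)\<^sup>2 + (dist_n n (Tmap n s w) w)\<^sup>2 - 2 * s * (\<Sum>k<n. phi (w k) * (z k - w k))"
    using assms by (simp add: sum.distrib sum_subtractf dist_Tmap dist_n_power2[of n w] Upow_eq sum_distrib_left)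
  finally show ?thesis using mult_nonneg_nonpos[of s, OF _ normal_ineq[OF assms(2,3)]] assms(1) by linarith
qed

lemma metric_proj_Tmap:
  assumes "s \<ge> 0" "Spow n w = 1" "w \<in> space (lborel_n n)"
  shows "metric_proj n (lp_ball p n) (Tmap n s w) = w"
  unfolding metric_proj_def
proof (rule the_equality)
  show "w \<in> lp_ball p n \<and> (\<forall>z\<in>lp_ball p n. dist_n n (Tmap n s w) w \<le> dist_n n (Tmap n s w) z)"
  proof (intro conjI ballI)
    fix z assume "z \<in> lp_ball p n"
    then have "(dist_n n (Tmap n s w) w)\<^sup>2 \<le> (dist_n n (Tmap n s w) z)\<^sup>2"
      using dist_Tmap_ge[OF assms(1,2), of z] by (smt (verit) zero_le_power2 lp_ball_eq mem_Collect_eq)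
    then show "dist_n n (Tmap n s w) w \<le> dist_n n (Tmap n s w) z"
      using power2_le_imp_le dist_n_nonneg by blast
  qed (use assms in \<open>simp add: lp_ball_eq\<close>)
next
  fix x assume x: "x \<in> lp_ball p n \<and> (\<forall>z\<in>lp_ball p n. dist_n n (Tmap n s w) x \<le> dist_n n (Tmap n s w) z)"
  then have "dist_n n (Tmap n s w) x \<le> dist_n n (Tmap n s w) w" using assms by (simp add: lp_ball_eq)
  then have "(dist_n n (Tmap n s w) x)\<^sup>2 \<le> (dist_n n (Tmap n s w) w)\<^sup>2" by (intro power_mono) auto
  moreover have "Spow n x \<le> 1" using x by (simp add: lp_ball_eq)
  ultimately have "(dist_n n w x)\<^sup>2 \<le> 0"
    using dist_Tmap_ge[OF assms(1,2), of x] by linarith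
  then have "(\<Sum>k<n. (w k - x k)\<^sup>2) = 0"
    unfolding dist_n_power2 by (intro antisym sum_nonneg) auto
  then have "\<forall>k<n. x k = w k" by (subst (asm) sum_nonneg_eq_0_iff) auto
  then show "x = w" using x assms by (intro lborel_n_eqI) (auto simp: lp_ball_eq)
qed

text \<open>\<open>x\<close> and \<open>phi x\<close> have the same sign, so the moduli of the
  coordinates add up under \<open>tau\<close> and every nonzero coordinate grows.\<close>

lemma Spow_Tmap_gt:
  assumes "s > 0" "Spow n w > 0"
  shows "Spow n (Tmap n s w) > Spow n w"
proof -
  obtain i where i: "i < n" "w i \<noteq> 0" using assms Spow_pos_iff by blast
  have tau: "\<bar>tau s x\<bar> = \<bar>x\<bar> + s * \<bar>phi x\<bar>" for x
  proof (cases "x \<ge> 0")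
    case True
    then have "phi x \<ge> 0" by (simp add: phi_def)
    then show ?thesis using True assms by (simp add: tau_def)
  next
    case False
    then have "phi x \<le> 0" by (simp add: phi_def)
    moreover from this have "s * phi x \<le> 0" using assms by (simp add: mult_nonneg_nonpos)
    ultimately show ?thesis using False assms by (simp add: tau_def)
  qed
  have "\<bar>x\<bar> powr p \<le> \<bar>tau s x\<bar> powr p" for x
    using p_gt_1 assms by (intro powr_mono2) (auto simp: tau)
  moreover have "\<bar>w i\<bar> powr p < \<bar>tau s (w i)\<bar> powr p"
    using p_gt_1 assms i by (intro powr_less_mono2) (auto simp: tau)
  ultimately show ?thesis unfolding Spow_def Tmap_def
    using i by (intro sum_strict_mono_ex1) auto
qed

text \<open>The distance from \<open>Tmap n s w\<close> to the ball is
  \<open>s * sqrt (Upow n w)\<close>. Any decomposition with a summand in the ball bounds this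
  distance by \<open>\<rho>\<close>; conversely the displacement along the normal is itself of the
  form \<open>\<rho> z\<close> with \<open>z\<close> in the Euclidean ball.\<close>

lemma Tmap_mem_parallel_set:
  assumes s: "s > 0" and w: "Spow n w = 1" "w \<in> space (lborel_n n)" and rho: "\<rho> \<ge> 0"
  shows "Tmap n s w \<in> parallel_set n \<rho> (lp_ball p n) \<longleftrightarrow> s * sqrt (Upow n w) \<le> \<rho>"
proof
  have w0: "Upow n w > 0" using w Spow_pos_iff[of n w] Upow_pos_iff[of n w] by simp
  assume "Tmap n s w \<in> parallel_set n \<rho> (lp_ball p n)"
  then obtain x z where xz: "Tmap n s w = add_n n x (scale_n n \<rho> z)" "x \<in> lp_ball p n" "z \<in> lp_ball 2 n"
    by (auto simp: parallel_set_def)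
  have "(dist_n n (Tmap n s w) x)\<^sup>2 = \<rho>\<^sup>2 * (\<Sum>k<n. (z k)\<^sup>2)"
    unfolding dist_n_power2 xz(1) by (simp add: add_n_def scale_n_def power_mult_distrib sum_distrib_left)
  moreover have "(\<Sum>k<n. (z k)\<^sup>2) \<le> 1" using xz(3) by (simp add: lp_ball_def)
  ultimately have "(dist_n n (Tmap n s w) x)\<^sup>2 \<le> \<rho>\<^sup>2" by (simp add: mult_left_le)
  moreover have "s\<^sup>2 * Upow n w \<le> (dist_n n (Tmap n s w) x)\<^sup>2"
    using dist_Tmap_ge[of s n w x] dist_Tmap[of s n w] s w xz(2)
    by (smt (verit) lp_ball_eq mem_Collect_eq zero_le_power2)
  ultimately have "(s * sqrt (Upow n w))\<^sup>2 \<le> \<rho>\<^sup>2" by (simp add: power_mult_distrib)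
  then show "s * sqrt (Upow n w) \<le> \<rho>" using rho power2_le_imp_le by blast
next
  have w0: "Upow n w > 0" using w Spow_pos_iff[of n w] Upow_pos_iff[of n w] by simp
  assume le: "s * sqrt (Upow n w) \<le> \<rho>"
  then have rpos: "\<rho> > 0" using s w0 by (smt (verit) mult_pos_pos real_sqrt_gt_zero)
  define z where "z = (\<lambda>k\<in>{..<n}. s * phi (w k) / \<rho>)"
  have "Tmap n s w = add_n n w (scale_n n \<rho> z)"
    using s rpos by (auto simp: Tmap_def add_n_def scale_n_def z_def tau_def)
  moreover have "z \<in> lp_ball 2 n"
  proof -
    have "(\<Sum>k<n. \<bar>z k\<bar> powr 2) = (\<Sum>k<n. (s / \<rho>)\<^sup>2 * (phi (w k))\<^sup>2)"
      by (intro sum.cong) (auto simp: z_def power_mult_distrib power_divide)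
    also have "\<dots> = (s / \<rho>)\<^sup>2 * Upow n w" by (simp only: Upow_eq sum_distrib_left)
    also have "\<dots> = (s * sqrt (Upow n w) / \<rho>)\<^sup>2"
      by (simp add: power_divide power_mult_distrib)
    also have "\<dots> \<le> 1"
      using le rpos s w0 by (intro power_le_one) (auto simp: divide_le_eq)
    finally have "(\<Sum>k<n. \<bar>z k\<bar> powr 2) \<le> 1" .
    moreover have "z \<in> PiE {..<n} (\<lambda>_. UNIV)" by (simp add: z_def)
    ultimately show ?thesis unfolding lp_ball_def by blast
  qed
  moreover have "w \<in> lp_ball p n" using w by (simp add: lp_ball_eq)
  ultimately show "Tmap n s w \<in> parallel_set n \<rho> (lp_ball p n)" unfolding parallel_set_def by blast
qed

lemma mem_local_parallel_set:
  assumes s: "s > 0" and w: "Spow n w = 1" "w \<in> space (lborel_n n)" and rho: "\<rho> \<ge> 0"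
  shows "Tmap n s w \<in> local_parallel_set n \<rho> (lp_ball p n) B \<longleftrightarrow> w \<in> B \<and> s * sqrt (Upow n w) \<le> \<rho>"
proof -
  have "Tmap n s w \<notin> lp_ball p n" using Spow_Tmap_gt[of s n w] s w by (simp add: lp_ball_eq)
  then show ?thesis
    using Tmap_mem_parallel_set[OF assms] metric_proj_Tmap[of s n w] s w
    by (auto simp: local_parallel_set_def)
qed

text \<open>
  The value at the origin is an arbitrary boundary point; it is only charged by null sets.
\<close>

definition dir :: "nat \<Rightarrow> (nat \<Rightarrow> real) \<Rightarrow> nat \<Rightarrow> real" where
  "dir n x = (if Spow n x = 0 then (\<lambda>k\<in>{..<n}. if k = 0 then 1 else 0)
              else scale_n n (Spow n x powr (- 1 / p)) x)"

lemma Spow_scale: "c \<ge> 0 \<Longrightarrow> Spow n (scale_n n c x) = c powr p * Spow n x"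
  by (simp add: Spow_def scale_n_def sum_distrib_left abs_mult powr_mult)

lemma Upow_scale: "c \<ge> 0 \<Longrightarrow> Upow n (scale_n n c x) = c powr (2 * p - 2) * Upow n x"
  by (simp add: Upow_def scale_n_def sum_distrib_left abs_mult powr_mult)

lemma scale_n_scale_n: "scale_n n a (scale_n n b x) = scale_n n (a * b) x"
  by (auto simp: scale_n_def)

lemma scale_n_1: "x \<in> space (lborel_n n) \<Longrightarrow> scale_n n 1 x = x"
  by (rule lborel_n_eqI[OF scale_n_space]) (auto simp: scale_n_def)

lemma Spow_dir: "n > 0 \<Longrightarrow> Spow n (dir n x) = 1"
proof -
  assume n: "n > 0"
  show ?thesis
  proof (cases "Spow n x = 0")
    case True
    have "(\<Sum>i<n. \<bar>if i = 0 then 1 else 0 :: real\<bar> powr p) = (\<Sum>i<n. if i = 0 then 1 else 0)"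
      by (intro sum.cong) auto
    also have "\<dots> = 1" using n by simp
    finally have "(\<Sum>i<n. \<bar>if i = 0 then 1 else 0 :: real\<bar> powr p) = 1" .
    then show ?thesis using True by (simp add: dir_def) (simp add: Spow_def)
  next
    case False
    then have "Spow n (dir n x) = (Spow n x powr (- 1 / p)) powr p * Spow n x"
      by (simp add: dir_def Spow_scale)
    also have "(Spow n x powr (- 1 / p)) powr p = Spow n x powr (- 1)"
      using p_gt_1 by (simp add: powr_powr)
    also have "\<dots> * Spow n x = 1" using False Spow_nonneg[of n x] by (simp add: powr_minus_divide)
    finally show ?thesis .
  qed
qed

lemma dir_space [simp]: "dir n x \<in> space (lborel_n n)"
  by (simp add: dir_def space_lborel_n scale_n_def)

lemma measurable_scale_n [measurable]:
  assumes [measurable]: "f \<in> borel_measurable M" "g \<in> measurable M (lborel_n n)"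
  shows "(\<lambda>x. scale_n n (f x) (g x)) \<in> measurable M (lborel_n n)"
proof -
  have [measurable]: "(\<lambda>x. g x k) \<in> borel_measurable M" if "k \<in> {..<n}" for k
    using measurable_coord[OF assms(2)] that by simp
  show ?thesis unfolding scale_n_def by measurable
qed

lemma measurable_dir [measurable]: "dir n \<in> measurable (lborel_n n) (lborel_n n)"
proof -
  have "(\<lambda>k\<in>{..<n}. if k = 0 then 1 else 0 :: real) \<in> space (lborel_n n)" by (simp add: space_lborel_n)
  then have [measurable]: "(\<lambda>_. \<lambda>k\<in>{..<n}. if k = 0 then 1 else 0 :: real) \<in> measurable (lborel_n n) (lborel_n n)"
    by simp
  show ?thesis unfolding dir_def by measurable
qed

text \<open>\<open>phi\<close> is homogeneous of degree \<open>p - 1\<close>, so a dilation by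
  \<open>c\<close> multiplies the displacement parameter by \<open>c powr (2 - p)\<close>.\<close>

lemma Tmap_scale: "c > 0 \<Longrightarrow> s > 0 \<Longrightarrow>
    scale_n n c (Tmap n s x) = Tmap n (s * c powr (2 - p)) (scale_n n c x)"
proof -
  assume c: "c > 0" and s: "s > 0"
  have "c powr (2 - p) * c powr (p - 1) = c" using c by (simp add: powr_add[symmetric])
  then have "c * tau s z = tau (s * c powr (2 - p)) (c * z)" for z
    using c s by (simp add: tau_def phi_scale distrib_left)
  then show ?thesis by (auto simp: scale_n_def Tmap_def)
qed

text \<open>Scaling transfers the description of local parallel sets from boundary points to
  arbitrary base points. This is what allows integrals over the whole space to stand in for
  integrals over the boundary.\<close>

lemma mem_local_parallel_set_scaled:
  assumes s: "s > 0" and x: "Spow n x > 0" "x \<in> space (lborel_n n)" and rho: "\<rho> \<ge> 0" and n: "n > 0"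
  shows "scale_n n (Spow n x powr (- 1 / p)) (Tmap n s x) \<in> local_parallel_set n \<rho> (lp_ball p n) B
    \<longleftrightarrow> dir n x \<in> B \<and> s * sqrt (Upow n x) \<le> \<rho> * Spow n x powr (1 / p)"
proof -
  let ?N = "Spow n x" let ?c = "?N powr (- 1 / p)"
  have c: "?c > 0" using x by simp
  have e: "scale_n n ?c (Tmap n s x) = Tmap n (s * ?c powr (2 - p)) (dir n x)"
  proof -
    have "dir n x = scale_n n ?c x" using x by (simp add: dir_def)
    then show ?thesis by (simp only: Tmap_scale[OF c s])
  qed
  have "sqrt (Upow n (dir n x)) = ?c powr (p - 1) * sqrt (Upow n x)"
  proof -
    have "?c powr (2 * p - 2) = (?c powr (p - 1))\<^sup>2" by (simp add: power2_eq_square powr_add[symmetric])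
    then show ?thesis using x c by (simp add: dir_def Upow_scale real_sqrt_mult)
  qed
  moreover have "?c powr (2 - p) * ?c powr (p - 1) = ?c" using c by (simp add: powr_add[symmetric])
  moreover have "s * A * (B * u) = (A * B) * (s * u)" for A B u :: real by simp
  ultimately have "s * ?c powr (2 - p) * sqrt (Upow n (dir n x)) = ?c * (s * sqrt (Upow n x))"
    by (simp only:)
  moreover have "?c * z \<le> \<rho> \<longleftrightarrow> z \<le> \<rho> * ?N powr (1 / p)" for z
  proof -
    have "?c = 1 / ?N powr (1 / p)" by (simp add: powr_minus_divide)
    moreover have "?N powr (1 / p) > 0" using x by simp
    ultimately show ?thesis by (simp add: divide_le_eq)
  qed
  ultimately have "s * ?c powr (2 - p) * sqrt (Upow n (dir n x)) \<le> \<rho> \<longleftrightarrow> s * sqrt (Upow n x) \<le> \<rho> * ?N powr (1 / p)"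
    by (simp only:)
  then show ?thesis unfolding e using s c n rho
    by (subst mem_local_parallel_set) (auto simp: Spow_dir)
qed

text \<open>Outside the ball, \<open>sfoot n v\<close> and \<open>foot n v\<close> are the normal
  coordinates of \<open>v\<close>: the displacement parameter and the point of the boundary from
  which it starts. The default \<open>0\<close> elsewhere lets one formula describe all sublevel
  sets of \<open>sfoot\<close>.\<close>

definition sfoot :: "nat \<Rightarrow> (nat \<Rightarrow> real) \<Rightarrow> real" where
  "sfoot n v = (if Spow n v > 1 then (THE s. s > 0 \<and> Spow n (Tinv n s v) = 1) else 0)"

definition foot :: "nat \<Rightarrow> (nat \<Rightarrow> real) \<Rightarrow> nat \<Rightarrow> real" where
  "foot n v = Tinv n (sfoot n v) v"

lemma sfoot_eqI:
  assumes "Spow n v > 1" "s > 0" "Spow n (Tinv n s v) = 1"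
  shows "sfoot n v = s"
proof -
  have "(THE s. s > 0 \<and> Spow n (Tinv n s v) = 1) = s"
  proof (rule the_equality)
    fix t assume "t > 0 \<and> Spow n (Tinv n t v) = 1"
    then show "t = s"
      using assms Spow_Tinv_decreasing[of n v s t] Spow_Tinv_decreasing[of n v t s]
      by (smt (verit))
  qed (use assms in auto)
  then show ?thesis using assms by (simp add: sfoot_def)
qed

lemma sfoot_props:
  assumes "Spow n v > 1"
  shows "sfoot n v > 0" "Spow n (foot n v) = 1"
proof -
  obtain s where "s > 0" "Spow n (Tinv n s v) = 1" using Spow_Tinv_level[of 1 n v] assms by auto
  with sfoot_eqI[OF assms this] show "sfoot n v > 0" "Spow n (foot n v) = 1" by (auto simp: foot_def)
qed

lemma foot_space [simp]: "foot n v \<in> space (lborel_n n)" by (simp add: foot_def)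

lemma Tmap_foot: "v \<in> space (lborel_n n) \<Longrightarrow> Tmap n (sfoot n v) (foot n v) = v"
  by (simp add: foot_def Tmap_Tinv)

lemma foot_Tmap:
  assumes "s > 0" "Spow n w = 1" "w \<in> space (lborel_n n)"
  shows "foot n (Tmap n s w) = w" "sfoot n (Tmap n s w) = s"
proof -
  have "Spow n (Tmap n s w) > 1" using Spow_Tmap_gt[of s n w] assms by simp
  then show "sfoot n (Tmap n s w) = s"
    using assms by (intro sfoot_eqI) (auto simp: Tinv_Tmap)
  then show "foot n (Tmap n s w) = w" using assms by (simp add: foot_def Tinv_Tmap)
qed

text \<open>The level \<open>Spow n (Tinv n a v)\<close> does not increase in
  \<open>a \<ge> 0\<close>. So \<open>sfoot n v \<le> a\<close> says that the level has dropped to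
  at most \<open>1\<close> by the time \<open>a\<close>, and this is a measurable condition on
  \<open>v\<close>.\<close>

lemma measurable_sfoot [measurable]: "sfoot n \<in> borel_measurable (lborel_n n)"
proof -
  have eq: "sfoot n v \<le> a \<longleftrightarrow> a \<ge> 0 \<and> Spow n (Tinv n a v) \<le> 1" for a v
  proof (cases "Spow n v > 1")
    case True
    note f = sfoot_props[OF True]
    have v: "Spow n v > 0" using True by simp
    show ?thesis
    proof (cases "a \<ge> 0")
      case True
      then show ?thesis
        using f Spow_Tinv_decreasing[OF v, of a "sfoot n v"] Spow_Tinv_decreasing[OF v, of "sfoot n v" a]
        unfolding foot_def by (smt (verit))
    qed (use f in auto)
  next
    case False
    have "Spow n (Tinv n a v) \<le> 1" if "a \<ge> 0"
    proof (cases "Spow n v > 0 \<and> a > 0")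
      case True
      then show ?thesis using Spow_Tinv_decreasing[of n v 0 a] False by (simp add: Spow_Tinv_0)
    next
      case f: False
      show ?thesis
      proof (cases "a = 0")
        case False
        then have "\<not> Spow n v > 0" using f that by auto
        then have "\<not> Spow n (Tinv n a v) > 0" by (auto simp: Spow_pos_iff Tinv_def)
        then show ?thesis by simp
      qed (use False in \<open>simp add: Spow_Tinv_0\<close>)
    qed
    then show ?thesis using False by (auto simp: sfoot_def)
  qed
  show ?thesis unfolding borel_measurable_iff_le eq by measurable
qed

lemma measurable_foot [measurable]: "foot n \<in> measurable (lborel_n n) (lborel_n n)"
  unfolding foot_def by measurable

text \<open>In normal coordinates the defining condition involves measurable functions only. This
  settles the measurability of local parallel sets although the projection is given by a definite
  description.\<close>

lemma local_parallel_set_eq: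
  assumes "\<rho> \<ge> 0"
  shows "local_parallel_set n \<rho> (lp_ball p n) B =
    {v \<in> space (lborel_n n). Spow n v > 1 \<and> foot n v \<in> B \<and> sfoot n v * sqrt (Upow n (foot n v)) \<le> \<rho>}"
    (is "?L = ?R")
proof -
  have sub: "v \<in> space (lborel_n n) \<and> Spow n v > 1" if "v \<in> ?L" for v
  proof -
    have v: "v \<in> space (lborel_n n)"
      using that by (auto simp: local_parallel_set_def parallel_set_def)
    then show ?thesis using that by (auto simp: local_parallel_set_def lp_ball_eq)
  qed
  have "v \<in> ?L \<longleftrightarrow> v \<in> ?R" if v: "v \<in> space (lborel_n n)" "Spow n v > 1" for v
    using mem_local_parallel_set[OF sfoot_props[OF v(2)] foot_space assms, of B] v
    by (simp add: Tmap_foot)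
  then show ?thesis using sub by blast
qed

lemma sets_local_parallel_set [measurable]:
  assumes "\<rho> \<ge> 0" and [measurable]: "B \<in> sets (lborel_n n)"
  shows "local_parallel_set n \<rho> (lp_ball p n) B \<in> sets (lborel_n n)"
  unfolding local_parallel_set_eq[OF assms(1)] by measurable

lemma continuous_map_Spow: "continuous_map (euclidean_top n) euclideanreal (Spow n)"
proof -
  have "continuous_map (euclidean_top n) euclideanreal (\<lambda>x. \<bar>x i\<bar> powr p)" if "i < n" for i
  proof -
    have "continuous_map euclideanreal euclideanreal (\<lambda>x. \<bar>x\<bar> powr p)"
      by (simp add: isCont_abs_powr continuous_at_imp_continuous_on)
    moreover have "continuous_map (euclidean_top n) euclideanreal (\<lambda>x. x i)"
      using that continuous_map_product_projection[of i "{..<n}" "\<lambda>_. euclideanreal"] by simp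
    ultimately show ?thesis
      using continuous_map_compose[of "euclidean_top n" euclideanreal "\<lambda>x. x i" euclideanreal "\<lambda>x. \<bar>x\<bar> powr p"]
      by (simp add: o_def)
  qed
  then show ?thesis unfolding Spow_def by (intro continuous_map_sum) auto
qed

text \<open>The points with \<open>Spow n x < 1\<close> form an open set, and a point with
  \<open>Spow n x = 1\<close> is not interior because its slightly larger dilates have left the
  ball.\<close>

lemma frontier_lp_ball:
  "euclidean_top n frontier_of lp_ball p n = {x \<in> space (lborel_n n). Spow n x = 1}"
proof -
  have ts: "topspace (euclidean_top n) = space (lborel_n n)" by (simp add: space_lborel_n)
  have cl: "closedin (euclidean_top n) (lp_ball p n)"
    using closedin_continuous_map_preimage[OF continuous_map_Spow, of "{..1}" n]
    unfolding lp_ball_eq ts by simp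
  have op: "openin (euclidean_top n) {x \<in> space (lborel_n n). Spow n x < 1}"
    using openin_continuous_map_preimage[OF continuous_map_Spow, of "{..<1}" n]
    unfolding ts by simp
  have fr: "euclidean_top n frontier_of lp_ball p n = lp_ball p n - euclidean_top n interior_of lp_ball p n"
    by (simp add: frontier_of_def closure_of_closedin[OF cl])
  define I where "I = euclidean_top n interior_of lp_ball p n"
  have "x \<notin> I" if x: "x \<in> space (lborel_n n)" "Spow n x = 1" for x
  proof
    assume "x \<in> I"
    then obtain T where T: "openin (euclidean_top n) T" "x \<in> T" "T \<subseteq> lp_ball p n"
      by (auto simp: interior_of_def I_def)
    have "continuous_map euclideanreal (euclidean_top n) (\<lambda>t. scale_n n t x)"
      unfolding continuous_map_componentwise
      by (auto simp: scale_n_def intro!: continuous_intros)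
    from openin_continuous_map_preimage[OF this T(1)]
    have "open {t. scale_n n t x \<in> T}" by simp
    moreover have "1 \<in> {t. scale_n n t x \<in> T}" using x T by (simp add: scale_n_1)
    ultimately obtain e where e: "e > 0" "ball 1 e \<subseteq> {t. scale_n n t x \<in> T}"
      by (meson open_contains_ball)
    then have "1 + e / 2 \<in> ball 1 e" by (auto simp: dist_real_def)
    then have "scale_n n (1 + e / 2) x \<in> lp_ball p n" using e T by auto
    then have "(1 + e / 2) powr p \<le> 1" using x e by (simp add: lp_ball_eq Spow_scale)
    moreover have "1 < (1 + e / 2) powr p" using e p_gt_1 by (intro gr_one_powr) auto
    ultimately show False by simp
  qed
  moreover have "{x \<in> space (lborel_n n). Spow n x < 1} \<subseteq> I"
    unfolding I_def by (rule interior_of_maximal[OF _ op]) (auto simp: lp_ball_eq)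
  ultimately show ?thesis unfolding fr I_def[symmetric] by (force simp: lp_ball_eq)
qed

end

section \<open>Expansion of the Jacobian and the local Steiner formula with a weight\<close>

lemma sigma_finite_lborel_n: "sigma_finite_measure (lborel_n n)"
proof -
  interpret finite_product_sigma_finite "\<lambda>_::nat. lborel :: real measure" "{..<n}"
    by standard auto
  show ?thesis by (rule sigma_finite_measure_axioms)
qed

lemma Fubini_lborel_n:
  assumes "case_prod f \<in> borel_measurable (lborel \<Otimes>\<^sub>M lborel_n n)"
  shows "(\<integral>\<^sup>+y. (\<integral>\<^sup>+s. f s y \<partial>(lborel :: real measure)) \<partial>lborel_n n) =
         (\<integral>\<^sup>+s. (\<integral>\<^sup>+y. f s y \<partial>lborel_n n) \<partial>lborel)"
proof -
  interpret pair_sigma_finite "lborel :: real measure" "lborel_n n"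
    by (intro pair_sigma_finite.intro sigma_finite_lborel sigma_finite_lborel_n)
  show ?thesis by (rule Fubini'[OF assms])
qed

text \<open>In a pair \<open>(i, T)\<close> the coordinate \<open>i\<close> is the one that carries
  \<open>phi\<close> squared, and \<open>T\<close> collects the \<open>q - 1\<close> other
  coordinates that carry \<open>dphi\<close>.\<close>

definition idx :: "nat \<Rightarrow> nat \<Rightarrow> (nat \<times> nat set) set" where
  "idx n q = (SIGMA i:{..<n}. {T. T \<subseteq> {..<n} - {i} \<and> card T = q - 1})"

lemma finite_idx [simp]: "finite (idx n q)"
  unfolding idx_def by (intro finite_SigmaI) (auto intro: finite_subset[of _ "Pow {..<n}"])

context lp_exponent
begin

text \<open>
  Up to the factor \<open>p\<close>, this is the coefficient of \<open>s ^ (q - 1)\<close> in the product of \<open>speed n s x\<close> and the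
  Jacobian of \<open>Tmap n s\<close>.
\<close>

definition hsym :: "nat \<Rightarrow> nat \<Rightarrow> (nat \<Rightarrow> real) \<Rightarrow> real" where
  "hsym n q x = (\<Sum>(i, T)\<in>idx n q. (phi (x i))\<^sup>2 * (\<Prod>k\<in>T. dphi (x k)))"

lemma hsym_nonneg [simp]: "hsym n q x \<ge> 0"
  unfolding hsym_def by (auto intro!: sum_nonneg mult_nonneg_nonneg prod_nonneg)

lemma measurable_hsym [measurable]: "hsym n q \<in> borel_measurable (lborel_n n)"
proof -
  have [measurable]: "(\<lambda>x. x k) \<in> borel_measurable (lborel_n n)" if "k < n" for k
    using measurable_coord[of "\<lambda>x. x" "lborel_n n" n k] that by simp
  have "(\<lambda>x. (phi (x (fst z)))\<^sup>2 * (\<Prod>k\<in>snd z. dphi (x k))) \<in> borel_measurable (lborel_n n)" if "z \<in> idx n q" for z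
  proof -
    have "fst z < n" "\<And>k. k \<in> snd z \<Longrightarrow> k < n" using that by (auto simp: idx_def)
    then show ?thesis by (intro borel_measurable_times borel_measurable_power borel_measurable_prod) auto
  qed
  then show ?thesis unfolding hsym_def case_prod_beta' by (intro borel_measurable_sum) auto
qed

text \<open>The denominator in the \<open>i\<close>-th summand of \<open>speed\<close> cancels the
  \<open>i\<close>-th factor of the Jacobian, so no division remains. The product over the other
  coordinates is expanded over subsets, and grouping these by cardinality gives the powers of
  \<open>s\<close>.\<close>

lemma speed_expansion:
  assumes "s \<ge> 0"
  shows "speed n s x * (\<Prod>k<n. 1 + max 0 s * dphi (x k)) = p * (\<Sum>m<n. s ^ m * hsym n (Suc m) x)"
proof -
  let ?P = "\<Prod>k<n. 1 + max 0 s * dphi (x k)"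
  have pos: "1 + s * dphi z > 0" for z using assms by (simp add: add_pos_nonneg)
  have 1: "(phi (x i))\<^sup>2 / (1 + max 0 s * dphi (x i)) * ?P =
      (\<Sum>m<n. s ^ m * (\<Sum>T | T \<subseteq> {..<n} - {i} \<and> card T = m. (phi (x i))\<^sup>2 * (\<Prod>k\<in>T. dphi (x k))))"
    if i: "i < n" for i
  proof -
    let ?A = "{..<n} - {i}"
    have "?P = (1 + s * dphi (x i)) * (\<Prod>k\<in>?A. 1 + s * dphi (x k))"
      using i assms by (subst prod.remove[of _ i]) auto
    then have "(phi (x i))\<^sup>2 / (1 + max 0 s * dphi (x i)) * ?P = (phi (x i))\<^sup>2 * (\<Prod>k\<in>?A. s * dphi (x k) + 1)"
      using pos[of "x i"] assms by (simp add: add.commute)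
    also have "(\<Prod>k\<in>?A. s * dphi (x k) + 1) = (\<Sum>T\<in>Pow ?A. s ^ card T * (\<Prod>k\<in>T. dphi (x k)))"
      by (subst prod_add) (auto simp: prod.distrib)
    also have "\<dots> = (\<Sum>m<n. \<Sum>T | T \<in> Pow ?A \<and> card T = m. s ^ card T * (\<Prod>k\<in>T. dphi (x k)))"
    proof (rule sum.group[symmetric])
      show "card ` Pow ?A \<subseteq> {..<n}"
      proof safe
        fix T assume "T \<subseteq> ?A"
        then have "card T \<le> card ?A" by (intro card_mono) auto
        also have "\<dots> < n" using i by simp
        finally show "card T < n" .
      qed
    qed auto
    also have "\<dots> = (\<Sum>m<n. s ^ m * (\<Sum>T | T \<subseteq> ?A \<and> card T = m. (\<Prod>k\<in>T. dphi (x k))))"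
      by (intro sum.cong refl) (auto simp: sum_distrib_left)
    finally show ?thesis by (simp add: sum_distrib_left mult_ac)
  qed
  have "speed n s x * ?P = p * (\<Sum>i<n. (phi (x i))\<^sup>2 / (1 + max 0 s * dphi (x i)) * ?P)"
    by (simp add: speed_def sum_distrib_right mult.assoc)
  also have "(\<Sum>i<n. (phi (x i))\<^sup>2 / (1 + max 0 s * dphi (x i)) * ?P) =
      (\<Sum>i<n. \<Sum>m<n. s ^ m * (\<Sum>T | T \<subseteq> {..<n} - {i} \<and> card T = m. (phi (x i))\<^sup>2 * (\<Prod>k\<in>T. dphi (x k))))"
    by (intro sum.cong refl 1) auto
  also have "\<dots> = (\<Sum>m<n. s ^ m * (\<Sum>i<n. \<Sum>T | T \<subseteq> {..<n} - {i} \<and> card T = m. (phi (x i))\<^sup>2 * (\<Prod>k\<in>T. dphi (x k))))"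
    by (subst sum.swap) (simp add: sum_distrib_left)
  also have "\<dots> = (\<Sum>m<n. s ^ m * hsym n (Suc m) x)"
  proof -
    have "hsym n (Suc m) x = (\<Sum>i<n. \<Sum>T | T \<subseteq> {..<n} - {i} \<and> card T = m. (phi (x i))\<^sup>2 * (\<Prod>k\<in>T. dphi (x k)))" for m
      unfolding hsym_def idx_def
      by (subst sum.Sigma) (auto intro: finite_subset[of _ "Pow {..<n}"])
    then show ?thesis by simp
  qed
  finally show ?thesis .
qed

text \<open>Integration raises each power of \<open>s\<close> by one; reversing the order of
  summation then aligns the exponent \<open>n - j\<close> with the index \<open>j\<close> of the
  Steiner formula.\<close>

lemma nn_integral_speed:
  assumes b: "b \<ge> 0"
  shows "(\<integral>\<^sup>+s. ennreal (speed n s x * (\<Prod>k<n. 1 + max 0 s * dphi (x k))) * indicator {0<..b} s \<partial>lborel) =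
    ennreal (\<Sum>j<n. p / real (n - j) * b ^ (n - j) * hsym n (n - j) x)"
proof -
  let ?F = "\<lambda>s. p * (\<Sum>m<n. s ^ Suc m / real (Suc m) * hsym n (Suc m) x)"
  have "(\<integral>\<^sup>+s. ennreal (speed n s x * (\<Prod>k<n. 1 + max 0 s * dphi (x k))) * indicator {0<..b} s \<partial>lborel) =
    (\<integral>\<^sup>+s. ennreal (p * (\<Sum>m<n. s ^ m * hsym n (Suc m) x)) * indicator {0..b} s \<partial>lborel)"
  proof (rule nn_integral_cong_AE)
    show "AE s in lborel. ennreal (speed n s x * (\<Prod>k<n. 1 + max 0 s * dphi (x k))) * indicator {0<..b} s =
      ennreal (p * (\<Sum>m<n. s ^ m * hsym n (Suc m) x)) * indicator {0..b} s"
      using AE_lborel_singleton[of 0]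
    proof eventually_elim
      case (elim s)
      show "ennreal (speed n s x * (\<Prod>k<n. 1 + max 0 s * dphi (x k))) * indicator {0<..b} s =
        ennreal (p * (\<Sum>m<n. s ^ m * hsym n (Suc m) x)) * indicator {0..b} s"
      proof (cases "0 < s \<and> s \<le> b")
        case True
        then show ?thesis using speed_expansion[of s n x] by simp
      qed (use elim in auto)
    qed
  qed
  also have "\<dots> = ennreal (?F b - ?F 0)"
  proof (rule nn_integral_FTC_Icc)
    fix s assume s: "s \<in> {0..b}"
    have "((\<lambda>s. s ^ Suc m / real (Suc m) * hsym n (Suc m) x) has_real_derivative s ^ m * hsym n (Suc m) x) (at s)" for m
      by (rule derivative_eq_intros refl | simp)+
    then show "(?F has_real_derivative p * (\<Sum>m<n. s ^ m * hsym n (Suc m) x)) (at s)"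
      by (intro DERIV_cmult DERIV_sum)
    show "0 \<le> p * (\<Sum>m<n. s ^ m * hsym n (Suc m) x)" using s p_gt_1
      by (intro mult_nonneg_nonneg sum_nonneg) auto
  qed (use b in auto)
  also have "?F b - ?F 0 = (\<Sum>m<n. p / real (Suc m) * b ^ Suc m * hsym n (Suc m) x)"
    by (simp add: sum_distrib_left mult_ac)
  also have "\<dots> = (\<Sum>j<n. p / real (n - j) * b ^ (n - j) * hsym n (n - j) x)"
    by (subst sum.nat_diff_reindex[symmetric]) (intro sum.cong refl, simp add: Suc_diff_Suc)
  finally show ?thesis .
qed

lemma local_parallel_set_props:
  assumes "\<rho> \<ge> 0" "v \<in> local_parallel_set n \<rho> (lp_ball p n) B"
  shows "v \<in> space (lborel_n n)" "Spow n v > 1" "Spow n (foot n v) = 1"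
  using assms unfolding local_parallel_set_eq[OF assms(1)] by (auto simp: sfoot_props)

text \<open>Put \<open>x = Tinv n s y\<close> and \<open>N = Spow n x\<close>. Dividing by
  \<open>N powr (1 / p)\<close> moves \<open>x\<close> to the boundary, where it is the foot of the
  equally scaled \<open>y\<close>. Hence \<open>x\<close> can be recovered from \<open>N\<close> and
  \<open>y\<close> alone, and \<open>N\<close> may replace \<open>s\<close>.\<close>

lemma steiner_inner:
  assumes n: "n > 0" and rho: "\<rho> \<ge> 0" and [measurable]: "B \<in> sets (lborel_n n)"
    and [measurable]: "k \<in> borel_measurable (lborel_n n)"
    and y: "y \<in> space (lborel_n n)"
  defines "L \<equiv> local_parallel_set n \<rho> (lp_ball p n) B"
  shows "(\<integral>\<^sup>+s. k (Tinv n s y) * indicator L (scale_n n (Spow n (Tinv n s y) powr (- 1 / p)) y) *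
        ennreal (speed n s (Tinv n s y)) * indicator {0<..} s \<partial>lborel) =
    (\<integral>\<^sup>+N. k (scale_n n (N powr (1 / p)) (foot n (scale_n n (N powr (- 1 / p)) y))) *
        indicator L (scale_n n (N powr (- 1 / p)) y) * indicator {0<..} N \<partial>lborel)"
proof -
  have [measurable]: "L \<in> sets (lborel_n n)" unfolding L_def by (rule sets_local_parallel_set) (use rho in auto)
  have yc: "(\<lambda>x. y) \<in> measurable lborel (lborel_n n)" using y by simp
  note [measurable] = measurable_scale_n[OF _ yc]
  define g where "g N = k (scale_n n (N powr (1 / p)) (foot n (scale_n n (N powr (- 1 / p)) y))) *
        indicator L (scale_n n (N powr (- 1 / p)) y)" for N
  have g [measurable]: "g \<in> borel_measurable borel"
  proof -
    have "g \<in> borel_measurable lborel" unfolding g_def by measurable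
    then show ?thesis by simp
  qed
  \<comment> \<open>Levels \<open>N \<ge> Spow n y\<close> contribute nothing since the scaled
    \<open>y\<close> then lies in the ball. The range of \<open>N\<close> thereby becomes the whole
    half-line, independent of \<open>y\<close>, as is needed for exchanging the integrals.\<close>
  have notL: "scale_n n (N powr (- 1 / p)) y \<notin> L" if N: "N > 0" "Spow n y \<le> N" for N
  proof -
    have "(N powr (- 1 / p)) powr p = N powr (- 1)" using p_gt_1 by (simp add: powr_powr)
    also have "\<dots> = 1 / N" using N by (simp add: powr_minus_divide)
    finally have "Spow n (scale_n n (N powr (- 1 / p)) y) \<le> 1" using N by (simp add: Spow_scale)
    then show ?thesis using local_parallel_set_props(2)[OF rho] unfolding L_def by (meson not_le)
  qed
  show ?thesis
  proof (cases "Spow n y > 0")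
    case True
    have "k (Tinv n s y) * indicator L (scale_n n (Spow n (Tinv n s y) powr (- 1 / p)) y) = g (Spow n (Tinv n s y))"
      if s: "s > 0" for s
    proof -
      define x where "x = Tinv n s y"
      let ?c = "Spow n x powr (- 1 / p)"
      have x: "x \<in> space (lborel_n n)" "Spow n x > 0" "Tmap n s x = y"
        using Spow_Tinv_pos[OF True] y by (auto simp: x_def Tmap_Tinv)
      have c: "?c > 0" using x by simp
      have d: "dir n x = scale_n n ?c x" using x by (simp add: dir_def)
      have "scale_n n ?c y = Tmap n (s * ?c powr (2 - p)) (dir n x)"
        unfolding d using Tmap_scale[OF c s, of n x] x by simp
      moreover have "s * ?c powr (2 - p) > 0" using s c by (intro mult_pos_pos) auto
      ultimately have "foot n (scale_n n ?c y) = dir n x"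
        using foot_Tmap(1)[OF _ Spow_dir[OF n]] by simp
      then have "scale_n n (Spow n x powr (1 / p)) (foot n (scale_n n ?c y)) = scale_n n (Spow n x powr (1 / p) * ?c) x"
        by (simp add: d scale_n_scale_n)
      also have "Spow n x powr (1 / p) * ?c = 1" using x by (simp add: powr_add[symmetric])
      finally show ?thesis using x by (simp add: g_def scale_n_1 x_def[symmetric])
    qed
    then have "(\<integral>\<^sup>+s. k (Tinv n s y) * indicator L (scale_n n (Spow n (Tinv n s y) powr (- 1 / p)) y) *
        ennreal (speed n s (Tinv n s y)) * indicator {0<..} s \<partial>lborel) =
      (\<integral>\<^sup>+s. g (Spow n (Tinv n s y)) * ennreal (speed n s (Tinv n s y)) * indicator {0<..} s \<partial>lborel)"
      by (intro nn_integral_cong) (auto split: split_indicator)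
    also have "\<dots> = (\<integral>\<^sup>+N. g N * indicator {0<..<Spow n y} N \<partial>lborel)"
      by (rule nn_integral_level[OF y True g])
    also have "\<dots> = (\<integral>\<^sup>+N. g N * indicator {0<..} N \<partial>lborel)"
      using notL by (intro nn_integral_cong) (auto simp: g_def not_less split: split_indicator)
    finally show ?thesis by (simp add: g_def)
  next
    case False
    then have "\<not> Spow n (Tinv n s y) > 0" for s by (auto simp: Spow_pos_iff Tinv_def)
    then have "speed n s (Tinv n s y) = 0" for s by (simp add: speed_def Spow_pos_iff)
    moreover have "z * indicator L (scale_n n (N powr (- 1 / p)) y) * indicator {0<..} N = (0::ennreal)" for N z
      using notL[of N] False by (auto split: split_indicator)
    ultimately show ?thesis by (simp only:) simp
  qed
qed

text \<open>The hypothesis \<open>adm\<close> says that the radial integral of the kernel is the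
  same in every direction. It lets the kernel split off from the volume of the local parallel set as
  a constant, while on the other side it remains as a weight.\<close>

lemma local_steiner_weighted:
  assumes n: "n > 0" and rho: "\<rho> \<ge> 0" and [measurable]: "B \<in> sets (lborel_n n)"
    and [measurable]: "k \<in> borel_measurable (lborel_n n)"
    and adm: "\<And>w. w \<in> space (lborel_n n) \<Longrightarrow> Spow n w = 1 \<Longrightarrow>
      (\<integral>\<^sup>+N. ennreal (N powr (n / p)) * k (scale_n n (N powr (1 / p)) w) * indicator {0<..} N \<partial>lborel) = C"
  shows "C * emeasure (lborel_n n) (local_parallel_set n \<rho> (lp_ball p n) B) =
    (\<integral>\<^sup>+x. k x * indicator B (dir n x) * ennreal (\<Sum>j<n. p / real (n - j) *
       (\<rho> * Spow n x powr (1 / p) / sqrt (Upow n x)) ^ (n - j) * hsym n (n - j) x) \<partial>lborel_n n)"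
proof -
  define L where "L = local_parallel_set n \<rho> (lp_ball p n) B"
  have [measurable]: "L \<in> sets (lborel_n n)" unfolding L_def by (rule sets_local_parallel_set) (use rho in auto)
  define H where "H s y = k (Tinv n s y) * indicator L (scale_n n (Spow n (Tinv n s y) powr (- 1 / p)) y) *
        ennreal (speed n s (Tinv n s y)) * indicator {0<..} s" for s y
  have [measurable]: "case_prod H \<in> borel_measurable (lborel \<Otimes>\<^sub>M lborel_n n)"
    unfolding H_def case_prod_beta' by measurable
  define G where "G N y = k (scale_n n (N powr (1 / p)) (foot n (scale_n n (N powr (- 1 / p)) y))) *
        indicator L (scale_n n (N powr (- 1 / p)) y) * indicator {0<..} N" for N y
  have [measurable]: "case_prod G \<in> borel_measurable (lborel \<Otimes>\<^sub>M lborel_n n)"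
    unfolding G_def case_prod_beta' by measurable
  \<comment> \<open>After the scaling of \<open>y\<close>, the level \<open>N\<close> occurs only in
    the Jacobian \<open>N powr (n / p)\<close> and in the kernel, so the integral over
    \<open>N\<close> is the one evaluated by \<open>adm\<close>.\<close>
  define J where "J N v = ennreal (N powr (n / p)) * k (scale_n n (N powr (1 / p)) (foot n v)) * indicator L v * indicator {0<..} N" for N v
  have [measurable]: "case_prod J \<in> borel_measurable (lborel \<Otimes>\<^sub>M lborel_n n)"
    unfolding J_def case_prod_beta' by measurable

  have "(\<integral>\<^sup>+y. (\<integral>\<^sup>+s. H s y \<partial>lborel) \<partial>lborel_n n) = (\<integral>\<^sup>+y. (\<integral>\<^sup>+N. G N y \<partial>lborel) \<partial>lborel_n n)"
    unfolding H_def G_def L_def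
    by (intro nn_integral_cong steiner_inner[OF n rho]) auto
  also have "\<dots> = (\<integral>\<^sup>+N. (\<integral>\<^sup>+y. G N y \<partial>lborel_n n) \<partial>lborel)"
    by (rule Fubini_lborel_n) measurable
  also have "\<dots> = (\<integral>\<^sup>+N. (\<integral>\<^sup>+v. J N v \<partial>lborel_n n) \<partial>lborel)"
  proof (rule nn_integral_cong)
    fix N :: real
    show "(\<integral>\<^sup>+y. G N y \<partial>lborel_n n) = (\<integral>\<^sup>+v. J N v \<partial>lborel_n n)"
    proof (cases "N > 0")
      case True
      define f where "f v = k (scale_n n (N powr (1 / p)) (foot n v)) * indicator L v" for v
      have [measurable]: "f \<in> borel_measurable (lborel_n n)" unfolding f_def by measurable
      have "(\<integral>\<^sup>+y. G N y \<partial>lborel_n n) = (\<integral>\<^sup>+y. f (scale_n n (N powr (- 1 / p)) y) \<partial>lborel_n n)"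
        using True by (simp add: G_def f_def)
      also have "\<dots> = ennreal ((1 / N powr (- 1 / p)) ^ n) * (\<integral>\<^sup>+v. f v \<partial>lborel_n n)"
        using True by (intro nn_integral_scale_n) auto
      also have "(1 / N powr (- 1 / p)) ^ n = N powr (n / p)"
        using True by (simp add: powr_minus_divide powr_realpow[symmetric] powr_powr)
      also have "ennreal (N powr (n / p)) * (\<integral>\<^sup>+v. f v \<partial>lborel_n n) = (\<integral>\<^sup>+v. ennreal (N powr (n / p)) * f v \<partial>lborel_n n)"
        by (rule nn_integral_cmult[symmetric]) measurable
      also have "\<dots> = (\<integral>\<^sup>+v. J N v \<partial>lborel_n n)" using True by (simp add: J_def f_def mult.assoc)
      finally show ?thesis .
    qed (simp add: G_def J_def)
  qed
  also have "\<dots> = (\<integral>\<^sup>+v. (\<integral>\<^sup>+N. J N v \<partial>lborel) \<partial>lborel_n n)"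
    by (rule Fubini_lborel_n[symmetric]) measurable
  also have "\<dots> = (\<integral>\<^sup>+v. C * indicator L v \<partial>lborel_n n)"
  proof (rule nn_integral_cong)
    fix v
    show "(\<integral>\<^sup>+N. J N v \<partial>lborel) = C * indicator L v"
    proof (cases "v \<in> L")
      case True
      then have "Spow n (foot n v) = 1" using local_parallel_set_props(3)[OF rho] unfolding L_def by blast
      from adm[OF foot_space this] show ?thesis using True by (simp add: J_def)
    qed (simp add: J_def)
  qed
  also have "\<dots> = C * emeasure (lborel_n n) L" by (simp add: nn_integral_cmult)
  finally have left: "(\<integral>\<^sup>+y. (\<integral>\<^sup>+s. H s y \<partial>lborel) \<partial>lborel_n n) = C * emeasure (lborel_n n) L" .

  \<comment> \<open>For the second evaluation \<open>s\<close> is fixed first: \<open>F\<close> is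
    the integrand in terms of the base point \<open>x\<close>, and \<open>E\<close> includes the
    Jacobian of \<open>y = Tmap n s x\<close>.\<close>
  define F where "F s x = k x * indicator L (scale_n n (Spow n x powr (- 1 / p)) (Tmap n s x)) *
        ennreal (speed n s x) * indicator {0<..} s" for s x
  have [measurable]: "case_prod F \<in> borel_measurable (lborel \<Otimes>\<^sub>M lborel_n n)"
    unfolding F_def case_prod_beta' by measurable
  have Fs: "F s \<in> borel_measurable (lborel_n n)" for s unfolding F_def by measurable
  define E where "E s x = F s x * ennreal (\<Prod>k<n. 1 + max 0 s * dphi (x k))" for s x
  have [measurable]: "case_prod E \<in> borel_measurable (lborel \<Otimes>\<^sub>M lborel_n n)"
  proof -
    have [measurable]: "(\<lambda>z. snd z k) \<in> borel_measurable (lborel \<Otimes>\<^sub>M lborel_n n)" if "k \<in> {..<n}" for k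
      using measurable_coord[of snd "lborel \<Otimes>\<^sub>M lborel_n n" n k] that by simp
    show ?thesis unfolding E_def case_prod_beta' by measurable
  qed
  have "(\<integral>\<^sup>+y. (\<integral>\<^sup>+s. H s y \<partial>lborel) \<partial>lborel_n n) = (\<integral>\<^sup>+s. (\<integral>\<^sup>+y. H s y \<partial>lborel_n n) \<partial>lborel)"
    by (rule Fubini_lborel_n) measurable
  also have "\<dots> = (\<integral>\<^sup>+s. (\<integral>\<^sup>+x. E s x \<partial>lborel_n n) \<partial>lborel)"
  proof (rule nn_integral_cong)
    fix s :: real
    have "(\<integral>\<^sup>+y. H s y \<partial>lborel_n n) = (\<integral>\<^sup>+y. F s (Tinv n s y) \<partial>lborel_n n)"
      by (intro nn_integral_cong) (simp add: H_def F_def Tmap_Tinv)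
    also have "\<dots> = (\<integral>\<^sup>+x. E s x \<partial>lborel_n n)" unfolding E_def by (rule nn_integral_Tinv[OF Fs])
    finally show "(\<integral>\<^sup>+y. H s y \<partial>lborel_n n) = (\<integral>\<^sup>+x. E s x \<partial>lborel_n n)" .
  qed
  also have "\<dots> = (\<integral>\<^sup>+x. (\<integral>\<^sup>+s. E s x \<partial>lborel) \<partial>lborel_n n)"
    by (rule Fubini_lborel_n[symmetric]) measurable
  also have "\<dots> = (\<integral>\<^sup>+x. k x * indicator B (dir n x) * ennreal (\<Sum>j<n. p / real (n - j) *
       (\<rho> * Spow n x powr (1 / p) / sqrt (Upow n x)) ^ (n - j) * hsym n (n - j) x) \<partial>lborel_n n)"
  proof (rule nn_integral_cong)
    fix x assume x: "x \<in> space (lborel_n n)"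
    let ?b = "\<rho> * Spow n x powr (1 / p) / sqrt (Upow n x)"
    let ?w = "\<lambda>s. speed n s x * (\<Prod>k<n. 1 + max 0 s * dphi (x k))"
    have b: "?b \<ge> 0" using rho by simp
    show "(\<integral>\<^sup>+s. E s x \<partial>lborel) = k x * indicator B (dir n x) *
      ennreal (\<Sum>j<n. p / real (n - j) * ?b ^ (n - j) * hsym n (n - j) x)"
    proof (cases "Spow n x > 0")
      case True
      then have U: "Upow n x > 0" by (simp add: Spow_pos_iff Upow_pos_iff)
      \<comment> \<open>Membership in the scaled local parallel set separates into a condition on
        the direction of \<open>x\<close> and the upper limit \<open>?b\<close> for
        \<open>s\<close>.\<close>
      have "E s x = k x * indicator B (dir n x) * (ennreal (?w s) * indicator {0<..?b} s)" for s
      proof (cases "s > 0")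
        case s: True
        have "scale_n n (Spow n x powr (- 1 / p)) (Tmap n s x) \<in> L \<longleftrightarrow> dir n x \<in> B \<and> s \<le> ?b"
          unfolding L_def mem_local_parallel_set_scaled[OF s True x rho n] using U by (simp add: pos_le_divide_eq)
        then have "indicator L (scale_n n (Spow n x powr (- 1 / p)) (Tmap n s x)) = (indicator B (dir n x) * indicator {0<..?b} s :: ennreal)"
          using s by (auto split: split_indicator)
        moreover have "ennreal (?w s) = ennreal (speed n s x) * ennreal (\<Prod>k<n. 1 + max 0 s * dphi (x k))"
          by (intro ennreal_mult prod_nonneg) auto
        ultimately show ?thesis using s by (simp add: E_def F_def mult_ac)
      qed (simp add: E_def F_def)
      then have "(\<integral>\<^sup>+s. E s x \<partial>lborel) = (\<integral>\<^sup>+s. k x * indicator B (dir n x) * (ennreal (?w s) * indicator {0<..?b} s) \<partial>lborel)" by simp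
      also have "\<dots> = k x * indicator B (dir n x) * (\<integral>\<^sup>+s. (ennreal (?w s) * indicator {0<..?b} s) \<partial>lborel)"
      proof (rule nn_integral_cmult)
        have xc: "(\<lambda>s. x) \<in> measurable lborel (lborel_n n)" using x by simp
        note [measurable] = measurable_speed[OF _ xc]
        show "(\<lambda>s. ennreal (?w s) * indicator {0<..?b} s) \<in> borel_measurable lborel" by measurable
      qed
      finally show ?thesis unfolding nn_integral_speed[OF b] .
    next
      case False
      then have z: "Upow n x = 0" "\<And>k. k < n \<Longrightarrow> x k = 0"
        using Upow_nonneg[of n x] Upow_pos_iff[of n x] Spow_pos_iff[of n x] by (auto simp: less_le)
      then have "speed n s x = 0" for s by (simp add: speed_def)
      then have "E s x = 0" for s by (simp add: E_def F_def)
      moreover have "(\<Sum>j<n. p / real (n - j) * ?b ^ (n - j) * hsym n (n - j) x) = 0"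
        by (intro sum.neutral) (auto simp: z)
      ultimately show ?thesis by (simp only:) simp
    qed
  qed
  finally show ?thesis using left unfolding L_def by simp
qed

end

section \<open>Radial representation of the curvature measures\<close>

lemma nn_integral_Gamma:
  assumes a: "a > 0" and c: "c > 0"
  shows "(\<integral>\<^sup>+t. ennreal (t powr (a - 1) * exp (- (c * t))) * indicator {0<..} t \<partial>lborel) = ennreal (Gamma a * c powr (- a))"
proof -
  have "(\<integral>\<^sup>+t. ennreal (t powr (a - 1) / exp t) * indicator {0..} t \<partial>lborel) = ennreal (Gamma a)"
    by (intro nn_integral_has_integral_lebesgue' Gamma_integral_real a) auto
  also have "(\<integral>\<^sup>+t. ennreal (t powr (a - 1) / exp t) * indicator {0..} t \<partial>lborel) =
     (\<integral>\<^sup>+t. ennreal (t powr (a - 1) * exp (- t)) * indicator {0<..} t \<partial>lborel)"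
    by (intro nn_integral_cong) (auto simp: exp_minus field_simps split: split_indicator)
  also have "\<dots> = ennreal c * (\<integral>\<^sup>+t. ennreal ((c * t) powr (a - 1) * exp (- (c * t))) * indicator {0<..} (c * t) \<partial>lborel)"
    using nn_integral_real_affine[of "\<lambda>t. ennreal (t powr (a - 1) * exp (- t)) * indicator {0<..} t" c 0] c by simp
  also have "\<dots> = ennreal c * (\<integral>\<^sup>+t. ennreal (c powr (a - 1)) * (ennreal (t powr (a - 1) * exp (- (c * t))) * indicator {0<..} t) \<partial>lborel)"
  proof (rule arg_cong[where f="(*) (ennreal c)"], rule nn_integral_cong)
    fix t :: real
    show "ennreal ((c * t) powr (a - 1) * exp (- (c * t))) * indicator {0<..} (c * t) =
      ennreal (c powr (a - 1)) * (ennreal (t powr (a - 1) * exp (- (c * t))) * indicator {0<..} t)"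
      using c by (cases "t > 0") (auto simp: powr_mult ennreal_mult[symmetric] mult.assoc zero_less_mult_iff)
  qed
  also have "\<dots> = (ennreal c * ennreal (c powr (a - 1))) * (\<integral>\<^sup>+t. (ennreal (t powr (a - 1) * exp (- (c * t))) * indicator {0<..} t) \<partial>lborel)"
    by (subst nn_integral_cmult) (auto simp: mult.assoc)
  also have "ennreal c * ennreal (c powr (a - 1)) = ennreal (c powr a)"
    using c by (simp add: ennreal_mult[symmetric] powr_mult_base)
  finally have "ennreal (Gamma a) = ennreal (c powr a) * (\<integral>\<^sup>+t. (ennreal (t powr (a - 1) * exp (- (c * t))) * indicator {0<..} t) \<partial>lborel)" (is "_ = _ * ?I") by simp
  then have "ennreal (c powr (- a)) * ennreal (Gamma a) = (ennreal (c powr (- a)) * ennreal (c powr a)) * ?I"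
    by (simp add: mult.assoc)
  moreover have "ennreal (c powr (- a)) * ennreal (c powr a) = 1"
    using c by (simp add: ennreal_mult[symmetric] powr_add[symmetric])
  ultimately show ?thesis using a by (simp add: ennreal_mult[symmetric] mult.commute Gamma_real_nonneg less_imp_le)
qed

context lp_exponent
begin

text \<open>The substitution \<open>z = phi x\<close>, obtained like the one for \<open>tinv\<close>
  by comparison on intervals. It absorbs the weight \<open>dphi\<close> into Lebesgue measure, which
  is how masses of \<open>dphi\<close> type become integrals with a quadratic exponent.\<close>

lemma nn_integral_phi:
  assumes [measurable]: "f \<in> borel_measurable borel"
  shows "(\<integral>\<^sup>+x. f (phi x) * ennreal (dphi x) \<partial>lborel) = (\<integral>\<^sup>+z. f z \<partial>lborel)"
proof -
  have surj: "surj phi"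
  proof -
    have "\<exists>x. phi x = y" for y
    proof -
      have ge: "\<exists>x. phi x = y" if "y > 0" for y
        using that p_gt_1 by (intro exI[of _ "y powr (1 / (p - 1))"]) (simp add: phi_pos powr_powr)
      show ?thesis
        using ge[of y] ge[of "-y"] phi_minus phi_0
        by (metis linorder_neqE_linordered_idom neg_0_less_iff_less minus_minus)
    qed
    then show ?thesis by (metis surjI)
  qed
  let ?M = "distr (density lborel (\<lambda>x. ennreal (dphi x))) borel phi"
  have "lborel = ?M"
  proof (rule lborel_eqI)
    fix l u :: real assume "\<And>b. b \<in> Basis \<Longrightarrow> l \<bullet> b \<le> u \<bullet> b"
    then have lu: "l \<le> u" by simp
    obtain a b where a: "phi a = l" and b: "phi b = u" using surj by (metis surjD)
    have ab: "a \<le> b" using lu strict_mono_less_eq[OF phi_strict_mono] a b by blast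
    have vim: "phi -` box l u = {a<..<b}"
      using strict_mono_less[OF phi_strict_mono] a b by auto
    have "(dphi has_integral (phi b - phi a)) {a..b}"
    proof (rule fundamental_theorem_of_calculus_interior_strong[where S="{0}"])
      fix x assume "x \<in> {a<..<b} - {0}"
      then show "(phi has_vector_derivative dphi x) (at x)"
        unfolding has_real_derivative_iff_has_vector_derivative[symmetric]
        by (auto intro!: phi_has_derivative)
    qed (auto simp: ab intro: continuous_phi)
    then have "(dphi has_integral (u - l)) {a<..<b}"
      unfolding has_integral_Icc_iff_Ioo by (simp add: a b)
    then have I: "(\<integral>\<^sup>+x. ennreal (dphi x) * indicator {a<..<b} x \<partial>lborel) = ennreal (u - l)"
      by (intro nn_integral_has_integral_lebesgue') auto
    have "emeasure ?M (box l u) = (\<integral>\<^sup>+x. ennreal (dphi x) * indicator {a<..<b} x \<partial>lborel)"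
    proof (subst emeasure_distr)
      show "phi \<in> borel_measurable (density lborel (\<lambda>x. ennreal (dphi x)))" by measurable
    qed (simp_all only: vim space_density space_lborel space_borel Int_UNIV_right, simp_all add: emeasure_density)
    then show "emeasure ?M (box l u) = ennreal (\<Prod>b\<in>Basis. (u - l) \<bullet> b)" using I by simp
  qed simp
  then have "(\<integral>\<^sup>+y. f y \<partial>lborel) = (\<integral>\<^sup>+y. f y \<partial>?M)" by simp
  also have "\<dots> = (\<integral>\<^sup>+x. f (phi x) * ennreal (dphi x) \<partial>lborel)"
    by (simp add: nn_integral_distr nn_integral_density mult.commute)
  finally show ?thesis by simp
qed

lemma frontier_sets [measurable]: "euclidean_top n frontier_of lp_ball p n \<in> sets (lborel_n n)"
  unfolding frontier_lp_ball by measurable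

lemma sets_bdry_spaceD: "B \<in> sets (bdry_space n (lp_ball p n)) \<Longrightarrow> B \<in> sets (lborel_n n)"
  using frontier_sets[of n] unfolding bdry_space_def by (auto simp: sets_restrict_space)

lemma space_bdry_space: "space (bdry_space n (lp_ball p n)) = euclidean_top n frontier_of lp_ball p n"
  unfolding bdry_space_def space_restrict_space frontier_lp_ball by auto

lemma measurable_dir_bdry [measurable]:
  "n > 0 \<Longrightarrow> dir n \<in> measurable (lborel_n n) (bdry_space n (lp_ball p n))"
  unfolding bdry_space_def
  by (rule measurable_restrict_space2) (auto simp: frontier_lp_ball Spow_dir)

text \<open>The constant matches the coefficient \<open>p / q\<close> of the weighted Steiner
  formula, divided by the radial kernel mass \<open>C\<close>, with the factor
  \<open>unit_ball_vol q\<close> in the definition of curvature measures.\<close>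

definition radial_measure :: "nat \<Rightarrow> ((nat \<Rightarrow> real) \<Rightarrow> ennreal) \<Rightarrow> real \<Rightarrow> nat \<Rightarrow> (nat \<Rightarrow> real) measure" where
  "radial_measure n k C q = distr (density (lborel_n n) (\<lambda>x. k x * ennreal (p / (real q * C * unit_ball_vol (real q)) *
      (Spow n x powr (1 / p) / sqrt (Upow n x)) ^ q * hsym n q x)))
     (bdry_space n (lp_ball p n)) (dir n)"

lemma nn_integral_radial_measure:
  assumes "n > 0" and [measurable]: "k \<in> borel_measurable (lborel_n n)" "g \<in> borel_measurable (bdry_space n (lp_ball p n))"
  shows "(\<integral>\<^sup>+x. g x \<partial>radial_measure n k C q) = (\<integral>\<^sup>+x. g (dir n x) * (k x * ennreal (p / (real q * C * unit_ball_vol (real q)) *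
      (Spow n x powr (1 / p) / sqrt (Upow n x)) ^ q * hsym n q x)) \<partial>lborel_n n)"
proof -
  note [measurable] = measurable_dir_bdry[OF assms(1)]
  show ?thesis unfolding radial_measure_def
    by (simp add: nn_integral_distr nn_integral_density mult.commute)
qed

text \<open>Dividing the weighted formula by \<open>C\<close> gives the defining identity term by
  term. By uniqueness all admissible kernels represent the same curvature measures.\<close>

lemma is_curvature_measures_radial_measure:
  assumes n: "n > 0" and C: "C > 0" and k [measurable]: "k \<in> borel_measurable (lborel_n n)"
    and adm: "\<And>w. w \<in> space (lborel_n n) \<Longrightarrow> Spow n w = 1 \<Longrightarrow>
      (\<integral>\<^sup>+N. ennreal (N powr (n / p)) * k (scale_n n (N powr (1 / p)) w) * indicator {0<..} N \<partial>lborel) = ennreal C"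
  shows "is_curvature_measures n (lp_ball p n) (\<lambda>j. radial_measure n k C (n - j))"
proof -
  let ?bd = "bdry_space n (lp_ball p n)"
  let ?z = "\<lambda>x. Spow n x powr (1 / p) / sqrt (Upow n x)"
  let ?\<kappa> = "\<lambda>q. unit_ball_vol (real q)"
  have sets: "sets (radial_measure n k C q) = sets ?bd" for q by (simp add: radial_measure_def)
  have em: "emeasure (radial_measure n k C q) B = (\<integral>\<^sup>+x. indicator B (dir n x) * (k x * ennreal (p / (real q * C * ?\<kappa> q) * ?z x ^ q * hsym n q x)) \<partial>lborel_n n)"
    if "B \<in> sets ?bd" for B q
  proof -
    have "emeasure (radial_measure n k C q) B = (\<integral>\<^sup>+x. indicator B x \<partial>radial_measure n k C q)"
      using that by (simp add: sets nn_integral_indicator)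
    also have "\<dots> = (\<integral>\<^sup>+x. indicator B (dir n x) * (k x * ennreal (p / (real q * C * ?\<kappa> q) * ?z x ^ q * hsym n q x)) \<partial>lborel_n n)"
      using that by (intro nn_integral_radial_measure n k) auto
    finally show ?thesis .
  qed
  have main: "emeasure (lborel_n n) (local_parallel_set n \<rho> (lp_ball p n) B) =
      (\<Sum>j<n. ennreal (?\<kappa> (n - j) * \<rho> ^ (n - j)) * emeasure (radial_measure n k C (n - j)) B)"
    if B: "B \<in> sets ?bd" and rho: "\<rho> \<ge> 0" for B \<rho>
  proof -
    note [measurable] = sets_bdry_spaceD[OF B]
    have 1: "k x * indicator B (dir n x) * ennreal (\<Sum>j<n. p / real (n - j) * (\<rho> * Spow n x powr (1 / p) / sqrt (Upow n x)) ^ (n - j) * hsym n (n - j) x)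
      = (\<Sum>j<n. ennreal (C * (?\<kappa> (n - j) * \<rho> ^ (n - j))) * (indicator B (dir n x) * (k x * ennreal (p / (real (n - j) * C * ?\<kappa> (n - j)) * ?z x ^ (n - j) * hsym n (n - j) x))))" for x
    proof -
      have "ennreal (p / real (n - j) * (\<rho> * Spow n x powr (1 / p) / sqrt (Upow n x)) ^ (n - j) * hsym n (n - j) x) =
         ennreal (C * (?\<kappa> (n - j) * \<rho> ^ (n - j))) * ennreal (p / (real (n - j) * C * ?\<kappa> (n - j)) * ?z x ^ (n - j) * hsym n (n - j) x)"
        for j
      proof -
        define u where "u = ?\<kappa> (n - j)"
        have kp: "u > 0" by (simp add: u_def)
        have "p / real (n - j) * (\<rho> * Spow n x powr (1 / p) / sqrt (Upow n x)) ^ (n - j) * hsym n (n - j) x =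
          C * (u * \<rho> ^ (n - j)) * (p / (real (n - j) * C * u) * ?z x ^ (n - j) * hsym n (n - j) x)"
          using C kp by (simp add: power_mult_distrib power_divide)
        also have "ennreal \<dots> = ennreal (C * (u * \<rho> ^ (n - j))) * ennreal (p / (real (n - j) * C * u) * ?z x ^ (n - j) * hsym n (n - j) x)"
          using C kp rho p_gt_1 by (intro ennreal_mult mult_nonneg_nonneg divide_nonneg_nonneg zero_le_power) auto
        finally show ?thesis unfolding u_def .
      qed
      moreover have "ennreal (\<Sum>j<n. p / real (n - j) * (\<rho> * Spow n x powr (1 / p) / sqrt (Upow n x)) ^ (n - j) * hsym n (n - j) x)
        = (\<Sum>j<n. ennreal (p / real (n - j) * (\<rho> * Spow n x powr (1 / p) / sqrt (Upow n x)) ^ (n - j) * hsym n (n - j) x))"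
        using rho p_gt_1 by (intro sum_ennreal[symmetric] mult_nonneg_nonneg divide_nonneg_nonneg zero_le_power) auto
      ultimately show ?thesis
        by (simp only: sum_distrib_left) (intro sum.cong refl, simp only: mult_ac)
    qed
    have "ennreal C * emeasure (lborel_n n) (local_parallel_set n \<rho> (lp_ball p n) B) =
      (\<integral>\<^sup>+x. (\<Sum>j<n. ennreal (C * (?\<kappa> (n - j) * \<rho> ^ (n - j))) * (indicator B (dir n x) * (k x * ennreal (p / (real (n - j) * C * ?\<kappa> (n - j)) * ?z x ^ (n - j) * hsym n (n - j) x)))) \<partial>lborel_n n)"
      unfolding 1[symmetric] by (rule local_steiner_weighted[OF n rho _ k adm]) auto
    also have "\<dots> = (\<Sum>j<n. ennreal (C * (?\<kappa> (n - j) * \<rho> ^ (n - j))) * emeasure (radial_measure n k C (n - j)) B)"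
      unfolding em[OF B]
      by (subst nn_integral_sum) (auto intro!: sum.cong nn_integral_cmult)
    also have "\<dots> = ennreal C * (\<Sum>j<n. ennreal (?\<kappa> (n - j) * \<rho> ^ (n - j)) * emeasure (radial_measure n k C (n - j)) B)"
      using C rho by (simp add: sum_distrib_left ennreal_mult mult.assoc)
    finally have "ennreal (1 / C) * (ennreal C * emeasure (lborel_n n) (local_parallel_set n \<rho> (lp_ball p n) B)) =
      ennreal (1 / C) * (ennreal C * (\<Sum>j<n. ennreal (?\<kappa> (n - j) * \<rho> ^ (n - j)) * emeasure (radial_measure n k C (n - j)) B))" by simp
    then show ?thesis using C by (simp add: mult.assoc[symmetric] ennreal_mult[symmetric])
  qed
  \<comment> \<open>The local parallel set lies in a cube, because the coordinates of points in
    either ball are bounded by \<open>1\<close>.\<close>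
  have fin: "emeasure (lborel_n n) (local_parallel_set n \<rho> (lp_ball p n) B) < \<infinity>" if "\<rho> \<ge> 0" for \<rho> B
  proof -
    have sub: "local_parallel_set n \<rho> (lp_ball p n) B \<subseteq> PiE {..<n} (\<lambda>_. {- (1 + \<rho>)..1 + \<rho>})"
    proof
      have le1: "\<bar>x i\<bar> \<le> 1" if "(\<Sum>i<n. \<bar>x i\<bar> powr r) \<le> 1" "r > 0" "i < n" for x :: "nat \<Rightarrow> real" and r i
      proof -
        have "\<bar>x i\<bar> powr r \<le> (\<Sum>i<n. \<bar>x i\<bar> powr r)" using that(3) by (intro member_le_sum[of i "{..<n}" "\<lambda>i. \<bar>x i\<bar> powr r"]) auto
        then have "\<bar>x i\<bar> powr r \<le> 1" using that by simp
        then show ?thesis using that(2) gr_one_powr[of "\<bar>x i\<bar>" r] by linarith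
      qed
      fix y assume "y \<in> local_parallel_set n \<rho> (lp_ball p n) B"
      then obtain x z where y: "y = add_n n x (scale_n n \<rho> z)" "x \<in> lp_ball p n" "z \<in> lp_ball 2 n"
        by (auto simp: local_parallel_set_def parallel_set_def)
      have "\<bar>y i\<bar> \<le> 1 + \<rho>" if i: "i < n" for i
      proof -
        have "\<bar>x i\<bar> \<le> 1" "\<bar>z i\<bar> \<le> 1" using y i p_gt_1 le1[of x p i] le1[of z 2 i] by (auto simp: lp_ball_def)
        moreover have "\<bar>\<rho> * z i\<bar> \<le> \<rho>" using \<open>\<bar>z i\<bar> \<le> 1\<close> \<open>\<rho> \<ge> 0\<close> by (simp add: abs_mult mult_left_le)
        ultimately show ?thesis using i y(1) by (simp add: add_n_def scale_n_def)
      qed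
      moreover have "y \<in> extensional {..<n}" using y(1) by (simp add: add_n_def)
      ultimately show "y \<in> PiE {..<n} (\<lambda>_. {- (1 + \<rho>)..1 + \<rho>})" by (auto simp: PiE_def abs_le_iff) (smt (verit) abs_le_iff)+
    qed
    interpret product_sigma_finite "\<lambda>_::nat. lborel :: real measure" ..
    have "emeasure (lborel_n n) (local_parallel_set n \<rho> (lp_ball p n) B) \<le> emeasure (lborel_n n) (PiE {..<n} (\<lambda>_. {- (1 + \<rho>)..1 + \<rho>}))"
      by (intro emeasure_mono sub) auto
    also have "\<dots> = (\<Prod>i<n. emeasure lborel {- (1 + \<rho>)..1 + \<rho>})" by (rule emeasure_PiM) auto
    also have "\<dots> < \<infinity>" using that by (simp add: prod_constant power_less_top_ennreal)
    finally show ?thesis .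
  qed
  \<comment> \<open>Finiteness is read off from the identity itself at radius \<open>1\<close>: each
    nonnegative summand is at most the volume of a bounded set.\<close>
  have finm: "finite_measure (radial_measure n k C (n - j))" if "j < n" for j
  proof
    let ?B = "space ?bd"
    have "ennreal (?\<kappa> (n - j) * 1 ^ (n - j)) * emeasure (radial_measure n k C (n - j)) ?B \<le>
       (\<Sum>j<n. ennreal (?\<kappa> (n - j) * 1 ^ (n - j)) * emeasure (radial_measure n k C (n - j)) ?B)"
      using that by (intro member_le_sum) auto
    also have "\<dots> = emeasure (lborel_n n) (local_parallel_set n 1 (lp_ball p n) ?B)"
      by (rule main[symmetric]) auto
    also have "\<dots> < \<infinity>" by (rule fin) simp
    finally have "ennreal (?\<kappa> (n - j)) * emeasure (radial_measure n k C (n - j)) ?B < \<infinity>" by simp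
    moreover have "ennreal (?\<kappa> (n - j)) \<noteq> 0"
      by (simp only: ennreal_eq_0_iff not_le unit_ball_vol_pos of_nat_0_le_iff)
    ultimately have "emeasure (radial_measure n k C (n - j)) ?B < \<infinity>"
      by (metis ennreal_mult_eq_top_iff infinity_ennreal_def less_top)
    then show "emeasure (radial_measure n k C (n - j)) (space (radial_measure n k C (n - j))) \<noteq> \<infinity>"
      using sets_eq_imp_space_eq[OF sets[of "n - j"]] by simp
  qed
  show ?thesis unfolding is_curvature_measures_def
  proof (intro conjI allI impI ballI finm sets)
    fix \<rho> :: real and B assume rho: "0 \<le> \<rho>" and B: "B \<in> sets ?bd"
    have "emeasure (lborel_n n) (local_parallel_set n \<rho> (lp_ball p n) B) =
      (\<Sum>j<n. ennreal (?\<kappa> (n - j) * \<rho> ^ (n - j) * measure (radial_measure n k C (n - j)) B))"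
      unfolding main[OF B rho]
      using rho by (intro sum.cong refl) (auto simp: finite_measure.emeasure_eq_measure[OF finm] ennreal_mult)
    also have "\<dots> = ennreal (\<Sum>j<n. ?\<kappa> (n - j) * \<rho> ^ (n - j) * measure (radial_measure n k C (n - j)) B)"
      using rho by (intro sum_ennreal) auto
    finally show "measure (lborel_n n) (local_parallel_set n \<rho> (lp_ball p n) B) =
      (\<Sum>j<n. ?\<kappa> (n - j) * \<rho> ^ (n - j) * measure (radial_measure n k C (n - j)) B)"
    proof (rule measure_eq_emeasure_eq_ennreal[rotated])
      show "0 \<le> (\<Sum>j<n. ?\<kappa> (n - j) * \<rho> ^ (n - j) * measure (radial_measure n k C (n - j)) B)"
        using rho by (intro sum_nonneg mult_nonneg_nonneg zero_le_power measure_nonneg less_imp_le[OF unit_ball_vol_pos]) auto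
    qed
  qed
qed

text \<open>The total mass of \<open>W\<close> depends on the kernel only through \<open>C\<close>;
  the other factors are determined by \<open>n\<close>, \<open>j\<close> and \<open>p\<close>. Two
  kernels can therefore be compared without knowing the intrinsic volume.\<close>

lemma curvature_law_repr:
  assumes n: "n > 0" and j: "j < n" and C: "C > 0" and k [measurable]: "k \<in> borel_measurable (lborel_n n)"
    and adm: "\<And>w. w \<in> space (lborel_n n) \<Longrightarrow> Spow n w = 1 \<Longrightarrow>
      (\<integral>\<^sup>+N. ennreal (N powr (n / p)) * k (scale_n n (N powr (1 / p)) w) * indicator {0<..} N \<partial>lborel) = ennreal C"
    and M: "prob_space M" and X [measurable]: "X \<in> measurable M (bdry_space n (lp_ball p n))"
    and law: "\<And>A. A \<in> sets (bdry_space n (lp_ball p n)) \<Longrightarrow> measure M (X -` A \<inter> space M) =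
         measure (curvature_measure n (lp_ball p n) j) A / intrinsic_volume n (lp_ball p n) j"
  defines "W \<equiv> \<lambda>x. k x * ennreal ((Spow n x powr (1 / p) / sqrt (Upow n x)) ^ (n - j) * hsym n (n - j) x)"
  shows "intrinsic_volume n (lp_ball p n) j > 0"
    "(\<integral>\<^sup>+x. W x \<partial>lborel_n n) = ennreal (C * (intrinsic_volume n (lp_ball p n) j * (real (n - j) * unit_ball_vol (real (n - j)) / p)))"
    "\<And>g. g \<in> borel_measurable (lborel_n n) \<Longrightarrow>
      (\<integral>\<^sup>+x. W x \<partial>lborel_n n) * (\<integral>\<^sup>+\<omega>. g (X \<omega>) \<partial>M) = (\<integral>\<^sup>+x. g (dir n x) * W x \<partial>lborel_n n)"
proof -
  let ?bd = "bdry_space n (lp_ball p n)"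
  interpret prob_space M by (rule M)
  define cq where "cq = radial_measure n k C (n - j)"
  have isc: "is_curvature_measures n (lp_ball p n) (\<lambda>j. radial_measure n k C (n - j))"
    by (rule is_curvature_measures_radial_measure[OF n C k adm])
  have ceq: "curvature_measure n (lp_ball p n) j = cq"
    unfolding cq_def using curvature_measure_eq[OF isc j] .
  have sets: "sets cq = sets ?bd" by (simp add: cq_def radial_measure_def)
  have space: "space cq = space ?bd" by (rule sets_eq_imp_space_eq[OF sets])
  interpret Q: finite_measure cq using isc j by (simp add: is_curvature_measures_def cq_def)
  define V where "V = measure cq (space cq)"
  have iv: "intrinsic_volume n (lp_ball p n) j = V"
    by (simp add: intrinsic_volume_def ceq V_def space space_bdry_space)
  have "X -` space ?bd \<inter> space M = space M" using measurable_space[OF X] by auto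
  \<comment> \<open>The whole boundary has probability \<open>1\<close>, whereas a vanishing
    intrinsic volume would make this quotient \<open>0\<close> by the convention for
    division.\<close>
  then have "V / V = 1" using law[of "space ?bd"] by (simp add: ceq iv V_def space prob_space)
  then have V: "V > 0" by (metis V_def div_0 less_le measure_nonneg zero_neq_one)
  have D: "distr M ?bd X = scale_measure (ennreal (1 / V)) cq"
  proof (rule measure_eqI)
    fix A assume "A \<in> sets (distr M ?bd X)"
    then have A: "A \<in> sets ?bd" by simp
    have "emeasure (distr M ?bd X) A = ennreal (measure M (X -` A \<inter> space M))"
      using A by (simp add: emeasure_distr emeasure_eq_measure)
    also have "\<dots> = ennreal (1 / V) * emeasure cq A"
      using V by (simp add: law[OF A] ceq iv Q.emeasure_eq_measure ennreal_mult[symmetric])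
    finally show "emeasure (distr M ?bd X) A = emeasure (scale_measure (ennreal (1 / V)) cq) A" by simp
  qed (simp add: sets)
  define c where "c = p / (real (n - j) * C * unit_ball_vol (real (n - j)))"
  have c: "c > 0" using p_gt_1 C j by (simp add: c_def)
  have Wm [measurable]: "W \<in> borel_measurable (lborel_n n)" unfolding W_def by measurable
  have ncq: "(\<integral>\<^sup>+x. g x \<partial>cq) = ennreal c * (\<integral>\<^sup>+x. g (dir n x) * W x \<partial>lborel_n n)"
    if g: "g \<in> borel_measurable (lborel_n n)" for g
  proof -
    have [measurable]: "g \<in> borel_measurable ?bd"
      unfolding bdry_space_def using g by (rule measurable_restrict_space1)
    note [measurable] = g
    have "(\<integral>\<^sup>+x. g x \<partial>cq) = (\<integral>\<^sup>+x. ennreal c * (g (dir n x) * W x) \<partial>lborel_n n)"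
    proof -
      have e: "ennreal (p / (real (n - j) * C * unit_ball_vol (real (n - j))) * z ^ (n - j) * hsym n (n - j) x) =
          ennreal c * ennreal (z ^ (n - j) * hsym n (n - j) x)" if "z \<ge> 0" for z x
      proof -
        have "p / (real (n - j) * C * unit_ball_vol (real (n - j))) * z ^ (n - j) * hsym n (n - j) x =
          c * (z ^ (n - j) * hsym n (n - j) x)" by (simp only: c_def mult.assoc)
        then show ?thesis using c that by (simp only: ennreal_mult mult_nonneg_nonneg zero_le_power hsym_nonneg less_imp_le)
      qed
      have z0: "Spow n x powr (1 / p) / sqrt (Upow n x) \<ge> 0" for x by simp
      show ?thesis unfolding cq_def nn_integral_radial_measure[OF n k \<open>g \<in> borel_measurable ?bd\<close>] W_def
        by (rule nn_integral_cong) (simp only: e[OF z0], simp only: mult_ac)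
    qed
    also have "\<dots> = ennreal c * (\<integral>\<^sup>+x. g (dir n x) * W x \<partial>lborel_n n)"
      by (rule nn_integral_cmult) measurable
    finally show ?thesis .
  qed
  have Vc: "ennreal V = ennreal c * (\<integral>\<^sup>+x. W x \<partial>lborel_n n)"
    using ncq[of "\<lambda>_. 1"] by (simp add: V_def Q.emeasure_eq_measure)
  show "intrinsic_volume n (lp_ball p n) j > 0" using V iv by simp
  have "ennreal (1 / c) * ennreal V = (ennreal (1 / c) * ennreal c) * (\<integral>\<^sup>+x. W x \<partial>lborel_n n)"
    unfolding Vc by (simp only: mult.assoc)
  also have "ennreal (1 / c) * ennreal c = 1" using c by (simp add: ennreal_mult[symmetric])
  finally have "(\<integral>\<^sup>+x. W x \<partial>lborel_n n) = ennreal (1 / c * V)" using c V by (simp add: ennreal_mult[symmetric])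
  also have "1 / c * V = C * (V * (real (n - j) * unit_ball_vol (real (n - j)) / p))"
    unfolding c_def by simp
  finally show "(\<integral>\<^sup>+x. W x \<partial>lborel_n n) = ennreal (C * (intrinsic_volume n (lp_ball p n) j * (real (n - j) * unit_ball_vol (real (n - j)) / p)))"
    unfolding iv .
  fix g :: "(nat \<Rightarrow> real) \<Rightarrow> ennreal" assume g: "g \<in> borel_measurable (lborel_n n)"
  have gb [measurable]: "g \<in> borel_measurable ?bd"
    unfolding bdry_space_def using g by (rule measurable_restrict_space1)
  then have gc [measurable]: "g \<in> borel_measurable cq" using sets by (simp cong: measurable_cong_sets)
  have "(\<integral>\<^sup>+\<omega>. g (X \<omega>) \<partial>M) = (\<integral>\<^sup>+x. g x \<partial>distr M ?bd X)" by (simp add: nn_integral_distr)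
  also have "\<dots> = ennreal (1 / V) * (\<integral>\<^sup>+x. g x \<partial>cq)"
    unfolding D by (rule nn_integral_scale_measure) measurable
  finally have "ennreal V * (\<integral>\<^sup>+\<omega>. g (X \<omega>) \<partial>M) = (ennreal V * ennreal (1 / V)) * (\<integral>\<^sup>+x. g x \<partial>cq)"
    by (simp add: mult.assoc)
  also have "ennreal V * ennreal (1 / V) = 1" using V by (simp add: ennreal_mult[symmetric])
  finally have "ennreal c * ((\<integral>\<^sup>+x. W x \<partial>lborel_n n) * (\<integral>\<^sup>+\<omega>. g (X \<omega>) \<partial>M)) = ennreal c * (\<integral>\<^sup>+x. g (dir n x) * W x \<partial>lborel_n n)"
    by (simp add: Vc ncq[OF g] mult.assoc)
  then show "(\<integral>\<^sup>+x. W x \<partial>lborel_n n) * (\<integral>\<^sup>+\<omega>. g (X \<omega>) \<partial>M) = (\<integral>\<^sup>+x. g (dir n x) * W x \<partial>lborel_n n)"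
    using c by (simp add: ennreal_mult_cancel_left)
qed

end

section \<open>Power integrals on the line and the two radial kernels\<close>

lemma nn_integral_powr_subst:
  fixes f :: "real \<Rightarrow> ennreal"
  assumes e: "e > 0" and [measurable]: "f \<in> borel_measurable borel"
  shows "(\<integral>\<^sup>+x. f (x powr e) * ennreal (e * x powr (e - 1)) * indicator {0<..} x \<partial>lborel) =
         (\<integral>\<^sup>+v. f v * indicator {0<..} v \<partial>lborel)"
proof -
  \<comment> \<open>For the exponent \<open>1 + e\<close> the normal map is \<open>x powr e\<close>
    on the positive half-line, so the substitution is an instance of the one for
    \<open>phi\<close>.\<close>
  interpret E: lp_exponent "1 + e" using e by unfold_locales simp
  have "(\<integral>\<^sup>+v. f v * indicator {0<..} v \<partial>lborel) =
      (\<integral>\<^sup>+x. f (E.phi x) * indicator {0<..} (E.phi x) * ennreal (E.dphi x) \<partial>lborel)"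
    by (rule E.nn_integral_phi[symmetric]) measurable
  also have "\<dots> = (\<integral>\<^sup>+x. f (x powr e) * ennreal (e * x powr (e - 1)) * indicator {0<..} x \<partial>lborel)"
  proof (rule nn_integral_cong)
    fix x :: real
    show "f (E.phi x) * indicator {0<..} (E.phi x) * ennreal (E.dphi x) =
      f (x powr e) * ennreal (e * x powr (e - 1)) * indicator {0<..} x"
    proof (cases "x > 0")
      case True
      then show ?thesis by (simp add: E.phi_pos E.dphi_def)
    next
      case False
      then have "E.phi x \<le> 0" by (auto simp: E.phi_def sgn_if mult_le_0_iff)
      then show ?thesis using False by simp
    qed
  qed
  finally show ?thesis by simp
qed

lemma nn_integral_even:
  fixes f :: "real \<Rightarrow> ennreal"
  assumes even: "\<And>x. f (- x) = f x" and [measurable]: "f \<in> borel_measurable borel"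
  shows "(\<integral>\<^sup>+x. f x \<partial>lborel) = 2 * (\<integral>\<^sup>+x. f x * indicator {0<..} x \<partial>lborel)"
proof -
  have "(\<integral>\<^sup>+x. f x * indicator {..<0} x \<partial>lborel) = (\<integral>\<^sup>+x. f x * indicator {0<..} x \<partial>lborel)"
    using nn_integral_real_affine[of "\<lambda>x. f x * indicator {..<0} x" "-1" 0]
    by (simp add: even indicator_def)
  moreover have "(\<integral>\<^sup>+x. f x \<partial>lborel) = (\<integral>\<^sup>+x. f x * indicator {0<..} x + f x * indicator {..<0} x \<partial>lborel)"
    by (rule nn_integral_cong_AE, use AE_lborel_singleton[of 0] in eventually_elim)
      (auto split: split_indicator)
  ultimately show ?thesis by (simp add: nn_integral_add mult_2)
qed

text \<open>By symmetry and \<open>v = x powr e\<close> this is a Gamma integral. The condition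
  \<open>m > -1\<close> is integrability at the origin and admits the singular weight with
  \<open>m = p - 2\<close>.\<close>

lemma nn_integral_abs_powr_exp:
  assumes m: "m > -1" and e: "e > 0" and b: "b > 0"
  shows "(\<integral>\<^sup>+x. ennreal (\<bar>x\<bar> powr m * exp (- (b * \<bar>x\<bar> powr e))) \<partial>lborel) =
    ennreal (2 / e * Gamma ((m + 1) / e) * b powr (- ((m + 1) / e)))"
proof -
  let ?a = "(m + 1) / e"
  have a: "?a > 0" using m e by simp
  define f where "f v = ennreal (1 / e) * ennreal (v powr (?a - 1) * exp (- (b * v)))" for v
  have [measurable]: "f \<in> borel_measurable borel" unfolding f_def by measurable
  have "(\<integral>\<^sup>+x. ennreal (\<bar>x\<bar> powr m * exp (- (b * \<bar>x\<bar> powr e))) * indicator {0<..} x \<partial>lborel) =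
      (\<integral>\<^sup>+x. f (x powr e) * ennreal (e * x powr (e - 1)) * indicator {0<..} x \<partial>lborel)"
  proof (rule nn_integral_cong)
    fix x :: real
    show "ennreal (\<bar>x\<bar> powr m * exp (- (b * \<bar>x\<bar> powr e))) * indicator {0<..} x =
      f (x powr e) * ennreal (e * x powr (e - 1)) * indicator {0<..} x"
    proof (cases "x > 0")
      case True
      have "(x powr e) powr (?a - 1) * x powr (e - 1) = x powr m"
        using True e by (simp add: powr_powr powr_add[symmetric] field_simps)
      then have "\<bar>x\<bar> powr m * exp (- (b * \<bar>x\<bar> powr e)) =
        1 / e * ((x powr e) powr (?a - 1) * exp (- (b * (x powr e)))) * (e * x powr (e - 1))"
        using True e by simp
      then show ?thesis using e unfolding f_def by (simp only: ennreal_mult[symmetric] mult_nonneg_nonneg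
         divide_nonneg_nonneg powr_ge_zero exp_ge_zero zero_le_one less_imp_le)
    qed simp
  qed
  also have "\<dots> = (\<integral>\<^sup>+v. f v * indicator {0<..} v \<partial>lborel)"
    by (rule nn_integral_powr_subst[OF e]) measurable
  also have "\<dots> = ennreal (1 / e) * ennreal (Gamma ?a * b powr (- ?a))"
    unfolding f_def mult.assoc by (subst nn_integral_cmult) (use nn_integral_Gamma[OF a b] in auto)
  finally have h: "(\<integral>\<^sup>+x. ennreal (\<bar>x\<bar> powr m * exp (- (b * \<bar>x\<bar> powr e))) * indicator {0<..} x \<partial>lborel) =
      ennreal (1 / e) * ennreal (Gamma ?a * b powr (- ?a))" .
  have two: "2 * (ennreal (1 / e) * ennreal y) = ennreal (2 / e * y)" if "y \<ge> 0" for y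
  proof -
    have "2 * (ennreal (1 / e) * ennreal y) = ennreal 2 * ennreal (1 / e * y)"
      using e that by (simp add: ennreal_mult[symmetric])
    also have "\<dots> = ennreal (2 * (1 / e * y))" using e that by (intro ennreal_mult[symmetric]) auto
    finally show ?thesis by simp
  qed
  have "(\<integral>\<^sup>+x. ennreal (\<bar>x\<bar> powr m * exp (- (b * \<bar>x\<bar> powr e))) \<partial>lborel) =
      2 * (ennreal (1 / e) * ennreal (Gamma ?a * b powr (- ?a)))"
    by (subst nn_integral_even) (simp_all add: h)
  also have "\<dots> = ennreal (2 / e * (Gamma ?a * b powr (- ?a)))"
    using a by (intro two) (simp add: Gamma_real_nonneg)
  finally show ?thesis by (simp add: mult.assoc)
qed

context lp_exponent
begin

lemma hsym_zero: "Spow n x = 0 \<Longrightarrow> hsym n q x = 0"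
proof -
  assume "Spow n x = 0"
  then have "\<And>k. k < n \<Longrightarrow> x k = 0" using Spow_pos_iff[of n x] by auto
  then show ?thesis unfolding hsym_def idx_def by (intro sum.neutral) auto
qed

text \<open>
  The representation of the curvature measures leaves the radial kernel free. The first choice
  makes the sum with exponent \<open>p\<close> exponential and is used in the bulk (positive \<open>b\<close> gives the moments of
  \<open>Spow\<close>), the second one does so for the sum with exponent \<open>2 * p - 2\<close> and is used at the left edge.
\<close>

definition kernel1 :: "nat \<Rightarrow> nat \<Rightarrow> real \<Rightarrow> (nat \<Rightarrow> real) \<Rightarrow> ennreal" where
  "kernel1 n q b x = ennreal (exp (- Spow n x) * Spow n x powr (b - q / p))"

definition kernel2 :: "nat \<Rightarrow> nat \<Rightarrow> (nat \<Rightarrow> real) \<Rightarrow> ennreal" where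
  "kernel2 n q x = ennreal (exp (- Upow n x) * Spow n x powr (- (n + p) / p) * Upow n x powr (q / 2))"

lemma measurable_kernel1 [measurable]: "kernel1 n q b \<in> borel_measurable (lborel_n n)"
  unfolding kernel1_def by measurable

lemma measurable_kernel2 [measurable]: "kernel2 n q \<in> borel_measurable (lborel_n n)"
  unfolding kernel2_def by measurable

lemma Spow_radial: "N > 0 \<Longrightarrow> Spow n w = 1 \<Longrightarrow> Spow n (scale_n n (N powr (1 / p)) w) = N"
  using p_gt_1 by (simp add: Spow_scale powr_powr)

text \<open>Along a ray only powers of \<open>N\<close> and \<open>exp (- N)\<close> remain. The
  dimension contributes the exponent \<open>n / p\<close> and the kernel
  \<open>b - (n - j) / p\<close>, with sum \<open>j / p + b\<close>.\<close>

lemma kernel1_admissible: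
  assumes "j < n" "b \<ge> 0" "Spow n w = 1"
  shows "(\<integral>\<^sup>+N. ennreal (N powr (n / p)) * kernel1 n (n - j) b (scale_n n (N powr (1 / p)) w) * indicator {0<..} N \<partial>lborel)
    = ennreal (Gamma (j / p + b + 1))"
proof -
  have "(\<integral>\<^sup>+N. ennreal (N powr (n / p)) * kernel1 n (n - j) b (scale_n n (N powr (1 / p)) w) * indicator {0<..} N \<partial>lborel)
    = (\<integral>\<^sup>+N. ennreal (N powr ((j / p + b + 1) - 1) * exp (- (1 * N))) * indicator {0<..} N \<partial>lborel)"
  proof (rule nn_integral_cong)
    fix N :: real
    show "ennreal (N powr (n / p)) * kernel1 n (n - j) b (scale_n n (N powr (1 / p)) w) * indicator {0<..} N =
      ennreal (N powr ((j / p + b + 1) - 1) * exp (- (1 * N))) * indicator {0<..} N"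
    proof (cases "N > 0")
      case True
      have "n / p + (b - real (n - j) / p) = (j / p + b + 1) - 1"
        using assms p_gt_1 by (simp add: of_nat_diff field_simps)
      then have "N powr (n / p) * N powr (b - real (n - j) / p) = N powr ((j / p + b + 1) - 1)"
        by (simp only: powr_add[symmetric])
      then show ?thesis using True
        by (simp only: kernel1_def Spow_radial[OF True assms(3)] ennreal_mult[symmetric] powr_ge_zero
           exp_ge_zero mult_nonneg_nonneg) (simp add: mult_ac)
    qed simp
  qed
  also have "\<dots> = ennreal (Gamma (j / p + b + 1) * 1 powr (- (j / p + b + 1)))"
    using assms p_gt_1 by (intro nn_integral_Gamma) (auto intro!: add_nonneg_pos)
  finally show ?thesis by simp
qed

text \<open>Along a ray \<open>Upow\<close> grows like \<open>N powr ((2 * p - 2) / p)\<close>, and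
  \<open>N\<close> raised to this power is the natural variable. The factor
  \<open>Upow powr (q / 2)\<close> of the kernel is there to cancel the power of
  \<open>Upow n w\<close> that the Gamma integral produces.\<close>

lemma kernel2_admissible:
  assumes "q > 0" "Spow n w = 1"
  shows "(\<integral>\<^sup>+N. ennreal (N powr (n / p)) * kernel2 n q (scale_n n (N powr (1 / p)) w) * indicator {0<..} N \<partial>lborel)
    = ennreal (p / (2 * p - 2) * Gamma (q / 2))"
proof -
  define e where "e = (2 * p - 2) / p"
  have e: "e > 0" using p_gt_1 by (simp add: e_def)
  define u where "u = Upow n w"
  have u: "u > 0" using assms Spow_pos_iff[of n w] Upow_pos_iff[of n w] by (simp add: u_def)
  define f where "f v = ennreal (u powr (q / 2) / e) * ennreal (v powr (q / 2 - 1) * exp (- (u * v)))" for v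
  have [measurable]: "f \<in> borel_measurable borel" unfolding f_def by measurable
  have "(\<integral>\<^sup>+N. ennreal (N powr (n / p)) * kernel2 n q (scale_n n (N powr (1 / p)) w) * indicator {0<..} N \<partial>lborel)
    = (\<integral>\<^sup>+x. f (x powr e) * ennreal (e * x powr (e - 1)) * indicator {0<..} x \<partial>lborel)"
  proof (rule nn_integral_cong)
    fix N :: real
    show "ennreal (N powr (n / p)) * kernel2 n q (scale_n n (N powr (1 / p)) w) * indicator {0<..} N =
      f (N powr e) * ennreal (e * N powr (e - 1)) * indicator {0<..} N"
    proof (cases "N > 0")
      case True
      have U: "Upow n (scale_n n (N powr (1 / p)) w) = N powr e * u"
        by (simp add: Upow_scale powr_powr u_def e_def)
      have x1: "(N powr e * u) powr (q / 2) = N powr (e * q / 2) * u powr (q / 2)"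
        using True u by (simp add: powr_mult powr_powr)
      have x2: "N powr (n / p) * N powr (- (n + p) / p) = N powr (- 1)"
        using p_gt_1 by (simp add: powr_add[symmetric] field_simps)
      have x3: "(N powr e) powr (q / 2 - 1) * N powr (e - 1) = N powr (e * q / 2) * N powr (- 1)"
      proof -
        have "e * (q / 2 - 1) + (e - 1) = e * q / 2 + - 1" by (simp add: algebra_simps)
        then show ?thesis by (simp only: powr_powr powr_add[symmetric])
      qed
      have "N powr (n / p) * (exp (- (N powr e * u)) * N powr (- (n + p) / p) * (N powr e * u) powr (q / 2)) =
        exp (- (N powr e * u)) * (N powr (n / p) * N powr (- (n + p) / p)) * (N powr e * u) powr (q / 2)" by (simp only: mult_ac)
      also have "\<dots> = exp (- (u * N powr e)) * (N powr (e * q / 2) * N powr (- 1)) * u powr (q / 2)"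
        unfolding x1 x2 by (simp only: mult_ac)
      also have "\<dots> = u powr (q / 2) / e * ((N powr e) powr (q / 2 - 1) * exp (- (u * N powr e))) * (e * N powr (e - 1))"
        unfolding x3[symmetric] using e by simp
      finally show ?thesis using True e
        by (simp only: kernel2_def f_def Spow_radial[OF True assms(2)] U ennreal_mult[symmetric] powr_ge_zero
           exp_ge_zero mult_nonneg_nonneg divide_nonneg_nonneg less_imp_le)
    qed simp
  qed
  also have "\<dots> = (\<integral>\<^sup>+v. f v * indicator {0<..} v \<partial>lborel)"
    by (rule nn_integral_powr_subst[OF e]) measurable
  also have "\<dots> = ennreal (u powr (q / 2) / e) * ennreal (Gamma (q / 2) * u powr (- (q / 2)))"
    unfolding f_def mult.assoc using assms
    by (subst nn_integral_cmult) (auto simp: nn_integral_Gamma u)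
  also have "\<dots> = ennreal (1 / e * Gamma (q / 2))"
    using u e assms by (simp add: ennreal_mult[symmetric] powr_minus_divide Gamma_real_nonneg)
  finally show ?thesis by (simp add: e_def)
qed

text \<open>The exponent \<open>- q / p\<close> in the kernel compensates the power of
  \<open>Spow\<close> from the representation, so for \<open>b = 0\<close> only a negative power of
  \<open>Upow\<close> is left, to be resolved by the mixture.\<close>

lemma kernel1_weight:
  assumes "q > 0"
  shows "kernel1 n q b x * ennreal ((Spow n x powr (1 / p) / sqrt (Upow n x)) ^ q * hsym n q x) =
    ennreal (exp (- Spow n x) * Spow n x powr b * Upow n x powr (- (q / 2)) * hsym n q x)"
proof (cases "Spow n x = 0")
  case False
  then have S: "Spow n x > 0" using Spow_nonneg[of n x] by linarith
  then have U: "Upow n x > 0" by (simp add: Spow_pos_iff Upow_pos_iff)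
  have "(Spow n x powr (1 / p) / sqrt (Upow n x)) ^ q = Spow n x powr (q / p) * Upow n x powr (- (q / 2))"
    using S U by (simp add: power_divide powr_realpow[symmetric] powr_powr powr_half_sqrt[symmetric] powr_minus_divide)
  moreover have "Spow n x powr (b - q / p) * Spow n x powr (q / p) = Spow n x powr b"
    by (simp add: powr_add[symmetric])
  ultimately have "exp (- Spow n x) * Spow n x powr (b - q / p) * ((Spow n x powr (1 / p) / sqrt (Upow n x)) ^ q * hsym n q x)
    = exp (- Spow n x) * Spow n x powr b * Upow n x powr (- (q / 2)) * hsym n q x" by simp
  then show ?thesis unfolding kernel1_def by (subst ennreal_mult[symmetric]) auto
qed (simp add: hsym_zero)

text \<open>Here the powers of \<open>Upow\<close> cancel instead, and a negative power of
  \<open>Spow\<close> is left. Its exponent \<open>j / p + 1\<close> stays bounded when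
  \<open>j\<close> does.\<close>

lemma kernel2_weight:
  assumes "j < n"
  shows "kernel2 n (n - j) x * ennreal ((Spow n x powr (1 / p) / sqrt (Upow n x)) ^ (n - j) * hsym n (n - j) x) =
    ennreal (exp (- Upow n x) * Spow n x powr (- (j / p + 1)) * hsym n (n - j) x)"
proof (cases "Spow n x = 0")
  case False
  let ?q = "n - j"
  have S: "Spow n x > 0" using False Spow_nonneg[of n x] by linarith
  then have U: "Upow n x > 0" by (simp add: Spow_pos_iff Upow_pos_iff)
  have e: "- (n + p) / p + ?q / p = - (j / p + 1)"
    using assms p_gt_1 by (simp add: of_nat_diff field_simps)
  have f1: "(Spow n x powr (1 / p) / sqrt (Upow n x)) ^ ?q = Spow n x powr (?q / p) * Upow n x powr (- (?q / 2))"
    using S U by (simp add: power_divide powr_realpow[symmetric] powr_powr powr_half_sqrt[symmetric] powr_minus_divide)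
  have f2: "Spow n x powr (- (n + p) / p) * Spow n x powr (?q / p) = Spow n x powr (- (j / p + 1))"
    unfolding powr_add[symmetric] e ..
  have f3: "Upow n x powr (?q / 2) * Upow n x powr (- (?q / 2)) = 1"
    using U by (simp add: powr_add[symmetric])
  have "E * A * B * ((A' * B') * h) = E * (A * A') * (B * B') * h" for E A B A' B' h :: real by simp
  then have "exp (- Upow n x) * Spow n x powr (- (n + p) / p) * Upow n x powr (?q / 2) * ((Spow n x powr (1 / p) / sqrt (Upow n x)) ^ ?q * hsym n ?q x)
    = exp (- Upow n x) * Spow n x powr (- (j / p + 1)) * hsym n ?q x" by (simp only: f1 f2 f3 mult_1_right)
  then show ?thesis unfolding kernel2_def by (subst ennreal_mult[symmetric]) auto
qed (simp add: hsym_zero)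

end

section \<open>Mixtures of independent coordinates\<close>

text \<open>Sampling without replacement: each element forced into the chosen set contributes a
  factor tending to \<open>\<beta>\<close>, each excluded element a factor tending to
  \<open>1 - \<beta>\<close>. The alternatives for \<open>a\<close> and \<open>b\<close> guarantee
  enough elements to force or to exclude, while a bounded \<open>Q\<close> or a bounded complement
  remains admissible.\<close>

lemma binomial_ratio_tendsto:
  fixes N Q :: "nat \<Rightarrow> nat"
  assumes QN: "eventually (\<lambda>n. Q n \<le> N n) sequentially"
    and N: "filterlim N at_top sequentially"
    and \<beta>: "(\<lambda>n. real (Q n) / real (N n)) \<longlonglongrightarrow> \<beta>"
    and a: "a = 0 \<or> filterlim Q at_top sequentially"
    and b: "b = 0 \<or> filterlim (\<lambda>n. N n - Q n) at_top sequentially"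
  shows "(\<lambda>n. real ((N n - a - b) choose (Q n - a)) / real (N n choose Q n)) \<longlonglongrightarrow> \<beta> ^ a * (1 - \<beta>) ^ b"
proof -
  have Nr: "filterlim (\<lambda>n. real (N n)) at_top sequentially"
    using filterlim_compose[OF filterlim_real_sequentially N] .
  have cN: "(\<lambda>n. x / real (N n)) \<longlonglongrightarrow> 0" for x
    by (rule real_tendsto_divide_at_top[OF tendsto_const Nr])
  have Nge: "eventually (\<lambda>n. N n \<ge> k) sequentially" for k
    using N by (simp add: filterlim_at_top)
  have frac: "(\<lambda>n. (real (Q n) - x) / (real (N n) - y)) \<longlonglongrightarrow> \<beta>" for x y
  proof -
    have "(\<lambda>n. (real (Q n) / real (N n) - x / real (N n)) / (1 - y / real (N n))) \<longlonglongrightarrow> (\<beta> - 0) / (1 - 0)"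
      by (intro tendsto_intros \<beta> cN) auto
    then have "(\<lambda>n. (real (Q n) / real (N n) - x / real (N n)) / (1 - y / real (N n))) \<longlonglongrightarrow> \<beta>" by simp
    moreover have "eventually (\<lambda>n. (real (Q n) / real (N n) - x / real (N n)) / (1 - y / real (N n)) = (real (Q n) - x) / (real (N n) - y)) sequentially"
      using Nge[of 1]
    proof eventually_elim
      case (elim n)
      then have "real (Q n) / real (N n) - x / real (N n) = (real (Q n) - x) / real (N n)"
        "1 - y / real (N n) = (real (N n) - y) / real (N n)" by (auto simp: field_simps)
      then show ?case using elim by simp
    qed
    ultimately show ?thesis by (rule Lim_transform_eventually)
  qed
  have "(\<lambda>n. real ((N n - a) choose (Q n - a)) / real (N n choose Q n)) \<longlonglongrightarrow> \<beta> ^ a"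
    using a
  proof (induction a)
    case 0
    have "eventually (\<lambda>n. real ((N n - 0) choose (Q n - 0)) / real (N n choose Q n) = 1) sequentially"
      using QN by eventually_elim auto
    then have "(\<lambda>n. real ((N n - 0) choose (Q n - 0)) / real (N n choose Q n)) \<longlonglongrightarrow> 1"
      by (rule tendsto_eventually)
    then show ?case by simp
  next
    case (Suc a)
    then have Q: "filterlim Q at_top sequentially" by simp
    then have IH: "(\<lambda>n. real ((N n - a) choose (Q n - a)) / real (N n choose Q n)) \<longlonglongrightarrow> \<beta> ^ a" using Suc by blast
    have "(\<lambda>n. real ((N n - a) choose (Q n - a)) / real (N n choose Q n) * ((real (Q n) - real a) / (real (N n) - real a))) \<longlonglongrightarrow> \<beta> ^ a * \<beta>"
      by (intro tendsto_mult IH frac)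
    moreover have "eventually (\<lambda>n. Q n \<ge> Suc a) sequentially" using Q by (simp add: filterlim_at_top)
    then have "eventually (\<lambda>n. real ((N n - a) choose (Q n - a)) / real (N n choose Q n) * ((real (Q n) - real a) / (real (N n) - real a))
        = real ((N n - Suc a) choose (Q n - Suc a)) / real (N n choose Q n)) sequentially"
      using QN
    proof eventually_elim
      case (elim n)
      have e1: "real (Q n - a) * real ((N n - a) choose (Q n - a)) = real (N n - a) * real ((N n - a - 1) choose (Q n - a - 1))"
        using times_binomial_minus1_eq[of "Q n - a" "N n - a"] elim
        by (metis of_nat_mult Suc_le_lessD zero_less_diff)
      have e2: "real (Q n - a) = real (Q n) - real a" "real (N n - a) = real (N n) - real a" and pos: "real (N n) - real a > 0"
        using elim by (auto simp: of_nat_diff)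
      have gen: "C / D * (k / m) = C' / D" if "k * C = m * C'" "m > 0" for C D k m C' :: real
      proof -
        have "C / D * (k / m) = (k * C) / m / D" by (simp add: mult.commute)
        then show ?thesis using that by simp
      qed
      show ?case using gen[OF e1[unfolded e2] pos] by (simp only: diff_diff_left Suc_eq_plus1)
    qed
    ultimately have "(\<lambda>n. real ((N n - Suc a) choose (Q n - Suc a)) / real (N n choose Q n)) \<longlonglongrightarrow> \<beta> ^ a * \<beta>"
      by (rule Lim_transform_eventually)
    then show ?case by (simp add: mult.commute)
  qed
  then have base: "(\<lambda>n. real ((N n - a - 0) choose (Q n - a)) / real (N n choose Q n)) \<longlonglongrightarrow> \<beta> ^ a" by simp
  have Qa: "eventually (\<lambda>n. Q n \<ge> a) sequentially" using a by (auto simp: filterlim_at_top)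
  show ?thesis using b
  proof (induction b)
    case 0
    then show ?case using base by simp
  next
    case (Suc b)
    then have Q: "filterlim (\<lambda>n. N n - Q n) at_top sequentially" by simp
    then have IH: "(\<lambda>n. real ((N n - a - b) choose (Q n - a)) / real (N n choose Q n)) \<longlonglongrightarrow> \<beta> ^ a * (1 - \<beta>) ^ b" using Suc by blast
    have fr: "(\<lambda>n. 1 - (real (Q n) - real a) / (real (N n) - real (a + b))) \<longlonglongrightarrow> 1 - \<beta>"
      by (intro tendsto_intros frac)
    have "(\<lambda>n. real ((N n - a - b) choose (Q n - a)) / real (N n choose Q n) * (1 - (real (Q n) - real a) / (real (N n) - real (a + b)))) \<longlonglongrightarrow> \<beta> ^ a * (1 - \<beta>) ^ b * (1 - \<beta>)"
      by (intro tendsto_mult IH fr)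
    moreover have "eventually (\<lambda>n. N n - Q n \<ge> Suc b) sequentially" using Q by (simp add: filterlim_at_top)
    then have "eventually (\<lambda>n. real ((N n - a - b) choose (Q n - a)) / real (N n choose Q n) * (1 - (real (Q n) - real a) / (real (N n) - real (a + b)))
        = real ((N n - a - Suc b) choose (Q n - a)) / real (N n choose Q n)) sequentially"
      using QN Qa
    proof eventually_elim
      case (elim n)
      let ?M = "N n - a - b" let ?K = "Q n - a"
      have "real (?M - ?K) * real (?M choose ?K) = real ?M * real ((?M - 1) choose ?K)"
        using binomial_absorb_comp[of ?M ?K] by (metis of_nat_mult)
      moreover have "real (?M - ?K) = real ?M - real ?K" using elim by (intro of_nat_diff) auto
      moreover have K: "real ?K = real (Q n) - real a" and M: "real ?M = real (N n) - real (a + b)" "real ?M > 0"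
        using elim by (auto simp: of_nat_diff)
      ultimately have "real (?M choose ?K) * (1 - real ?K / real ?M) = real ((?M - 1) choose ?K)"
        by (simp add: field_simps)
      then show ?case unfolding K M(1) by (simp add: field_simps)
    qed
    ultimately have "(\<lambda>n. real ((N n - a - Suc b) choose (Q n - a)) / real (N n choose Q n)) \<longlonglongrightarrow> \<beta> ^ a * (1 - \<beta>) ^ b * (1 - \<beta>)"
      by (rule Lim_transform_eventually)
    then show ?case by (simp add: mult_ac)
  qed
qed

lemma card_idx: "card (idx n q) = n * ((n - 1) choose (q - 1))"
proof -
  have "card (idx n q) = (\<Sum>i<n. card {T. T \<subseteq> {..<n} - {i} \<and> card T = q - 1})"
    unfolding idx_def by (rule card_SigmaI) (auto intro: finite_subset[of _ "Pow {..<n}"])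
  also have "\<dots> = (\<Sum>i<n. (n - 1) choose (q - 1))"
    by (intro sum.cong refl) (simp add: n_subsets)
  finally show ?thesis by simp
qed

text \<open>For given \<open>i \<ge> r\<close>, a set with trace \<open>T'\<close> on
  \<open>{..<r}\<close> consists of \<open>T'\<close> and a free choice among the remaining
  coordinates from \<open>r\<close> on, with \<open>i\<close> excluded.\<close>

lemma card_idx_pattern:
  assumes T': "T' \<subseteq> {..<r}" "card T' \<le> q - 1" and r: "r \<le> n"
  shows "card {z \<in> idx n q. r \<le> fst z \<and> snd z \<inter> {..<r} = T'} = (n - r) * ((n - 1 - r) choose (q - 1 - card T'))"
proof -
  have fT: "finite T'" using T'(1) finite_subset by blast
  have inner: "card {T. T \<subseteq> {..<n} - {i} \<and> card T = q - 1 \<and> T \<inter> {..<r} = T'} = (n - 1 - r) choose (q - 1 - card T')"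
    if i: "i \<in> {r..<n}" for i
  proof -
    have "bij_betw (\<lambda>S. S \<union> T') {S. S \<subseteq> {r..<n} - {i} \<and> card S = q - 1 - card T'}
       {T. T \<subseteq> {..<n} - {i} \<and> card T = q - 1 \<and> T \<inter> {..<r} = T'}"
    proof (rule bij_betwI[where g="\<lambda>T. T - T'"])
      show "(\<lambda>S. S \<union> T') \<in> {S. S \<subseteq> {r..<n} - {i} \<and> card S = q - 1 - card T'} \<rightarrow>
         {T. T \<subseteq> {..<n} - {i} \<and> card T = q - 1 \<and> T \<inter> {..<r} = T'}"
      proof
        fix S assume "S \<in> {S. S \<subseteq> {r..<n} - {i} \<and> card S = q - 1 - card T'}"
        then have S: "S \<subseteq> {r..<n} - {i}" "card S = q - 1 - card T'" by auto
        have fS: "finite S" using S(1) finite_subset by blast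
        have "S \<inter> T' = {}" using S(1) T'(1) by fastforce
        then have "card (S \<union> T') = q - 1" using S(2) T'(2) fS fT by (simp add: card_Un_disjoint)
        moreover have "S \<union> T' \<subseteq> {..<n} - {i}" "(S \<union> T') \<inter> {..<r} = T'"
          using T' S(1) r i by (auto simp: subset_iff)
        ultimately show "S \<union> T' \<in> {T. T \<subseteq> {..<n} - {i} \<and> card T = q - 1 \<and> T \<inter> {..<r} = T'}" by simp
      qed
      show "(\<lambda>T. T - T') \<in> {T. T \<subseteq> {..<n} - {i} \<and> card T = q - 1 \<and> T \<inter> {..<r} = T'} \<rightarrow>
         {S. S \<subseteq> {r..<n} - {i} \<and> card S = q - 1 - card T'}"
      proof
        fix T assume "T \<in> {T. T \<subseteq> {..<n} - {i} \<and> card T = q - 1 \<and> T \<inter> {..<r} = T'}"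
        then have T: "T \<subseteq> {..<n} - {i}" "card T = q - 1" "T \<inter> {..<r} = T'" by auto
        have "T' \<subseteq> T" using T(3) by auto
        then have "card (T - T') = q - 1 - card T'" using fT T(2) by (simp add: card_Diff_subset)
        moreover have "T - T' \<subseteq> {r..<n} - {i}" using T by (auto simp: subset_iff)
        ultimately show "T - T' \<in> {S. S \<subseteq> {r..<n} - {i} \<and> card S = q - 1 - card T'}" by simp
      qed
    qed (use T' in \<open>fastforce simp: subset_iff\<close>)+
    then have "card {T. T \<subseteq> {..<n} - {i} \<and> card T = q - 1 \<and> T \<inter> {..<r} = T'} =
      card {S. S \<subseteq> {r..<n} - {i} \<and> card S = q - 1 - card T'}" by (rule bij_betw_same_card[symmetric])
    also have "\<dots> = card ({r..<n} - {i}) choose (q - 1 - card T')" by (intro n_subsets) auto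
    also have "card ({r..<n} - {i}) = n - 1 - r" using i by simp
    finally show ?thesis .
  qed
  have "{z \<in> idx n q. r \<le> fst z \<and> snd z \<inter> {..<r} = T'} =
    (SIGMA i:{r..<n}. {T. T \<subseteq> {..<n} - {i} \<and> card T = q - 1 \<and> T \<inter> {..<r} = T'})"
    by (auto simp: idx_def)
  also have "card \<dots> = (\<Sum>i\<in>{r..<n}. card {T. T \<subseteq> {..<n} - {i} \<and> card T = q - 1 \<and> T \<inter> {..<r} = T'})"
    by (rule card_SigmaI) (auto intro: finite_subset[of _ "Pow {..<n}"])
  also have "\<dots> = (\<Sum>i\<in>{r..<n}. (n - 1 - r) choose (q - 1 - card T'))"
    by (intro sum.cong refl inner)
  finally show ?thesis by simp
qed

lemma measurable_restrict_lborel_n [measurable]: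
  "r \<le> n \<Longrightarrow> (\<lambda>x. restrict x {..<r}) \<in> measurable (lborel_n n) (lborel_n r)"
  by (intro measurable_restrict_subset) auto

text \<open>Coordinates from \<open>r\<close> on occur in the product only, so they are integrated
  out one at a time by an induction that starts at \<open>n = r\<close>.\<close>

lemma nn_integral_prod_split:
  fixes v :: "nat \<Rightarrow> real \<Rightarrow> ennreal"
  assumes "r \<le> n" and [measurable]: "F \<in> borel_measurable (lborel_n r)"
    and v [measurable]: "\<And>k. v k \<in> borel_measurable borel"
  shows "(\<integral>\<^sup>+x. F (restrict x {..<r}) * (\<Prod>k<n. v k (x k)) \<partial>lborel_n n) =
    (\<integral>\<^sup>+x. F x * (\<Prod>k<r. v k (x k)) \<partial>lborel_n r) * (\<Prod>k\<in>{r..<n}. \<integral>\<^sup>+u. v k u \<partial>lborel)"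
  using assms(1)
proof (induction n rule: dec_induct)
  case base
  have "restrict x {..<r} = x" if "x \<in> space (lborel_n r)" for x :: "nat \<Rightarrow> real"
    using that by (simp add: space_PiM PiE_restrict)
  then show ?case by (simp cong: nn_integral_cong)
next
  case (step n)
  interpret product_sigma_finite "\<lambda>_::nat. lborel :: real measure" ..
  have rn: "r \<le> n" using step by simp
  note [measurable] = measurable_restrict_lborel_n[OF rn] measurable_restrict_lborel_n[of r "Suc n"]
  have co [measurable]: "(\<lambda>x. x k) \<in> borel_measurable (lborel_n m)" if "k < m" for k m
    using measurable_coord[of "\<lambda>x. x" "lborel_n m" m k] that by simp
  have mF [measurable]: "(\<lambda>x. F (restrict x {..<r}) * (\<Prod>k<n. v k (x k))) \<in> borel_measurable (lborel_n n)"
    by (intro borel_measurable_times_ennreal borel_measurable_prod_ennreal) (auto intro!: measurable_compose[OF co v] measurable_compose[OF measurable_restrict_lborel_n[OF rn] assms(2)])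
  have mS: "(\<lambda>x. F (restrict x {..<r}) * (\<Prod>k<Suc n. v k (x k))) \<in> borel_measurable (Pi\<^sub>M (insert n {..<n}) (\<lambda>_. lborel))"
    unfolding lessThan_Suc[symmetric] using rn
    by (intro borel_measurable_times_ennreal borel_measurable_prod_ennreal) (auto intro!: measurable_compose[OF co v] measurable_compose[OF measurable_restrict_lborel_n assms(2)])
  have "(\<integral>\<^sup>+x. F (restrict x {..<r}) * (\<Prod>k<Suc n. v k (x k)) \<partial>lborel_n (Suc n)) =
    (\<integral>\<^sup>+x. (\<integral>\<^sup>+y. F (restrict (x(n := y)) {..<r}) * (\<Prod>k<Suc n. v k ((x(n := y)) k)) \<partial>lborel) \<partial>lborel_n n)"
    unfolding lessThan_Suc[of n] using mS by (subst product_nn_integral_insert) (auto simp: lessThan_Suc)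
  also have "\<dots> = (\<integral>\<^sup>+x. F (restrict x {..<r}) * (\<Prod>k<n. v k (x k)) * (\<integral>\<^sup>+y. v n y \<partial>lborel) \<partial>lborel_n n)"
  proof (rule nn_integral_cong)
    fix x :: "nat \<Rightarrow> real"
    have "restrict (x(n := y)) {..<r} = restrict x {..<r}" for y using rn by (auto simp: restrict_def)
    then have "F (restrict (x(n := y)) {..<r}) * (\<Prod>k<Suc n. v k ((x(n := y)) k)) = F (restrict x {..<r}) * (\<Prod>k<n. v k (x k)) * v n y" for y
      by (simp add: mult.assoc)
    then show "(\<integral>\<^sup>+y. F (restrict (x(n := y)) {..<r}) * (\<Prod>k<Suc n. v k ((x(n := y)) k)) \<partial>lborel) =
      F (restrict x {..<r}) * (\<Prod>k<n. v k (x k)) * (\<integral>\<^sup>+y. v n y \<partial>lborel)"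
      by (simp only:) (rule nn_integral_cmult, use v in simp)
  qed
  also have "\<dots> = (\<integral>\<^sup>+x. F (restrict x {..<r}) * (\<Prod>k<n. v k (x k)) \<partial>lborel_n n) * (\<integral>\<^sup>+y. v n y \<partial>lborel)"
    by (rule nn_integral_multc[OF mF])
  also have "\<dots> = (\<integral>\<^sup>+x. F x * (\<Prod>k<r. v k (x k)) \<partial>lborel_n r) * (\<Prod>k\<in>{r..<Suc n}. \<integral>\<^sup>+u. v k u \<partial>lborel)"
    using rn by (simp add: step.IH prod.atLeastLessThan_Suc mult.assoc)
  finally show ?case .
qed

text \<open>The same argument serves twice with the exponents \<open>p\<close> and
  \<open>2 * p - 2\<close> interchanged: \<open>ea\<close> belongs to the fixed exponential and
  \<open>eb\<close> is paired with the mixing parameter. The functions \<open>phi\<close> and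
  \<open>dphi\<close> keep the exponent \<open>p\<close> in both uses.\<close>

locale lp_mixture = lp_exponent +
  fixes ea eb :: real
  assumes ea: "ea > 0" and eb: "eb > 0"
begin

definition base :: "real \<Rightarrow> real \<Rightarrow> real" where
  "base t x = exp (- (\<bar>x\<bar> powr ea) - t * \<bar>x\<bar> powr eb)"

definition Asum :: "nat \<Rightarrow> (nat \<Rightarrow> real) \<Rightarrow> real" where "Asum n x = (\<Sum>k<n. \<bar>x k\<bar> powr ea)"
definition Bsum :: "nat \<Rightarrow> (nat \<Rightarrow> real) \<Rightarrow> real" where "Bsum n x = (\<Sum>k<n. \<bar>x k\<bar> powr eb)"

definition Imass :: "real \<Rightarrow> ennreal" where "Imass t = (\<integral>\<^sup>+x. ennreal (base t x) \<partial>lborel)"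
definition Jmass :: "real \<Rightarrow> ennreal" where "Jmass t = (\<integral>\<^sup>+x. ennreal (dphi x * base t x) \<partial>lborel)"
definition Qmass :: "real \<Rightarrow> ennreal" where "Qmass t = (\<integral>\<^sup>+x. ennreal ((phi x)\<^sup>2 * base t x) \<partial>lborel)"

definition wgt :: "nat \<Rightarrow> nat \<Rightarrow> real \<Rightarrow> real \<Rightarrow> ennreal" where
  "wgt n q c t = ennreal (t powr (c - 1)) * (Qmass t * Jmass t ^ (q - 1) * Imass t ^ (n - q)) * indicator {0<..} t"

text \<open>
  Integrating \<open>t powr (c - 1) * exp (- t * Bsum)\<close> over \<open>t\<close> produces \<open>Gamma c * Bsum powr (- c)\<close>, while for
  fixed \<open>t\<close> each term of \<open>hsym\<close> is a product over the coordinates.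
\<close>

definition mix :: "nat \<Rightarrow> nat \<Rightarrow> real \<Rightarrow> ((nat \<Rightarrow> real) \<Rightarrow> ennreal) \<Rightarrow> ennreal" where
  "mix n q c G = (\<integral>\<^sup>+t. ennreal (t powr (c - 1)) * indicator {0<..} t *
      (\<integral>\<^sup>+x. G x * ennreal (exp (- Asum n x - t * Bsum n x) * hsym n q x) \<partial>lborel_n n) \<partial>lborel)"

definition pattern_integral :: "nat \<Rightarrow> ((nat \<Rightarrow> real) \<Rightarrow> ennreal) \<Rightarrow> nat set \<Rightarrow> real \<Rightarrow> ennreal" where
  "pattern_integral r F T t = (\<integral>\<^sup>+x. F x * (\<Prod>k<r. ennreal (if k \<in> T then dphi (x k) * base t (x k) else base t (x k))) \<partial>lborel_n r)"

lemma base_pos [simp]: "base t x > 0" by (simp add: base_def)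
lemma base_nonneg [simp]: "base t x \<ge> 0" by (simp add: base_def)

lemma measurable_base [measurable]:
  assumes [measurable]: "f \<in> borel_measurable M" "g \<in> borel_measurable M"
  shows "(\<lambda>x. base (f x) (g x)) \<in> borel_measurable M"
  unfolding base_def by measurable

lemma base_antimono: "s \<le> t \<Longrightarrow> base t x \<le> base s x"
  by (simp add: base_def mult_right_mono)

lemma measurable_Asum [measurable]: "Asum n \<in> borel_measurable (lborel_n n)"
  unfolding Asum_def by measurable
lemma measurable_Bsum [measurable]: "Bsum n \<in> borel_measurable (lborel_n n)"
  unfolding Bsum_def by measurable

lemma Imass_measurable [measurable]: "Imass \<in> borel_measurable borel"
proof -
  have "(\<lambda>t. \<integral>\<^sup>+x. ennreal (base t x) \<partial>lborel) \<in> borel_measurable borel"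
    by (rule sigma_finite_measure.borel_measurable_nn_integral[OF sigma_finite_lborel]) measurable
  then show ?thesis unfolding Imass_def .
qed
lemma Jmass_measurable [measurable]: "Jmass \<in> borel_measurable borel"
proof -
  have "(\<lambda>t. \<integral>\<^sup>+x. ennreal (dphi x * base t x) \<partial>lborel) \<in> borel_measurable borel"
    by (rule sigma_finite_measure.borel_measurable_nn_integral[OF sigma_finite_lborel]) measurable
  then show ?thesis unfolding Jmass_def .
qed
lemma Qmass_measurable [measurable]: "Qmass \<in> borel_measurable borel"
proof -
  have "(\<lambda>t. \<integral>\<^sup>+x. ennreal ((phi x)\<^sup>2 * base t x) \<partial>lborel) \<in> borel_measurable borel"
    by (rule sigma_finite_measure.borel_measurable_nn_integral[OF sigma_finite_lborel]) measurable
  then show ?thesis unfolding Qmass_def .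
qed
lemma wgt_measurable [measurable]: "wgt n q c \<in> borel_measurable borel"
  unfolding wgt_def by measurable

lemma Imass_antimono: "s \<le> t \<Longrightarrow> Imass t \<le> Imass s"
  unfolding Imass_def by (intro nn_integral_mono ennreal_leI base_antimono)
lemma Qmass_antimono: "s \<le> t \<Longrightarrow> Qmass t \<le> Qmass s"
  unfolding Qmass_def by (intro nn_integral_mono ennreal_leI mult_left_mono base_antimono) auto

lemma nn_integral_powr_base_finite:
  assumes m: "m > -1" and t: "t \<ge> 0"
  shows "(\<integral>\<^sup>+x. ennreal (\<bar>x\<bar> powr m * base t x) \<partial>lborel) < \<infinity>"
proof -
  have "(\<integral>\<^sup>+x. ennreal (\<bar>x\<bar> powr m * base t x) \<partial>lborel) \<le>
     (\<integral>\<^sup>+x. ennreal (\<bar>x\<bar> powr m * exp (- (1 * \<bar>x\<bar> powr ea))) \<partial>lborel)"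
    using t by (intro nn_integral_mono ennreal_leI mult_left_mono) (auto simp: base_def)
  also have "\<dots> < \<infinity>" unfolding nn_integral_abs_powr_exp[OF m ea zero_less_one] by simp
  finally show ?thesis .
qed

lemma Imass_finite: "t \<ge> 0 \<Longrightarrow> Imass t < \<infinity>"
proof -
  assume t: "t \<ge> 0"
  have "Imass t = (\<integral>\<^sup>+x. ennreal (\<bar>x\<bar> powr 0 * base t x) \<partial>lborel)"
    unfolding Imass_def by (rule nn_integral_cong_AE, use AE_lborel_singleton[of 0] in eventually_elim) auto
  then show ?thesis using nn_integral_powr_base_finite[of 0 t] t by simp
qed

lemma Jmass_finite: "t \<ge> 0 \<Longrightarrow> Jmass t < \<infinity>"
proof -
  assume t: "t \<ge> 0"
  have "Jmass t = (\<integral>\<^sup>+x. ennreal (p - 1) * ennreal (\<bar>x\<bar> powr (p - 2) * base t x) \<partial>lborel)"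
    unfolding Jmass_def dphi_def using p_gt_1 by (intro nn_integral_cong) (simp add: ennreal_mult[symmetric] mult.assoc)
  also have "\<dots> = ennreal (p - 1) * (\<integral>\<^sup>+x. ennreal (\<bar>x\<bar> powr (p - 2) * base t x) \<partial>lborel)"
    by (rule nn_integral_cmult) measurable
  finally show ?thesis using nn_integral_powr_base_finite[of "p - 2" t] t p_gt_1 by (simp add: ennreal_mult_less_top)
qed

lemma Qmass_finite: "t \<ge> 0 \<Longrightarrow> Qmass t < \<infinity>"
  unfolding Qmass_def phi_power2 using p_gt_1 by (intro nn_integral_powr_base_finite) auto

lemma nn_integral_pos_AE:
  fixes f :: "real \<Rightarrow> real"
  assumes [measurable]: "f \<in> borel_measurable borel" and "\<And>x. x \<noteq> 0 \<Longrightarrow> f x > 0"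
  shows "(\<integral>\<^sup>+x. ennreal (f x) \<partial>lborel) > 0"
proof (rule ccontr)
  assume "\<not> ?thesis"
  then have "(\<integral>\<^sup>+x. ennreal (f x) \<partial>lborel) = 0" by simp
  then have "AE x in lborel. ennreal (f x) = 0" by (subst (asm) nn_integral_0_iff_AE) auto
  then have "AE x in lborel. (x::real) = 0"
    by (rule eventually_mono) (metis assms(2) ennreal_eq_0_iff not_le)
  then have "emeasure lborel {x :: real. x \<noteq> 0} = 0" by (subst (asm) AE_iff_measurable[OF _ refl]) auto
  moreover have "emeasure lborel {0<..<1::real} \<le> emeasure lborel {x :: real. x \<noteq> 0}"
    by (intro emeasure_mono) auto
  ultimately show False by simp
qed

lemma Imass_pos: "Imass t > 0" unfolding Imass_def by (intro nn_integral_pos_AE) auto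
lemma Jmass_pos: "Jmass t > 0" unfolding Jmass_def using p_gt_1 by (intro nn_integral_pos_AE) (auto simp: dphi_def)
lemma Qmass_pos: "Qmass t > 0" unfolding Qmass_def by (intro nn_integral_pos_AE) auto

text \<open>Tonelli and the Gamma integral in \<open>t\<close>. That integral needs
  \<open>Bsum n x > 0\<close>; this fails only where all coordinates vanish, and there
  \<open>hsym\<close> is \<open>0\<close>.\<close>

lemma mix_eq:
  assumes c: "c > 0" and [measurable]: "G \<in> borel_measurable (lborel_n n)"
  shows "mix n q c G = ennreal (Gamma c) * (\<integral>\<^sup>+x. G x * ennreal (exp (- Asum n x) * Bsum n x powr (- c) * hsym n q x) \<partial>lborel_n n)"
proof -
  define H where "H t x = ennreal (t powr (c - 1)) * indicator {0<..} t * (G x * ennreal (exp (- Asum n x - t * Bsum n x) * hsym n q x))" for t x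
  have [measurable]: "case_prod H \<in> borel_measurable (lborel \<Otimes>\<^sub>M lborel_n n)"
    unfolding H_def case_prod_beta' by measurable
  have "mix n q c G = (\<integral>\<^sup>+t. (\<integral>\<^sup>+x. H t x \<partial>lborel_n n) \<partial>lborel)"
    unfolding mix_def H_def by (intro nn_integral_cong nn_integral_cmult[symmetric]) measurable
  also have "\<dots> = (\<integral>\<^sup>+x. (\<integral>\<^sup>+t. H t x \<partial>lborel) \<partial>lborel_n n)"
    by (rule Fubini_lborel_n[symmetric]) measurable
  also have "\<dots> = (\<integral>\<^sup>+x. ennreal (Gamma c) * (G x * ennreal (exp (- Asum n x) * Bsum n x powr (- c) * hsym n q x)) \<partial>lborel_n n)"
  proof (rule nn_integral_cong)
    fix x assume x: "x \<in> space (lborel_n n)"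
    show "(\<integral>\<^sup>+t. H t x \<partial>lborel) = ennreal (Gamma c) * (G x * ennreal (exp (- Asum n x) * Bsum n x powr (- c) * hsym n q x))"
    proof (cases "Spow n x = 0")
      case True
      then show ?thesis by (simp add: H_def hsym_zero)
    next
      case False
      then obtain k where "k < n" "x k \<noteq> 0" using Spow_pos_iff[of n x] Spow_nonneg[of n x] by (metis less_eq_real_def)
      then have B: "Bsum n x > 0" unfolding Bsum_def by (intro sum_pos2[of _ k]) auto
      have "H t x = (G x * ennreal (exp (- Asum n x) * hsym n q x)) * (ennreal (t powr (c - 1) * exp (- (Bsum n x * t))) * indicator {0<..} t)" for t
      proof -
        have "exp (- Asum n x - t * Bsum n x) = exp (- Asum n x) * exp (- (Bsum n x * t))"
          by (simp add: exp_add[symmetric] mult.commute)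
        then have "t powr (c - 1) * (exp (- Asum n x - t * Bsum n x) * hsym n q x) =
          (exp (- Asum n x) * hsym n q x) * (t powr (c - 1) * exp (- (Bsum n x * t)))" by (simp only: mult_ac)
        then have e: "ennreal (t powr (c - 1)) * ennreal (exp (- Asum n x - t * Bsum n x) * hsym n q x) =
          ennreal (exp (- Asum n x) * hsym n q x) * ennreal (t powr (c - 1) * exp (- (Bsum n x * t)))"
          by (simp only: ennreal_mult[symmetric] powr_ge_zero exp_ge_zero hsym_nonneg mult_nonneg_nonneg)
        have "H t x = G x * (ennreal (t powr (c - 1)) * ennreal (exp (- Asum n x - t * Bsum n x) * hsym n q x)) * indicator {0<..} t"
          unfolding H_def by (simp only: mult_ac)
        also have "\<dots> = (G x * ennreal (exp (- Asum n x) * hsym n q x)) * (ennreal (t powr (c - 1) * exp (- (Bsum n x * t))) * indicator {0<..} t)"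
          unfolding e by (simp only: mult_ac)
        finally show ?thesis .
      qed
      then have "(\<integral>\<^sup>+t. H t x \<partial>lborel) = (G x * ennreal (exp (- Asum n x) * hsym n q x)) * ennreal (Gamma c * Bsum n x powr (- c))"
        by (simp only:) (subst nn_integral_cmult, measurable, simp only: nn_integral_Gamma[OF c B])
      also have "\<dots> = G x * (ennreal (exp (- Asum n x) * hsym n q x) * ennreal (Gamma c * Bsum n x powr (- c)))"
        by (simp only: mult_ac)
      also have "ennreal (exp (- Asum n x) * hsym n q x) * ennreal (Gamma c * Bsum n x powr (- c)) =
         ennreal (Gamma c) * ennreal (exp (- Asum n x) * Bsum n x powr (- c) * hsym n q x)"
        using c by (simp add: ennreal_mult[symmetric] Gamma_real_nonneg mult_ac)
      also have "G x * (ennreal (Gamma c) * ennreal (exp (- Asum n x) * Bsum n x powr (- c) * hsym n q x)) =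
        ennreal (Gamma c) * (G x * ennreal (exp (- Asum n x) * Bsum n x powr (- c) * hsym n q x))"
        by (simp only: mult_ac)
      finally show ?thesis .
    qed
  qed
  also have "\<dots> = ennreal (Gamma c) * (\<integral>\<^sup>+x. G x * ennreal (exp (- Asum n x) * Bsum n x powr (- c) * hsym n q x) \<partial>lborel_n n)"
    by (rule nn_integral_cmult) measurable
  finally show ?thesis .
qed

definition vmark :: "nat \<times> nat set \<Rightarrow> real \<Rightarrow> nat \<Rightarrow> real \<Rightarrow> real" where
  "vmark z t k u = (if k = fst z then (phi u)\<^sup>2 * base t u else if k \<in> snd z then dphi u * base t u else base t u)"

lemma vmark_nonneg [simp]: "vmark z t k u \<ge> 0" by (simp add: vmark_def)

lemma measurable_vmark [measurable]: "vmark z t k \<in> borel_measurable borel"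
  unfolding vmark_def by measurable

lemma vmark_prod:
  assumes "z \<in> idx n q"
  shows "exp (- Asum n x - t * Bsum n x) * ((phi (x (fst z)))\<^sup>2 * (\<Prod>k\<in>snd z. dphi (x k))) = (\<Prod>k<n. vmark z t k (x k))"
proof -
  have z: "fst z < n" "snd z \<subseteq> {..<n}" "fst z \<notin> snd z" using assms by (auto simp: idx_def)
  have "exp (- Asum n x - t * Bsum n x) = (\<Prod>k<n. base t (x k))"
    unfolding Asum_def Bsum_def base_def
    by (simp add: exp_sum[symmetric] sum_subtractf sum_negf sum_distrib_left)
  moreover have "(phi (x (fst z)))\<^sup>2 = (\<Prod>k<n. if k = fst z then (phi (x k))\<^sup>2 else 1)"
    using z by (simp add: prod.delta)
  moreover have "(\<Prod>k\<in>snd z. dphi (x k)) = (\<Prod>k<n. if k \<in> snd z then dphi (x k) else 1)"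
    using z by (simp add: prod.inter_restrict[symmetric] Int_absorb1)
  ultimately have "exp (- Asum n x - t * Bsum n x) * ((phi (x (fst z)))\<^sup>2 * (\<Prod>k\<in>snd z. dphi (x k))) =
     (\<Prod>k<n. base t (x k) * ((if k = fst z then (phi (x k))\<^sup>2 else 1) * (if k \<in> snd z then dphi (x k) else 1)))"
    by (simp only: prod.distrib)
  also have "\<dots> = (\<Prod>k<n. vmark z t k (x k))"
    using z by (intro prod.cong refl) (auto simp: vmark_def)
  finally show ?thesis .
qed

lemma vmark_mass: "(\<integral>\<^sup>+u. ennreal (vmark z t k u) \<partial>lborel) = (if k = fst z then Qmass t else if k \<in> snd z then Jmass t else Imass t)"
  by (simp add: vmark_def Qmass_def Jmass_def Imass_def)

text \<open>The exponentials of the two sums factorize over coordinates. For each index pair the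
  integrand is thus a product, and every coordinate beyond the first \<open>r\<close> contributes
  its total mass.\<close>

lemma inner_eq:
  assumes r: "r \<le> n" and F [measurable]: "F \<in> borel_measurable (lborel_n r)"
  shows "(\<integral>\<^sup>+x. F (restrict x {..<r}) * ennreal (exp (- Asum n x - t * Bsum n x) * hsym n q x) \<partial>lborel_n n) =
    (\<Sum>z\<in>idx n q. (\<integral>\<^sup>+x. F x * (\<Prod>k<r. ennreal (vmark z t k (x k))) \<partial>lborel_n r) *
       (\<Prod>k\<in>{r..<n}. if k = fst z then Qmass t else if k \<in> snd z then Jmass t else Imass t))"
proof -
  have "F (restrict x {..<r}) * ennreal (exp (- Asum n x - t * Bsum n x) * hsym n q x) =
    (\<Sum>z\<in>idx n q. F (restrict x {..<r}) * (\<Prod>k<n. ennreal (vmark z t k (x k))))" for x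
  proof -
    have "exp (- Asum n x - t * Bsum n x) * hsym n q x =
      (\<Sum>z\<in>idx n q. exp (- Asum n x - t * Bsum n x) * ((phi (x (fst z)))\<^sup>2 * (\<Prod>k\<in>snd z. dphi (x k))))"
      by (simp only: hsym_def case_prod_beta' sum_distrib_left)
    also have "\<dots> = (\<Sum>z\<in>idx n q. \<Prod>k<n. vmark z t k (x k))"
      by (rule sum.cong[OF refl]) (rule vmark_prod)
    also have "ennreal \<dots> = (\<Sum>z\<in>idx n q. ennreal (\<Prod>k<n. vmark z t k (x k)))"
      by (rule sum_ennreal[symmetric]) (simp add: prod_nonneg)
    also have "\<dots> = (\<Sum>z\<in>idx n q. \<Prod>k<n. ennreal (vmark z t k (x k)))"
      by (intro sum.cong refl prod_ennreal[symmetric]) simp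
    finally show ?thesis by (simp only: sum_distrib_left)
  qed
  then have "(\<integral>\<^sup>+x. F (restrict x {..<r}) * ennreal (exp (- Asum n x - t * Bsum n x) * hsym n q x) \<partial>lborel_n n) =
    (\<integral>\<^sup>+x. (\<Sum>z\<in>idx n q. F (restrict x {..<r}) * (\<Prod>k<n. ennreal (vmark z t k (x k)))) \<partial>lborel_n n)" by simp
  also have "\<dots> = (\<Sum>z\<in>idx n q. \<integral>\<^sup>+x. F (restrict x {..<r}) * (\<Prod>k<n. ennreal (vmark z t k (x k))) \<partial>lborel_n n)"
  proof (rule nn_integral_sum)
    fix z assume "z \<in> idx n q"
    have co: "(\<lambda>x. x k) \<in> borel_measurable (lborel_n n)" if "k < n" for k
      using measurable_coord[of "\<lambda>x. x" "lborel_n n" n k] that by simp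
    show "(\<lambda>x. F (restrict x {..<r}) * (\<Prod>k<n. ennreal (vmark z t k (x k)))) \<in> borel_measurable (lborel_n n)"
      by (intro borel_measurable_times_ennreal borel_measurable_prod_ennreal measurable_compose[OF _ measurable_ennreal])
         (auto intro!: measurable_compose[OF co measurable_vmark] measurable_compose[OF measurable_restrict_lborel_n[OF r] F])
  qed
  also have "\<dots> = (\<Sum>z\<in>idx n q. (\<integral>\<^sup>+x. F x * (\<Prod>k<r. ennreal (vmark z t k (x k))) \<partial>lborel_n r) *
       (\<Prod>k\<in>{r..<n}. if k = fst z then Qmass t else if k \<in> snd z then Jmass t else Imass t))"
    by (intro sum.cong refl) (subst nn_integral_prod_split[OF r F], auto simp: vmark_mass)
  finally show ?thesis .
qed

lemma mass_prod:
  assumes "z \<in> idx n q" "q > 0" "q \<le> n"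
  shows "(\<Prod>k<n. if k = fst z then Q else if k \<in> snd z then J else I) = (Q::ennreal) * J ^ (q - 1) * I ^ (n - q)"
proof -
  have z: "fst z < n" "snd z \<subseteq> {..<n} - {fst z}" "card (snd z) = q - 1" using assms by (auto simp: idx_def)
  have fz: "finite (snd z)" using z(2) finite_subset by blast
  let ?A = "{..<n} - {fst z}"
  have "(\<Prod>k<n. if k = fst z then Q else if k \<in> snd z then J else I) = Q * (\<Prod>k\<in>?A. if k = fst z then Q else if k \<in> snd z then J else I)"
    using z by (subst prod.remove[of _ "fst z"]) auto
  also have "(\<Prod>k\<in>?A. if k = fst z then Q else if k \<in> snd z then J else I) = (\<Prod>k\<in>?A. if k \<in> snd z then J else I)"
    by (intro prod.cong) auto
  also have "\<dots> = J ^ card (snd z) * I ^ card (?A - snd z)"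
  proof -
    have "?A \<inter> {k. k \<in> snd z} = snd z" "?A \<inter> - {k. k \<in> snd z} = ?A - snd z" using z by auto
    then show ?thesis by (simp add: prod.If_cases)
  qed
  also have "card (?A - snd z) = n - q"
    using z fz assms by (simp add: card_Diff_subset)
  finally show ?thesis using z by (simp add: mult.assoc)
qed

text \<open>All index pairs carry the same mass: one factor \<open>Qmass\<close>,
  \<open>q - 1\<close> factors \<open>Jmass\<close> and \<open>n - q\<close> factors
  \<open>Imass\<close>. This is why the cardinality splits off and relative counts become
  probabilities.\<close>

lemma mix_one:
  assumes "q > 0" "q \<le> n"
  shows "mix n q c (\<lambda>_. 1) = ennreal (card (idx n q)) * (\<integral>\<^sup>+t. wgt n q c t \<partial>lborel)"
proof -
  have "(\<integral>\<^sup>+x. 1 * ennreal (exp (- Asum n x - t * Bsum n x) * hsym n q x) \<partial>lborel_n n) =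
    ennreal (card (idx n q)) * (Qmass t * Jmass t ^ (q - 1) * Imass t ^ (n - q))" for t
  proof -
    have "(\<integral>\<^sup>+x. (\<lambda>_. 1) (restrict x {..<0}) * ennreal (exp (- Asum n x - t * Bsum n x) * hsym n q x) \<partial>lborel_n n) =
      (\<Sum>z\<in>idx n q. (\<integral>\<^sup>+x. (\<lambda>_. 1) x * (\<Prod>k<0. ennreal (vmark z t k (x k))) \<partial>lborel_n 0) *
       (\<Prod>k\<in>{0..<n}. if k = fst z then Qmass t else if k \<in> snd z then Jmass t else Imass t))"
      by (rule inner_eq) auto
    also have "\<dots> = (\<Sum>z\<in>idx n q. Qmass t * Jmass t ^ (q - 1) * Imass t ^ (n - q))"
    proof (rule sum.cong[OF refl])
      fix z assume "z \<in> idx n q"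
      from mass_prod[OF this assms] show "(\<integral>\<^sup>+x. (\<lambda>_. 1) x * (\<Prod>k<0. ennreal (vmark z t k (x k))) \<partial>lborel_n 0) *
       (\<Prod>k\<in>{0..<n}. if k = fst z then Qmass t else if k \<in> snd z then Jmass t else Imass t) = Qmass t * Jmass t ^ (q - 1) * Imass t ^ (n - q)"
        by (simp add: PiM_empty nn_integral_count_space_finite atLeast0LessThan)
    qed
    finally show ?thesis by (simp add: ennreal_of_nat_eq_real_of_nat)
  qed
  then have "mix n q c (\<lambda>_. 1) = (\<integral>\<^sup>+t. ennreal (card (idx n q)) * wgt n q c t \<partial>lborel)"
    unfolding mix_def wgt_def by (intro nn_integral_cong) (simp only: mult_ac)
  then show ?thesis by (simp add: nn_integral_cmult)
qed

text \<open>Applied to \<open>F\<close> and to the constant \<open>1\<close>, this bounds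
  conditional means uniformly over a window of mixing parameters by values at its two ends.\<close>

lemma pattern_integral_antimono: "s \<le> t \<Longrightarrow> pattern_integral r F T t \<le> pattern_integral r F T s"
  unfolding pattern_integral_def by (intro nn_integral_mono mult_left_mono prod_mono_ennreal) (auto intro!: ennreal_leI mult_left_mono base_antimono)

lemma pattern_integral_one:
  assumes "T \<subseteq> {..<r}"
  shows "pattern_integral r (\<lambda>_. 1) T t = Jmass t ^ card T * Imass t ^ (r - card T)"
proof -
  have fT: "finite T" using assms finite_subset by blast
  let ?v = "\<lambda>k u. ennreal (if k \<in> T then dphi u * base t u else base t u)"
  have "pattern_integral r (\<lambda>_. 1) T t = (\<integral>\<^sup>+x. (\<lambda>_. 1) (restrict x {..<0}) * (\<Prod>k<r. ?v k (x k)) \<partial>lborel_n r)"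
    by (simp add: pattern_integral_def)
  also have "\<dots> = (\<integral>\<^sup>+x. (\<lambda>_. 1) x * (\<Prod>k<0. ?v k (x k)) \<partial>lborel_n 0) * (\<Prod>k\<in>{0..<r}. \<integral>\<^sup>+u. ?v k u \<partial>lborel)"
    by (rule nn_integral_prod_split) auto
  also have "\<dots> = (\<Prod>k<r. if k \<in> T then Jmass t else Imass t)"
    by (simp add: PiM_empty nn_integral_count_space_finite atLeast0LessThan Jmass_def Imass_def if_distrib[of "\<lambda>f. \<integral>\<^sup>+u. f u \<partial>lborel"] cong: if_cong)
       (intro prod.cong refl, auto)
  also have "\<dots> = Jmass t ^ card T * Imass t ^ (r - card T)"
  proof -
    have "{..<r} \<inter> {k. k \<in> T} = T" "{..<r} \<inter> - {k. k \<in> T} = {..<r} - T" using assms by auto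
    then show ?thesis using fT assms by (simp add: prod.If_cases card_Diff_subset)
  qed
  finally show ?thesis .
qed

end

lemma filterlim_nat_of_real:
  assumes "filterlim (\<lambda>n. real (f n)) at_top F"
  shows "filterlim f at_top F"
  unfolding filterlim_at_top
proof
  fix Z :: nat
  have "eventually (\<lambda>n. real Z \<le> real (f n)) F" using assms[unfolded filterlim_at_top, rule_format, of "real Z"] .
  then show "eventually (\<lambda>n. Z \<le> f n) F" by eventually_elim simp
qed

context lp_mixture
begin

lemma pattern_integral_one_finite:
  assumes "T \<subseteq> {..<r}" "t \<ge> 0"
  shows "pattern_integral r (\<lambda>_. 1) T t < \<infinity>"
  unfolding pattern_integral_one[OF assms(1)] using Imass_finite[OF assms(2)] Jmass_finite[OF assms(2)]
  by (simp add: ennreal_mult_less_top power_less_top_ennreal)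

lemma pattern_integral_one_pos:
  assumes "T \<subseteq> {..<r}"
  shows "pattern_integral r (\<lambda>_. 1) T t > 0"
proof -
  have "Jmass t ^ card T * Imass t ^ (r - card T) \<noteq> 0"
    using Imass_pos[of t] Jmass_pos[of t] by auto
  then show ?thesis unfolding pattern_integral_one[OF assms(1)] by (rule zero_less_iff_neq_zero[THEN iffD2])
qed

lemma pattern_integral_le_one:
  assumes "\<And>x. F x \<le> 1"
  shows "pattern_integral r F T t \<le> pattern_integral r (\<lambda>_. 1) T t"
  unfolding pattern_integral_def using assms by (intro nn_integral_mono mult_right_mono) auto

text \<open>Dominated convergence with the integrand at \<open>t = 0\<close> as majorant.\<close>

lemma pattern_integral_tendsto:
  assumes T: "T \<subseteq> {..<r}" and F [measurable]: "F \<in> borel_measurable (lborel_n r)" and F1: "\<And>x. F x \<le> 1"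
    and t: "\<And>m. t m \<ge> 0" "t \<longlonglongrightarrow> \<theta>"
  shows "(\<lambda>m. pattern_integral r F T (t m)) \<longlonglongrightarrow> pattern_integral r F T \<theta>"
proof -
  define v where "v s k u = (if k \<in> T then dphi u * base s u else base s u)" for s :: real and k :: nat and u :: real
  have v0: "v s k u \<ge> 0" for s k u by (simp add: v_def)
  have vm: "v s k \<in> borel_measurable borel" for s k unfolding v_def by measurable
  have co: "(\<lambda>x. x k) \<in> borel_measurable (lborel_n r)" if "k < r" for k
    using measurable_coord[of "\<lambda>x. x" "lborel_n r" r k] that by simp
  have pe: "(\<Prod>k<r. ennreal (v s k (x k))) = ennreal (\<Prod>k<r. v s k (x k))" for s x
    by (intro prod_ennreal v0)
  have m: "(\<lambda>x. ennreal (\<Prod>k<r. v s k (x k))) \<in> borel_measurable (lborel_n r)" for s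
    unfolding pe[symmetric]
    by (intro borel_measurable_prod_ennreal measurable_compose[OF _ measurable_ennreal]) (auto intro!: measurable_compose[OF co vm])
  have pattern_integral: "pattern_integral r G T s = (\<integral>\<^sup>+x. G x * ennreal (\<Prod>k<r. v s k (x k)) \<partial>lborel_n r)" for s G
    unfolding pattern_integral_def v_def[symmetric] pe ..
  show ?thesis unfolding pattern_integral
  proof (rule nn_integral_dominated_convergence)
    show "(\<lambda>x. F x * ennreal (\<Prod>k<r. v (t i) k (x k))) \<in> borel_measurable (lborel_n r)" for i
      using m[of "t i"] by measurable
    show "(\<lambda>x. F x * ennreal (\<Prod>k<r. v \<theta> k (x k))) \<in> borel_measurable (lborel_n r)"
      using m[of \<theta>] by measurable
    show "(\<lambda>x. 1 * ennreal (\<Prod>k<r. v 0 k (x k))) \<in> borel_measurable (lborel_n r)"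
      using m[of 0] by simp
    show "AE x in lborel_n r. F x * ennreal (\<Prod>k<r. v (t j) k (x k)) \<le> 1 * ennreal (\<Prod>k<r. v 0 k (x k))" for j
      using t(1)[of j] by (intro AE_I2 mult_mono F1 ennreal_leI prod_mono)
        (auto simp: v0 v_def intro!: mult_left_mono base_antimono)
    have "(\<integral>\<^sup>+x. 1 * ennreal (\<Prod>k<r. v 0 k (x k)) \<partial>lborel_n r) = pattern_integral r (\<lambda>_. 1) T 0" by (simp add: pattern_integral)
    then show "(\<integral>\<^sup>+x. 1 * ennreal (\<Prod>k<r. v 0 k (x k)) \<partial>lborel_n r) < \<infinity>"
      using pattern_integral_one_finite[OF T, of 0] by simp
    have "(\<lambda>i. F x * ennreal (\<Prod>k<r. v (t i) k (x k))) \<longlonglongrightarrow> F x * ennreal (\<Prod>k<r. v \<theta> k (x k))" for x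
    proof (rule ennreal_tendsto_cmult)
      show "F x < \<top>" using F1[of x] by (meson ennreal_one_less_top le_less_trans)
      have "(\<lambda>i. v (t i) k u) \<longlonglongrightarrow> v \<theta> k u" for k u
        unfolding v_def base_def using t(2) by (auto intro!: tendsto_intros)
      then show "(\<lambda>i. ennreal (\<Prod>k<r. v (t i) k (x k))) \<longlonglongrightarrow> ennreal (\<Prod>k<r. v \<theta> k (x k))"
        by (intro tendsto_ennrealI tendsto_prod)
    qed
    then show "AE x in lborel_n r. (\<lambda>i. F x * ennreal (\<Prod>k<r. v (t i) k (x k))) \<longlonglongrightarrow> F x * ennreal (\<Prod>k<r. v \<theta> k (x k))"
      by simp
  qed
qed

section \<open>Asymptotic lower bound for the mixture\<close>

definition pattern_mean :: "nat \<Rightarrow> ((nat \<Rightarrow> real) \<Rightarrow> ennreal) \<Rightarrow> nat set \<Rightarrow> real \<Rightarrow> real" where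
  "pattern_mean r F T \<theta> = enn2real (pattern_integral r F T \<theta>) / enn2real (pattern_integral r (\<lambda>_. 1) T \<theta>)"

text \<open>Index pairs whose squared coordinate lies among the first \<open>r\<close> are
  discarded, which can only lower the sum; they form a fraction \<open>r / n\<close> of all pairs.
  The other pairs depend on the first \<open>r\<close> coordinates through their trace
  \<open>T\<close> alone, where \<open>l T\<close> bounds the conditional mean of \<open>F\<close>
  from below.\<close>

lemma inner_lower:
  fixes l :: "nat set \<Rightarrow> ennreal"
  assumes r: "r \<le> n" and q: "0 < q" "q \<le> n" and F [measurable]: "F \<in> borel_measurable (lborel_n r)"
    and l: "\<And>T. T \<subseteq> {..<r} \<Longrightarrow> l T * pattern_integral r (\<lambda>_. 1) T t \<le> pattern_integral r F T t"
  shows "(\<Sum>T\<in>Pow {..<r}. of_nat (card {z \<in> idx n q. r \<le> fst z \<and> snd z \<inter> {..<r} = T}) * l T) *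
      (Qmass t * Jmass t ^ (q - 1) * Imass t ^ (n - q)) \<le>
    (\<integral>\<^sup>+x. F (restrict x {..<r}) * ennreal (exp (- Asum n x - t * Bsum n x) * hsym n q x) \<partial>lborel_n n)"
proof -
  let ?M = "Qmass t * Jmass t ^ (q - 1) * Imass t ^ (n - q)"
  let ?m = "\<lambda>z k. if k = fst z then Qmass t else if k \<in> snd z then Jmass t else Imass t"
  let ?term = "\<lambda>z. (\<integral>\<^sup>+x. F x * (\<Prod>k<r. ennreal (vmark z t k (x k))) \<partial>lborel_n r) * (\<Prod>k\<in>{r..<n}. ?m z k)"
  let ?S = "{z \<in> idx n q. r \<le> fst z}"
  have fS: "finite ?S" by simp
  have zterm: "l (snd z \<inter> {..<r}) * ?M \<le> ?term z" if z: "z \<in> ?S" for z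
  proof -
    let ?T = "snd z \<inter> {..<r}"
    have eq: "(\<integral>\<^sup>+x. G x * (\<Prod>k<r. ennreal (vmark z t k (x k))) \<partial>lborel_n r) = pattern_integral r G ?T t" for G
      unfolding pattern_integral_def
    proof (intro nn_integral_cong arg_cong2[where f="(*)"] prod.cong refl)
      fix x k assume "k \<in> {..<r}"
      then show "ennreal (vmark z t k (x k)) = ennreal (if k \<in> ?T then dphi (x k) * base t (x k) else base t (x k))"
        using z by (auto simp: vmark_def)
    qed
    have one: "pattern_integral r (\<lambda>_. 1) ?T t = (\<Prod>k<r. ?m z k)"
    proof -
      have "pattern_integral r (\<lambda>_. 1) ?T t = (\<integral>\<^sup>+x. (\<lambda>_. 1) (restrict x {..<0}) * (\<Prod>k<r. ennreal (vmark z t k (x k))) \<partial>lborel_n r)"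
        using eq[of "\<lambda>_. 1"] by simp
      also have "\<dots> = (\<integral>\<^sup>+x. (\<lambda>_. 1) x * (\<Prod>k<0. ennreal (vmark z t k (x k))) \<partial>lborel_n 0) * (\<Prod>k\<in>{0..<r}. \<integral>\<^sup>+u. ennreal (vmark z t k u) \<partial>lborel)"
        by (rule nn_integral_prod_split) auto
      also have "\<dots> = (\<Prod>k<r. ?m z k)"
        by (simp add: vmark_mass PiM_empty nn_integral_count_space_finite atLeast0LessThan)
      finally show ?thesis .
    qed
    have "?M = (\<Prod>k<n. ?m z k)" using mass_prod[of z n q] z q by simp
    also have "\<dots> = (\<Prod>k<r. ?m z k) * (\<Prod>k\<in>{r..<n}. ?m z k)"
      using r by (simp add: prod.atLeastLessThan_concat atLeast0LessThan[symmetric])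
    finally have "l ?T * ?M = (l ?T * pattern_integral r (\<lambda>_. 1) ?T t) * (\<Prod>k\<in>{r..<n}. ?m z k)"
      by (simp add: one mult.assoc)
    also have "\<dots> \<le> pattern_integral r F ?T t * (\<Prod>k\<in>{r..<n}. ?m z k)"
      by (intro mult_right_mono l) auto
    finally show ?thesis by (simp add: eq)
  qed
  have "(\<Sum>T\<in>Pow {..<r}. of_nat (card {z \<in> idx n q. r \<le> fst z \<and> snd z \<inter> {..<r} = T}) * l T) * ?M =
    (\<Sum>T\<in>Pow {..<r}. \<Sum>z\<in>{z \<in> ?S. snd z \<inter> {..<r} = T}. l (snd z \<inter> {..<r}) * ?M)"
  proof -
    have "{z \<in> idx n q. r \<le> fst z \<and> snd z \<inter> {..<r} = T} = {z \<in> ?S. snd z \<inter> {..<r} = T}" for T by auto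
    moreover have "(\<Sum>z\<in>{z \<in> ?S. snd z \<inter> {..<r} = T}. l (snd z \<inter> {..<r}) * ?M) = of_nat (card {z \<in> ?S. snd z \<inter> {..<r} = T}) * l T * ?M" for T
    proof -
      have "(\<Sum>z\<in>{z \<in> ?S. snd z \<inter> {..<r} = T}. l (snd z \<inter> {..<r}) * ?M) = (\<Sum>z\<in>{z \<in> ?S. snd z \<inter> {..<r} = T}. l T * ?M)"
        by (rule sum.cong) auto
      then show ?thesis by (simp add: mult.assoc)
    qed
    ultimately show ?thesis by (simp add: sum_distrib_right)
  qed
  also have "\<dots> = (\<Sum>z\<in>?S. l (snd z \<inter> {..<r}) * ?M)"
    by (rule sum.group[OF fS]) auto
  also have "\<dots> \<le> (\<Sum>z\<in>?S. ?term z)" by (intro sum_mono zterm)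
  also have "\<dots> \<le> (\<Sum>z\<in>idx n q. ?term z)" by (intro sum_mono2) auto
  also have "\<dots> = (\<integral>\<^sup>+x. F (restrict x {..<r}) * ennreal (exp (- Asum n x - t * Bsum n x) * hsym n q x) \<partial>lborel_n n)"
    by (rule inner_eq[OF r F, symmetric])
  finally show ?thesis .
qed

text \<open>The second component of an index pair is a uniformly distributed subset of the other
  \<open>n - 1\<close> coordinates, so its trace on finitely many of them becomes a Bernoulli
  sequence. The hypothesis \<open>nz\<close> supplies the growth conditions of the binomial limit;
  patterns with limit \<open>0\<close> are dropped by the caller.\<close>

lemma pattern_ratio_tendsto:
  fixes j :: "nat \<Rightarrow> nat"
  assumes j: "eventually (\<lambda>n. j n < n) sequentially" and lim: "(\<lambda>n. real (j n) / real n) \<longlonglongrightarrow> \<alpha>"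
    and \<alpha>: "0 \<le> \<alpha>" "\<alpha> \<le> 1" and T: "T \<subseteq> {..<r}" and nz: "(1 - \<alpha>) ^ card T * \<alpha> ^ (r - card T) \<noteq> 0"
  shows "(\<lambda>n. real (card {z \<in> idx n (n - j n). r \<le> fst z \<and> snd z \<inter> {..<r} = T}) / real (card (idx n (n - j n))))
    \<longlonglongrightarrow> (1 - \<alpha>) ^ card T * \<alpha> ^ (r - card T)"
proof -
  \<comment> \<open>The squared coordinate is set aside, so both the ground set and the chosen
    number are lowered by one.\<close>
  define N Q where "N n = n - 1" and "Q n = n - j n - 1" for n :: nat
  have cT: "card T \<le> r" using T card_mono[of "{..<r}" T] by simp
  have Nt: "filterlim N at_top sequentially"
    unfolding N_def filterlim_at_top
  proof
    fix Z show "eventually (\<lambda>n. Z \<le> n - 1) sequentially"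
      using eventually_ge_at_top[of "Suc Z"] by eventually_elim simp
  qed
  have inv: "(\<lambda>n. 1 / real n) \<longlonglongrightarrow> 0" by (rule lim_1_over_n)
  have QN: "(\<lambda>n. real (Q n) / real (N n)) \<longlonglongrightarrow> 1 - \<alpha>"
  proof -
    have "(\<lambda>n. (1 - real (j n) / real n - 1 / real n) / (1 - 1 / real n)) \<longlonglongrightarrow> (1 - \<alpha> - 0) / (1 - 0)"
      by (intro tendsto_intros lim inv) auto
    then have "(\<lambda>n. (1 - real (j n) / real n - 1 / real n) / (1 - 1 / real n)) \<longlonglongrightarrow> 1 - \<alpha>" by simp
    moreover have "eventually (\<lambda>n. (1 - real (j n) / real n - 1 / real n) / (1 - 1 / real n) = real (Q n) / real (N n)) sequentially"
      using j eventually_gt_at_top[of 1]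
    proof eventually_elim
      case (elim n)
      then have Q: "real (Q n) = real n - real (j n) - 1" and N: "real (N n) = real n - 1"
        by (auto simp: Q_def N_def of_nat_diff)
      have "1 - real (j n) / real n - 1 / real n = (real n - real (j n) - 1) / real n"
        "1 - 1 / real n = (real n - 1) / real n" using elim by (auto simp: field_simps)
      then show ?case unfolding Q N using elim by simp
    qed
    ultimately show ?thesis by (rule Lim_transform_eventually)
  qed
  have le: "eventually (\<lambda>n. Q n \<le> N n) sequentially"
    by (rule always_eventually) (auto simp: Q_def N_def)
  have Qt: "filterlim Q at_top sequentially" if "card T \<noteq> 0"
  proof (rule filterlim_nat_of_real)
    have "1 - \<alpha> > 0" using nz that \<alpha> by (cases "\<alpha> = 1") auto
    then have "filterlim (\<lambda>n. real (Q n) / real (N n) * real (N n)) at_top sequentially"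
      by (intro filterlim_tendsto_pos_mult_at_top[OF QN] filterlim_compose[OF filterlim_real_sequentially Nt])
    moreover have "eventually (\<lambda>n. real (Q n) / real (N n) * real (N n) = real (Q n)) sequentially"
      using eventually_gt_at_top[of 1] by eventually_elim (simp add: N_def)
    ultimately show "filterlim (\<lambda>n. real (Q n)) at_top sequentially" by (simp add: filterlim_cong)
  qed
  have jt: "filterlim (\<lambda>n. N n - Q n) at_top sequentially" if "r - card T \<noteq> 0"
  proof (rule filterlim_nat_of_real)
    have "\<alpha> > 0" using nz that \<alpha> by (cases "\<alpha> = 0") auto
    then have "filterlim (\<lambda>n. real (j n) / real n * real n) at_top sequentially"
      by (intro filterlim_tendsto_pos_mult_at_top[OF lim] filterlim_real_sequentially)
    moreover have "eventually (\<lambda>n. real (j n) / real n * real n = real (N n - Q n)) sequentially"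
      using j eventually_gt_at_top[of 1] by eventually_elim (simp add: N_def Q_def)
    ultimately show "filterlim (\<lambda>n. real (N n - Q n)) at_top sequentially" by (simp add: filterlim_cong)
  qed
  have B: "(\<lambda>n. real ((N n - card T - (r - card T)) choose (Q n - card T)) / real (N n choose Q n)) \<longlonglongrightarrow> (1 - \<alpha>) ^ card T * (1 - (1 - \<alpha>)) ^ (r - card T)"
    by (rule binomial_ratio_tendsto[OF le Nt QN]) (use Qt jt in auto)
  have "(\<lambda>n. (1 - real r * (1 / real n)) * (real ((N n - card T - (r - card T)) choose (Q n - card T)) / real (N n choose Q n))) \<longlonglongrightarrow> (1 - real r * 0) * ((1 - \<alpha>) ^ card T * (1 - (1 - \<alpha>)) ^ (r - card T))"
    by (intro tendsto_mult B tendsto_diff tendsto_const inv)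
  moreover have "eventually (\<lambda>n. card T \<le> Q n) sequentially"
    using Qt by (cases "card T = 0") (auto simp: filterlim_at_top)
  then have "eventually (\<lambda>n. (1 - real r * (1 / real n)) * (real ((N n - card T - (r - card T)) choose (Q n - card T)) / real (N n choose Q n))
     = real (card {z \<in> idx n (n - j n). r \<le> fst z \<and> snd z \<inter> {..<r} = T}) / real (card (idx n (n - j n)))) sequentially"
    using eventually_ge_at_top[of "Suc r"]
  proof eventually_elim
    case (elim n)
    have a: "N n - card T - (r - card T) = n - 1 - r" using cT by (simp add: N_def)
    have b: "real (card {z \<in> idx n (n - j n). r \<le> fst z \<and> snd z \<inter> {..<r} = T}) = real (n - r) * real ((n - 1 - r) choose (Q n - card T))"
      using card_idx_pattern[OF T, of "n - j n" n] elim by (simp add: Q_def)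
    have c: "real (card (idx n (n - j n))) = real n * real (N n choose Q n)" by (simp add: card_idx N_def Q_def)
    have d: "1 - real r * (1 / real n) = real (n - r) / real n" using elim by (simp add: of_nat_diff diff_divide_distrib)
    show ?case unfolding a b c d by simp
  qed
  ultimately show ?thesis using Lim_transform_eventually by fastforce
qed

text \<open>Inside a window around \<open>\<theta>\<close> the conditional means stay above ratios
  close to \<open>pattern_mean\<close>, and the frequencies of the patterns converge. Everything
  outside the window is dropped at the cost of a factor \<open>\<eta> < 1\<close>, for which the
  strict inequality on \<open>L\<close> leaves room.\<close>

lemma mix_liminf:
  fixes j :: "nat \<Rightarrow> nat" and c :: "nat \<Rightarrow> real"
  assumes F [measurable]: "F \<in> borel_measurable (lborel_n r)" and F1: "\<And>x. F x \<le> 1"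
    and j: "eventually (\<lambda>n. j n < n) sequentially" and lim: "(\<lambda>n. real (j n) / real n) \<longlonglongrightarrow> \<alpha>"
    and \<alpha>: "0 \<le> \<alpha>" "\<alpha> \<le> 1" and \<theta>: "\<theta> \<ge> 0"
    and conc: "\<And>\<delta> \<eta>. \<delta> > 0 \<Longrightarrow> 0 < \<eta> \<Longrightarrow> \<eta> < 1 \<Longrightarrow>
      eventually (\<lambda>n. ennreal \<eta> * (\<integral>\<^sup>+t. wgt n (n - j n) (c n) t \<partial>lborel) \<le>
        (\<integral>\<^sup>+t. wgt n (n - j n) (c n) t * indicator {t. \<bar>t - \<theta>\<bar> \<le> \<delta>} t \<partial>lborel)) sequentially"
    and L: "L < (\<Sum>T\<in>Pow {..<r}. (1 - \<alpha>) ^ card T * \<alpha> ^ (r - card T) * pattern_mean r F T \<theta>)"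
  shows "eventually (\<lambda>n. ennreal L * mix n (n - j n) (c n) (\<lambda>_. 1) \<le> mix n (n - j n) (c n) (\<lambda>x. F (restrict x {..<r}))) sequentially"
proof (cases "L \<le> 0")
  case True
  then show ?thesis by (simp add: ennreal_neg)
next
  case False
  then have Lpos: "L > 0" by simp
  let ?k = "\<lambda>T. (1 - \<alpha>) ^ card T * \<alpha> ^ (r - card T)"
  let ?one = "\<lambda>_::nat \<Rightarrow> real. 1 :: ennreal"
  define d where "d m = 1 / real (Suc m)" for m
  have d: "d m > 0" for m by (simp add: d_def)
  have dl: "d \<longlonglongrightarrow> 0" unfolding d_def by (rule LIMSEQ_Suc[OF lim_1_over_n])
  \<comment> \<open>The numerator is taken at the right end of the window and the denominator at the
    left end, so by monotonicity the ratio is a lower bound throughout. The left end is clipped at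
    \<open>0\<close>, where all masses are still finite.\<close>
  define lr where "lr m T = enn2real (pattern_integral r F T (\<theta> + d m)) / enn2real (pattern_integral r ?one T (max 0 (\<theta> - d m)))" for m T
  have fin1: "pattern_integral r ?one T t \<noteq> \<top>" if "T \<subseteq> {..<r}" "t \<ge> 0" for T t using pattern_integral_one_finite[OF that] by simp
  have finF: "pattern_integral r F T t \<noteq> \<top>" if "T \<subseteq> {..<r}" "t \<ge> 0" for T t
    using pattern_integral_le_one[of F r T t, OF F1] fin1[OF that] by (metis neq_top_trans)
  have lrlim: "(\<lambda>m. lr m T) \<longlonglongrightarrow> pattern_mean r F T \<theta>" if T: "T \<subseteq> {..<r}" for T
    unfolding lr_def pattern_mean_def
  proof (rule tendsto_divide)
    have "(\<lambda>m. \<theta> + d m) \<longlonglongrightarrow> \<theta> + 0" by (intro tendsto_intros dl)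
    then have "(\<lambda>m. pattern_integral r F T (\<theta> + d m)) \<longlonglongrightarrow> pattern_integral r F T \<theta>"
      using \<theta> d by (intro pattern_integral_tendsto T F F1) (auto simp: less_imp_le)
    then show "(\<lambda>m. enn2real (pattern_integral r F T (\<theta> + d m))) \<longlonglongrightarrow> enn2real (pattern_integral r F T \<theta>)"
      using finF[OF T \<theta>] by (intro tendsto_enn2real) (auto simp: less_top)
    have "(\<lambda>m. max 0 (\<theta> - d m)) \<longlonglongrightarrow> max 0 (\<theta> - 0)" by (intro tendsto_intros dl)
    then have "(\<lambda>m. max 0 (\<theta> - d m)) \<longlonglongrightarrow> \<theta>" using \<theta> by (simp add: max_absorb2)
    then have "(\<lambda>m. pattern_integral r ?one T (max 0 (\<theta> - d m))) \<longlonglongrightarrow> pattern_integral r ?one T \<theta>"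
      by (intro pattern_integral_tendsto T) auto
    then show "(\<lambda>m. enn2real (pattern_integral r ?one T (max 0 (\<theta> - d m)))) \<longlonglongrightarrow> enn2real (pattern_integral r ?one T \<theta>)"
      using fin1[OF T \<theta>] by (intro tendsto_enn2real) (auto simp: less_top)
    show "enn2real (pattern_integral r ?one T \<theta>) \<noteq> 0"
      using fin1[OF T \<theta>] pattern_integral_one_pos[OF T, of \<theta>] by (simp add: enn2real_eq_0_iff)
  qed
  have "(\<lambda>m. \<Sum>T\<in>Pow {..<r}. ?k T * lr m T) \<longlonglongrightarrow> (\<Sum>T\<in>Pow {..<r}. ?k T * pattern_mean r F T \<theta>)"
    by (intro tendsto_sum tendsto_mult tendsto_const lrlim) auto
  from order_tendstoD(1)[OF this L] obtain m where m: "L < (\<Sum>T\<in>Pow {..<r}. ?k T * lr m T)"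
    by (auto simp: eventually_sequentially)
  \<comment> \<open>For \<open>\<alpha> = 0\<close> or \<open>\<alpha> = 1\<close> most patterns
    have limit \<open>0\<close>. The others carry the whole sum and are the ones to which the
    frequency limit applies.\<close>
  define G where "G = {T \<in> Pow {..<r}. ?k T \<noteq> 0}"
  have fG: "finite G" "G \<subseteq> Pow {..<r}" by (auto simp: G_def)
  have lr0: "lr m T \<ge> 0" for T by (simp add: lr_def)
  have "(\<Sum>T\<in>Pow {..<r}. ?k T * lr m T) = (\<Sum>T\<in>G. ?k T * lr m T)"
    by (rule sum.mono_neutral_right) (auto simp: G_def)
  with m obtain L2 where L2: "L < L2" "L2 < (\<Sum>T\<in>G. ?k T * lr m T)" using dense by auto
  let ?cn = "\<lambda>n T. card {z \<in> idx n (n - j n). r \<le> fst z \<and> snd z \<inter> {..<r} = T}"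
  have "(\<lambda>n. \<Sum>T\<in>G. real (?cn n T) / real (card (idx n (n - j n))) * lr m T) \<longlonglongrightarrow> (\<Sum>T\<in>G. ?k T * lr m T)"
    by (intro tendsto_sum tendsto_mult tendsto_const pattern_ratio_tendsto[OF j lim \<alpha>]) (auto simp: G_def)
  from order_tendstoD(1)[OF this L2(2)]
  have ev: "eventually (\<lambda>n. L2 < (\<Sum>T\<in>G. real (?cn n T) / real (card (idx n (n - j n))) * lr m T)) sequentially" .
  \<comment> \<open>The gap between \<open>L\<close> and \<open>L2\<close> pays for the mass lost
    outside the window.\<close>
  define \<eta> where "\<eta> = L / L2"
  have \<eta>: "0 < \<eta>" "\<eta> < 1" "\<eta> * L2 = L" using Lpos L2 by (auto simp: \<eta>_def)
  show ?thesis using ev conc[OF d[of m] \<eta>(1,2)] j eventually_ge_at_top[of r]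
  proof eventually_elim
    case (elim n)
    let ?q = "n - j n"
    let ?w = "wgt n ?q (c n)"
    let ?ci = "real (card (idx n ?q))"
    have q: "0 < ?q" "?q \<le> n" using elim by auto
    have ci: "?ci > 0"
    proof -
      have "card (idx n ?q) > 0" unfolding card_idx using q elim(3) by simp
      then show ?thesis by simp
    qed
    have low: "ennreal (lr m T) * pattern_integral r ?one T t \<le> pattern_integral r F T t" if T: "T \<subseteq> {..<r}" and t: "t > 0" "\<bar>t - \<theta>\<bar> \<le> d m" for T t
    proof -
      let ?x = "pattern_integral r F T (\<theta> + d m)" and ?y = "pattern_integral r ?one T (max 0 (\<theta> - d m))"
      have yf: "?y \<noteq> \<top>" and xf: "?x \<noteq> \<top>" using fin1[OF T] finF[OF T] \<theta> d[of m] by auto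
      have y0: "enn2real ?y > 0" using yf pattern_integral_one_pos[OF T] by (simp add: enn2real_positive_iff less_top)
      have "ennreal (lr m T) * pattern_integral r ?one T t \<le> ennreal (lr m T) * ?y"
        using t by (intro mult_left_mono pattern_integral_antimono) auto
      also have "\<dots> = ennreal (lr m T) * ennreal (enn2real ?y)" using yf by (simp add: less_top)
      also have "\<dots> = ennreal (lr m T * enn2real ?y)" using lr0 by (simp add: ennreal_mult)
      also have "lr m T * enn2real ?y = enn2real ?x" using y0 by (simp add: lr_def)
      also have "ennreal (enn2real ?x) = ?x" using xf by (simp add: less_top)
      also have "?x \<le> pattern_integral r F T t" using t by (intro pattern_integral_antimono) auto
      finally show ?thesis .
    qed
    let ?K = "\<Sum>T\<in>Pow {..<r}. of_nat (?cn n T) * ennreal (lr m T)"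
    have "?K * (\<integral>\<^sup>+t. ?w t * indicator {t. \<bar>t - \<theta>\<bar> \<le> d m} t \<partial>lborel) = (\<integral>\<^sup>+t. ?K * (?w t * indicator {t. \<bar>t - \<theta>\<bar> \<le> d m} t) \<partial>lborel)"
      by (rule nn_integral_cmult[symmetric]) measurable
    also have "\<dots> \<le> mix n ?q (c n) (\<lambda>x. F (restrict x {..<r}))"
      unfolding mix_def
    proof (rule nn_integral_mono)
      fix t :: real
      show "?K * (?w t * indicator {t. \<bar>t - \<theta>\<bar> \<le> d m} t) \<le> ennreal (t powr (c n - 1)) * indicator {0<..} t *
         (\<integral>\<^sup>+x. F (restrict x {..<r}) * ennreal (exp (- Asum n x - t * Bsum n x) * hsym n ?q x) \<partial>lborel_n n)"
      proof (cases "t > 0 \<and> \<bar>t - \<theta>\<bar> \<le> d m")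
        case True
        have "?K * (Qmass t * Jmass t ^ (?q - 1) * Imass t ^ (n - ?q)) \<le>
          (\<integral>\<^sup>+x. F (restrict x {..<r}) * ennreal (exp (- Asum n x - t * Bsum n x) * hsym n ?q x) \<partial>lborel_n n)"
          by (rule inner_lower[OF elim(4) q F low]) (use True in auto)
        then have "ennreal (t powr (c n - 1)) * (?K * (Qmass t * Jmass t ^ (?q - 1) * Imass t ^ (n - ?q))) \<le> ennreal (t powr (c n - 1)) *
          (\<integral>\<^sup>+x. F (restrict x {..<r}) * ennreal (exp (- Asum n x - t * Bsum n x) * hsym n ?q x) \<partial>lborel_n n)"
          by (rule mult_left_mono) simp
        moreover have "?K * (?w t * indicator {t. \<bar>t - \<theta>\<bar> \<le> d m} t) = ennreal (t powr (c n - 1)) * (?K * (Qmass t * Jmass t ^ (?q - 1) * Imass t ^ (n - ?q)))"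
          using True unfolding wgt_def by (simp add: mult_ac)
        ultimately show ?thesis using True by simp
      qed (auto simp: wgt_def)
    qed
    finally have A: "?K * (\<integral>\<^sup>+t. ?w t * indicator {t. \<bar>t - \<theta>\<bar> \<le> d m} t \<partial>lborel) \<le> mix n ?q (c n) (\<lambda>x. F (restrict x {..<r}))" .
    have K: "ennreal (?ci * L2) \<le> ?K"
    proof -
      have "?ci * L2 \<le> ?ci * (\<Sum>T\<in>G. real (?cn n T) / ?ci * lr m T)" using elim(1) ci by (intro mult_left_mono) auto
      also have "\<dots> = (\<Sum>T\<in>G. real (?cn n T) * lr m T)"
      proof -
        have "C * (a / C * b) = a * b" if "C > 0" for C a b :: real using that by simp
        from this[OF ci] show ?thesis by (simp only: sum_distrib_left)
      qed
      also have "\<dots> \<le> (\<Sum>T\<in>Pow {..<r}. real (?cn n T) * lr m T)" using fG lr0 by (intro sum_mono2) auto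
      finally have "ennreal (?ci * L2) \<le> ennreal (\<Sum>T\<in>Pow {..<r}. real (?cn n T) * lr m T)" by (rule ennreal_leI)
      also have "\<dots> = ?K" using lr0 by (simp add: sum_ennreal[symmetric] ennreal_mult ennreal_of_nat_eq_real_of_nat)
      finally show ?thesis .
    qed
    have "ennreal L * mix n ?q (c n) (\<lambda>_. 1) = ennreal L * (ennreal ?ci * (\<integral>\<^sup>+t. ?w t \<partial>lborel))"
      by (simp add: mix_one[OF q])
    also have "\<dots> = ennreal (?ci * L2) * (ennreal \<eta> * (\<integral>\<^sup>+t. ?w t \<partial>lborel))"
    proof -
      have "L * ?ci = (?ci * L2) * \<eta>" by (simp only: \<eta>(3)[symmetric] mult_ac)
      then have "ennreal L * ennreal ?ci = ennreal (?ci * L2) * ennreal \<eta>"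
        using ci L2 Lpos \<eta>(1) by (simp only: ennreal_mult[symmetric] less_imp_le mult_nonneg_nonneg)
      then show ?thesis by (simp only: mult.assoc[symmetric])
    qed
    also have "\<dots> \<le> ?K * (\<integral>\<^sup>+t. ?w t * indicator {t. \<bar>t - \<theta>\<bar> \<le> d m} t \<partial>lborel)"
      by (intro mult_mono K elim(2)) auto
    also note A
    finally show ?case .
  qed
qed

end

section \<open>Weak convergence of the scaled marginals\<close>

text \<open>Composition with the restriction map transports continuity from the finite product to
  the space of all sequences, where the Borel sets and the product sigma-algebra coincide.\<close>

lemma measurable_continuous_map_euclidean_top:
  assumes f: "continuous_map (euclidean_top r) euclideanreal f"
  shows "f \<in> borel_measurable (lborel_n r)"
proof -
  have "continuous_map euclidean (euclidean_top r) (\<lambda>x :: nat \<Rightarrow> real. restrict x {..<r})"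
    unfolding continuous_map_componentwise
    by (auto intro!: continuous_on_product_coordinates)
  from continuous_map_compose[OF this f]
  have "continuous_on UNIV (\<lambda>x. f (restrict x {..<r}))" by (simp add: o_def)
  then have g: "(\<lambda>x. f (restrict x {..<r})) \<in> borel_measurable borel" by (rule borel_measurable_continuous_onI)
  have "(\<lambda>x. x) \<in> measurable (lborel_n r) (Pi\<^sub>M UNIV (\<lambda>_. borel))"
  proof (rule measurable_PiM_single')
    fix i :: nat
    show "(\<lambda>x. x i) \<in> borel_measurable (lborel_n r)"
    proof (cases "i < r")
      case True
      then show ?thesis using measurable_coord[of "\<lambda>x. x" "lborel_n r" r i] by simp
    next
      case False
      then have "x i = undefined" if "x \<in> space (lborel_n r)" for x :: "nat \<Rightarrow> real"
        using that by (auto simp: space_PiM PiE_def extensional_def)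
      then show ?thesis by (subst measurable_cong[where g="\<lambda>_. undefined"]) auto
    qed
  qed auto
  then have "(\<lambda>x. x) \<in> measurable (lborel_n r) borel"
    by (simp add: measurable_cong_sets[OF refl sets_PiM_equal_borel])
  from measurable_compose[OF this g]
  have "(\<lambda>x. f (restrict x {..<r})) \<in> borel_measurable (lborel_n r)" .
  then show ?thesis
    by (rule measurable_cong[THEN iffD1, rotated]) (auto simp: space_PiM PiE_restrict)
qed

lemma continuous_scale_n:
  assumes f: "continuous_map (euclidean_top r) euclideanreal f"
  shows "continuous_on UNIV (\<lambda>t. f (scale_n r t y))"
proof -
  have "continuous_map euclideanreal (euclidean_top r) (\<lambda>t. scale_n r t y)"
    unfolding continuous_map_componentwise by (auto simp: scale_n_def intro!: continuous_intros)
  from continuous_map_compose[OF this f] show ?thesis by (simp add: o_def)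
qed

lemma scale_n_space': "scale_n r t y \<in> topspace (euclidean_top r)"
  by (simp add: scale_n_def)

text \<open>An affine map brings \<open>g\<close> and \<open>- g\<close> into \<open>[0, 1]\<close>,
  and the assumed lower bounds for the two give both halves of the limit. They are assumed for all
  measurable functions, so the conclusion reaches beyond continuous \<open>g\<close>, as the
  oscillation function in the next lemma requires.\<close>

lemma expectation_tendsto_of_liminf:
  fixes g :: "'b \<Rightarrow> real" and Y :: "nat \<Rightarrow> 'a \<Rightarrow> 'b"
  assumes P: "eventually (\<lambda>n. prob_space (P n)) sequentially"
    and Y: "\<And>n. Y n \<in> measurable (P n) N" and \<nu>: "prob_space \<nu>" "sets \<nu> = sets N"
    and low: "\<And>F L. F \<in> borel_measurable N \<Longrightarrow> (\<And>x. F x \<le> 1) \<Longrightarrow> L < enn2real (\<integral>\<^sup>+y. F y \<partial>\<nu>) \<Longrightarrow>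
      eventually (\<lambda>n. ennreal L \<le> (\<integral>\<^sup>+\<omega>. F (Y n \<omega>) \<partial>P n)) sequentially"
    and g [measurable]: "g \<in> borel_measurable N" and B: "\<And>y. \<bar>g y\<bar> \<le> B"
  shows "(\<lambda>n. LINT \<omega>|P n. g (Y n \<omega>)) \<longlonglongrightarrow> (LINT y|\<nu>. g y)"
proof -
  interpret nu: prob_space \<nu> by (rule \<nu>)
  note [measurable] = Y
  have [measurable_cong]: "sets \<nu> = sets N" by (rule \<nu>)
  define B' where "B' = max B 1"
  have B': "B' > 0" "\<And>y. \<bar>g y\<bar> \<le> B'" using B by (auto simp: B'_def le_max_iff_disj)
  have gi: "integrable \<nu> g" by (rule nu.integrable_const_bound[of _ B']) (use B' in auto)
  have half: "eventually (\<lambda>n. (LINT y|\<nu>. h y) - e < (LINT \<omega>|P n. h (Y n \<omega>))) sequentially"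
    if h [measurable]: "h \<in> borel_measurable N" and hB: "\<And>y. \<bar>h y\<bar> \<le> B'" and e: "e > 0" for h e
  proof -
    define F where "F y = (h y + B') / (2 * B')" for y
    have Fm [measurable]: "F \<in> borel_measurable N" unfolding F_def by measurable
    have F01: "0 \<le> F y" "F y \<le> 1" for y
      using hB[of y] B' by (auto simp: F_def field_simps abs_le_iff)
    have Fabs: "\<bar>F y\<bar> \<le> 1" for y using F01[of y] by simp
    have nnF: "(\<integral>\<^sup>+y. ennreal (F (u y)) \<partial>Q) = ennreal (LINT y|Q. F (u y))"
      "(LINT y|Q. F (u y)) = ((LINT y|Q. h (u y)) + B') / (2 * B')"
      if "prob_space Q" and u [measurable]: "u \<in> measurable Q N" for Q and u :: "'z \<Rightarrow> 'b"
    proof -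
      interpret Q: prob_space Q by fact
      have "integrable Q (\<lambda>y. F (u y))"
        by (rule Q.integrable_const_bound[of _ 1]) (use F01 Fabs in auto)
      then show "(\<integral>\<^sup>+y. ennreal (F (u y)) \<partial>Q) = ennreal (LINT y|Q. F (u y))"
        by (intro nn_integral_eq_integral) (use F01 in auto)
      have "integrable Q (\<lambda>y. h (u y))"
        by (rule Q.integrable_const_bound[of _ B']) (use hB in auto)
      then show "(LINT y|Q. F (u y)) = ((LINT y|Q. h (u y)) + B') / (2 * B')"
        unfolding F_def using B' by (simp add: Q.prob_space)
    qed
    \<comment> \<open>In the scale of \<open>F\<close> the tolerance \<open>e\<close> becomes
      \<open>e / (2 * B')\<close>; half of it is used, so that the final inequality is
      strict.\<close>
    define L where "L = (LINT y|\<nu>. F y) - e / (4 * B')"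
    have "ennreal (LINT y|\<nu>. F y) = (\<integral>\<^sup>+y. ennreal (F y) \<partial>\<nu>)"
      using nnF(1)[OF \<nu>(1), of "\<lambda>y. y"] by simp
    moreover have "0 \<le> (LINT y|\<nu>. F y)" using F01 by simp
    ultimately have "L < enn2real (\<integral>\<^sup>+y. ennreal (F y) \<partial>\<nu>)"
      using e B' by (simp add: L_def enn2real_ennreal flip: \<open>ennreal (LINT y|\<nu>. F y) = (\<integral>\<^sup>+y. ennreal (F y) \<partial>\<nu>)\<close>)
    then have "eventually (\<lambda>n. ennreal L \<le> (\<integral>\<^sup>+\<omega>. ennreal (F (Y n \<omega>)) \<partial>P n)) sequentially"
      using F01 by (intro low) (auto simp: ennreal_le_1)
    then show ?thesis using P
    proof eventually_elim
      case (elim n)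
      have "ennreal L \<le> ennreal (LINT \<omega>|P n. F (Y n \<omega>))" using elim nnF(1)[OF elim(2) Y] by simp
      moreover have "0 \<le> (LINT \<omega>|P n. F (Y n \<omega>))" using F01 by simp
      ultimately have "L \<le> (LINT \<omega>|P n. F (Y n \<omega>))" by (simp add: ennreal_le_iff)
      then have "((LINT y|\<nu>. h y) + B') / (2 * B') - e / (4 * B') \<le> ((LINT \<omega>|P n. h (Y n \<omega>)) + B') / (2 * B')"
        using nnF(2)[OF elim(2) Y] nnF(2)[OF \<nu>(1), of "\<lambda>y. y"] by (simp add: L_def)
      moreover have "((LINT y|\<nu>. h y) + B') / (2 * B') - e / (4 * B') = ((LINT y|\<nu>. h y) + B' - e / 2) / (2 * B')"
        by (simp add: diff_divide_distrib)
      ultimately have "(LINT y|\<nu>. h y) - e / 2 \<le> (LINT \<omega>|P n. h (Y n \<omega>))"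
        using B' by (simp add: divide_le_cancel)
      then show ?case using e by simp
    qed
  qed
  show ?thesis
  proof (rule tendstoI)
    fix e :: real assume e: "e > 0"
    have "eventually (\<lambda>n. (LINT y|\<nu>. g y) - e < (LINT \<omega>|P n. g (Y n \<omega>))) sequentially"
      by (rule half[OF g B'(2) e])
    moreover have "eventually (\<lambda>n. (LINT y|\<nu>. - g y) - e < (LINT \<omega>|P n. - g (Y n \<omega>))) sequentially"
      by (rule half) (use B' e in auto)
    ultimately show "eventually (\<lambda>n. dist (LINT \<omega>|P n. g (Y n \<omega>)) (LINT y|\<nu>. g y) < e) sequentially"
      by eventually_elim (auto simp: dist_real_def abs_less_iff)
  qed
qed

text \<open>Slutsky's argument: the random factor is replaced by \<open>c\<close> at the price of
  the oscillation \<open>w \<delta>\<close> of \<open>f\<close> along rays plus the probability of a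
  deviation. The expected oscillation is transferred to the limit law, where dominated convergence
  makes it small.\<close>

lemma slutsky_scale:
  fixes \<rho> :: "nat \<Rightarrow> 'a \<Rightarrow> real"
  assumes P: "eventually (\<lambda>n. prob_space (P n)) sequentially"
    and Y: "\<And>n. Y n \<in> measurable (P n) (lborel_n r)" and \<rho> [measurable]: "\<And>n. \<rho> n \<in> borel_measurable (P n)"
    and \<nu>: "prob_space \<nu>" "sets \<nu> = sets (lborel_n r)"
    and low: "\<And>F L. F \<in> borel_measurable (lborel_n r) \<Longrightarrow> (\<And>x. F x \<le> 1) \<Longrightarrow> L < enn2real (\<integral>\<^sup>+y. F y \<partial>\<nu>) \<Longrightarrow>
      eventually (\<lambda>n. ennreal L \<le> (\<integral>\<^sup>+\<omega>. F (Y n \<omega>) \<partial>P n)) sequentially"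
    and dev: "\<And>\<epsilon>. \<epsilon> > 0 \<Longrightarrow> (\<lambda>n. measure (P n) {\<omega> \<in> space (P n). \<epsilon> \<le> \<bar>\<rho> n \<omega> - c\<bar>}) \<longlonglongrightarrow> 0"
    and f: "continuous_map (euclidean_top r) euclideanreal f"
    and fB: "bounded (f ` topspace (euclidean_top r))"
  shows "(\<lambda>n. LINT \<omega>|P n. f (scale_n r (\<rho> n \<omega>) (Y n \<omega>))) \<longlonglongrightarrow> (LINT y|\<nu>. f (scale_n r c y))"
proof -
  interpret nu: prob_space \<nu> by (rule \<nu>)
  note [measurable] = Y
  have [measurable_cong]: "sets \<nu> = sets (lborel_n r)" by (rule \<nu>)
  have fm [measurable]: "f \<in> borel_measurable (lborel_n r)" by (rule measurable_continuous_map_euclidean_top[OF f])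
  have sm [measurable]: "(\<lambda>x. scale_n r (a x) (b x)) \<in> measurable N (lborel_n r)"
    if [measurable]: "a \<in> borel_measurable N" and b: "b \<in> measurable N (lborel_n r)" for a b and N :: "'z measure"
  proof -
    have [measurable]: "(\<lambda>x. b x k) \<in> borel_measurable N" if "k \<in> {..<r}" for k
      using measurable_coord[OF b] that by simp
    show ?thesis unfolding scale_n_def by measurable
  qed
  obtain B where B: "B > 0" "\<And>x. x \<in> topspace (euclidean_top r) \<Longrightarrow> \<bar>f x\<bar> \<le> B"
    using fB unfolding bounded_pos by (auto simp: image_iff)
  have fs: "\<bar>f (scale_n r t y)\<bar> \<le> B" for t y using B(2)[OF scale_n_space'] .
  define D where "D t y = \<bar>f (scale_n r t y) - f (scale_n r c y)\<bar>" for t y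
  have D: "0 \<le> D t y" "D t y \<le> 2 * B" for t y
    using fs[of t y] fs[of c y] by (auto simp: D_def)
  have Dm [measurable]: "D t \<in> borel_measurable (lborel_n r)" for t unfolding D_def by measurable
  \<comment> \<open>A supremum over rational factors is countable and therefore measurable;
    continuity of \<open>D\<close> in the factor extends the bound to the whole window.\<close>
  define R where "R \<delta> = {c - \<delta><..<c + \<delta>} \<inter> \<rat>" for \<delta> :: real
  have Rne: "R \<delta> \<noteq> {}" if "\<delta> > 0" for \<delta>
    using Rats_dense_in_real[of "c - \<delta>" "c + \<delta>"] that by (auto simp: R_def)
  have Rc: "countable (R \<delta>)" for \<delta> unfolding R_def by (simp add: countable_rat countable_Int2)
  define w where "w \<delta> y = (SUP t\<in>R \<delta>. D t y)" for \<delta> y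
  have bdd: "bdd_above ((\<lambda>t. D t y) ` R \<delta>)" for \<delta> y using D by (intro bdd_aboveI[of _ "2 * B"]) auto
  have wm [measurable]: "w \<delta> \<in> borel_measurable (lborel_n r)" for \<delta>
    unfolding w_def by (rule borel_measurable_cSUP[OF Rc]) (use bdd in auto)
  have w0: "0 \<le> w \<delta> y" "w \<delta> y \<le> 2 * B" if \<delta>: "\<delta> > 0" for \<delta> y
  proof -
    obtain t where t: "t \<in> R \<delta>" using Rne[OF \<delta>] by blast
    show "0 \<le> w \<delta> y" unfolding w_def using D(1)[of t y] cSUP_upper[OF t bdd, of y] by linarith
    show "w \<delta> y \<le> 2 * B" unfolding w_def using Rne[OF \<delta>] D by (intro cSUP_least) auto
  qed
  have cD: "continuous_on UNIV (\<lambda>t. D t y)" for y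
    unfolding D_def by (intro continuous_intros continuous_scale_n f)
  have Dle: "D t y \<le> w \<delta> y" if "\<bar>t - c\<bar> < \<delta>" for t y \<delta>
  proof -
    have "t \<in> {c - \<delta><..<c + \<delta>} \<inter> closure \<rat>" using that by (auto simp: Rats_closure_real)
    then have cl: "t \<in> closure (R \<delta>)" unfolding R_def using open_Int_closure_subset[of "{c - \<delta><..<c + \<delta>}" \<rat>] by auto
    show ?thesis
    proof (rule continuous_le_on_closure[OF _ cl])
      show "continuous_on (closure (R \<delta>)) (\<lambda>t. D t y)" using cD continuous_on_subset by blast
      show "D x y \<le> w \<delta> y" if "x \<in> R \<delta>" for x unfolding w_def by (rule cSUP_upper[OF that bdd])
    qed
  qed
  define d where "d m = 1 / real (Suc m)" for m
  have d: "d m > 0" for m by (simp add: d_def)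
  have dl: "d \<longlonglongrightarrow> 0" unfolding d_def by (rule LIMSEQ_Suc[OF lim_1_over_n])
  have wl: "(\<lambda>m. w (d m) y) \<longlonglongrightarrow> 0" for y
  proof (rule tendstoI)
    fix e :: real assume e: "e > 0"
    have "isCont (\<lambda>t. D t y) c" using cD by (simp add: continuous_on_eq_continuous_at)
    moreover have "D c y = 0" by (simp add: D_def)
    ultimately have "(\<lambda>t. D t y) \<midarrow>c\<rightarrow> 0" by (simp add: isCont_def)
    then obtain s where s: "s > 0" "\<And>t. t \<noteq> c \<Longrightarrow> \<bar>t - c\<bar> < s \<Longrightarrow> D t y < e / 2"
      using e unfolding LIM_def by (metis (no_types, lifting) D(1) abs_of_nonneg diff_zero dist_real_def half_gt_zero)
    have "eventually (\<lambda>m. d m < s) sequentially" using order_tendstoD(2)[OF dl s(1)] .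
    then show "eventually (\<lambda>m. dist (w (d m) y) 0 < e) sequentially"
    proof eventually_elim
      case (elim m)
      have "D t y \<le> e / 2" if "t \<in> R (d m)" for t
      proof (cases "t = c")
        case False
        have "\<bar>t - c\<bar> < s" using that elim by (auto simp: R_def)
        then show ?thesis using s(2)[OF False] by simp
      qed (use e \<open>D c y = 0\<close> in simp)
      then have "w (d m) y \<le> e / 2" unfolding w_def using Rne[OF d] by (intro cSUP_least) auto
      then show ?case using w0(1)[OF d[of m], of y] e by simp
    qed
  qed
  have "(\<lambda>m. LINT y|\<nu>. w (d m) y) \<longlonglongrightarrow> (LINT y|\<nu>. 0)"
    by (rule integral_dominated_convergence[where w="\<lambda>_. 2 * B"]) (use wl w0[OF d] in auto)
  then have wi: "(\<lambda>m. LINT y|\<nu>. w (d m) y) \<longlonglongrightarrow> 0" by simp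
  show ?thesis
  proof (rule tendstoI)
    fix e :: real assume e: "e > 0"
    have "eventually (\<lambda>m. (LINT y|\<nu>. w (d m) y) < e / 8) sequentially"
      using order_tendstoD(2)[OF wi, of "e / 8"] e by simp
    then obtain m where m: "(LINT y|\<nu>. w (d m) y) < e / 8" by (auto simp: eventually_sequentially)
    have "(\<lambda>n. LINT \<omega>|P n. w (d m) (Y n \<omega>)) \<longlonglongrightarrow> (LINT y|\<nu>. w (d m) y)"
    proof (rule expectation_tendsto_of_liminf[OF P Y \<nu> low wm])
      show "\<bar>w (d m) y\<bar> \<le> 2 * B" for y using w0[OF d[of m], of y] by simp
    qed
    from order_tendstoD(2)[OF this m]
    have e1: "eventually (\<lambda>n. (LINT \<omega>|P n. w (d m) (Y n \<omega>)) < e / 8) sequentially" .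
    have "(\<lambda>n. LINT \<omega>|P n. f (scale_n r c (Y n \<omega>))) \<longlonglongrightarrow> (LINT y|\<nu>. f (scale_n r c y))"
    proof (rule expectation_tendsto_of_liminf[OF P Y \<nu> low])
      show "\<bar>f (scale_n r c y)\<bar> \<le> B" for y by (rule fs)
      show "(\<lambda>y. f (scale_n r c y)) \<in> borel_measurable (lborel_n r)" by measurable
    qed
    from tendstoD[OF this, of "e / 4"] e
    have e2: "eventually (\<lambda>n. dist (LINT \<omega>|P n. f (scale_n r c (Y n \<omega>))) (LINT y|\<nu>. f (scale_n r c y)) < e / 4) sequentially" by simp
    \<comment> \<open>On the deviation event the difference is at most \<open>2 * B\<close>, so this
      choice contributes another \<open>e / 8\<close>.\<close>
    have e3: "eventually (\<lambda>n. measure (P n) {\<omega> \<in> space (P n). d m \<le> \<bar>\<rho> n \<omega> - c\<bar>} < e / (16 * B)) sequentially"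
      using order_tendstoD(2)[OF dev[OF d[of m]], of "e / (16 * B)"] e B by simp
    show "eventually (\<lambda>n. dist (LINT \<omega>|P n. f (scale_n r (\<rho> n \<omega>) (Y n \<omega>))) (LINT y|\<nu>. f (scale_n r c y)) < e) sequentially"
      using P e1 e2 e3
    proof eventually_elim
      case (elim n)
      interpret Pn: prob_space "P n" by fact
      let ?E = "{\<omega> \<in> space (P n). d m \<le> \<bar>\<rho> n \<omega> - c\<bar>}"
      have Em [measurable]: "?E \<in> sets (P n)" by measurable
      have i1: "integrable (P n) (\<lambda>\<omega>. f (scale_n r (\<rho> n \<omega>) (Y n \<omega>)))"
        by (rule Pn.integrable_const_bound[of _ B]) (use fs in auto)
      have i2: "integrable (P n) (\<lambda>\<omega>. f (scale_n r c (Y n \<omega>)))"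
        by (rule Pn.integrable_const_bound[of _ B]) (use fs in auto)
      have i3: "integrable (P n) (\<lambda>\<omega>. w (d m) (Y n \<omega>))"
        by (rule Pn.integrable_const_bound[of _ "2 * B"]) (use w0[OF d] in auto)
      have i4: "integrable (P n) (\<lambda>\<omega>. 2 * B * indicator ?E \<omega> :: real)"
        by (intro integrable_mult_right integrable_real_indicator) (auto simp: Pn.emeasure_eq_measure)
      have "\<bar>(LINT \<omega>|P n. f (scale_n r (\<rho> n \<omega>) (Y n \<omega>))) - (LINT \<omega>|P n. f (scale_n r c (Y n \<omega>)))\<bar>
         = \<bar>LINT \<omega>|P n. f (scale_n r (\<rho> n \<omega>) (Y n \<omega>)) - f (scale_n r c (Y n \<omega>))\<bar>"
        using i1 i2 by simp
      also have "\<dots> \<le> (LINT \<omega>|P n. w (d m) (Y n \<omega>) + 2 * B * indicator ?E \<omega>)"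
      proof (rule order_trans[OF integral_abs_bound])
        show "(LINT \<omega>|P n. \<bar>f (scale_n r (\<rho> n \<omega>) (Y n \<omega>)) - f (scale_n r c (Y n \<omega>))\<bar>) \<le> (LINT \<omega>|P n. w (d m) (Y n \<omega>) + 2 * B * indicator ?E \<omega>)"
        proof (rule integral_mono)
          fix \<omega> assume "\<omega> \<in> space (P n)"
          then show "\<bar>f (scale_n r (\<rho> n \<omega>) (Y n \<omega>)) - f (scale_n r c (Y n \<omega>))\<bar> \<le> w (d m) (Y n \<omega>) + 2 * B * indicator ?E \<omega>"
            using Dle[of "\<rho> n \<omega>" "d m" "Y n \<omega>"] D(2)[of "\<rho> n \<omega>" "Y n \<omega>"] w0(1)[OF d[of m], of "Y n \<omega>"]
            by (cases "\<omega> \<in> ?E") (auto simp: D_def not_le)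
        qed (use i1 i2 i3 i4 in auto)
      qed
      also have "\<dots> = (LINT \<omega>|P n. w (d m) (Y n \<omega>)) + 2 * B * measure (P n) ?E"
        using i3 i4 by (subst Bochner_Integration.integral_add) auto
      also have "\<dots> < e / 8 + 2 * B * (e / (16 * B))"
        using elim B by (intro add_strict_mono mult_strict_left_mono) auto
      also have "\<dots> = e / 4" using B by simp
      finally show ?case using elim(3) e unfolding dist_real_def by linarith
    qed
  qed
qed

lemma nn_integral_PiM_density:
  fixes f :: "real \<Rightarrow> real"
  assumes [measurable]: "f \<in> borel_measurable borel" and f0: "\<And>x. f x \<ge> 0"
    and pr: "prob_space (density lborel (\<lambda>u. ennreal (f u)))"
    and "F \<in> borel_measurable (lborel_n r)"
  shows "(\<integral>\<^sup>+y. F y \<partial>Pi\<^sub>M {..<r} (\<lambda>_. density lborel (\<lambda>u. ennreal (f u)))) =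
    (\<integral>\<^sup>+x. F x * (\<Prod>k<r. ennreal (f (x k))) \<partial>lborel_n r)"
  using assms(4)
proof (induction r arbitrary: F)
  case 0
  show ?case by (simp add: PiM_empty nn_integral_count_space_finite)
next
  case (Suc r)
  let ?D = "density lborel (\<lambda>u. ennreal (f u))"
  interpret D: prob_space ?D by (rule pr)
  interpret L: product_sigma_finite "\<lambda>_::nat. lborel :: real measure" ..
  interpret P: product_sigma_finite "\<lambda>_::nat. ?D" ..
  have Fm [measurable]: "F \<in> borel_measurable (Pi\<^sub>M (insert r {..<r}) (\<lambda>_. lborel))"
    using Suc.prems by (simp add: lessThan_Suc)
  have sets: "sets (Pi\<^sub>M I (\<lambda>_. ?D)) = sets (Pi\<^sub>M I (\<lambda>_. lborel))" for I :: "nat set"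
    by (intro sets_PiM_cong) auto
  have FD: "F \<in> borel_measurable (Pi\<^sub>M (insert r {..<r}) (\<lambda>_. ?D))"
    using Fm by (simp cong: measurable_cong_sets add: measurable_cong_sets[OF sets refl])
  have co [measurable]: "(\<lambda>x. f (x k)) \<in> borel_measurable (lborel_n m)" if "k < m" for k m
    using measurable_compose[OF measurable_coord[of "\<lambda>x. x" "lborel_n m" m k] assms(1)] that by simp
  have mS: "(\<lambda>x. F x * (\<Prod>k<Suc r. ennreal (f (x k)))) \<in> borel_measurable (Pi\<^sub>M (insert r {..<r}) (\<lambda>_. lborel))"
    unfolding lessThan_Suc[symmetric] using Suc.prems
    by (intro borel_measurable_times_ennreal borel_measurable_prod_ennreal) (auto intro!: measurable_compose[OF co measurable_ennreal])
  have m1: "(\<lambda>y. F (x(r := y))) \<in> borel_measurable borel" if "x \<in> space (lborel_n r)" for x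
  proof -
    have "(\<lambda>y. x(r := y)) \<in> measurable lborel (Pi\<^sub>M (insert r {..<r}) (\<lambda>_. lborel))"
      using measurable_component_update[OF that, of r] by simp
    then show ?thesis by measurable
  qed
  have "(\<integral>\<^sup>+y. F y \<partial>Pi\<^sub>M {..<Suc r} (\<lambda>_. ?D)) = (\<integral>\<^sup>+x. (\<integral>\<^sup>+y. F (x(r := y)) \<partial>?D) \<partial>Pi\<^sub>M {..<r} (\<lambda>_. ?D))"
    unfolding lessThan_Suc using FD by (subst P.product_nn_integral_insert) auto
  also have "\<dots> = (\<integral>\<^sup>+x. (\<integral>\<^sup>+y. F (x(r := y)) * ennreal (f y) \<partial>lborel) \<partial>Pi\<^sub>M {..<r} (\<lambda>_. ?D))"
  proof (rule nn_integral_cong)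
    fix x assume "x \<in> space (Pi\<^sub>M {..<r} (\<lambda>_. ?D))"
    then have "x \<in> space (lborel_n r)" by (simp add: space_PiM)
    from m1[OF this] show "(\<integral>\<^sup>+y. F (x(r := y)) \<partial>?D) = (\<integral>\<^sup>+y. F (x(r := y)) * ennreal (f y) \<partial>lborel)"
      by (subst nn_integral_density) (auto simp: mult.commute)
  qed
  also have "\<dots> = (\<integral>\<^sup>+x. (\<integral>\<^sup>+y. F (x(r := y)) * ennreal (f y) \<partial>lborel) * (\<Prod>k<r. ennreal (f (x k))) \<partial>lborel_n r)"
    by (rule Suc.IH) measurable
  also have "\<dots> = (\<integral>\<^sup>+x. (\<integral>\<^sup>+y. F (x(r := y)) * (\<Prod>k<Suc r. ennreal (f ((x(r := y)) k))) \<partial>lborel) \<partial>lborel_n r)"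
  proof (rule nn_integral_cong)
    fix x assume x: "x \<in> space (lborel_n r)"
    have [measurable]: "(\<lambda>y. F (x(r := y))) \<in> borel_measurable borel" by (rule m1[OF x])
    show "(\<integral>\<^sup>+y. F (x(r := y)) * ennreal (f y) \<partial>lborel) * (\<Prod>k<r. ennreal (f (x k))) =
      (\<integral>\<^sup>+y. F (x(r := y)) * (\<Prod>k<Suc r. ennreal (f ((x(r := y)) k))) \<partial>lborel)"
      by (subst nn_integral_multc[symmetric]) (auto simp: mult_ac)
  qed
  also have "\<dots> = (\<integral>\<^sup>+x. F x * (\<Prod>k<Suc r. ennreal (f (x k))) \<partial>lborel_n (Suc r))"
    unfolding lessThan_Suc[of r] using mS by (subst L.product_nn_integral_insert) (auto simp: lessThan_Suc)
  finally show ?case .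
qed

section \<open>The limit density and the passage from the mixture to the marginals\<close>

context lp_mixture
begin

definition rI :: "real \<Rightarrow> real" where "rI t = enn2real (Imass t)"
definition rJ :: "real \<Rightarrow> real" where "rJ t = enn2real (Jmass t)"

lemma rI: "t \<ge> 0 \<Longrightarrow> rI t > 0" "t \<ge> 0 \<Longrightarrow> Imass t = ennreal (rI t)"
  using Imass_finite[of t] Imass_pos[of t] by (auto simp: rI_def enn2real_positive_iff less_top)

lemma rJ: "t \<ge> 0 \<Longrightarrow> rJ t > 0" "t \<ge> 0 \<Longrightarrow> Jmass t = ennreal (rJ t)"
  using Jmass_finite[of t] Jmass_pos[of t] by (auto simp: rJ_def enn2real_positive_iff less_top)

text \<open>The factor \<open>p - 1\<close> in \<open>dphi\<close> also sits in \<open>rJ\<close>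
  and cancels, so the bulk choice of exponents recovers the density of the statement.\<close>

definition limit_density :: "real \<Rightarrow> real \<Rightarrow> real \<Rightarrow> real" where
  "limit_density \<alpha> \<theta> u = \<alpha> * (base \<theta> u / rI \<theta>) + (1 - \<alpha>) * (dphi u * base \<theta> u / rJ \<theta>)"

lemma measurable_limit_density [measurable]: "limit_density \<alpha> \<theta> \<in> borel_measurable borel"
  unfolding limit_density_def by measurable

lemma limit_density_nonneg: "0 \<le> \<alpha> \<Longrightarrow> \<alpha> \<le> 1 \<Longrightarrow> limit_density \<alpha> \<theta> u \<ge> 0"
  unfolding limit_density_def by (intro add_nonneg_nonneg mult_nonneg_nonneg divide_nonneg_nonneg) (auto simp: rI_def rJ_def)

lemma prob_space_limit_density:
  assumes "0 \<le> \<alpha>" "\<alpha> \<le> 1" "\<theta> \<ge> 0"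
  shows "prob_space (density lborel (\<lambda>u. ennreal (limit_density \<alpha> \<theta> u)))"
proof
  note I = rI[OF assms(3)] and J = rJ[OF assms(3)]
  have e: "ennreal (limit_density \<alpha> \<theta> u) = ennreal (\<alpha> / rI \<theta>) * ennreal (base \<theta> u) + ennreal ((1 - \<alpha>) / rJ \<theta>) * ennreal (dphi u * base \<theta> u)" for u
    using assms I(1) J(1) unfolding limit_density_def
    by (simp add: ennreal_mult[symmetric] ennreal_plus[symmetric] del: ennreal_plus)
  have "(\<integral>\<^sup>+u. ennreal (limit_density \<alpha> \<theta> u) \<partial>lborel) = ennreal (\<alpha> / rI \<theta>) * Imass \<theta> + ennreal ((1 - \<alpha>) / rJ \<theta>) * Jmass \<theta>"
    unfolding e Imass_def Jmass_def by (subst nn_integral_add, measurable) (simp add: nn_integral_cmult)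
  also have "\<dots> = ennreal (\<alpha> / rI \<theta> * rI \<theta> + (1 - \<alpha>) / rJ \<theta> * rJ \<theta>)"
    using assms I J by (simp add: ennreal_mult[symmetric] ennreal_plus[symmetric] del: ennreal_plus)
  also have "\<dots> = 1" using I(1) J(1) by simp
  finally show "emeasure (density lborel (\<lambda>u. ennreal (limit_density \<alpha> \<theta> u))) (space (density lborel (\<lambda>u. ennreal (limit_density \<alpha> \<theta> u)))) = 1"
    by (simp add: emeasure_density)
qed

text \<open>Expanding the product of the two-term densities over subsets exhibits the product law as
  a mixture of patterns with independent types, which is the form of the asymptotic lower
  bound.\<close>

lemma nn_integral_limit_density:
  assumes \<alpha>: "0 \<le> \<alpha>" "\<alpha> \<le> 1" and \<theta>: "\<theta> \<ge> 0" and F [measurable]: "F \<in> borel_measurable (lborel_n r)" and F1: "\<And>x. F x \<le> 1"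
  shows "(\<integral>\<^sup>+y. F y \<partial>Pi\<^sub>M {..<r} (\<lambda>_. density lborel (\<lambda>u. ennreal (limit_density \<alpha> \<theta> u)))) =
    ennreal (\<Sum>T\<in>Pow {..<r}. (1 - \<alpha>) ^ card T * \<alpha> ^ (r - card T) * pattern_mean r F T \<theta>)"
proof -
  note I = rI[OF \<theta>] and J = rJ[OF \<theta>]
  let ?k = "\<lambda>T. (1 - \<alpha>) ^ card T * \<alpha> ^ (r - card T)"
  let ?n = "\<lambda>T. rJ \<theta> ^ card T * rI \<theta> ^ (r - card T)"
  let ?v = "\<lambda>T k u. if k \<in> T then dphi u * base \<theta> u else base \<theta> u"
  have npos: "?n T > 0" for T using I J by simp
  have k0: "?k T \<ge> 0" for T using \<alpha> by simp
  have p1: "(\<Prod>k<r. limit_density \<alpha> \<theta> (x k)) = (\<Sum>T\<in>Pow {..<r}. ?k T / ?n T * (\<Prod>k<r. ?v T k (x k)))" for x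
  proof -
    have "(\<Prod>k<r. limit_density \<alpha> \<theta> (x k)) = (\<Prod>k<r. (1 - \<alpha>) / rJ \<theta> * (dphi (x k) * base \<theta> (x k)) + \<alpha> / rI \<theta> * base \<theta> (x k))"
      by (intro prod.cong refl) (simp add: limit_density_def)
    also have "\<dots> = (\<Sum>T\<in>Pow {..<r}. (\<Prod>k\<in>T. (1 - \<alpha>) / rJ \<theta> * (dphi (x k) * base \<theta> (x k))) * (\<Prod>k\<in>{..<r} - T. \<alpha> / rI \<theta> * base \<theta> (x k)))"
      by (rule prod_add) simp
    also have "\<dots> = (\<Sum>T\<in>Pow {..<r}. ?k T / ?n T * (\<Prod>k<r. ?v T k (x k)))"
    proof (rule sum.cong[OF refl])
      fix T assume "T \<in> Pow {..<r}"
      then have T: "T \<subseteq> {..<r}" by simp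
      then have fT: "finite T" using finite_subset by blast
      have s: "{..<r} \<inter> {k. k \<in> T} = T" "{..<r} \<inter> - {k. k \<in> T} = {..<r} - T" using T by auto
      have "(\<Prod>k<r. ?v T k (x k)) = (\<Prod>k\<in>T. dphi (x k) * base \<theta> (x k)) * (\<Prod>k\<in>{..<r} - T. base \<theta> (x k))"
        by (subst prod.If_cases) (auto simp only: s finite_lessThan)
      moreover have "(\<Prod>k\<in>T. (1 - \<alpha>) / rJ \<theta> * (dphi (x k) * base \<theta> (x k))) = ((1 - \<alpha>) / rJ \<theta>) ^ card T * (\<Prod>k\<in>T. dphi (x k) * base \<theta> (x k))"
        by (simp only: prod.distrib[of "\<lambda>_. (1 - \<alpha>) / rJ \<theta>"] prod_constant)
      moreover have "(\<Prod>k\<in>{..<r} - T. \<alpha> / rI \<theta> * base \<theta> (x k)) = (\<alpha> / rI \<theta>) ^ card ({..<r} - T) * (\<Prod>k\<in>{..<r} - T. base \<theta> (x k))"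
        by (simp only: prod.distrib[of "\<lambda>_. \<alpha> / rI \<theta>"] prod_constant)
      moreover have "card ({..<r} - T) = r - card T" using T fT by (simp add: card_Diff_subset)
      ultimately show "(\<Prod>k\<in>T. (1 - \<alpha>) / rJ \<theta> * (dphi (x k) * base \<theta> (x k))) * (\<Prod>k\<in>{..<r} - T. \<alpha> / rI \<theta> * base \<theta> (x k)) = ?k T / ?n T * (\<Prod>k<r. ?v T k (x k))"
        by (simp only: power_divide) simp
    qed
    finally show ?thesis .
  qed
  have v0: "?v T k u \<ge> 0" for T k u by simp
  have p2: "F x * (\<Prod>k<r. ennreal (limit_density \<alpha> \<theta> (x k))) = (\<Sum>T\<in>Pow {..<r}. ennreal (?k T / ?n T) * (F x * (\<Prod>k<r. ennreal (?v T k (x k)))))" for x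
  proof -
    have "(\<Prod>k<r. ennreal (limit_density \<alpha> \<theta> (x k))) = ennreal (\<Prod>k<r. limit_density \<alpha> \<theta> (x k))"
      by (intro prod_ennreal limit_density_nonneg \<alpha>)
    also have "\<dots> = (\<Sum>T\<in>Pow {..<r}. ennreal (?k T / ?n T * (\<Prod>k<r. ?v T k (x k))))"
      unfolding p1 by (intro sum_ennreal[symmetric] mult_nonneg_nonneg divide_nonneg_pos k0 npos prod_nonneg ballI v0)
    also have "\<dots> = (\<Sum>T\<in>Pow {..<r}. ennreal (?k T / ?n T) * (\<Prod>k<r. ennreal (?v T k (x k))))"
    proof (rule sum.cong[OF refl])
      fix T
      have "(\<Prod>k<r. ennreal (?v T k (x k))) = ennreal (\<Prod>k<r. ?v T k (x k))" by (intro prod_ennreal v0)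
      moreover have "ennreal (?k T / ?n T * (\<Prod>k<r. ?v T k (x k))) = ennreal (?k T / ?n T) * ennreal (\<Prod>k<r. ?v T k (x k))"
        by (intro ennreal_mult divide_nonneg_pos k0 npos prod_nonneg ballI v0)
      ultimately show "ennreal (?k T / ?n T * (\<Prod>k<r. ?v T k (x k))) = ennreal (?k T / ?n T) * (\<Prod>k<r. ennreal (?v T k (x k)))" by (simp only:)
    qed
    finally show ?thesis by (simp only: sum_distrib_left mult.left_commute)
  qed
  have co: "(\<lambda>x. x k) \<in> borel_measurable (lborel_n r)" if "k < r" for k
    using measurable_coord[of "\<lambda>x. x" "lborel_n r" r k] that by simp
  have vm: "(\<lambda>u. ?v T k u) \<in> borel_measurable borel" for T k by measurable
  have mm [measurable]: "(\<lambda>x. F x * (\<Prod>k<r. ennreal (?v T k (x k)))) \<in> borel_measurable (lborel_n r)" for T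
    by (intro borel_measurable_times_ennreal borel_measurable_prod_ennreal F) (auto intro!: measurable_compose[OF measurable_compose[OF co vm] measurable_ennreal] simp del: measurable_If)
  have "(\<integral>\<^sup>+y. F y \<partial>Pi\<^sub>M {..<r} (\<lambda>_. density lborel (\<lambda>u. ennreal (limit_density \<alpha> \<theta> u)))) = (\<integral>\<^sup>+x. F x * (\<Prod>k<r. ennreal (limit_density \<alpha> \<theta> (x k))) \<partial>lborel_n r)"
    by (rule nn_integral_PiM_density) (use \<alpha> \<theta> in \<open>auto intro: limit_density_nonneg prob_space_limit_density F\<close>)
  also have "\<dots> = (\<Sum>T\<in>Pow {..<r}. ennreal (?k T / ?n T) * pattern_integral r F T \<theta>)"
    unfolding p2 pattern_integral_def by (subst nn_integral_sum) (auto intro!: sum.cong nn_integral_cmult mm borel_measurable_times_ennreal)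
  also have "\<dots> = (\<Sum>T\<in>Pow {..<r}. ennreal (?k T * pattern_mean r F T \<theta>))"
  proof (rule sum.cong[OF refl])
    fix T assume "T \<in> Pow {..<r}"
    then have T: "T \<subseteq> {..<r}" by simp
    have one: "pattern_integral r (\<lambda>_. 1) T \<theta> = ennreal (?n T)"
      unfolding pattern_integral_one[OF T] using I J by (simp add: ennreal_power ennreal_mult)
    have "pattern_integral r F T \<theta> < \<infinity>" using pattern_integral_le_one[of F r T \<theta>, OF F1] pattern_integral_one_finite[OF T \<theta>] by (rule le_less_trans)
    then obtain e where e: "pattern_integral r F T \<theta> = ennreal e" "e \<ge> 0" by (cases "pattern_integral r F T \<theta>") auto
    have "pattern_mean r F T \<theta> = e / ?n T"
      unfolding pattern_mean_def one e(1) using npos[of T] e(2) by (simp only: enn2real_ennreal less_imp_le)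
    moreover have "ennreal (?k T / ?n T) * ennreal e = ennreal (?k T / ?n T * e)"
      by (intro ennreal_mult[symmetric] divide_nonneg_pos k0 npos e(2))
    ultimately show "ennreal (?k T / ?n T) * pattern_integral r F T \<theta> = ennreal (?k T * pattern_mean r F T \<theta>)"
      unfolding e(1) by simp
  qed
  also have "\<dots> = ennreal (\<Sum>T\<in>Pow {..<r}. ?k T * pattern_mean r F T \<theta>)"
    using \<alpha> by (intro sum_ennreal mult_nonneg_nonneg) (auto simp: pattern_mean_def)
  finally show ?thesis .
qed

definition mix_weight :: "nat \<Rightarrow> nat \<Rightarrow> real \<Rightarrow> (nat \<Rightarrow> real) \<Rightarrow> ennreal" where
  "mix_weight n q c x = ennreal (exp (- Asum n x) * Bsum n x powr (- c) * hsym n q x)"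

definition mix_law :: "nat \<Rightarrow> nat \<Rightarrow> real \<Rightarrow> (nat \<Rightarrow> real) measure" where
  "mix_law n q c = density (lborel_n n) (\<lambda>x. mix_weight n q c x / (\<integral>\<^sup>+x. mix_weight n q c x \<partial>lborel_n n))"

lemma measurable_mix_weight [measurable]: "mix_weight n q c \<in> borel_measurable (lborel_n n)"
  unfolding mix_weight_def by measurable

lemma sets_mix_law [simp, measurable_cong]: "sets (mix_law n q c) = sets (lborel_n n)" by (simp add: mix_law_def)

lemma nn_integral_mix_law:
  assumes [measurable]: "G \<in> borel_measurable (lborel_n n)"
  shows "(\<integral>\<^sup>+x. G x \<partial>mix_law n q c) = (\<integral>\<^sup>+x. G x * mix_weight n q c x \<partial>lborel_n n) / (\<integral>\<^sup>+x. mix_weight n q c x \<partial>lborel_n n)"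
  unfolding mix_law_def
  by (subst nn_integral_density, measurable) (simp add: nn_integral_divide[symmetric] ennreal_times_divide mult.commute)

lemma measurable_scale_restrict:
  assumes "r \<le> n" shows "(\<lambda>x. scale_n r a x) \<in> measurable (lborel_n n) (lborel_n r)"
proof -
  have [measurable]: "(\<lambda>x. x k) \<in> borel_measurable (lborel_n n)" if "k \<in> {..<r}" for k
    using measurable_coord[of "\<lambda>x. x" "lborel_n n" n k] that assms by simp
  show ?thesis unfolding scale_n_def by measurable
qed

text \<open>By the radial representation \<open>X n\<close> is distributed like \<open>dir n\<close>
  under \<open>mix_law\<close>. The unscaled first coordinates converge under
  \<open>mix_law\<close>; the division by the random radius is left to Slutsky's argument, for which
  \<open>dev\<close> is the input.\<close>

lemma weak_limit:
  fixes M :: "nat \<Rightarrow> 'a measure" and X :: "nat \<Rightarrow> 'a \<Rightarrow> nat \<Rightarrow> real" and j :: "nat \<Rightarrow> nat"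
    and C c :: "nat \<Rightarrow> real"
  assumes j: "\<And>n. n \<ge> 2 \<Longrightarrow> j n < n"
    and M: "\<And>n. n \<ge> 2 \<Longrightarrow> prob_space (M n)"
    and X: "\<And>n. n \<ge> 2 \<Longrightarrow> X n \<in> measurable (M n) (bdry_space n (lp_ball p n))"
    and law: "\<And>n A. n \<ge> 2 \<Longrightarrow> A \<in> sets (bdry_space n (lp_ball p n)) \<Longrightarrow>
       measure (M n) (X n -` A \<inter> space (M n)) =
         measure (curvature_measure n (lp_ball p n) (j n)) A / intrinsic_volume n (lp_ball p n) (j n)"
    and k: "\<And>n. k n \<in> borel_measurable (lborel_n n)" and C: "\<And>n. n \<ge> 2 \<Longrightarrow> C n > 0"
    and adm: "\<And>n w. n \<ge> 2 \<Longrightarrow> w \<in> space (lborel_n n) \<Longrightarrow> Spow n w = 1 \<Longrightarrow>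
      (\<integral>\<^sup>+N. ennreal (N powr (n / p)) * k n (scale_n n (N powr (1 / p)) w) * indicator {0<..} N \<partial>lborel) = ennreal (C n)"
    and c: "\<And>n. n \<ge> 2 \<Longrightarrow> c n > 0"
    and weight: "\<And>n x. n \<ge> 2 \<Longrightarrow> k n x * ennreal ((Spow n x powr (1 / p) / sqrt (Upow n x)) ^ (n - j n) * hsym n (n - j n) x)
      = mix_weight n (n - j n) (c n) x"
    and lim: "(\<lambda>n. real (j n) / real n) \<longlonglongrightarrow> \<alpha>" and \<alpha>: "0 \<le> \<alpha>" "\<alpha> \<le> 1" and \<theta>: "\<theta> \<ge> 0"
    and conc: "\<And>\<delta> \<eta>. \<delta> > 0 \<Longrightarrow> 0 < \<eta> \<Longrightarrow> \<eta> < 1 \<Longrightarrow>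
      eventually (\<lambda>n. ennreal \<eta> * (\<integral>\<^sup>+t. wgt n (n - j n) (c n) t \<partial>lborel) \<le>
        (\<integral>\<^sup>+t. wgt n (n - j n) (c n) t * indicator {t. \<bar>t - \<theta>\<bar> \<le> \<delta>} t \<partial>lborel)) sequentially"
    and dev: "\<And>\<epsilon>. \<epsilon> > 0 \<Longrightarrow> (\<lambda>n. measure (mix_law n (n - j n) (c n))
      {x \<in> space (lborel_n n). \<epsilon> \<le> \<bar>real n powr (1 / p) * Spow n x powr (- 1 / p) - s\<bar>}) \<longlonglongrightarrow> 0"
  shows "weakly_conv_n r (\<lambda>n. scaled_marginal_law p r (M n) n (X n)) (scaled_iid_law r s (limit_density \<alpha> \<theta>))"
proof -
  let ?W = "\<lambda>n. mix_weight n (n - j n) (c n)"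
  let ?Z = "\<lambda>n. \<integral>\<^sup>+x. ?W n x \<partial>lborel_n n"
  let ?P = "\<lambda>n. mix_law n (n - j n) (c n)"
  \<comment> \<open>Filling with \<open>0\<close> from index \<open>n\<close> on makes
    \<open>Y n\<close> measurable into \<open>lborel_n r\<close> for every \<open>n\<close>; for
    \<open>r \<le> n\<close> it is plain restriction.\<close>
  define Y where "Y n x = (\<lambda>k\<in>{..<r}. if k < n then x k else 0)" for n :: nat and x :: "nat \<Rightarrow> real"
  define \<rho> where "\<rho> n x = real n powr (1 / p) * Spow n x powr (- 1 / p)" for n x
  define \<nu> where "\<nu> = Pi\<^sub>M {..<r} (\<lambda>_. density lborel (\<lambda>u. ennreal (limit_density \<alpha> \<theta> u)))"
  have space: "space (?P n) = space (lborel_n n)" for n by (simp add: mix_law_def)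
  have repr: "0 < ?Z n" "?Z n < \<infinity>"
    "\<And>g. g \<in> borel_measurable (lborel_n n) \<Longrightarrow> ?Z n * (\<integral>\<^sup>+\<omega>. g (X n \<omega>) \<partial>M n) = (\<integral>\<^sup>+x. g (dir n x) * ?W n x \<partial>lborel_n n)"
    if n: "n \<ge> 2" for n
  proof -
    have n0: "n > 0" using n by simp
    note R = curvature_law_repr[OF n0 j[OF n] C[OF n] k adm[OF n] M[OF n] X[OF n] law[OF n], unfolded weight[OF n]]
    have u: "unit_ball_vol (real (n - j n)) > 0" by (intro unit_ball_vol_pos) simp
    have "C n * (intrinsic_volume n (lp_ball p n) (j n) * (real (n - j n) * unit_ball_vol (real (n - j n)) / p)) > 0"
      using R(1) C[OF n] j[OF n] p_gt_1 u by (intro mult_pos_pos divide_pos_pos) auto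
    then show "0 < ?Z n" "?Z n < \<infinity>"
      by (simp_all only: R(2) ennreal_less_zero_iff ennreal_less_top infinity_ennreal_def)
    show "\<And>g. g \<in> borel_measurable (lborel_n n) \<Longrightarrow> ?Z n * (\<integral>\<^sup>+\<omega>. g (X n \<omega>) \<partial>M n) = (\<integral>\<^sup>+x. g (dir n x) * ?W n x \<partial>lborel_n n)"
      by (rule R(3))
  qed
  have P: "prob_space (?P n)" if n: "n \<ge> 2" for n
  proof
    have "emeasure (?P n) (space (?P n)) = (\<integral>\<^sup>+x. 1 \<partial>?P n)" by simp
    also have "\<dots> = ?Z n / ?Z n" by (subst nn_integral_mix_law) auto
    also have "\<dots> = 1" using repr(1,2)[OF n] by (intro ennreal_divide_self) auto
    finally show "emeasure (?P n) (space (?P n)) = 1" .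
  qed
  have XL: "X n \<in> measurable (M n) (lborel_n n)" if n: "n \<ge> 2" for n
    using X[OF n] unfolding bdry_space_def by (rule measurable_restrict_space2_iff[THEN iffD1, THEN conjunct1])
  have exg: "(\<integral>\<^sup>+\<omega>. g (X n \<omega>) \<partial>M n) = (\<integral>\<^sup>+x. g (dir n x) \<partial>?P n)"
    if n: "n \<ge> 2" and g [measurable]: "g \<in> borel_measurable (lborel_n n)" for n g
  proof -
    have "(\<integral>\<^sup>+x. g (dir n x) \<partial>?P n) = ?Z n * (\<integral>\<^sup>+\<omega>. g (X n \<omega>) \<partial>M n) / ?Z n"
      unfolding repr(3)[OF n g] by (rule nn_integral_mix_law) measurable
    also have "\<dots> = (\<integral>\<^sup>+\<omega>. g (X n \<omega>) \<partial>M n)"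
      using repr(1,2)[OF n] by (metis ennreal_mult_divide_eq infinity_ennreal_def less_irrefl mult.commute)
    finally show ?thesis by simp
  qed
  have D: "distr (M n) (lborel_n n) (X n) = distr (?P n) (lborel_n n) (dir n)" if n: "n \<ge> 2" for n
  proof (rule measure_eqI)
    fix A assume "A \<in> sets (distr (M n) (lborel_n n) (X n))"
    then have [measurable]: "A \<in> sets (lborel_n n)" by simp
    note [measurable] = XL[OF n]
    have "(\<integral>\<^sup>+x. indicator A x \<partial>distr (M n) (lborel_n n) (X n)) = (\<integral>\<^sup>+x. indicator A x \<partial>distr (?P n) (lborel_n n) (dir n))"
      by (subst (1 2) nn_integral_distr) (auto intro!: exg n)
    then show "emeasure (distr (M n) (lborel_n n) (X n)) A = emeasure (distr (?P n) (lborel_n n) (dir n)) A" by simp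
  qed simp
  have Ym: "Y n \<in> measurable (?P n) (lborel_n r)" for n
  proof -
    have "Y n \<in> measurable (lborel_n n) (lborel_n r)"
      unfolding Y_def
    proof (rule measurable_restrict)
      fix k
      show "(\<lambda>x. if k < n then x k else 0) \<in> measurable (lborel_n n) lborel"
        using measurable_coord[of "\<lambda>x. x" "lborel_n n" n k] by (cases "k < n") auto
    qed
    then show ?thesis using measurable_cong_sets[OF sets_mix_law refl, of n "n - j n" "c n" "lborel_n r"] by simp
  qed
  have \<rho>m: "\<rho> n \<in> borel_measurable (?P n)" for n unfolding \<rho>_def by measurable
  have \<nu>p: "prob_space \<nu>" unfolding \<nu>_def
    by (intro prob_space_PiM prob_space_limit_density \<alpha> \<theta>)
  have \<nu>s: "sets \<nu> = sets (lborel_n r)" unfolding \<nu>_def by (intro sets_PiM_cong) auto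
  show ?thesis unfolding weakly_conv_n_def
  proof (intro allI impI, elim conjE)
    fix f assume f: "continuous_map (euclidean_top r) euclideanreal f" "bounded (f ` topspace (euclidean_top r))"
    have fm: "f \<in> borel_measurable (lborel_n r)" by (rule measurable_continuous_map_euclidean_top[OF f(1)])
    have "(\<lambda>n. LINT \<omega>|?P n. f (scale_n r (\<rho> n \<omega>) (Y n \<omega>))) \<longlonglongrightarrow> (LINT y|\<nu>. f (scale_n r s y))"
    proof (rule slutsky_scale[OF _ Ym \<rho>m \<nu>p \<nu>s _ _ f])
      show "eventually (\<lambda>n. prob_space (?P n)) sequentially"
        using eventually_ge_at_top[of 2] by eventually_elim (rule P)
      show "(\<lambda>n. measure (?P n) {\<omega> \<in> space (?P n). \<epsilon> \<le> \<bar>\<rho> n \<omega> - s\<bar>}) \<longlonglongrightarrow> 0" if "\<epsilon> > 0" for \<epsilon>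
        using dev[OF that] by (simp add: \<rho>_def space)
      fix F L assume F: "F \<in> borel_measurable (lborel_n r)" "\<And>x. F x \<le> 1" and L: "L < enn2real (\<integral>\<^sup>+y. F y \<partial>\<nu>)"
      have "L < (\<Sum>T\<in>Pow {..<r}. (1 - \<alpha>) ^ card T * \<alpha> ^ (r - card T) * pattern_mean r F T \<theta>)"
      proof -
        have "0 \<le> (\<Sum>T\<in>Pow {..<r}. (1 - \<alpha>) ^ card T * \<alpha> ^ (r - card T) * pattern_mean r F T \<theta>)"
          using \<alpha> by (intro sum_nonneg mult_nonneg_nonneg) (auto simp: pattern_mean_def)
        then show ?thesis using L unfolding \<nu>_def nn_integral_limit_density[OF \<alpha> \<theta> F] by simp
      qed
      moreover have "eventually (\<lambda>n. j n < n) sequentially"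
        using eventually_ge_at_top[of 2] by eventually_elim (rule j)
      ultimately have "eventually (\<lambda>n. ennreal L * mix n (n - j n) (c n) (\<lambda>_. 1) \<le> mix n (n - j n) (c n) (\<lambda>x. F (restrict x {..<r}))) sequentially"
        by (intro mix_liminf[OF F _ lim \<alpha> \<theta> conc]) auto
      then show "eventually (\<lambda>n. ennreal L \<le> (\<integral>\<^sup>+\<omega>. F (Y n \<omega>) \<partial>?P n)) sequentially"
        using eventually_ge_at_top[of 2] eventually_ge_at_top[of r]
      proof eventually_elim
        case (elim n)
        note [measurable] = measurable_restrict_lborel_n[OF elim(3)] F(1)
        have YR: "Y n x = restrict x {..<r}" for x using elim(3) by (auto simp: Y_def restrict_def)
        have G: "0 < ennreal (Gamma (c n))" using c[OF elim(2)] by (simp add: Gamma_real_pos)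
        have "ennreal L * (ennreal (Gamma (c n)) * ?Z n) \<le> ennreal (Gamma (c n)) * (\<integral>\<^sup>+x. F (restrict x {..<r}) * ?W n x \<partial>lborel_n n)"
          using elim(1) by (subst (asm) (1 2) mix_eq[OF c[OF elim(2)]]) (auto simp: mix_weight_def)
        then have "ennreal (Gamma (c n)) * (ennreal L * ?Z n) \<le> ennreal (Gamma (c n)) * (\<integral>\<^sup>+x. F (restrict x {..<r}) * ?W n x \<partial>lborel_n n)"
          by (simp only: mult.left_commute)
        then have "ennreal L * ?Z n \<le> (\<integral>\<^sup>+x. F (restrict x {..<r}) * ?W n x \<partial>lborel_n n)"
          using G by (subst (asm) ennreal_mult_le_mult_iff) auto
        then have "ennreal L * ?Z n / ?Z n \<le> (\<integral>\<^sup>+x. F (restrict x {..<r}) * ?W n x \<partial>lborel_n n) / ?Z n"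
          by (rule divide_right_mono_ennreal)
        moreover have "ennreal L * ?Z n / ?Z n = ennreal L"
          using repr(1,2)[OF elim(2)] by (intro ennreal_mult_divide_eq) auto
        ultimately show ?case unfolding YR by (subst nn_integral_mix_law) auto
      qed
    qed
    moreover have "(LINT y|\<nu>. f (scale_n r s y)) = (LINT x|scaled_iid_law r s (limit_density \<alpha> \<theta>). f x)"
    proof -
      have "(\<lambda>y. scale_n r s y) \<in> measurable \<nu> (lborel_n r)"
        using measurable_scale_restrict[of r r s] by (simp add: measurable_cong_sets[OF \<nu>s refl])
      then show ?thesis unfolding scaled_iid_law_def \<nu>_def[symmetric] by (simp add: integral_distr fm)
    qed
    moreover have "eventually (\<lambda>n. (LINT \<omega>|?P n. f (scale_n r (\<rho> n \<omega>) (Y n \<omega>))) = (LINT x|scaled_marginal_law p r (M n) n (X n). f x)) sequentially"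
      using eventually_ge_at_top[of 2] eventually_ge_at_top[of r]
    proof eventually_elim
      case (elim n)
      let ?a = "real n powr (1 / p)"
      note sr = measurable_scale_restrict[OF elim(2), of ?a]
      have hm: "(\<lambda>x. f (scale_n r ?a x)) \<in> borel_measurable (lborel_n n)"
        by (rule measurable_compose[OF sr fm])
      have dm: "dir n \<in> measurable (?P n) (lborel_n n)"
        using measurable_dir measurable_cong_sets[OF sets_mix_law refl, of n "n - j n" "c n" "lborel_n n"] by simp
      have "(LINT x|scaled_marginal_law p r (M n) n (X n). f x) = (LINT \<omega>|M n. f (scale_n r ?a (X n \<omega>)))"
        unfolding scaled_marginal_law_def
        by (rule integral_distr[OF measurable_compose[OF XL[OF elim(1)] sr] fm])
      also have "\<dots> = (LINT x|distr (M n) (lborel_n n) (X n). f (scale_n r ?a x))"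
        by (rule integral_distr[OF XL[OF elim(1)] hm, symmetric])
      also have "\<dots> = (LINT x|?P n. f (scale_n r ?a (dir n x)))"
        unfolding D[OF elim(1)] by (rule integral_distr[OF dm hm])
      also have "\<dots> = (LINT x|?P n. f (scale_n r (\<rho> n x) (Y n x)))"
      proof (rule integral_cong_AE)
        show "(\<lambda>x. f (scale_n r ?a (dir n x))) \<in> borel_measurable (?P n)"
          by (rule measurable_compose[OF dm hm])
        have "(\<lambda>x. scale_n r (\<rho> n x) (Y n x)) \<in> measurable (?P n) (lborel_n r)"
          by (rule measurable_scale_n[OF \<rho>m Ym])
        then show "(\<lambda>x. f (scale_n r (\<rho> n x) (Y n x))) \<in> borel_measurable (?P n)"
          by (rule measurable_compose[OF _ fm])
        \<comment> \<open>Where the density is positive \<open>hsym\<close> does not vanish, so the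
          default branch of \<open>dir\<close> is not met.\<close>
        have "AE x in lborel_n n. 0 < ?W n x / ?Z n \<longrightarrow> f (scale_n r ?a (dir n x)) = f (scale_n r (\<rho> n x) (Y n x))"
        proof (intro AE_I2 impI)
          fix x assume "0 < ?W n x / ?Z n"
          then have "hsym n (n - j n) x \<noteq> 0" by (auto simp: mix_weight_def)
          then have "Spow n x \<noteq> 0" using hsym_zero by blast
          then have "dir n x = scale_n n (Spow n x powr (- 1 / p)) x" by (simp add: dir_def)
          then have "scale_n r ?a (dir n x) = scale_n r (\<rho> n x) (Y n x)"
            using elim(2) by (auto simp: scale_n_def \<rho>_def Y_def)
          then show "f (scale_n r ?a (dir n x)) = f (scale_n r (\<rho> n x) (Y n x))" by simp
        qed
        then show "AE x in ?P n. f (scale_n r ?a (dir n x)) = f (scale_n r (\<rho> n x) (Y n x))"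
          unfolding mix_law_def by (subst AE_density) auto
      qed
      finally show ?case by simp
    qed
    ultimately show "(\<lambda>n. LINT x|scaled_marginal_law p r (M n) n (X n). f x) \<longlonglongrightarrow> (LINT x|scaled_iid_law r s (limit_density \<alpha> \<theta>). f x)"
      using Lim_transform_eventually by fastforce
  qed
qed

end

section \<open>The bulk and the right edge\<close>

text \<open>Chebyshev's inequality around a prescribed centre \<open>v\<close>, expressed by raw
  moments so that only nonnegative integrals have to be computed.\<close>

lemma prob_dev_le:
  assumes P: "prob_space P" and V [measurable]: "V \<in> borel_measurable P" and V0: "\<And>x. V x \<ge> 0"
    and m1: "(\<integral>\<^sup>+x. ennreal (V x) \<partial>P) = ennreal a1" and m2: "(\<integral>\<^sup>+x. ennreal ((V x)\<^sup>2) \<partial>P) = ennreal a2"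
    and a: "a1 \<ge> 0" "a2 \<ge> 0" and d: "d > 0"
  shows "measure P {x \<in> space P. d \<le> \<bar>V x - v\<bar>} \<le> (a2 - 2 * v * a1 + v\<^sup>2) / d\<^sup>2"
proof -
  interpret prob_space P by (rule P)
  have "has_bochner_integral P V a1" "has_bochner_integral P (\<lambda>x. (V x)\<^sup>2) a2"
    using m1 m2 V0 a by (auto intro!: has_bochner_integral_nn_integral)
  then have i: "integrable P V" "integral\<^sup>L P V = a1" "integrable P (\<lambda>x. (V x)\<^sup>2)" "integral\<^sup>L P (\<lambda>x. (V x)\<^sup>2) = a2"
    by (auto simp: has_bochner_integral_iff)
  have e: "(\<lambda>x. (V x - v)\<^sup>2) = (\<lambda>x. (V x)\<^sup>2 - 2 * v * V x + v\<^sup>2)" by (auto simp: power2_eq_square algebra_simps)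
  have i2: "integrable P (\<lambda>x. (V x - v)\<^sup>2)" unfolding e using i by (intro Bochner_Integration.integrable_add Bochner_Integration.integrable_diff integrable_mult_right) auto
  have I2: "(LINT x|P. (V x - v)\<^sup>2) = a2 - 2 * v * a1 + v\<^sup>2"
    unfolding e using i by (simp add: prob_space)
  have "{x \<in> space P. d \<le> \<bar>V x - v\<bar>} = {x \<in> space P. d\<^sup>2 \<le> (V x - v)\<^sup>2}"
    using d by (auto simp: abs_le_square_iff[symmetric])
  moreover have "measure P {x \<in> space P. d\<^sup>2 \<le> (V x - v)\<^sup>2} \<le> (LINT x|P. (V x - v)\<^sup>2) / d\<^sup>2"
    using d i2 by (intro integral_Markov_inequality_measure[where A="{}"]) auto
  ultimately show ?thesis by (simp add: I2)
qed

lemma prob_dev_tendsto: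
  fixes g :: "real \<Rightarrow> real"
  assumes ev: "eventually (\<lambda>n. prob_space (P n) \<and> (\<integral>\<^sup>+x. ennreal (V n x) \<partial>P n) = ennreal (a1 n) \<and>
      (\<integral>\<^sup>+x. ennreal ((V n x)\<^sup>2) \<partial>P n) = ennreal (a2 n) \<and> a1 n \<ge> 0 \<and> a2 n \<ge> 0) sequentially"
    and V [measurable]: "\<And>n. V n \<in> borel_measurable (P n)" and V0: "\<And>n x. V n x \<ge> 0"
    and a1: "a1 \<longlonglongrightarrow> v" and a2: "a2 \<longlonglongrightarrow> v\<^sup>2"
    and g: "isCont g v" and e: "e > 0"
  shows "(\<lambda>n. measure (P n) {x \<in> space (P n). e \<le> \<bar>g (V n x) - g v\<bar>}) \<longlonglongrightarrow> 0"
proof -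
  obtain d where d: "d > 0" "\<And>x. \<bar>x - v\<bar> < d \<Longrightarrow> \<bar>g x - g v\<bar> < e"
    using g e unfolding isCont_def LIM_def dist_real_def by (metis abs_zero diff_self)
  have "(\<lambda>n. (a2 n - 2 * v * a1 n + v\<^sup>2) / d\<^sup>2) \<longlonglongrightarrow> (v\<^sup>2 - 2 * v * v + v\<^sup>2) / d\<^sup>2"
    using d by (intro tendsto_intros a1 a2) auto
  then have lim: "(\<lambda>n. (a2 n - 2 * v * a1 n + v\<^sup>2) / d\<^sup>2) \<longlonglongrightarrow> 0" by (simp add: power2_eq_square)
  show ?thesis
  proof (rule tendsto_sandwich[OF _ _ tendsto_const lim])
    show "eventually (\<lambda>n. measure (P n) {x \<in> space (P n). e \<le> \<bar>g (V n x) - g v\<bar>} \<le> (a2 n - 2 * v * a1 n + v\<^sup>2) / d\<^sup>2) sequentially"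
      using ev
    proof eventually_elim
      case (elim n)
      then interpret prob_space "P n" by simp
      have "{x \<in> space (P n). e \<le> \<bar>g (V n x) - g v\<bar>} \<subseteq> {x \<in> space (P n). d \<le> \<bar>V n x - v\<bar>}"
        using d(2) by (auto simp: not_less[symmetric])
      then have "measure (P n) {x \<in> space (P n). e \<le> \<bar>g (V n x) - g v\<bar>} \<le> measure (P n) {x \<in> space (P n). d \<le> \<bar>V n x - v\<bar>}"
        by (intro finite_measure_mono) measurable
      also have "\<dots> \<le> (a2 n - 2 * v * a1 n + v\<^sup>2) / d\<^sup>2"
        using elim V0 d(1) by (intro prob_dev_le) auto
      finally show ?case .
    qed
  qed auto
qed

lemma nn_integral_Fubini_lborel:
  assumes "case_prod f \<in> borel_measurable (lborel \<Otimes>\<^sub>M (lborel :: real measure))"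
  shows "(\<integral>\<^sup>+y. (\<integral>\<^sup>+x. f x y \<partial>(lborel :: real measure)) \<partial>(lborel :: real measure)) = (\<integral>\<^sup>+x. (\<integral>\<^sup>+y. f x y \<partial>lborel) \<partial>lborel)"
  by (rule lborel_pair.Fubini'[OF assms])

context lp_exponent
begin

section \<open>The bulk masses as functions of the mixing parameter\<close>

definition bexp :: real where "bexp = 2 * p - 2"

sublocale bulk: lp_mixture p p bexp
  by unfold_locales (use p_gt_1 in \<open>auto simp: bexp_def\<close>)

lemma bulk_base: "bulk.base t x = exp (- (\<bar>x\<bar> powr p) - t * (phi x)\<^sup>2)"
  unfolding bulk.base_def phi_power2 by (simp add: bexp_def)

text \<open>The integrated form of \<open>I' = - Q\<close>: the exponential is differentiated
  pointwise in the parameter, and Tonelli exchanges the integrals.\<close>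

lemma Imass_bulk_diff:
  assumes "u \<le> t"
  shows "bulk.Imass u = bulk.Imass t + (\<integral>\<^sup>+v. bulk.Qmass v * indicator {u..t} v \<partial>lborel)"
proof -
  have pt: "ennreal (bulk.base u x) = ennreal (bulk.base t x) + (\<integral>\<^sup>+v. ennreal ((phi x)\<^sup>2 * bulk.base v x) * indicator {u..t} v \<partial>lborel)" for x
  proof -
    have "(\<integral>\<^sup>+v. ennreal ((phi x)\<^sup>2 * bulk.base v x) * indicator {u..t} v \<partial>lborel) = ennreal (- bulk.base t x - (- bulk.base u x))"
    proof (rule nn_integral_FTC_Icc)
      fix v
      show "((\<lambda>v. - bulk.base v x) has_real_derivative (phi x)\<^sup>2 * bulk.base v x) (at v)"
        unfolding bulk_base by (auto intro!: derivative_eq_intros)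
    qed (use assms in auto)
    then show ?thesis using bulk.base_antimono[OF assms, of x] by (simp add: ennreal_plus[symmetric] del: ennreal_plus)
  qed
  have "bulk.Imass u = bulk.Imass t + (\<integral>\<^sup>+x. (\<integral>\<^sup>+v. ennreal ((phi x)\<^sup>2 * bulk.base v x) * indicator {u..t} v \<partial>lborel) \<partial>lborel)"
    unfolding bulk.Imass_def pt[of u] by (subst nn_integral_add[symmetric]) (auto simp: pt[symmetric])
  also have "(\<integral>\<^sup>+x. (\<integral>\<^sup>+v. ennreal ((phi x)\<^sup>2 * bulk.base v x) * indicator {u..t} v \<partial>lborel) \<partial>lborel) =
     (\<integral>\<^sup>+v. (\<integral>\<^sup>+x. ennreal ((phi x)\<^sup>2 * bulk.base v x) * indicator {u..t} v \<partial>lborel) \<partial>lborel)"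
    by (rule nn_integral_Fubini_lborel) measurable
  also have "\<dots> = (\<integral>\<^sup>+v. bulk.Qmass v * indicator {u..t} v \<partial>lborel)"
    unfolding bulk.Qmass_def by (intro nn_integral_cong nn_integral_multc) measurable
  finally show ?thesis .
qed

text \<open>The Hoelder conjugate of \<open>p\<close>. With \<open>w = phi x\<close> the term
  \<open>\<bar>x\<bar> powr p\<close> becomes \<open>\<bar>w\<bar> powr conj_exp\<close>, and
  \<open>\<bar>x\<bar> powr (2 * p - 2)\<close> becomes \<open>w\<^sup>2\<close>.\<close>

definition conj_exp :: real where "conj_exp = p / (p - 1)"

lemma conj_exp: "conj_exp > 1" "(p - 1) * conj_exp = p" using p_gt_1 by (auto simp: conj_exp_def)

lemma abs_phi_conj: "\<bar>phi x\<bar> powr conj_exp = \<bar>x\<bar> powr p"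
  unfolding abs_phi by (simp add: powr_powr conj_exp)

lemma nn_integral_base_phi:
  assumes [measurable]: "h \<in> borel_measurable borel"
  shows "(\<integral>\<^sup>+x. h (phi x) * ennreal (dphi x * bulk.base t x) \<partial>lborel) =
    (\<integral>\<^sup>+w. h w * ennreal (exp (- (\<bar>w\<bar> powr conj_exp) - t * w\<^sup>2)) \<partial>lborel)"
proof -
  have "(\<integral>\<^sup>+w. h w * ennreal (exp (- (\<bar>w\<bar> powr conj_exp) - t * w\<^sup>2)) \<partial>lborel) =
    (\<integral>\<^sup>+x. h (phi x) * ennreal (exp (- (\<bar>phi x\<bar> powr conj_exp) - t * (phi x)\<^sup>2)) * ennreal (dphi x) \<partial>lborel)"
    by (rule nn_integral_phi[symmetric]) measurable
  also have "\<dots> = (\<integral>\<^sup>+x. h (phi x) * ennreal (dphi x * bulk.base t x) \<partial>lborel)"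
    unfolding abs_phi_conj bulk_base
    by (intro nn_integral_cong) (simp add: ennreal_mult mult_ac)
  finally show ?thesis by simp
qed

definition Eker :: "real \<Rightarrow> real \<Rightarrow> real" where "Eker v z = exp (- z\<^sup>2 - v powr (- (conj_exp / 2)) * \<bar>z\<bar> powr conj_exp)"

lemma nn_integral_Eker:
  assumes v: "v > 0" and [measurable]: "h \<in> borel_measurable borel"
  shows "(\<integral>\<^sup>+z. h (z / sqrt v) * ennreal (Eker v z) \<partial>lborel) = ennreal (sqrt v) * (\<integral>\<^sup>+x. h (phi x) * ennreal (dphi x * bulk.base v x) \<partial>lborel)"
proof -
  have [measurable]: "Eker v \<in> borel_measurable borel" unfolding Eker_def by measurable
  have "(\<integral>\<^sup>+z. h (z / sqrt v) * ennreal (Eker v z) \<partial>lborel) = ennreal (sqrt v) * (\<integral>\<^sup>+w. h ((sqrt v * w) / sqrt v) * ennreal (Eker v (sqrt v * w)) \<partial>lborel)"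
    using nn_integral_real_affine[of "\<lambda>z. h (z / sqrt v) * ennreal (Eker v z)" "sqrt v" 0] v by simp
  also have "(\<integral>\<^sup>+w. h ((sqrt v * w) / sqrt v) * ennreal (Eker v (sqrt v * w)) \<partial>lborel) =
    (\<integral>\<^sup>+w. h w * ennreal (exp (- (\<bar>w\<bar> powr conj_exp) - v * w\<^sup>2)) \<partial>lborel)"
  proof (rule nn_integral_cong)
    fix w
    have "v powr (- (conj_exp / 2)) * \<bar>sqrt v * w\<bar> powr conj_exp = \<bar>w\<bar> powr conj_exp"
    proof -
      have "sqrt v powr conj_exp = v powr (conj_exp / 2)" using v by (simp add: powr_half_sqrt[symmetric] powr_powr)
      then have "v powr (- (conj_exp / 2)) * \<bar>sqrt v * w\<bar> powr conj_exp = (v powr (- (conj_exp / 2)) * v powr (conj_exp / 2)) * \<bar>w\<bar> powr conj_exp"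
        using v by (simp add: abs_mult powr_mult)
      also have "v powr (- (conj_exp / 2)) * v powr (conj_exp / 2) = 1" using v by (simp add: powr_add[symmetric])
      finally show ?thesis by simp
    qed
    then have "Eker v (sqrt v * w) = exp (- (\<bar>w\<bar> powr conj_exp) - v * w\<^sup>2)"
      using v by (simp add: Eker_def power_mult_distrib)
    then show "h ((sqrt v * w) / sqrt v) * ennreal (Eker v (sqrt v * w)) = h w * ennreal (exp (- (\<bar>w\<bar> powr conj_exp) - v * w\<^sup>2))"
      using v by simp
  qed
  finally show ?thesis by (simp add: nn_integral_base_phi)
qed

text \<open>The integrated form of \<open>(sqrt t * J t)' = p / (2 * sqrt t) * Q t\<close>.
  Differentiating \<open>Eker\<close> in \<open>v\<close> brings down
  \<open>\<bar>z\<bar> powr conj_exp\<close>; after undoing the substitution, this factor times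
  \<open>dphi x\<close> is a multiple of \<open>(phi x)\<^sup>2\<close>, so the same
  \<open>Q\<close> appears as in the derivative of \<open>I\<close>.\<close>

lemma Jmass_bulk_diff:
  assumes u: "0 < u" "u \<le> t"
  shows "ennreal (sqrt t) * bulk.Jmass t = ennreal (sqrt u) * bulk.Jmass u +
    (\<integral>\<^sup>+v. ennreal (p / 2 / sqrt v) * bulk.Qmass v * indicator {u..t} v \<partial>lborel)"
proof -
  let ?e = "conj_exp"
  define D where "D v z = ?e / 2 * v powr (- (?e / 2) - 1) * \<bar>z\<bar> powr ?e * Eker v z" for v z
  have Ek: "(\<integral>\<^sup>+z. ennreal (Eker v z) \<partial>lborel) = ennreal (sqrt v) * bulk.Jmass v" if "v > 0" for v
    using nn_integral_Eker[OF that, of "\<lambda>_. 1"] by (simp add: bulk.Jmass_def)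
  have pt: "ennreal (Eker t z) = ennreal (Eker u z) + (\<integral>\<^sup>+v. ennreal (D v z) * indicator {u..t} v \<partial>lborel)" for z
  proof -
    have "(\<integral>\<^sup>+v. ennreal (D v z) * indicator {u..t} v \<partial>lborel) = ennreal (Eker t z - Eker u z)"
    proof (rule nn_integral_FTC_Icc)
      fix v assume v: "v \<in> {u..t}"
      then have v0: "v > 0" using u by simp
      have "((\<lambda>v. v powr (- (?e / 2))) has_real_derivative - (?e / 2) * v powr (- (?e / 2) - 1)) (at v)"
        using has_real_derivative_powr[OF v0, of "- (?e / 2)"] by simp
      then show "((\<lambda>v. Eker v z) has_real_derivative D v z) (at v)"
        using v0 unfolding Eker_def D_def by (auto intro!: derivative_eq_intros)
      show "0 \<le> D v z" using conj_exp(1) by (simp add: D_def Eker_def)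
    next
      show "(\<lambda>v. D v z) \<in> borel_measurable borel" unfolding D_def Eker_def by measurable
    qed (use u in auto)
    moreover have "Eker u z \<le> Eker t z"
    proof -
      have "t powr (- (?e / 2)) \<le> u powr (- (?e / 2))" using u conj_exp(1) by (intro powr_mono2') auto
      then show ?thesis unfolding Eker_def by (simp add: mult_right_mono)
    qed
    moreover have "Eker u z > 0" by (simp add: Eker_def)
    ultimately show ?thesis by (simp add: ennreal_plus[symmetric] del: ennreal_plus)
  qed
  have [measurable]: "(\<lambda>z. Eker v z) \<in> borel_measurable borel" for v unfolding Eker_def by measurable
  have Dm [measurable]: "case_prod (\<lambda>v z. ennreal (D v z) * indicator {u..t} v) \<in> borel_measurable (lborel \<Otimes>\<^sub>M lborel)"
    unfolding D_def Eker_def case_prod_beta' by measurable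
  have Dm2 [measurable]: "(\<lambda>z. \<integral>\<^sup>+v. ennreal (D v z) * indicator {u..t} v \<partial>lborel) \<in> borel_measurable borel"
    unfolding D_def Eker_def by measurable
  have "ennreal (sqrt t) * bulk.Jmass t = (\<integral>\<^sup>+z. ennreal (Eker u z) + (\<integral>\<^sup>+v. ennreal (D v z) * indicator {u..t} v \<partial>lborel) \<partial>lborel)"
    using Ek[of t] u by (simp add: pt)
  also have "\<dots> = (\<integral>\<^sup>+z. ennreal (Eker u z) \<partial>lborel) + (\<integral>\<^sup>+z. (\<integral>\<^sup>+v. ennreal (D v z) * indicator {u..t} v \<partial>lborel) \<partial>lborel)"
    by (rule nn_integral_add) measurable
  also have "(\<integral>\<^sup>+z. (\<integral>\<^sup>+v. ennreal (D v z) * indicator {u..t} v \<partial>lborel) \<partial>lborel) =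
    (\<integral>\<^sup>+v. (\<integral>\<^sup>+z. ennreal (D v z) * indicator {u..t} v \<partial>lborel) \<partial>lborel)"
    by (rule nn_integral_Fubini_lborel) (rule Dm)
  also have "\<dots> = (\<integral>\<^sup>+v. ennreal (p / 2 / sqrt v) * bulk.Qmass v * indicator {u..t} v \<partial>lborel)"
  proof (rule nn_integral_cong)
    fix v :: real
    show "(\<integral>\<^sup>+z. ennreal (D v z) * indicator {u..t} v \<partial>lborel) = ennreal (p / 2 / sqrt v) * bulk.Qmass v * indicator {u..t} v"
    proof (cases "v \<in> {u..t}")
      case True
      then have v: "v > 0" using u by simp
      have "D v z = (?e / 2 / v * \<bar>z / sqrt v\<bar> powr ?e) * Eker v z" for z
      proof -
        have s: "sqrt v powr ?e = v powr (?e / 2)" using v by (simp add: powr_half_sqrt[symmetric] powr_powr)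
        have "\<bar>z / sqrt v\<bar> powr ?e = \<bar>z\<bar> powr ?e / v powr (?e / 2)" using v by (simp add: powr_divide s)
        moreover have "v powr (- (?e / 2) - 1) = 1 / v powr (?e / 2) / v" using v by (simp add: powr_diff powr_minus_divide)
        ultimately show ?thesis by (simp add: D_def)
      qed
      then have "(\<integral>\<^sup>+z. ennreal (D v z) \<partial>lborel) = (\<integral>\<^sup>+z. (\<lambda>w. ennreal (?e / 2 / v * \<bar>w\<bar> powr ?e)) (z / sqrt v) * ennreal (Eker v z) \<partial>lborel)"
        using v conj_exp(1) by (intro nn_integral_cong) (simp add: ennreal_mult[symmetric] Eker_def)
      also have "\<dots> = ennreal (sqrt v) * (\<integral>\<^sup>+x. ennreal (?e / 2 / v * \<bar>phi x\<bar> powr ?e) * ennreal (dphi x * bulk.base v x) \<partial>lborel)"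
        by (rule nn_integral_Eker[OF v]) measurable
      also have "(\<integral>\<^sup>+x. ennreal (?e / 2 / v * \<bar>phi x\<bar> powr ?e) * ennreal (dphi x * bulk.base v x) \<partial>lborel) =
        (\<integral>\<^sup>+x. ennreal (p / 2 / v) * ennreal ((phi x)\<^sup>2 * bulk.base v x) \<partial>lborel)"
      proof (rule nn_integral_cong)
        fix x
        \<comment> \<open>The relation \<open>(p - 1) * conj_exp = p\<close> collects the constants
          into \<open>p / 2\<close>.\<close>
        have "?e / 2 / v * \<bar>phi x\<bar> powr ?e * (dphi x * bulk.base v x) = p / 2 / v * ((phi x)\<^sup>2 * bulk.base v x)"
        proof -
          have "\<bar>x\<bar> powr p * \<bar>x\<bar> powr (p - 2) = \<bar>x\<bar> powr (2 * p - 2)" by (simp add: powr_add[symmetric])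
          then have "?e * (\<bar>phi x\<bar> powr ?e * dphi x) = ((p - 1) * ?e) * (phi x)\<^sup>2"
            unfolding abs_phi_conj phi_power2 dphi_def by (simp add: mult.left_commute)
          then have "?e * (\<bar>phi x\<bar> powr ?e * dphi x) = p * (phi x)\<^sup>2" unfolding conj_exp(2) .
          moreover have "?e / 2 / v * \<bar>phi x\<bar> powr ?e * (dphi x * bulk.base v x) = (?e * (\<bar>phi x\<bar> powr ?e * dphi x)) / 2 / v * bulk.base v x" by simp
          ultimately show ?thesis by simp
        qed
        then show "ennreal (?e / 2 / v * \<bar>phi x\<bar> powr ?e) * ennreal (dphi x * bulk.base v x) = ennreal (p / 2 / v) * ennreal ((phi x)\<^sup>2 * bulk.base v x)"
          using v p_gt_1 conj_exp(1) by (simp add: ennreal_mult[symmetric])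
      qed
      also have "\<dots> = ennreal (p / 2 / v) * bulk.Qmass v" unfolding bulk.Qmass_def by (rule nn_integral_cmult) measurable
      also have "ennreal (sqrt v) * (ennreal (p / 2 / v) * bulk.Qmass v) = ennreal (p / 2 / sqrt v) * bulk.Qmass v"
      proof -
        have "s * (p / 2 / (s * s)) = p / 2 / s" if "s > 0" for s :: real using that by simp
        from this[of "sqrt v"] have "sqrt v * (p / 2 / v) = p / 2 / sqrt v" using v by simp
        then show ?thesis using v p_gt_1 by (simp add: mult.assoc[symmetric] ennreal_mult[symmetric])
      qed
      finally show ?thesis using True by simp
    qed simp
  qed
  finally show ?thesis using Ek[OF u(1)] by simp
qed

text \<open>
  Substituting \<open>z = sqrt t * phi x\<close> turns \<open>gfun t\<close> into the integral of
  \<open>exp (- z\<^sup>2 - t powr (- conj_exp / 2) * \<bar>z\<bar> powr conj_exp)\<close>, which increases in \<open>t\<close>.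
\<close>

abbreviation "bI \<equiv> bulk.rI"
abbreviation "bJ \<equiv> bulk.rJ"

definition gfun :: "real \<Rightarrow> real" where "gfun t = sqrt t * bJ t"
definition Gfun :: "real \<Rightarrow> real" where "Gfun t = t * bJ t / bI t"

lemma rI_diff:
  assumes "0 \<le> u" "u \<le> t"
  shows "(\<integral>\<^sup>+v. bulk.Qmass v * indicator {u..t} v \<partial>lborel) = ennreal (bI u - bI t)" "bI t \<le> bI u"
proof -
  let ?X = "\<integral>\<^sup>+v. bulk.Qmass v * indicator {u..t} v \<partial>lborel"
  have e: "ennreal (bI u) = ennreal (bI t) + ?X"
    using Imass_bulk_diff[OF assms(2)] bulk.rI(2)[of u] bulk.rI(2)[of t] assms by simp
  then have "?X \<noteq> \<top>" by (metis ennreal_add_eq_top ennreal_neq_top)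
  then obtain x where x: "?X = ennreal x" "x \<ge> 0" by (cases ?X) auto
  have "bI t > 0" "bI u > 0" using bulk.rI(1) assms by auto
  then have "bI u = bI t + x" using e x by (simp add: ennreal_plus[symmetric] del: ennreal_plus)
  then show "?X = ennreal (bI u - bI t)" "bI t \<le> bI u" using x by auto
qed

text \<open>\<open>Qmass\<close> is antitone and positive, so its integral over
  \<open>{u..t}\<close> is at least \<open>Qmass t * (t - u)\<close>.\<close>

lemma rI_strict:
  assumes "0 \<le> u" "u < t"
  shows "bI t < bI u"
proof (rule ccontr)
  assume "\<not> ?thesis"
  then have "(\<integral>\<^sup>+v. bulk.Qmass v * indicator {u..t} v \<partial>lborel) = 0"
    using rI_diff[of u t] assms by (simp add: ennreal_neg)
  moreover have "(\<integral>\<^sup>+v. bulk.Qmass t * indicator {u..t} v \<partial>lborel) \<le> (\<integral>\<^sup>+v. bulk.Qmass v * indicator {u..t} v \<partial>lborel)"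
    by (intro nn_integral_mono) (auto split: split_indicator intro: bulk.Qmass_antimono)
  moreover have "(\<integral>\<^sup>+v. bulk.Qmass t * indicator {u..t} v \<partial>lborel) = bulk.Qmass t * ennreal (t - u)"
    using assms by (simp add: nn_integral_cmult)
  moreover have "bulk.Qmass t * ennreal (t - u) \<noteq> 0"
    using bulk.Qmass_pos[of t] assms by auto
  ultimately show False by simp
qed

lemma gfun_pos: "t > 0 \<Longrightarrow> gfun t > 0" by (simp add: gfun_def bulk.rJ(1))

text \<open>Both increments are integrals of \<open>Qmass\<close> over the same interval, one of
  them with the weight \<open>p / (2 * sqrt v)\<close>. Replacing this weight by its values at the
  ends compares them in both directions.\<close>

lemma gfun_diff:
  assumes "0 < u" "u \<le> t"
  shows "gfun t - gfun u \<le> p / 2 / sqrt u * (bI u - bI t)" "p / 2 / sqrt t * (bI u - bI t) \<le> gfun t - gfun u"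
proof -
  let ?X = "\<integral>\<^sup>+v. bulk.Qmass v * indicator {u..t} v \<partial>lborel"
  let ?Y = "\<integral>\<^sup>+v. ennreal (p / 2 / sqrt v) * bulk.Qmass v * indicator {u..t} v \<partial>lborel"
  have X: "?X = ennreal (bI u - bI t)" "bI t \<le> bI u" using rI_diff[of u t] assms by auto
  have e: "ennreal (gfun t) = ennreal (gfun u) + ?Y"
    using Jmass_bulk_diff[OF assms] bulk.rJ[of u] bulk.rJ[of t] assms
    by (simp add: gfun_def ennreal_mult)
  then have "?Y \<noteq> \<top>" by (metis ennreal_add_eq_top ennreal_neq_top)
  then obtain y where y: "?Y = ennreal y" "y \<ge> 0" by (cases ?Y) auto
  have "gfun t > 0" "gfun u > 0" using gfun_pos assms by auto
  then have ge: "gfun t = gfun u + y" using e y by (simp add: ennreal_plus[symmetric] del: ennreal_plus)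
  have "?Y \<le> (\<integral>\<^sup>+v. ennreal (p / 2 / sqrt u) * (bulk.Qmass v * indicator {u..t} v) \<partial>lborel)"
    using assms p_gt_1
    by (intro nn_integral_mono) (auto split: split_indicator intro!: mult_right_mono ennreal_leI divide_left_mono)
  also have "\<dots> = ennreal (p / 2 / sqrt u * (bI u - bI t))"
    using assms p_gt_1 X by (simp add: nn_integral_cmult X(1) ennreal_mult[symmetric])
  finally have "y \<le> p / 2 / sqrt u * (bI u - bI t)"
    using y assms p_gt_1 X(2) by (subst (asm) y(1)) (simp add: ennreal_le_iff)
  then show "gfun t - gfun u \<le> p / 2 / sqrt u * (bI u - bI t)" using ge by simp
  have "ennreal (p / 2 / sqrt t * (bI u - bI t)) = (\<integral>\<^sup>+v. ennreal (p / 2 / sqrt t) * (bulk.Qmass v * indicator {u..t} v) \<partial>lborel)"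
    using assms p_gt_1 X by (simp add: nn_integral_cmult X(1) ennreal_mult[symmetric])
  also have "\<dots> \<le> ?Y"
    using assms p_gt_1
    by (intro nn_integral_mono) (auto split: split_indicator intro!: mult_right_mono ennreal_leI divide_left_mono)
  finally have "p / 2 / sqrt t * (bI u - bI t) \<le> y" using y by (simp add: ennreal_le_iff)
  then show "p / 2 / sqrt t * (bI u - bI t) \<le> gfun t - gfun u" using ge by simp
qed

lemma gfun_mono: "0 < u \<Longrightarrow> u \<le> t \<Longrightarrow> gfun u \<le> gfun t"
proof -
  assume a: "0 < u" "u \<le> t"
  have "0 \<le> p / 2 / sqrt t * (bI u - bI t)" using a p_gt_1 rI_diff(2)[of u t] by simp
  then show ?thesis using gfun_diff(2)[OF a] by linarith
qed

lemma Gfun_eq: "t > 0 \<Longrightarrow> Gfun t = sqrt t * gfun t / bI t"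
  by (simp add: Gfun_def gfun_def mult.assoc[symmetric])

text \<open>In the form \<open>sqrt t * gfun t / bI t\<close> the numerator increases and the
  denominator decreases. This monotonicity makes the saddle point unique and decides the sign in the
  tangent-type bound.\<close>

lemma Gfun_strict:
  assumes "0 \<le> u" "u < t"
  shows "Gfun u < Gfun t"
proof (cases "u = 0")
  case True
  then show ?thesis using assms bulk.rI(1)[of t] bulk.rJ(1)[of t] by (simp add: Gfun_def)
next
  case False
  then have u: "u > 0" using assms by simp
  have I: "bI u > 0" "bI t > 0" "bI t \<le> bI u" using bulk.rI(1) rI_diff(2)[of u t] assms by auto
  have "sqrt u * gfun u < sqrt t * gfun t"
    using u assms gfun_mono[of u t] gfun_pos[of u] by (intro mult_less_le_imp_less) auto
  then have "sqrt u * gfun u / bI u < sqrt t * gfun t / bI u" using I by (simp add: divide_strict_right_mono)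
  also have "\<dots> \<le> sqrt t * gfun t / bI t"
    using I u assms gfun_pos[of t] by (intro divide_left_mono) auto
  finally show ?thesis using u assms by (simp add: Gfun_eq)
qed

text \<open>The logarithm of the part of the mixing density that carries the large exponents, used
  with \<open>\<beta> = q - 1\<close> and \<open>\<gamma> = j\<close>. Working with
  \<open>gfun\<close> instead of \<open>bJ\<close> absorbs all but a fixed power of
  \<open>t\<close>.\<close>

definition Flog :: "real \<Rightarrow> real \<Rightarrow> real \<Rightarrow> real" where
  "Flog \<beta> \<gamma> t = \<beta> * ln (gfun t) + \<gamma> * ln (bI t)"

text \<open>
  Concavity of the logarithm and the two-sided bounds of \<open>gfun_diff\<close> give a tangent-type bound
  with a factor whose sign only depends on the comparison of \<open>Gfun u\<close> with \<open>\<beta> p / (2 \<gamma>)\<close>.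
\<close>

lemma Flog_le:
  assumes u: "u > 0" and t: "t > 0" and bc: "\<beta> \<ge> 0" "\<gamma> \<ge> 0"
  shows "Flog \<beta> \<gamma> t \<le> Flog \<beta> \<gamma> u + (bI u - bI t) / (u * bJ u) * (\<beta> * p / 2 - \<gamma> * Gfun u)"
proof -
  have pos: "gfun t > 0" "gfun u > 0" "bI t > 0" "bI u > 0" "bJ u > 0"
    using u t gfun_pos bulk.rI(1) bulk.rJ(1) by auto
  have "gfun t - gfun u \<le> p / 2 / sqrt u * (bI u - bI t)"
  proof (cases "u \<le> t")
    case True
    then show ?thesis using gfun_diff(1)[OF u] by simp
  next
    case False
    \<comment> \<open>For \<open>t < u\<close> the roles are exchanged: the lower estimate on
      \<open>{t..u}\<close> has its weight at the right end, which is again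
      \<open>u\<close>.\<close>
    then have "p / 2 / sqrt u * (bI t - bI u) \<le> gfun u - gfun t" using gfun_diff(2)[OF t] by simp
    then show ?thesis by (simp add: algebra_simps)
  qed
  moreover have lnle: "ln x - ln y \<le> (x - y) / y" if "x > 0" "y > 0" for x y :: real
  proof -
    have "ln (x / y) \<le> x / y - 1" using that by (intro ln_le_minus_one) simp
    then show ?thesis using that by (simp add: ln_div diff_divide_distrib)
  qed
  ultimately have "ln (gfun t) - ln (gfun u) \<le> p / 2 / sqrt u * (bI u - bI t) / gfun u"
    using lnle[OF pos(1,2)] divide_right_mono[of "gfun t - gfun u" _ "gfun u"] pos by (meson less_imp_le order_trans)
  also have "\<dots> = p / 2 * (bI u - bI t) / (u * bJ u)" using u by (simp add: gfun_def)
  finally have 1: "\<beta> * (ln (gfun t) - ln (gfun u)) \<le> \<beta> * (p / 2 * (bI u - bI t) / (u * bJ u))"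
    using bc by (intro mult_left_mono)
  have "\<gamma> * (ln (bI t) - ln (bI u)) \<le> \<gamma> * ((bI t - bI u) / bI u)" using bc lnle[OF pos(3,4)] by (intro mult_left_mono)
  also have "\<dots> = - ((bI u - bI t) / (u * bJ u) * (\<gamma> * Gfun u))"
    using u pos by (simp add: Gfun_def field_simps)
  finally have 2: "\<gamma> * (ln (bI t) - ln (bI u)) \<le> - ((bI u - bI t) / (u * bJ u) * (\<gamma> * Gfun u))" .
  have "\<beta> * (p / 2 * D / E) - D / E * g = D / E * (\<beta> * p / 2 - g)" for D E g :: real
    by (simp add: right_diff_distrib mult_ac)
  then have "\<beta> * (p / 2 * (bI u - bI t) / (u * bJ u)) - (bI u - bI t) / (u * bJ u) * (\<gamma> * Gfun u) =
    (bI u - bI t) / (u * bJ u) * (\<beta> * p / 2 - \<gamma> * Gfun u)" .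
  then show ?thesis using 1 2 unfolding Flog_def by (simp add: right_diff_distrib)
qed

text \<open>What is left of the mixing density once \<open>exp (Flog ...)\<close> is split off. It
  does not involve \<open>n\<close>, so its total mass and its mass on a fixed interval act as
  constants.\<close>

definition base_wgt :: "real \<Rightarrow> ennreal" where
  "base_wgt t = ennreal (t powr (- (1 / 2))) * bulk.Qmass t * indicator {0<..} t"

lemma measurable_base_wgt [measurable]: "base_wgt \<in> borel_measurable borel"
  unfolding base_wgt_def by measurable

lemma wgt_eq:
  assumes "j < n" "t > 0"
  shows "bulk.wgt n (n - j) (real (n - j) / 2) t = base_wgt t * ennreal (exp (Flog (real (n - j - 1)) (real j) t))"
proof -
  define q where "q = n - j"
  have q: "q > 0" "n - q = j" using assms by (auto simp: q_def)
  have I: "bI t > 0" and J: "bJ t > 0" using assms bulk.rI(1) bulk.rJ(1) by auto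
  have "exp (Flog (real (q - 1)) (real j) t) = gfun t ^ (q - 1) * bI t ^ j"
    using gfun_pos[OF assms(2)] I by (simp add: Flog_def exp_add exp_of_nat_mult del: of_nat_diff)
  moreover have "t powr (real q / 2 - 1) = t powr (- (1 / 2)) * sqrt t ^ (q - 1)"
  proof -
    have "sqrt t ^ (q - 1) = t powr (1 / 2 * real (q - 1))"
      using assms by (simp add: powr_half_sqrt[symmetric] powr_realpow[symmetric] powr_powr del: of_nat_diff)
    moreover have "real q / 2 - 1 = - (1 / 2) + 1 / 2 * real (q - 1)"
      using q by (simp add: of_nat_diff field_simps)
    ultimately show ?thesis by (simp only: powr_add)
  qed
  ultimately have "t powr (real q / 2 - 1) * (bJ t ^ (q - 1) * bI t ^ j) = t powr (- (1 / 2)) * exp (Flog (real (q - 1)) (real j) t)"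
    by (simp only: gfun_def power_mult_distrib mult_ac)
  then have e: "ennreal (t powr (real q / 2 - 1)) * (ennreal (bJ t ^ (q - 1)) * ennreal (bI t ^ j)) =
    ennreal (t powr (- (1 / 2))) * ennreal (exp (Flog (real (q - 1)) (real j) t))"
    using I J by (simp add: ennreal_mult[symmetric] del: of_nat_diff)
  have "bulk.wgt n q (real q / 2) t = ennreal (t powr (real q / 2 - 1)) * (bulk.Qmass t * ennreal (bJ t ^ (q - 1)) * ennreal (bI t ^ j))"
    using assms I J bulk.rI(2)[of t] bulk.rJ(2)[of t] q
    by (simp add: bulk.wgt_def ennreal_power)
  also have "\<dots> = bulk.Qmass t * (ennreal (t powr (real q / 2 - 1)) * (ennreal (bJ t ^ (q - 1)) * ennreal (bI t ^ j)))"
    by (simp only: mult_ac)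
  also have "\<dots> = base_wgt t * ennreal (exp (Flog (real (q - 1)) (real j) t))"
    unfolding e using assms by (simp add: base_wgt_def mult_ac)
  finally show ?thesis unfolding q_def .
qed

text \<open>Integrating over \<open>t\<close> first gives \<open>Gamma (1 / 2)\<close> divided by
  \<open>\<bar>phi x\<bar>\<close>. One factor \<open>\<bar>x\<bar> powr (p - 1)\<close> then
  remains against \<open>exp (- (\<bar>x\<bar> powr p))\<close>.\<close>

lemma base_wgt_total: "(\<integral>\<^sup>+t. base_wgt t \<partial>lborel) < \<infinity>"
proof -
  have "(\<integral>\<^sup>+t. base_wgt t \<partial>lborel) = (\<integral>\<^sup>+t. (\<integral>\<^sup>+x. ennreal (t powr (- (1 / 2))) * indicator {0<..} t * ennreal ((phi x)\<^sup>2 * bulk.base t x) \<partial>lborel) \<partial>lborel)"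
    unfolding base_wgt_def bulk.Qmass_def
  proof (rule nn_integral_cong)
    fix t :: real
    show "ennreal (t powr (- (1 / 2))) * (\<integral>\<^sup>+x. ennreal ((phi x)\<^sup>2 * bulk.base t x) \<partial>lborel) * indicator {0<..} t =
      (\<integral>\<^sup>+x. ennreal (t powr (- (1 / 2))) * indicator {0<..} t * ennreal ((phi x)\<^sup>2 * bulk.base t x) \<partial>lborel)"
      by (subst nn_integral_cmult) (auto simp: mult_ac)
  qed
  also have "\<dots> = (\<integral>\<^sup>+x. (\<integral>\<^sup>+t. ennreal (t powr (- (1 / 2))) * indicator {0<..} t * ennreal ((phi x)\<^sup>2 * bulk.base t x) \<partial>lborel) \<partial>lborel)"
    by (rule nn_integral_Fubini_lborel[symmetric]) measurable
  also have "\<dots> \<le> (\<integral>\<^sup>+x. ennreal (sqrt pi) * ennreal (\<bar>x\<bar> powr (p - 1) * exp (- (1 * \<bar>x\<bar> powr p))) \<partial>lborel)"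
  proof (rule nn_integral_mono)
    fix x :: real
    show "(\<integral>\<^sup>+t. ennreal (t powr (- (1 / 2))) * indicator {0<..} t * ennreal ((phi x)\<^sup>2 * bulk.base t x) \<partial>lborel) \<le>
      ennreal (sqrt pi) * ennreal (\<bar>x\<bar> powr (p - 1) * exp (- (1 * \<bar>x\<bar> powr p)))"
    proof (cases "x = 0")
      case False
      let ?c = "(phi x)\<^sup>2"
      have c: "?c > 0" using False by simp
      have "ennreal (t powr (- (1 / 2))) * indicator {0<..} t * ennreal ((phi x)\<^sup>2 * bulk.base t x) =
        ennreal (?c * exp (- (\<bar>x\<bar> powr p))) * (ennreal (t powr (1 / 2 - 1) * exp (- (?c * t))) * indicator {0<..} t)" for t
      proof -
        have "bulk.base t x = exp (- (\<bar>x\<bar> powr p)) * exp (- (?c * t))"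
          unfolding bulk_base by (simp add: exp_add[symmetric] mult.commute)
        then have "t powr (- (1 / 2)) * (?c * bulk.base t x) = (?c * exp (- (\<bar>x\<bar> powr p))) * (t powr (1 / 2 - 1) * exp (- (?c * t)))" by simp
        then have "ennreal (t powr (- (1 / 2))) * ennreal (?c * bulk.base t x) = ennreal (?c * exp (- (\<bar>x\<bar> powr p))) * ennreal (t powr (1 / 2 - 1) * exp (- (?c * t)))"
          by (simp add: ennreal_mult[symmetric])
        then show ?thesis by (simp only: mult_ac)
      qed
      then have "(\<integral>\<^sup>+t. ennreal (t powr (- (1 / 2))) * indicator {0<..} t * ennreal ((phi x)\<^sup>2 * bulk.base t x) \<partial>lborel) =
        ennreal (?c * exp (- (\<bar>x\<bar> powr p))) * ennreal (Gamma (1 / 2) * ?c powr (- (1 / 2)))"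
        using nn_integral_Gamma[of "1 / 2" ?c] c by (simp only:) (subst nn_integral_cmult, auto)
      also have "\<dots> = ennreal (sqrt pi * (\<bar>x\<bar> powr (p - 1) * exp (- (\<bar>x\<bar> powr p))))"
      proof -
        have "?c powr (- (1 / 2)) = 1 / \<bar>phi x\<bar>"
          using c by (simp add: powr_minus_divide powr_half_sqrt)
        then have "?c * exp (- (\<bar>x\<bar> powr p)) * (Gamma (1 / 2) * ?c powr (- (1 / 2))) = sqrt pi * (?c / \<bar>phi x\<bar> * exp (- (\<bar>x\<bar> powr p)))"
          by (simp add: Gamma_one_half_real)
        also have "?c / \<bar>phi x\<bar> = \<bar>phi x\<bar>"
        proof -
          have "a * a / a = a" if "a \<noteq> 0" for a :: real using that by simp
          from this[of "\<bar>phi x\<bar>"] show ?thesis using False by (simp add: power2_eq_square)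
        qed
        finally show ?thesis by (simp add: ennreal_mult[symmetric] Gamma_one_half_real abs_phi)
      qed
      finally show ?thesis by (simp add: ennreal_mult)
    qed simp
  qed
  also have "\<dots> = ennreal (sqrt pi) * (\<integral>\<^sup>+x. ennreal (\<bar>x\<bar> powr (p - 1) * exp (- (1 * \<bar>x\<bar> powr p))) \<partial>lborel)"
    by (rule nn_integral_cmult) measurable
  also have "\<dots> < \<infinity>"
    using p_gt_1 by (subst nn_integral_abs_powr_exp) (auto simp: ennreal_mult_less_top)
  finally show ?thesis .
qed

lemma base_wgt_interval:
  assumes "0 < a" "a < b"
  shows "(\<integral>\<^sup>+t. base_wgt t * indicator {a..b} t \<partial>lborel) > 0"
proof -
  have "0 < ennreal (b powr (- (1 / 2))) * bulk.Qmass b * ennreal (b - a)"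
    using assms bulk.Qmass_pos[of b] by (simp add: ennreal_zero_less_mult_iff)
  also have "\<dots> = (\<integral>\<^sup>+t. ennreal (b powr (- (1 / 2))) * bulk.Qmass b * indicator {a..b} t \<partial>lborel)"
    using assms by (simp add: nn_integral_cmult)
  also have "\<dots> \<le> (\<integral>\<^sup>+t. base_wgt t * indicator {a..b} t \<partial>lborel)"
  proof (rule nn_integral_mono)
    fix t :: real
    show "ennreal (b powr (- (1 / 2))) * bulk.Qmass b * indicator {a..b} t \<le> base_wgt t * indicator {a..b} t"
    proof (cases "t \<in> {a..b}")
      case True
      then have "ennreal (b powr (- (1 / 2))) * bulk.Qmass b \<le> ennreal (t powr (- (1 / 2))) * bulk.Qmass t"
        using assms by (intro mult_mono ennreal_leI powr_mono2' bulk.Qmass_antimono) auto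
      then show ?thesis using True assms by (simp add: base_wgt_def)
    qed simp
  qed
  finally show ?thesis .
qed

text \<open>The mass on \<open>A\<close> is at most a constant times \<open>exp (a n)\<close>, while
  the total is at least \<open>exp (b n)\<close> times the positive mass of \<open>base_wgt\<close>
  on the reference set \<open>B\<close>. The diverging gap \<open>b n - a n\<close> beats both
  constants.\<close>

lemma wgt_far_le:
  fixes j :: "nat \<Rightarrow> nat" and a b :: "nat \<Rightarrow> real"
  defines "F \<equiv> \<lambda>n. Flog (real (n - j n - 1)) (real (j n))"
  assumes j: "eventually (\<lambda>n. j n < n) sequentially"
    and A [measurable]: "A \<in> sets borel" and B [measurable]: "B \<in> sets borel"
    and FA: "eventually (\<lambda>n. \<forall>t\<in>A. t > 0 \<longrightarrow> F n t \<le> a n) sequentially"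
    and FB: "eventually (\<lambda>n. \<forall>t\<in>B. t > 0 \<longrightarrow> b n \<le> F n t) sequentially"
    and ab: "filterlim (\<lambda>n. b n - a n) at_top sequentially"
    and mB: "(\<integral>\<^sup>+t. base_wgt t * indicator B t \<partial>lborel) > 0" and e: "e > 0"
  shows "eventually (\<lambda>n. (\<integral>\<^sup>+t. bulk.wgt n (n - j n) (real (n - j n) / 2) t * indicator A t \<partial>lborel) \<le>
    ennreal e * (\<integral>\<^sup>+t. bulk.wgt n (n - j n) (real (n - j n) / 2) t \<partial>lborel)) sequentially"
proof -
  obtain m0 where m0: "(\<integral>\<^sup>+t. base_wgt t \<partial>lborel) = ennreal m0" "m0 \<ge> 0"
    using base_wgt_total by (cases "\<integral>\<^sup>+t. base_wgt t \<partial>lborel") auto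
  have "(\<integral>\<^sup>+t. base_wgt t * indicator B t \<partial>lborel) \<le> (\<integral>\<^sup>+t. base_wgt t \<partial>lborel)"
    by (intro nn_integral_mono) (auto split: split_indicator)
  then obtain mb where mb: "(\<integral>\<^sup>+t. base_wgt t * indicator B t \<partial>lborel) = ennreal mb" "mb > 0"
    using m0 mB by (cases "\<integral>\<^sup>+t. base_wgt t * indicator B t \<partial>lborel") (auto simp: top_unique)
  \<comment> \<open>The \<open>1\<close> added to \<open>m0\<close> keeps the argument of the
    logarithm positive.\<close>
  have "eventually (\<lambda>n. ln ((m0 + 1) / (e * mb)) \<le> b n - a n) sequentially"
    using ab by (simp add: filterlim_at_top)
  then show ?thesis using FA FB j
  proof eventually_elim
    case (elim n)
    let ?w = "bulk.wgt n (n - j n) (real (n - j n) / 2)"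
    have "(m0 + 1) / (e * mb) \<le> exp (b n - a n)"
    proof -
      have "exp (ln ((m0 + 1) / (e * mb))) \<le> exp (b n - a n)" using elim(1) by simp
      then show ?thesis using m0 mb e by (subst (asm) exp_ln) auto
    qed
    then have "(m0 + 1) * exp (a n) \<le> e * mb * exp (b n)"
      using mb e by (simp add: exp_diff field_simps)
    moreover have "exp (a n) * m0 \<le> (m0 + 1) * exp (a n)" by (simp add: algebra_simps)
    ultimately have "exp (a n) * m0 \<le> e * mb * exp (b n)" by (rule order_trans[rotated])
    then have k: "exp (a n) * m0 \<le> e * (exp (b n) * mb)" by (simp only: mult_ac)
    have "(\<integral>\<^sup>+t. ?w t * indicator A t \<partial>lborel) \<le> (\<integral>\<^sup>+t. ennreal (exp (a n)) * base_wgt t \<partial>lborel)"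
    proof (rule nn_integral_mono)
      fix t :: real
      show "?w t * indicator A t \<le> ennreal (exp (a n)) * base_wgt t"
      proof (cases "t > 0 \<and> t \<in> A")
        case True
        then have "ennreal (exp (F n t)) \<le> ennreal (exp (a n))" using elim(2) by (intro ennreal_leI) auto
        then have "base_wgt t * ennreal (exp (F n t)) \<le> base_wgt t * ennreal (exp (a n))" by (rule mult_left_mono) simp
        then show ?thesis using True wgt_eq[OF elim(4)] by (simp add: F_def mult.commute)
      qed (auto simp: bulk.wgt_def)
    qed
    also have "\<dots> = ennreal (exp (a n) * m0)" using m0 by (simp add: nn_integral_cmult ennreal_mult)
    also have "\<dots> \<le> ennreal (e * (exp (b n) * mb))" using k by (rule ennreal_leI)
    also have "\<dots> = ennreal e * (ennreal (exp (b n)) * ennreal mb)" using e mb by (simp add: ennreal_mult)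
    also have "ennreal (exp (b n)) * ennreal mb = (\<integral>\<^sup>+t. ennreal (exp (b n)) * (base_wgt t * indicator B t) \<partial>lborel)"
      by (subst nn_integral_cmult) (auto simp: mb)
    also have "\<dots> \<le> (\<integral>\<^sup>+t. ?w t \<partial>lborel)"
    proof (rule nn_integral_mono)
      fix t :: real
      show "ennreal (exp (b n)) * (base_wgt t * indicator B t) \<le> ?w t"
      proof (cases "t > 0 \<and> t \<in> B")
        case True
        then have "ennreal (exp (b n)) \<le> ennreal (exp (F n t))" using elim(3) by (intro ennreal_leI) auto
        then have "base_wgt t * ennreal (exp (b n)) \<le> base_wgt t * ennreal (exp (F n t))" by (rule mult_left_mono) simp
        then show ?thesis using True wgt_eq[OF elim(4)] by (simp add: F_def mult.commute)
      qed (auto simp: base_wgt_def)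
    qed
    finally show ?case by (simp add: mult_left_mono)
  qed
qed

end

text \<open>The far part is subtracted in the reals, which is possible because the total is finite;
  an infinite \<open>near\<close> is trivial.\<close>

lemma ennreal_conc_of_far:
  assumes far: "far \<le> ennreal (1 - \<eta>) * tot" and split: "tot \<le> near + far" and fin: "tot < \<infinity>" and eta: "0 < \<eta>" "\<eta> < 1"
  shows "ennreal \<eta> * tot \<le> near"
proof -
  obtain x where x: "tot = ennreal x" "x \<ge> 0" using fin by (cases tot) auto
  have fle: "far \<le> ennreal ((1 - \<eta>) * x)" using far x eta by (simp add: ennreal_mult)
  show ?thesis
  proof (cases near)
    case (real y)
    have "ennreal x \<le> ennreal y + ennreal ((1 - \<eta>) * x)" using split fle x real by (metis add_left_mono order_trans)
    also have "\<dots> = ennreal (y + (1 - \<eta>) * x)" using real x eta by (intro ennreal_plus[symmetric]) auto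
    finally have "x \<le> y + (1 - \<eta>) * x" using real x eta by (subst (asm) ennreal_le_iff) auto
    then have "\<eta> * x \<le> y" by (simp add: algebra_simps)
    then show ?thesis using real x eta by (simp add: ennreal_mult[symmetric] ennreal_leI)
  qed simp
qed

section \<open>Concentration of the mixing parameter at the saddle point\<close>

context lp_exponent
begin

text \<open>Dropping \<open>\<bar>w\<bar> powr conj_exp\<close> from the exponent leaves a Gaussian
  integral.\<close>

lemma gfun_le: "t > 0 \<Longrightarrow> gfun t \<le> sqrt pi"
proof -
  assume t: "t > 0"
  have "bulk.Jmass t = (\<integral>\<^sup>+w. ennreal (exp (- (\<bar>w\<bar> powr conj_exp) - t * w\<^sup>2)) \<partial>lborel)"
    using nn_integral_base_phi[of "\<lambda>_. 1" t] by (simp add: bulk.Jmass_def)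
  also have "\<dots> \<le> (\<integral>\<^sup>+w. ennreal (\<bar>w\<bar> powr 0 * exp (- (t * \<bar>w\<bar> powr 2))) \<partial>lborel)"
  proof (rule nn_integral_mono_AE, use AE_lborel_singleton[of 0] in eventually_elim)
    fix w :: real assume "w \<noteq> 0"
    then show "ennreal (exp (- (\<bar>w\<bar> powr conj_exp) - t * w\<^sup>2)) \<le> ennreal (\<bar>w\<bar> powr 0 * exp (- (t * \<bar>w\<bar> powr 2)))"
      by (intro ennreal_leI) simp
  qed
  also have "\<dots> = ennreal (2 / 2 * Gamma ((0 + 1) / 2) * t powr (- ((0 + 1) / 2)))"
    by (rule nn_integral_abs_powr_exp) (use t in auto)
  also have "\<dots> = ennreal (sqrt pi / sqrt t)"
    using t by (simp add: Gamma_one_half_real powr_minus_divide powr_half_sqrt)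
  finally have "bJ t \<le> sqrt pi / sqrt t"
    using bulk.rJ(2)[of t] t by (simp add: ennreal_le_iff)
  then show ?thesis using t by (simp add: gfun_def field_simps)
qed

lemma wgt_total_finite:
  assumes "j < n"
  shows "(\<integral>\<^sup>+t. bulk.wgt n (n - j) (real (n - j) / 2) t \<partial>lborel) < \<infinity>"
proof -
  define c where "c = real (n - j - 1) * ln (sqrt pi) + real j * ln (bI 0)"
  have "(\<integral>\<^sup>+t. bulk.wgt n (n - j) (real (n - j) / 2) t \<partial>lborel) \<le> (\<integral>\<^sup>+t. ennreal (exp c) * base_wgt t \<partial>lborel)"
  proof (rule nn_integral_mono)
    fix t :: real
    show "bulk.wgt n (n - j) (real (n - j) / 2) t \<le> ennreal (exp c) * base_wgt t"
    proof (cases "t > 0")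
      case True
      have "Flog (real (n - j - 1)) (real j) t \<le> c"
        unfolding Flog_def c_def using True gfun_le[of t] gfun_pos[of t] rI_diff(2)[of 0 t] bulk.rI(1)[of t]
        by (intro add_mono mult_left_mono) (auto simp: ln_le_cancel_iff)
      then have "base_wgt t * ennreal (exp (Flog (real (n - j - 1)) (real j) t)) \<le> base_wgt t * ennreal (exp c)"
        by (intro mult_left_mono ennreal_leI) auto
      then show ?thesis using wgt_eq[OF assms True] by (simp add: mult.commute)
    qed (simp add: bulk.wgt_def)
  qed
  also have "\<dots> < \<infinity>" using base_wgt_total by (simp add: nn_integral_cmult ennreal_mult_less_top)
  finally show ?thesis .
qed

text \<open>\<open>H n u\<close> decides the sign in the tangent-type bound and is of order
  \<open>n\<close>, since \<open>H n u / n\<close> tends to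
  \<open>\<alpha> * (Gfun \<theta> - Gfun u)\<close>. Of the three points, \<open>u1\<close> fixes
  the sign of \<open>H\<close> on the side away from \<open>\<theta>\<close>, the interval between
  \<open>u1\<close> and \<open>u2\<close> is the reference set, and the step from \<open>u2\<close>
  to \<open>u3\<close> creates the diverging gap.\<close>

lemma bulk_far:
  fixes j :: "nat \<Rightarrow> nat"
  assumes j: "eventually (\<lambda>n. j n < n) sequentially" and lim: "(\<lambda>n. real (j n) / real n) \<longlonglongrightarrow> \<alpha>"
    and \<alpha>: "0 < \<alpha>" and \<theta>: "0 \<le> \<theta>" "(1 - \<alpha>) * p / 2 = \<alpha> * Gfun \<theta>"
    and far: "(\<theta> < u1 \<and> u1 < u2 \<and> u2 < u3 \<and> A = {u3<..}) \<or> (0 < u3 \<and> u3 < u2 \<and> u2 < u1 \<and> u1 < \<theta> \<and> A = {0<..<u3})"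
    and e: "e > 0"
  shows "eventually (\<lambda>n. (\<integral>\<^sup>+t. bulk.wgt n (n - j n) (real (n - j n) / 2) t * indicator A t \<partial>lborel) \<le>
    ennreal e * (\<integral>\<^sup>+t. bulk.wgt n (n - j n) (real (n - j n) / 2) t \<partial>lborel)) sequentially"
proof -
  define F where "F n = Flog (real (n - j n - 1)) (real (j n))" for n
  define H where "H n u = real (n - j n - 1) * p / 2 - real (j n) * Gfun u" for n u
  have Fle: "F n t \<le> F n u + (bI u - bI t) / (u * bJ u) * H n u" if "u > 0" "t > 0" for n t u
    unfolding F_def H_def by (rule Flog_le) (use that in auto)
  have pos: "u * bJ u > 0" if "u > 0" for u using that bulk.rJ(1)[of u] by simp
  have Hlim: "(\<lambda>n. H n u / real n) \<longlonglongrightarrow> \<alpha> * (Gfun \<theta> - Gfun u)" for u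
  proof -
    have "(\<lambda>n. (1 - real (j n) / real n - 1 / real n) * p / 2 - real (j n) / real n * Gfun u) \<longlonglongrightarrow> (1 - \<alpha> - 0) * p / 2 - \<alpha> * Gfun u"
      by (intro tendsto_intros lim lim_1_over_n) auto
    moreover have "eventually (\<lambda>n. (1 - real (j n) / real n - 1 / real n) * p / 2 - real (j n) / real n * Gfun u = H n u / real n) sequentially"
      using j eventually_gt_at_top[of 0]
    proof eventually_elim
      case (elim n)
      then have "real (n - j n - 1) = real n - real (j n) - 1" by (simp add: of_nat_diff)
      then show ?case unfolding H_def using elim by (simp add: field_simps)
    qed
    ultimately have "(\<lambda>n. H n u / real n) \<longlonglongrightarrow> (1 - \<alpha> - 0) * p / 2 - \<alpha> * Gfun u"
      by (rule Lim_transform_eventually)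
    moreover have "(1 - \<alpha> - 0) * p / 2 - \<alpha> * Gfun u = \<alpha> * (Gfun \<theta> - Gfun u)"
      using \<theta>(2) by (simp only: diff_zero right_diff_distrib)
    ultimately show ?thesis by (simp only:)
  qed
  have Hneg: "filterlim (\<lambda>n. - H n u) at_top sequentially" if "\<theta> < u" for u
  proof -
    have "\<alpha> * (Gfun u - Gfun \<theta>) > 0" using Gfun_strict[OF \<theta>(1) that] \<alpha> by simp
    moreover have "(\<lambda>n. - (H n u / real n)) \<longlonglongrightarrow> \<alpha> * (Gfun u - Gfun \<theta>)"
      using tendsto_minus[OF Hlim[of u]] by (simp add: algebra_simps)
    ultimately have "filterlim (\<lambda>n. - (H n u / real n) * real n) at_top sequentially"
      by (intro filterlim_tendsto_pos_mult_at_top[of _ "\<alpha> * (Gfun u - Gfun \<theta>)"] filterlim_real_sequentially)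
    moreover have "eventually (\<lambda>n. - (H n u / real n) * real n = - H n u) sequentially"
      using eventually_gt_at_top[of 0] by eventually_elim simp
    ultimately show ?thesis by (rule filterlim_cong[OF refl refl, THEN iffD1, rotated])
  qed
  have Hpos: "filterlim (\<lambda>n. H n u) at_top sequentially" if "0 < u" "u < \<theta>" for u
  proof -
    have "\<alpha> * (Gfun \<theta> - Gfun u) > 0" using Gfun_strict[of u \<theta>] that \<alpha> by simp
    then have "filterlim (\<lambda>n. H n u / real n * real n) at_top sequentially"
      by (intro filterlim_tendsto_pos_mult_at_top[OF Hlim] filterlim_real_sequentially)
    moreover have "eventually (\<lambda>n. H n u / real n * real n = H n u) sequentially"
      using eventually_gt_at_top[of 0] by eventually_elim simp
    ultimately show ?thesis by (rule filterlim_cong[OF refl refl, THEN iffD1, rotated])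
  qed
  have Hanti: "H n t \<le> H n u" if "0 \<le> u" "u \<le> t" for n u t
  proof (cases "u = t")
    case False
    then have "Gfun u \<le> Gfun t" using Gfun_strict[of u t] that by simp
    then show ?thesis unfolding H_def by (simp add: mult_left_mono)
  qed simp
  from far show ?thesis
  proof
    assume A: "\<theta> < u1 \<and> u1 < u2 \<and> u2 < u3 \<and> A = {u3<..}"
    then have u: "0 < u1" "0 < u2" "0 < u3" "u1 < u2" "u2 < u3" "\<theta> < u1" "\<theta> < u2" using \<theta> by auto
    have neg: "eventually (\<lambda>n. H n u1 \<le> 0) sequentially"
      using Hneg[OF u(6)] by (auto simp: filterlim_at_top dest: spec[of _ 0] elim: eventually_mono)
    show ?thesis
    proof (rule wgt_far_le[OF j, where B="{u1..u2}" and a="\<lambda>n. F n u3" and b="\<lambda>n. F n u2"])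
      show "eventually (\<lambda>n. \<forall>t\<in>A. t > 0 \<longrightarrow> Flog (real (n - j n - 1)) (real (j n)) t \<le> F n u3) sequentially"
        using neg
      proof eventually_elim
        case (elim n)
        show ?case
        proof (intro ballI impI)
          fix t assume t: "t \<in> A" "t > 0"
          have "bI u3 - bI t \<ge> 0" using rI_diff(2)[of u3 t] t A u by auto
          moreover have "H n u3 \<le> 0" using Hanti[of u1 u3 n] u elim by simp
          ultimately have "(bI u3 - bI t) / (u3 * bJ u3) * H n u3 \<le> 0"
            using pos[OF u(3)] by (intro mult_nonneg_nonpos divide_nonneg_pos)
          then show "Flog (real (n - j n - 1)) (real (j n)) t \<le> F n u3"
            using Fle[OF u(3) t(2), of n] by (simp add: F_def)
        qed
      qed
      show "eventually (\<lambda>n. \<forall>t\<in>{u1..u2}. t > 0 \<longrightarrow> F n u2 \<le> Flog (real (n - j n - 1)) (real (j n)) t) sequentially"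
        using neg
      proof eventually_elim
        case (elim n)
        show ?case
        proof (intro ballI impI)
          fix t assume t: "t \<in> {u1..u2}" "t > 0"
          have "bI t - bI u2 \<ge> 0" using rI_diff(2)[of t u2] t u by auto
          moreover have "H n t \<le> 0" using Hanti[of u1 t n] u t elim by simp
          ultimately have "(bI t - bI u2) / (t * bJ t) * H n t \<le> 0"
            using pos[OF t(2)] by (intro mult_nonneg_nonpos divide_nonneg_pos)
          then show "F n u2 \<le> Flog (real (n - j n - 1)) (real (j n)) t"
            using Fle[OF t(2) u(2), of n] by (simp add: F_def)
        qed
      qed
      have k: "(bI u2 - bI u3) / (u2 * bJ u2) > 0"
        using rI_strict[of u2 u3] u pos[OF u(2)] by (intro divide_pos_pos) auto
      have "filterlim (\<lambda>n. (bI u2 - bI u3) / (u2 * bJ u2) * (- H n u2)) at_top sequentially"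
        by (intro filterlim_tendsto_pos_mult_at_top[OF tendsto_const k] Hneg u)
      moreover have "(bI u2 - bI u3) / (u2 * bJ u2) * (- H n u2) \<le> F n u2 - F n u3" for n
        using Fle[OF u(2) u(3), of n] by simp
      ultimately show "filterlim (\<lambda>n. F n u2 - F n u3) at_top sequentially"
        by (rule filterlim_at_top_mono[OF _ always_eventually[OF allI]])
      show "(\<integral>\<^sup>+t. base_wgt t * indicator {u1..u2} t \<partial>lborel) > 0" by (rule base_wgt_interval) (use u in auto)
    qed (use A e in auto)
  next
    assume A: "0 < u3 \<and> u3 < u2 \<and> u2 < u1 \<and> u1 < \<theta> \<and> A = {0<..<u3}"
    then have u: "0 < u1" "0 < u2" "0 < u3" "u2 < u1" "u3 < u2" "u1 < \<theta>" "u2 < \<theta>" by auto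
    have ps: "eventually (\<lambda>n. 0 \<le> H n u1) sequentially"
      using Hpos[OF u(1) u(6)] by (simp add: filterlim_at_top)
    show ?thesis
    proof (rule wgt_far_le[OF j, where B="{u2..u1}" and a="\<lambda>n. F n u3" and b="\<lambda>n. F n u2"])
      show "eventually (\<lambda>n. \<forall>t\<in>A. t > 0 \<longrightarrow> Flog (real (n - j n - 1)) (real (j n)) t \<le> F n u3) sequentially"
        using ps
      proof eventually_elim
        case (elim n)
        show ?case
        proof (intro ballI impI)
          fix t assume t: "t \<in> A" "t > 0"
          have "bI u3 - bI t \<le> 0" using rI_diff(2)[of t u3] t A u by auto
          moreover have "H n u3 \<ge> 0" using Hanti[of u3 u1 n] u elim by simp
          ultimately have "(bI u3 - bI t) / (u3 * bJ u3) * H n u3 \<le> 0"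
            using pos[OF u(3)] by (intro mult_nonpos_nonneg divide_nonpos_pos)
          then show "Flog (real (n - j n - 1)) (real (j n)) t \<le> F n u3"
            using Fle[OF u(3) t(2), of n] by (simp add: F_def)
        qed
      qed
      show "eventually (\<lambda>n. \<forall>t\<in>{u2..u1}. t > 0 \<longrightarrow> F n u2 \<le> Flog (real (n - j n - 1)) (real (j n)) t) sequentially"
        using ps
      proof eventually_elim
        case (elim n)
        show ?case
        proof (intro ballI impI)
          fix t assume t: "t \<in> {u2..u1}" "t > 0"
          have "bI t - bI u2 \<le> 0" using rI_diff(2)[of u2 t] t u by auto
          moreover have "H n t \<ge> 0" using Hanti[of t u1 n] u t elim by simp
          ultimately have "(bI t - bI u2) / (t * bJ t) * H n t \<le> 0"
            using pos[OF t(2)] by (intro mult_nonpos_nonneg divide_nonpos_pos)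
          then show "F n u2 \<le> Flog (real (n - j n - 1)) (real (j n)) t"
            using Fle[OF t(2) u(2), of n] by (simp add: F_def)
        qed
      qed
      have k: "(bI u3 - bI u2) / (u2 * bJ u2) > 0"
        using rI_strict[of u3 u2] u pos[OF u(2)] by (intro divide_pos_pos) auto
      have "filterlim (\<lambda>n. (bI u3 - bI u2) / (u2 * bJ u2) * H n u2) at_top sequentially"
        by (intro filterlim_tendsto_pos_mult_at_top[OF tendsto_const k] Hpos u)
      moreover have "(bI u3 - bI u2) / (u2 * bJ u2) * H n u2 \<le> F n u2 - F n u3" for n
      proof -
        have "(bI u2 - bI u3) / (u2 * bJ u2) * H n u2 = - ((bI u3 - bI u2) / (u2 * bJ u2) * H n u2)"
          by (simp add: minus_mult_left minus_divide_left)
        then show ?thesis using Fle[OF u(2) u(3), of n] by linarith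
      qed
      ultimately show "filterlim (\<lambda>n. F n u2 - F n u3) at_top sequentially"
        by (rule filterlim_at_top_mono[OF _ always_eventually[OF allI]])
      show "(\<integral>\<^sup>+t. base_wgt t * indicator {u2..u1} t \<partial>lborel) > 0" by (rule base_wgt_interval) (use u in auto)
    qed (use A e in auto)
  qed
qed

lemma bulk_conc:
  fixes j :: "nat \<Rightarrow> nat"
  assumes j: "eventually (\<lambda>n. j n < n) sequentially" and lim: "(\<lambda>n. real (j n) / real n) \<longlonglongrightarrow> \<alpha>"
    and \<alpha>: "0 < \<alpha>" and \<theta>: "0 \<le> \<theta>" "(1 - \<alpha>) * p / 2 = \<alpha> * Gfun \<theta>"
    and \<delta>: "\<delta> > 0" and \<eta>: "0 < \<eta>" "\<eta> < 1"
  shows "eventually (\<lambda>n. ennreal \<eta> * (\<integral>\<^sup>+t. bulk.wgt n (n - j n) (real (n - j n) / 2) t \<partial>lborel) \<le>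
        (\<integral>\<^sup>+t. bulk.wgt n (n - j n) (real (n - j n) / 2) t * indicator {t. \<bar>t - \<theta>\<bar> \<le> \<delta>} t \<partial>lborel)) sequentially"
proof -
  \<comment> \<open>The left part ends at least at \<open>\<theta> / 2\<close>, which keeps all
    comparison points positive; for \<open>\<theta> = 0\<close> there is no left part.\<close>
  define L where "L = (if \<theta> = 0 then {} else {0<..<\<theta> - min \<delta> (\<theta> / 2)})"
  let ?w = "\<lambda>n. bulk.wgt n (n - j n) (real (n - j n) / 2)"
  have [measurable]: "L \<in> sets borel" by (simp add: L_def)
  have eL: "eventually (\<lambda>n. (\<integral>\<^sup>+t. ?w n t * indicator L t \<partial>lborel) \<le> ennreal ((1 - \<eta>) / 2) * (\<integral>\<^sup>+t. ?w n t \<partial>lborel)) sequentially"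
  proof (cases "\<theta> = 0")
    case False
    let ?d = "min \<delta> (\<theta> / 2)"
    have d: "?d > 0" "?d < \<theta>" using False \<theta> \<delta> by auto
    show ?thesis
      by (rule bulk_far[OF j lim \<alpha> \<theta>, where ?u1.0="\<theta> - ?d / 3" and ?u2.0="\<theta> - ?d / 2" and ?u3.0="\<theta> - ?d"])
        (use d \<eta> False in \<open>auto simp: L_def\<close>)
  qed (simp add: L_def)
  have eR: "eventually (\<lambda>n. (\<integral>\<^sup>+t. ?w n t * indicator {\<theta> + \<delta><..} t \<partial>lborel) \<le> ennreal ((1 - \<eta>) / 2) * (\<integral>\<^sup>+t. ?w n t \<partial>lborel)) sequentially"
    by (rule bulk_far[OF j lim \<alpha> \<theta>, where ?u1.0="\<theta> + \<delta> / 3" and ?u2.0="\<theta> + \<delta> / 2" and ?u3.0="\<theta> + \<delta>"])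
      (use \<delta> \<eta> in auto)
  show ?thesis using eL eR j
  proof eventually_elim
    case (elim n)
    let ?near = "\<integral>\<^sup>+t. ?w n t * indicator {t. \<bar>t - \<theta>\<bar> \<le> \<delta>} t \<partial>lborel"
    let ?far = "(\<integral>\<^sup>+t. ?w n t * indicator L t \<partial>lborel) + (\<integral>\<^sup>+t. ?w n t * indicator {\<theta> + \<delta><..} t \<partial>lborel)"
    show ?case
    proof (rule ennreal_conc_of_far)
      have "?far \<le> ennreal ((1 - \<eta>) / 2) * (\<integral>\<^sup>+t. ?w n t \<partial>lborel) + ennreal ((1 - \<eta>) / 2) * (\<integral>\<^sup>+t. ?w n t \<partial>lborel)"
        by (intro add_mono elim)
      also have "\<dots> = (ennreal ((1 - \<eta>) / 2) + ennreal ((1 - \<eta>) / 2)) * (\<integral>\<^sup>+t. ?w n t \<partial>lborel)" by (simp only: distrib_right)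
      also have "ennreal ((1 - \<eta>) / 2) + ennreal ((1 - \<eta>) / 2) = ennreal (1 - \<eta>)"
        using \<eta> by (simp add: ennreal_plus[symmetric] del: ennreal_plus)
      finally show "?far \<le> ennreal (1 - \<eta>) * (\<integral>\<^sup>+t. ?w n t \<partial>lborel)" .
      have "(\<integral>\<^sup>+t. ?w n t \<partial>lborel) \<le> (\<integral>\<^sup>+t. ?w n t * indicator {t. \<bar>t - \<theta>\<bar> \<le> \<delta>} t + (?w n t * indicator L t + ?w n t * indicator {\<theta> + \<delta><..} t) \<partial>lborel)"
      proof (rule nn_integral_mono)
        fix t :: real
        show "?w n t \<le> ?w n t * indicator {t. \<bar>t - \<theta>\<bar> \<le> \<delta>} t + (?w n t * indicator L t + ?w n t * indicator {\<theta> + \<delta><..} t)"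
        proof (cases "t > 0")
          case True
          then consider "\<bar>t - \<theta>\<bar> \<le> \<delta>" | "t \<in> L" | "t \<in> {\<theta> + \<delta><..}"
            using \<theta> by (fastforce simp: L_def min_def abs_le_iff split: if_splits)
          then show ?thesis by cases (auto intro: add_increasing add_increasing2)
        qed (simp add: bulk.wgt_def)
      qed
      also have "\<dots> = ?near + (\<integral>\<^sup>+t. ?w n t * indicator L t + ?w n t * indicator {\<theta> + \<delta><..} t \<partial>lborel)"
        by (rule nn_integral_add) measurable
      also have "(\<integral>\<^sup>+t. ?w n t * indicator L t + ?w n t * indicator {\<theta> + \<delta><..} t \<partial>lborel) = ?far"
        by (rule nn_integral_add) measurable
      finally show "(\<integral>\<^sup>+t. ?w n t \<partial>lborel) \<le> ?near + ?far" .
    qed (use wgt_total_finite[OF elim(3)] \<eta> in auto)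
  qed
qed

end

context lp_mixture
begin

text \<open>Both masses are pattern integrals for \<open>r = 1\<close>, with the empty pattern and
  with \<open>{0}\<close>.\<close>

lemma rI_rJ_tendsto:
  assumes "\<And>m. t m \<ge> 0" "t \<longlonglongrightarrow> \<theta>"
  shows "(\<lambda>m. rI (t m)) \<longlonglongrightarrow> rI \<theta>" "(\<lambda>m. rJ (t m)) \<longlonglongrightarrow> rJ \<theta>"
proof -
  have \<theta>: "\<theta> \<ge> 0" using assms by (intro LIMSEQ_le_const[of t]) auto
  have "(\<lambda>m. pattern_integral 1 (\<lambda>_. 1) {} (t m)) \<longlonglongrightarrow> pattern_integral 1 (\<lambda>_. 1) {} \<theta>" "(\<lambda>m. pattern_integral 1 (\<lambda>_. 1) {0} (t m)) \<longlonglongrightarrow> pattern_integral 1 (\<lambda>_. 1) {0} \<theta>"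
    by (intro pattern_integral_tendsto assms; simp)+
  then have "(\<lambda>m. Imass (t m)) \<longlonglongrightarrow> Imass \<theta>" "(\<lambda>m. Jmass (t m)) \<longlonglongrightarrow> Jmass \<theta>"
    by (simp_all add: pattern_integral_one)
  then show "(\<lambda>m. rI (t m)) \<longlonglongrightarrow> rI \<theta>" "(\<lambda>m. rJ (t m)) \<longlonglongrightarrow> rJ \<theta>"
    using \<theta> rI(2)[OF \<theta>] rJ(2)[OF \<theta>] rI(1)[OF \<theta>] rJ(1)[OF \<theta>]
    unfolding rI_def[of "t _"] rJ_def[of "t _"] by (auto intro!: tendsto_enn2real)
qed

end

context lp_exponent
begin

lemma continuous_Gfun: "continuous_on {0..} Gfun"
  unfolding continuous_on_sequentially o_def
proof (intro allI ballI impI, elim conjE)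
  fix x :: "nat \<Rightarrow> real" and a :: real assume a: "a \<in> {0..}" "\<forall>n. x n \<in> {0..}" "x \<longlonglongrightarrow> a"
  have "(\<lambda>n. bI (x n)) \<longlonglongrightarrow> bI a" "(\<lambda>n. bJ (x n)) \<longlonglongrightarrow> bJ a"
    using a by (intro bulk.rI_rJ_tendsto; auto)+
  then show "(\<lambda>n. Gfun (x n)) \<longlonglongrightarrow> Gfun a"
    unfolding Gfun_def using a bulk.rI(1)[of a] by (intro tendsto_intros) auto
qed

text \<open>Uniqueness is strict monotonicity. For existence, \<open>Gfun\<close> starts at
  \<open>0\<close> and is at least \<open>sqrt t * gfun 1 / bI 0\<close> for
  \<open>t \<ge> 1\<close>, because \<open>gfun\<close> is nondecreasing and
  \<open>bI t \<le> bI 0\<close>.\<close>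

lemma Gfun_unique_solution:
  assumes y: "y > 0"
  shows "\<exists>!\<theta>. \<theta> > 0 \<and> Gfun \<theta> = y"
proof -
  have c: "gfun 1 / bI 0 > 0" using gfun_pos[of 1] bulk.rI(1)[of 0] by simp
  \<comment> \<open>The square makes the lower bound reach \<open>y\<close>, and
    \<open>b \<ge> 1\<close> permits the comparison with \<open>gfun 1\<close>.\<close>
  define b where "b = max 1 ((y / (gfun 1 / bI 0))\<^sup>2)"
  have b: "b \<ge> 1" "sqrt b \<ge> y / (gfun 1 / bI 0)"
  proof -
    have "y / (gfun 1 / bI 0) \<ge> 0" using y c by (intro divide_nonneg_pos) auto
    then have "y / (gfun 1 / bI 0) = sqrt ((y / (gfun 1 / bI 0))\<^sup>2)" by (simp only: real_sqrt_abs abs_of_nonneg)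
    also have "\<dots> \<le> sqrt b" unfolding b_def by (intro real_sqrt_le_mono) simp
    finally show "sqrt b \<ge> y / (gfun 1 / bI 0)" .
  qed (simp add: b_def)
  have "y \<le> sqrt b * (gfun 1 / bI 0)" using b(2) by (simp only: pos_divide_le_eq[OF c])
  also have "\<dots> \<le> sqrt b * gfun b / bI b"
    using b(1) gfun_mono[of 1 b] rI_diff(2)[of 0 b] bulk.rI(1)[of b] gfun_pos[of 1]
    by (simp add: frac_le mult_left_mono)
  also have "\<dots> = Gfun b" using b by (simp add: Gfun_eq)
  finally have "y \<le> Gfun b" .
  moreover have G0: "Gfun 0 = 0" by (simp add: Gfun_def)
  ultimately obtain \<theta> where \<theta>: "0 \<le> \<theta>" "\<theta> \<le> b" "Gfun \<theta> = y"
    using IVT'[of Gfun 0 y b] y b continuous_on_subset[OF continuous_Gfun, of "{0..b}"] by auto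
  then have "\<theta> > 0" using y G0 by (cases "\<theta> = 0") auto
  then show ?thesis
    using \<theta>(3) Gfun_strict by (metis linorder_neqE_linordered_idom order_less_irrefl order_less_imp_le)
qed

section \<open>The quantities of the statement, the radial moments and the bulk limit\<close>

lemma I_int_eq: "\<theta> \<ge> 0 \<Longrightarrow> I_int p \<theta> = bI \<theta>"
  unfolding I_int_def bulk.rI_def bulk.Imass_def bulk.base_def unfolding bexp_def
  by (rule integral_eq_nn_integral) auto

lemma J_int_eq: "\<theta> \<ge> 0 \<Longrightarrow> (p - 1) * J_int p \<theta> = bJ \<theta>"
proof -
  have "bJ \<theta> = (LINT x|lborel. dphi x * bulk.base \<theta> x)"
    unfolding bulk.rJ_def bulk.Jmass_def by (rule integral_eq_nn_integral[symmetric]) auto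
  also have "\<dots> = (LINT x|lborel. (p - 1) * (\<bar>x\<bar> powr (p - 2) * exp (- (\<bar>x\<bar> powr p) - \<theta> * \<bar>x\<bar> powr (2 * p - 2))))"
    unfolding bulk.base_def unfolding dphi_def bexp_def by (simp add: mult.assoc)
  also have "\<dots> = (p - 1) * J_int p \<theta>" unfolding J_int_def by (rule integral_mult_right_zero)
  finally show ?thesis by simp
qed

text \<open>The factor \<open>p - 1\<close> between \<open>J_int\<close> and \<open>bJ\<close>
  cancels the one in the defining equation.\<close>

lemma is_theta_iff:
  assumes "0 < \<alpha>" shows "is_theta p \<alpha> \<theta> \<longleftrightarrow> \<theta> > 0 \<and> Gfun \<theta> = (1 - \<alpha>) * p / (2 * \<alpha>)"
proof (cases "\<theta> > 0")
  case True
  have J: "J_int p \<theta> = bJ \<theta> / (p - 1)" using J_int_eq[of \<theta>] True p_gt_1 by (simp add: field_simps)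
  have "\<theta> * (J_int p \<theta> / I_int p \<theta>) = Gfun \<theta> / (p - 1)"
    using True by (simp add: J I_int_eq Gfun_def)
  moreover have "(1 - \<alpha>) * p / (2 * (p - 1) * \<alpha>) = (1 - \<alpha>) * p / (2 * \<alpha>) / (p - 1)" by (simp add: mult_ac)
  ultimately have "is_theta p \<alpha> \<theta> \<longleftrightarrow> Gfun \<theta> / (p - 1) = (1 - \<alpha>) * p / (2 * \<alpha>) / (p - 1)"
    unfolding is_theta_def using True by (simp only: simp_thms)
  moreover have "p - 1 \<noteq> 0" using p_gt_1 by simp
  ultimately show ?thesis using True by (simp only: divide_cancel_right simp_thms)
qed (simp add: is_theta_def)

lemma bulk_density_eq:
  assumes "\<theta> \<ge> 0" shows "bulk_density p \<alpha> \<theta> = bulk.limit_density \<alpha> \<theta>"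
proof
  fix u
  have "dphi u * bulk.base \<theta> u / bJ \<theta> = \<bar>u\<bar> powr (p - 2) * bulk.base \<theta> u / J_int p \<theta>"
    unfolding J_int_eq[OF assms, symmetric] dphi_def using p_gt_1 by simp
  then show "bulk_density p \<alpha> \<theta> u = bulk.limit_density \<alpha> \<theta> u"
    unfolding bulk_density_def bulk.limit_density_def I_int_eq[OF assms]
    unfolding bulk.base_def unfolding bexp_def by (simp add: mult.assoc)
qed

lemma bulk_Asum: "bulk.Asum n x = Spow n x" by (simp add: bulk.Asum_def Spow_def)
lemma bulk_Bsum: "bulk.Bsum n x = Upow n x" unfolding bulk.Bsum_def Upow_def unfolding bexp_def ..

lemma bulk_mix_weight:
  "bulk.mix_weight n q (q / 2) x = ennreal (exp (- Spow n x) * Spow n x powr 0 * Upow n x powr (- (q / 2)) * hsym n q x)"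
  unfolding bulk.mix_weight_def bulk_Asum bulk_Bsum by (cases "Spow n x = 0") (auto simp: hsym_zero)

text \<open>Raising the exponent \<open>b\<close> of the first kernel multiplies the integrand by a
  power of \<open>Spow\<close>, but changes the total mass only through a Gamma value, the intrinsic
  volume being the same. The quotients are the moments of a Gamma distribution with shape
  \<open>j / p + 1\<close>.\<close>

lemma bulk_moments:
  fixes n j :: nat
  assumes n: "n \<ge> 2" and j: "j < n" and M: "prob_space M" and X: "X \<in> measurable M (bdry_space n (lp_ball p n))"
    and law: "\<And>A. A \<in> sets (bdry_space n (lp_ball p n)) \<Longrightarrow> measure M (X -` A \<inter> space M) =
         measure (curvature_measure n (lp_ball p n) j) A / intrinsic_volume n (lp_ball p n) j"
  defines "P \<equiv> bulk.mix_law n (n - j) (real (n - j) / 2)"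
  shows "(\<integral>\<^sup>+x. ennreal (Spow n x / n) \<partial>P) = ennreal ((j / p + 1) / n)"
    "(\<integral>\<^sup>+x. ennreal ((Spow n x / n)\<^sup>2) \<partial>P) = ennreal ((j / p + 2) * (j / p + 1) / (real n)\<^sup>2)"
    "prob_space P"
proof -
  let ?q = "n - j"
  let ?a = "real j / p + 1"
  have a: "?a > 0" using p_gt_1 by (simp add: add_nonneg_pos)
  have n0: "n > 0" using n by simp
  define w where "w b x = ennreal (exp (- Spow n x) * Spow n x powr b * Upow n x powr (- (real ?q / 2)) * hsym n ?q x)" for b x
  define R where "R = intrinsic_volume n (lp_ball p n) j * (real ?q * unit_ball_vol (real ?q) / p)"
  have Gp: "Gamma (j / p + b + 1) > 0" if "b \<ge> 0" for b using that p_gt_1 by (intro Gamma_real_pos) (simp add: add_nonneg_pos)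
  have W: "(\<integral>\<^sup>+x. w b x \<partial>lborel_n n) = ennreal (Gamma (j / p + b + 1) * R)" and R: "R > 0" if "b \<ge> 0" for b
  proof -
    have q0: "?q > 0" using j by simp
    note r = curvature_law_repr(1,2)[OF n0 j Gp[OF that] measurable_kernel1[of n ?q b] kernel1_admissible[OF j that] M X law]
    show "(\<integral>\<^sup>+x. w b x \<partial>lborel_n n) = ennreal (Gamma (j / p + b + 1) * R)"
      using r(2) unfolding kernel1_weight[OF q0] w_def R_def .
    have u: "unit_ball_vol (real ?q) > 0" by (intro unit_ball_vol_pos) simp
    show "R > 0" unfolding R_def using r(1) u j p_gt_1 by (intro mult_pos_pos divide_pos_pos) auto
  qed
  have Rp: "R > 0" using R[of 0] by simp
  have mix_weight: "bulk.mix_weight n ?q (real ?q / 2) x = w 0 x" for x unfolding bulk_mix_weight w_def ..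
  have Wd': "bulk.mix_weight n ?q (real ?q / 2) = w 0" by (rule ext) (rule mix_weight)
  have W0: "(\<integral>\<^sup>+x. w 0 x \<partial>lborel_n n) = ennreal (Gamma ?a * R)" using W[of 0] by simp
  have [measurable]: "w b \<in> borel_measurable (lborel_n n)" for b unfolding w_def by measurable
  have mom: "(\<integral>\<^sup>+x. ennreal (c * Spow n x powr b) \<partial>P) = ennreal (c * (Gamma (j / p + b + 1) / Gamma ?a))"
    if b: "b > 0" and c: "c \<ge> 0" for b c
  proof -
    have "(\<integral>\<^sup>+x. ennreal (c * Spow n x powr b) \<partial>P) = (\<integral>\<^sup>+x. ennreal (c * Spow n x powr b) * w 0 x \<partial>lborel_n n) / ennreal (Gamma ?a * R)"
      unfolding P_def by (subst bulk.nn_integral_mix_law) (auto simp: Wd' W0)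
    also have "(\<integral>\<^sup>+x. ennreal (c * Spow n x powr b) * w 0 x \<partial>lborel_n n) = (\<integral>\<^sup>+x. ennreal c * w b x \<partial>lborel_n n)"
    proof (rule nn_integral_cong)
      fix x
      have "c * Spow n x powr b * (exp (- Spow n x) * Spow n x powr 0 * Upow n x powr (- (real ?q / 2)) * hsym n ?q x) =
        c * (exp (- Spow n x) * Spow n x powr b * Upow n x powr (- (real ?q / 2)) * hsym n ?q x)"
        by (cases "Spow n x = 0") auto
      then show "ennreal (c * Spow n x powr b) * w 0 x = ennreal c * w b x"
        unfolding w_def using c by (subst (1 2) ennreal_mult[symmetric]) auto
    qed
    also have "\<dots> = ennreal c * ennreal (Gamma (j / p + b + 1) * R)"
      using W[of b] b by (simp add: nn_integral_cmult)
    also have "\<dots> / ennreal (Gamma ?a * R) = ennreal (c * (Gamma (j / p + b + 1) / Gamma ?a))"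
      using c Rp Gp[of b] Gp[of 0] b by (simp add: ennreal_mult[symmetric] divide_ennreal)
    finally show ?thesis .
  qed
  have notint: "x \<notin> \<int>\<^sub>\<le>\<^sub>0" if "x > 0" for x :: real using that by (auto elim!: nonpos_Ints_cases)
  have G1: "Gamma (j / p + 1 + 1) = ?a * Gamma ?a" by (rule Gamma_plus1) (rule notint[OF a])
  then have G1': "Gamma (2 + j / p) = ?a * Gamma ?a" by (simp add: add.commute)
  have "Gamma (j / p + 2 + 1) = (j / p + 2) * Gamma (j / p + 2)"
    by (rule Gamma_plus1) (rule notint, use a in simp)
  then have G2: "Gamma (j / p + 2 + 1) = (j / p + 2) * (?a * Gamma ?a)" using G1 by (simp add: add.assoc)
  then have G2': "Gamma (3 + j / p) = (j / p + 2) * (?a * Gamma ?a)" by (simp add: add.commute add.left_commute)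
  have Gpos: "Gamma ?a > 0" using Gp[of 0] by simp
  have "(\<integral>\<^sup>+x. ennreal (Spow n x / n) \<partial>P) = (\<integral>\<^sup>+x. ennreal (1 / n * Spow n x powr 1) \<partial>P)" by simp
  also have "\<dots> = ennreal ((j / p + 1) / n)"
    by (subst mom) (use Gpos in \<open>simp_all add: G1'\<close>)
  finally show "(\<integral>\<^sup>+x. ennreal (Spow n x / n) \<partial>P) = ennreal ((j / p + 1) / n)" .
  have "(\<integral>\<^sup>+x. ennreal ((Spow n x / n)\<^sup>2) \<partial>P) = (\<integral>\<^sup>+x. ennreal (1 / (real n)\<^sup>2 * Spow n x powr 2) \<partial>P)"
    by (simp add: power_divide)
  also have "\<dots> = ennreal ((j / p + 2) * (j / p + 1) / (real n)\<^sup>2)"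
    by (subst mom) (use Gpos in \<open>simp_all add: G2'\<close>)
  finally show "(\<integral>\<^sup>+x. ennreal ((Spow n x / n)\<^sup>2) \<partial>P) = ennreal ((j / p + 2) * (j / p + 1) / (real n)\<^sup>2)" .
  show "prob_space P"
  proof
    have "emeasure P (space P) = (\<integral>\<^sup>+x. 1 \<partial>P)" by simp
    also have "\<dots> = (\<integral>\<^sup>+x. w 0 x \<partial>lborel_n n) / (\<integral>\<^sup>+x. w 0 x \<partial>lborel_n n)"
      unfolding P_def by (subst bulk.nn_integral_mix_law) (auto simp: Wd')
    also have "\<dots> = 1" unfolding W0 using Rp Gpos by (intro ennreal_divide_self) auto
    finally show "emeasure P (space P) = 1" .
  qed
qed

text \<open>The value \<open>\<alpha> = 1\<close> is included; it forces
  \<open>Gfun \<theta> = 0\<close>, hence \<open>\<theta> = 0\<close>, and makes the right edge a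
  special case. The scale comes from \<open>Spow n x / n\<close>, which concentrates at
  \<open>\<alpha> / p\<close>.\<close>

lemma bulk_limit:
  fixes M :: "nat \<Rightarrow> 'a measure" and X :: "nat \<Rightarrow> 'a \<Rightarrow> nat \<Rightarrow> real" and j :: "nat \<Rightarrow> nat"
  assumes j: "\<And>n. n \<ge> 2 \<Longrightarrow> j n < n"
    and M: "\<And>n. n \<ge> 2 \<Longrightarrow> prob_space (M n)"
    and X: "\<And>n. n \<ge> 2 \<Longrightarrow> X n \<in> measurable (M n) (bdry_space n (lp_ball p n))"
    and law: "\<And>n A. n \<ge> 2 \<Longrightarrow> A \<in> sets (bdry_space n (lp_ball p n)) \<Longrightarrow>
       measure (M n) (X n -` A \<inter> space (M n)) =
         measure (curvature_measure n (lp_ball p n) (j n)) A / intrinsic_volume n (lp_ball p n) (j n)"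
    and lim: "(\<lambda>n. real (j n) / real n) \<longlonglongrightarrow> \<alpha>" and \<alpha>: "0 < \<alpha>" "\<alpha> \<le> 1"
    and \<theta>: "0 \<le> \<theta>" "(1 - \<alpha>) * p / 2 = \<alpha> * Gfun \<theta>"
  shows "weakly_conv_n r (\<lambda>n. scaled_marginal_law p r (M n) n (X n))
    (scaled_iid_law r ((p / \<alpha>) powr (1 / p)) (bulk_density p \<alpha> \<theta>))"
  unfolding bulk_density_eq[OF \<theta>(1)]
proof (rule bulk.weak_limit[where j=j and k="\<lambda>n. kernel1 n (n - j n) 0" and C="\<lambda>n. Gamma (j n / p + 0 + 1)" and c="\<lambda>n. real (n - j n) / 2" and \<theta>=\<theta>])
  have je: "eventually (\<lambda>n. j n < n) sequentially"
    using eventually_ge_at_top[of 2] by eventually_elim (rule j)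
  fix \<delta> \<eta> :: real assume "0 < \<delta>" "0 < \<eta>" "\<eta> < 1"
  then show "eventually (\<lambda>n. ennreal \<eta> * (\<integral>\<^sup>+t. bulk.wgt n (n - j n) (real (n - j n) / 2) t \<partial>lborel) \<le>
        (\<integral>\<^sup>+t. bulk.wgt n (n - j n) (real (n - j n) / 2) t * indicator {t. \<bar>t - \<theta>\<bar> \<le> \<delta>} t \<partial>lborel)) sequentially"
    by (intro bulk_conc[OF je lim \<alpha>(1) \<theta>])
next
  fix \<epsilon> :: real assume e: "\<epsilon> > 0"
  let ?P = "\<lambda>n. bulk.mix_law n (n - j n) (real (n - j n) / 2)"
  have inv: "(\<lambda>n. 1 / real n) \<longlonglongrightarrow> 0" by (rule lim_1_over_n)
  have e1: "eventually (\<lambda>n. real (j n) / real n / p + 1 / real n = (j n / p + 1) / n) sequentially"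
    by (rule always_eventually) (simp add: add_divide_distrib mult.commute)
  have "(\<lambda>n. real (j n) / real n / p + 1 / real n) \<longlonglongrightarrow> \<alpha> / p + 0"
    by (intro tendsto_intros lim inv) (use p_gt_1 in auto)
  from Lim_transform_eventually[OF this e1] have a1: "(\<lambda>n. (j n / p + 1) / n) \<longlonglongrightarrow> \<alpha> / p" by simp
  have "(\<lambda>n. ((j n / p + 1) / n + 1 / real n) * ((j n / p + 1) / n)) \<longlonglongrightarrow> (\<alpha> / p + 0) * (\<alpha> / p)"
    by (intro tendsto_intros a1 inv)
  moreover have "eventually (\<lambda>n. ((j n / p + 1) / n + 1 / real n) * ((j n / p + 1) / n) = (j n / p + 2) * (j n / p + 1) / (real n)\<^sup>2) sequentially"
  proof (rule always_eventually, rule allI)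
    fix n
    have "(j n / p + 1) / n + 1 / real n = (j n / p + 2) / n" by (simp add: add_divide_distrib[symmetric])
    then show "((j n / p + 1) / n + 1 / real n) * ((j n / p + 1) / n) = (j n / p + 2) * (j n / p + 1) / (real n)\<^sup>2"
      by (simp add: power2_eq_square)
  qed
  ultimately have "(\<lambda>n. (j n / p + 2) * (j n / p + 1) / (real n)\<^sup>2) \<longlonglongrightarrow> (\<alpha> / p + 0) * (\<alpha> / p)"
    by (rule Lim_transform_eventually)
  then have a2: "(\<lambda>n. (j n / p + 2) * (j n / p + 1) / (real n)\<^sup>2) \<longlonglongrightarrow> (\<alpha> / p)\<^sup>2" by (simp add: power2_eq_square)
  have v: "\<alpha> / p > 0" using \<alpha> p_gt_1 by simp
  have "(\<lambda>n. measure (?P n) {x \<in> space (?P n). \<epsilon> \<le> \<bar>(Spow n x / n) powr (- 1 / p) - (\<alpha> / p) powr (- 1 / p)\<bar>}) \<longlonglongrightarrow> 0"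
  proof (rule prob_dev_tendsto[OF _ _ _ a1 a2 _ e])
    show "eventually (\<lambda>n. prob_space (?P n) \<and> (\<integral>\<^sup>+x. ennreal (Spow n x / n) \<partial>?P n) = ennreal ((j n / p + 1) / n) \<and>
      (\<integral>\<^sup>+x. ennreal ((Spow n x / n)\<^sup>2) \<partial>?P n) = ennreal ((j n / p + 2) * (j n / p + 1) / (real n)\<^sup>2) \<and>
      0 \<le> (j n / p + 1) / n \<and> 0 \<le> (j n / p + 2) * (j n / p + 1) / (real n)\<^sup>2) sequentially"
      using eventually_ge_at_top[of 2]
    proof eventually_elim
      case (elim n)
      note m = bulk_moments[OF elim j[OF elim] M[OF elim] X[OF elim] law[OF elim]]
      show ?case using m p_gt_1 by simp
    qed
    show "isCont (\<lambda>v. v powr (- 1 / p)) (\<alpha> / p)" using v by (intro continuous_intros) auto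
  qed auto
  moreover have "(\<alpha> / p) powr (- 1 / p) = (p / \<alpha>) powr (1 / p)"
    using \<alpha> p_gt_1 by (simp add: powr_divide powr_minus_divide)
  moreover have "(Spow n x / n) powr (- 1 / p) = real n powr (1 / p) * Spow n x powr (- 1 / p)" for n x
    by (simp add: powr_divide powr_minus_divide)
  moreover have "space (?P n) = space (lborel_n n)" for n by (simp add: bulk.mix_law_def)
  ultimately show "(\<lambda>n. measure (?P n) {x \<in> space (lborel_n n). \<epsilon> \<le> \<bar>real n powr (1 / p) * Spow n x powr (- 1 / p) - (p / \<alpha>) powr (1 / p)\<bar>}) \<longlonglongrightarrow> 0"
    by (simp only:)
next
  fix n :: nat assume n: "2 \<le> n"
  show "0 < Gamma (real (j n) / p + 0 + 1)" using p_gt_1 by (intro Gamma_real_pos) (simp add: add_nonneg_pos)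
  show "0 < real (n - j n) / 2" using j[OF n] by simp
  fix x
  show "kernel1 n (n - j n) 0 x * ennreal ((Spow n x powr (1 / p) / sqrt (Upow n x)) ^ (n - j n) * hsym n (n - j n) x) =
      bulk.mix_weight n (n - j n) (real (n - j n) / 2) x"
    unfolding bulk_mix_weight by (rule kernel1_weight) (use j[OF n] in simp)
next
  fix n w assume n: "2 \<le> (n::nat)" and w: "Spow n w = 1"
  show "(\<integral>\<^sup>+N. ennreal (N powr (n / p)) * kernel1 n (n - j n) 0 (scale_n n (N powr (1 / p)) w) * indicator {0<..} N \<partial>lborel) = ennreal (Gamma (real (j n) / p + 0 + 1))"
    by (rule kernel1_admissible[OF j[OF n] _ w]) simp
qed (use j M X law lim \<alpha> \<theta> in auto)

end

section \<open>The left edge\<close>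

text \<open>A sandwich between \<open>exp (- d / (1 - d))\<close> and \<open>exp (- d)\<close>, both
  raised to the power. The fixed shift \<open>k\<close> is harmless because \<open>d n\<close> tends
  to \<open>0\<close>.\<close>

lemma power_one_minus_tendsto:
  fixes d :: "nat \<Rightarrow> real" and k :: nat
  assumes d: "\<And>n. 0 \<le> d n" and lim: "(\<lambda>n. real n * d n) \<longlonglongrightarrow> x"
  shows "(\<lambda>n. (1 - d n) ^ (n - k)) \<longlonglongrightarrow> exp (- x)"
proof -
  have "(\<lambda>n. (real n * d n) * (1 / real n)) \<longlonglongrightarrow> x * 0" by (intro tendsto_intros lim lim_1_over_n)
  moreover have "eventually (\<lambda>n. (real n * d n) * (1 / real n) = d n) sequentially"
    using eventually_gt_at_top[of 0] by eventually_elim simp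
  ultimately have d0: "d \<longlonglongrightarrow> 0" using Lim_transform_eventually by fastforce
  have "(\<lambda>n. real n * d n - real k * d n) \<longlonglongrightarrow> x - real k * 0" by (intro tendsto_intros lim d0)
  moreover have "eventually (\<lambda>n. real n * d n - real k * d n = real (n - k) * d n) sequentially"
    using eventually_ge_at_top[of k] by eventually_elim (simp add: of_nat_diff left_diff_distrib)
  ultimately have md: "(\<lambda>n. real (n - k) * d n) \<longlonglongrightarrow> x" using Lim_transform_eventually by fastforce
  have sm: "eventually (\<lambda>n. d n < 1) sequentially" using order_tendstoD(2)[OF d0, of 1] by simp
  show ?thesis
  proof (rule tendsto_sandwich)
    show "eventually (\<lambda>n. exp (- (real (n - k) * d n / (1 - d n))) \<le> (1 - d n) ^ (n - k)) sequentially"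
      using sm
    proof eventually_elim
      case (elim n)
      have "1 / (1 - d n) = 1 + d n / (1 - d n)" using elim by (simp add: field_simps)
      also have "\<dots> \<le> exp (d n / (1 - d n))" by (rule exp_ge_add_one_self)
      finally have "exp (- (d n / (1 - d n))) \<le> 1 - d n" using elim by (simp add: exp_minus field_simps)
      then have "exp (- (d n / (1 - d n))) ^ (n - k) \<le> (1 - d n) ^ (n - k)" by (intro power_mono) auto
      then show ?case by (simp add: exp_of_nat_mult[symmetric])
    qed
    show "eventually (\<lambda>n. (1 - d n) ^ (n - k) \<le> exp (- (real (n - k) * d n))) sequentially"
      using sm
    proof eventually_elim
      case (elim n)
      have "1 - d n \<le> exp (- d n)" using exp_ge_add_one_self[of "- d n"] by simp
      then have "(1 - d n) ^ (n - k) \<le> exp (- d n) ^ (n - k)" using elim by (intro power_mono) auto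
      then show ?case by (simp add: exp_of_nat_mult[symmetric])
    qed
    have "(\<lambda>n. exp (- (real (n - k) * d n / (1 - d n)))) \<longlonglongrightarrow> exp (- (x / (1 - 0)))"
      by (intro tendsto_intros md d0) auto
    then show "(\<lambda>n. exp (- (real (n - k) * d n / (1 - d n)))) \<longlonglongrightarrow> exp (- x)" by simp
    show "(\<lambda>n. exp (- (real (n - k) * d n))) \<longlonglongrightarrow> exp (- x)" by (intro tendsto_intros md)
  qed
qed

text \<open>This absorbs the polynomial factor that appears when a fixed number of the
  \<open>n\<close> factors is spent on integrability at infinity.\<close>

lemma eventually_powr_exp_le_one:
  fixes E \<kappa> :: real and k :: nat
  assumes "\<kappa> > 0"
  shows "eventually (\<lambda>n::nat. real n powr E * exp (- \<kappa>) ^ (n - k) \<le> 1) sequentially"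
proof -
  obtain K :: nat where K: "E \<le> real K" using real_arch_simple by blast
  have "filterlim (\<lambda>n::nat. \<kappa> * real n) at_top sequentially"
    using assms by (intro filterlim_tendsto_pos_mult_at_top[OF tendsto_const] filterlim_real_sequentially)
  from filterlim_compose[OF tendsto_power_div_exp_0[of K] this]
  have "(\<lambda>n::nat. (\<kappa> * real n) ^ K / exp (\<kappa> * real n)) \<longlonglongrightarrow> 0" .
  then have "eventually (\<lambda>n::nat. (\<kappa> * real n) ^ K / exp (\<kappa> * real n) < \<kappa> ^ K * exp (- (\<kappa> * real k))) sequentially"
    using assms by (intro order_tendstoD(2)[where y=0]) auto
  then show ?thesis using eventually_ge_at_top[of "max 1 k"]
  proof eventually_elim
    case (elim n)
    then have n: "n \<ge> 1" "n \<ge> k" by auto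
    have "real n powr E \<le> real n powr real K" using n K by (intro powr_mono) auto
    also have "\<dots> = real n ^ K" using n by (simp add: powr_realpow)
    finally have 1: "real n powr E \<le> real n ^ K" .
    have 2: "exp (- \<kappa>) ^ (n - k) = exp (- (\<kappa> * real n)) * exp (\<kappa> * real k)"
      using n by (simp add: exp_of_nat_mult[symmetric] exp_add[symmetric] of_nat_diff algebra_simps)
    have "\<kappa> ^ K * (real n ^ K * exp (- (\<kappa> * real n))) < \<kappa> ^ K * exp (- (\<kappa> * real k))"
      using elim(1) by (simp add: power_mult_distrib exp_minus divide_inverse mult.assoc)
    then have 3: "real n ^ K * exp (- (\<kappa> * real n)) < exp (- (\<kappa> * real k))" using assms by simp
    have "real n powr E * exp (- \<kappa>) ^ (n - k) \<le> real n ^ K * (exp (- (\<kappa> * real n)) * exp (\<kappa> * real k))"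
      unfolding 2 using 1 by (intro mult_right_mono) auto
    also have "\<dots> = real n ^ K * exp (- (\<kappa> * real n)) * exp (\<kappa> * real k)" by simp
    also have "\<dots> \<le> exp (- (\<kappa> * real k)) * exp (\<kappa> * real k)" using 3 by (intro mult_right_mono) auto
    also have "\<dots> = 1" by (simp add: exp_add[symmetric])
    finally show ?case .
  qed
qed

lemma nn_integral_powr_tail:
  fixes a :: real assumes a: "a > 0"
  shows "(\<integral>\<^sup>+u. ennreal (u powr (- a - 1)) * indicator {1..} u \<partial>lborel) = ennreal (1 / a)"
proof -
  have "(\<integral>\<^sup>+u. ennreal (u powr (- a - 1)) * indicator {1..} u \<partial>lborel) = ennreal (0 - (\<lambda>u. - (u powr (- a)) / a) 1)"
  proof (rule nn_integral_FTC_atLeast[where F="\<lambda>u. - (u powr (- a)) / a" and T=0])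
    fix x :: real assume "1 \<le> x"
    then show "((\<lambda>u. - (u powr (- a)) / a) has_real_derivative x powr (- a - 1)) (at x)"
      using a by (auto intro!: derivative_eq_intros)
  next
    have "((\<lambda>u::real. u powr (- a)) \<longlongrightarrow> 0) at_top" using a by (intro tendsto_neg_powr filterlim_ident) auto
    then have "((\<lambda>u::real. - (u powr (- a)) / a) \<longlongrightarrow> - 0 / a) at_top" using a by (intro tendsto_intros) auto
    then show "((\<lambda>u::real. - (u powr (- a)) / a) \<longlongrightarrow> 0) at_top" by simp
  qed auto
  then show ?thesis by simp
qed

text \<open>A version of Watson's lemma. After \<open>s = u / n\<close> the integrand converges to
  \<open>F 0 * u powr (e - 1) * exp (- (c * u))\<close>. For \<open>u \<le> n\<close> the bound
  \<open>near\<close> gives a majorant; for \<open>u > n\<close> most factors decay geometrically by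
  \<open>far\<close>, and a fixed number of them supplies a negative power of \<open>u\<close> by
  \<open>decay\<close>.\<close>

lemma laplace_power:
  fixes F h :: "real \<Rightarrow> real" and k :: nat
  assumes e: "e > 0" and c: "c > 0" and \<kappa>: "\<kappa> > 0" and \<gamma>: "\<gamma> > 0" and C: "C \<ge> 0"
    and F [measurable]: "F \<in> borel_measurable borel" and h [measurable]: "h \<in> borel_measurable borel"
    and F0: "\<And>s. s \<ge> 0 \<Longrightarrow> 0 \<le> F s" "\<And>s. s \<ge> 0 \<Longrightarrow> F s \<le> B" and Flim: "\<And>u. u > 0 \<Longrightarrow> (\<lambda>n. F (u / real n)) \<longlonglongrightarrow> F 0"
    and h0: "\<And>s. s \<ge> 0 \<Longrightarrow> 0 \<le> h s" "\<And>s. s \<ge> 0 \<Longrightarrow> h s \<le> 1"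
    and near: "\<And>s. 0 \<le> s \<Longrightarrow> s \<le> 1 \<Longrightarrow> h s \<le> exp (- (\<kappa> * s))" and far: "\<And>s. s \<ge> 1 \<Longrightarrow> h s \<le> exp (- \<kappa>)"
    and decay: "\<And>s. s > 0 \<Longrightarrow> h s \<le> C * s powr (- \<gamma>)"
    and der: "\<And>u. u > 0 \<Longrightarrow> (\<lambda>n. real n * (1 - h (u / real n))) \<longlonglongrightarrow> c * u"
  shows "(\<lambda>n. ennreal (real n powr e) * (\<integral>\<^sup>+s. ennreal (s powr (e - 1) * F s * h s ^ (n - k)) * indicator {0<..} s \<partial>lborel))
     \<longlonglongrightarrow> ennreal (F 0 * (Gamma e * c powr (- e)))"
proof -
  define g where "g n u = ennreal (u powr (e - 1) * F (u / real n) * h (u / real n) ^ (n - k)) * indicator {0<..} u" for n :: nat and u :: real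
  define g' where "g' u = ennreal (F 0) * (ennreal (u powr (e - 1) * exp (- (c * u))) * indicator {0<..} u)" for u
  \<comment> \<open>\<open>N\<close> factors of \<open>h\<close> provide
    \<open>u powr (- (\<gamma> * N))\<close>, which is integrable at infinity against
    \<open>u powr (e - 1)\<close> once \<open>\<gamma> * N > e\<close>.\<close>
  obtain N :: nat where N: "e / \<gamma> < real N" using reals_Archimedean2 by blast
  then have N: "e < \<gamma> * real N" using \<gamma> by (simp add: field_simps)
  define a where "a = \<gamma> * real N - e"
  have a: "a > 0" using N by (simp add: a_def)
  define w where "w u = ennreal B * (ennreal (u powr (e - 1) * exp (- (\<kappa> / 2 * u))) * indicator {0<..} u
     + ennreal (C ^ N) * (ennreal (u powr (- a - 1)) * indicator {1..} u))" for u
  have [measurable]: "g n \<in> borel_measurable borel" "g' \<in> borel_measurable borel" "w \<in> borel_measurable borel" for n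
    unfolding g_def g'_def w_def by measurable
  have B: "B \<ge> 0" using F0[of 0] by simp
  \<comment> \<open>The condition \<open>n \<ge> 2 * k\<close> ensures
    \<open>n - k \<ge> n / 2\<close>, hence the rate \<open>\<kappa> / 2\<close> in the
    majorant.\<close>
  have "eventually (\<lambda>n. \<forall>u. g n u \<le> w u) sequentially"
    using eventually_powr_exp_le_one[OF \<kappa>, of "\<gamma> * N" "k + N"] eventually_ge_at_top[of "2 * k + N + 1"]
  proof eventually_elim
    case (elim n)
    have n: "n > 0" "n \<ge> 2 * k" "n \<ge> k + N" using elim by auto
    show ?case
    proof
      fix u :: real
      show "g n u \<le> w u"
      proof (cases "u > 0")
        case True
        have un: "u / n > 0" using True n by simp
        have P: "u powr (e - 1) * F (u / real n) * h (u / real n) ^ (n - k) \<le> B * (u powr (e - 1) * H)"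
          if H: "h (u / real n) ^ (n - k) \<le> H" for H
        proof -
          have "F (u / n) * h (u / real n) ^ (n - k) \<le> B * H"
            using un F0[of "u / n"] h0[of "u / n"] H B by (intro mult_mono) auto
          then have "u powr (e - 1) * (F (u / n) * h (u / real n) ^ (n - k)) \<le> u powr (e - 1) * (B * H)"
            by (intro mult_left_mono) auto
          then show ?thesis by (simp add: mult_ac)
        qed
        show ?thesis
        proof (cases "u \<le> n")
          case le: True
          have "h (u / n) ^ (n - k) \<le> exp (- (\<kappa> * (u / n))) ^ (n - k)"
            using un le h0[of "u / n"] n by (intro power_mono near) auto
          also have "\<dots> = exp (- (\<kappa> * u * (real (n - k) / n)))" by (simp add: exp_of_nat_mult[symmetric] mult_ac)
          also have "\<dots> \<le> exp (- (\<kappa> / 2 * u))"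
          proof -
            have "1 / 2 \<le> real (n - k) / n" using n by (simp add: field_simps of_nat_diff)
            then have "\<kappa> * u * (1 / 2) \<le> \<kappa> * u * (real (n - k) / n)" by (rule mult_left_mono) (use \<kappa> True in simp)
            moreover have "\<kappa> / 2 * u = \<kappa> * u * (1 / 2)" by simp
            ultimately show ?thesis by (simp only: exp_le_cancel_iff neg_le_iff_le)
          qed
          finally have "ennreal (u powr (e - 1) * F (u / real n) * h (u / real n) ^ (n - k)) \<le> ennreal (B * (u powr (e - 1) * exp (- (\<kappa> / 2 * u))))"
            by (intro ennreal_leI P)
          also have "\<dots> = ennreal B * (ennreal (u powr (e - 1) * exp (- (\<kappa> / 2 * u))) * indicator {0<..} u)"
            using True B by (simp add: ennreal_mult)
          also have "\<dots> \<le> w u" unfolding w_def by (intro mult_left_mono) auto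
          finally show ?thesis using True by (simp add: g_def)
        next
          case False
          then have u1: "u \<ge> 1" "u / n \<ge> 1" using n by (auto simp: field_simps)
          have "h (u / n) ^ (n - k) = h (u / n) ^ (n - (k + N)) * h (u / n) ^ N"
            using n by (simp add: power_add[symmetric])
          also have "\<dots> \<le> exp (- \<kappa>) ^ (n - (k + N)) * (C * (u / n) powr (- \<gamma>)) ^ N"
            using un h0[of "u / n"] u1 by (intro mult_mono power_mono far decay) auto
          also have "(C * (u / n) powr (- \<gamma>)) ^ N = C ^ N * (u powr (- (\<gamma> * N)) * n powr (\<gamma> * N))"
          proof -
            have "((u / n) powr (- \<gamma>)) ^ N = (u / n) powr (- (\<gamma> * N))"
              using un n by (subst powr_power) (auto simp: mult.commute)
            also have "\<dots> = u powr (- (\<gamma> * N)) * n powr (\<gamma> * N)"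
              using True n by (simp add: powr_divide powr_minus_divide)
            finally show ?thesis by (simp add: power_mult_distrib)
          qed
          also have "exp (- \<kappa>) ^ (n - (k + N)) * (C ^ N * (u powr (- (\<gamma> * N)) * n powr (\<gamma> * N))) =
             C ^ N * u powr (- (\<gamma> * N)) * (n powr (\<gamma> * N) * exp (- \<kappa>) ^ (n - (k + N)))" by (simp add: mult_ac)
          also have "\<dots> \<le> C ^ N * u powr (- (\<gamma> * N)) * 1" using elim(1) C by (intro mult_left_mono) auto
          finally have H: "h (u / n) ^ (n - k) \<le> C ^ N * u powr (- (\<gamma> * N))" by simp
          have ex: "u powr (e - 1) * u powr (- (\<gamma> * N)) = u powr (- a - 1)"
            unfolding powr_add[symmetric] a_def by (rule arg_cong[where f="\<lambda>z. u powr z"]) simp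
          have "ennreal (u powr (e - 1) * F (u / real n) * h (u / real n) ^ (n - k)) \<le> ennreal (B * (u powr (e - 1) * (C ^ N * u powr (- (\<gamma> * N)))))"
            by (intro ennreal_leI P H)
          also have "B * (u powr (e - 1) * (C ^ N * u powr (- (\<gamma> * N)))) = B * (C ^ N * u powr (- a - 1))"
            unfolding ex[symmetric] by (simp add: mult_ac)
          also have "ennreal \<dots> = ennreal B * (ennreal (C ^ N) * (ennreal (u powr (- a - 1)) * indicator {1..} u))"
            using u1 B C by (simp add: ennreal_mult)
          also have "\<dots> \<le> w u" unfolding w_def by (intro mult_left_mono) auto
          finally show ?thesis using True by (simp add: g_def)
        qed
      qed (simp add: g_def)
    qed
  qed
  \<comment> \<open>The majorant is valid from \<open>n0\<close> on only, so dominated convergence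
    is applied to the shifted sequence.\<close>
  then obtain n0 where n0: "\<And>n u. n \<ge> n0 \<Longrightarrow> g n u \<le> w u" unfolding eventually_sequentially by blast
  have "(\<lambda>i. \<integral>\<^sup>+u. g (i + n0) u \<partial>lborel) \<longlonglongrightarrow> (\<integral>\<^sup>+u. g' u \<partial>lborel)"
  proof (rule nn_integral_dominated_convergence[where w=w])
    show "AE u in lborel. (\<lambda>i. g (i + n0) u) \<longlonglongrightarrow> g' u"
    proof (rule AE_I2)
      fix u :: real
      show "(\<lambda>i. g (i + n0) u) \<longlonglongrightarrow> g' u"
      proof (cases "u > 0")
        case True
        have "(\<lambda>n. (1 - (1 - h (u / real n))) ^ (n - k)) \<longlonglongrightarrow> exp (- (c * u))"
          by (rule power_one_minus_tendsto[OF _ der[OF True]]) (use True h0 in auto)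
        then have "(\<lambda>n. u powr (e - 1) * F (u / real n) * h (u / real n) ^ (n - k)) \<longlonglongrightarrow> u powr (e - 1) * F 0 * exp (- (c * u))"
          by (intro tendsto_intros Flim True) simp
        then have "(\<lambda>n. g n u) \<longlonglongrightarrow> ennreal (u powr (e - 1) * F 0 * exp (- (c * u)))"
          unfolding g_def using True by (simp add: tendsto_ennrealI)
        also have "ennreal (u powr (e - 1) * F 0 * exp (- (c * u))) = g' u"
          using True F0[of 0] by (simp add: g'_def ennreal_mult mult_ac)
        finally show ?thesis by (rule LIMSEQ_ignore_initial_segment)
      qed (simp add: g_def g'_def)
    qed
    have G: "(\<integral>\<^sup>+u. ennreal (u powr (e - 1) * exp (- (\<kappa> / 2 * u))) * indicator {0<..} u \<partial>lborel) < \<infinity>"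
      by (subst nn_integral_Gamma) (use e \<kappa> in auto)
    have "(\<integral>\<^sup>+u. w u \<partial>lborel) = ennreal B * ((\<integral>\<^sup>+u. ennreal (u powr (e - 1) * exp (- (\<kappa> / 2 * u))) * indicator {0<..} u \<partial>lborel) +
       ennreal (C ^ N) * (\<integral>\<^sup>+u. ennreal (u powr (- a - 1)) * indicator {1..} u \<partial>lborel))"
      unfolding w_def by (simp add: nn_integral_cmult nn_integral_add)
    also have "\<dots> < \<infinity>" using G by (simp add: nn_integral_powr_tail[OF a] ennreal_mult_less_top)
    finally show "(\<integral>\<^sup>+u. w u \<partial>lborel) < \<infinity>" .
  qed (use n0 in auto)
  then have lim: "(\<lambda>n. \<integral>\<^sup>+u. g n u \<partial>lborel) \<longlonglongrightarrow> (\<integral>\<^sup>+u. g' u \<partial>lborel)" by (rule LIMSEQ_offset)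
  have "(\<integral>\<^sup>+u. g' u \<partial>lborel) = ennreal (F 0) * ennreal (Gamma e * c powr (- e))"
    unfolding g'_def by (subst nn_integral_cmult, measurable) (simp only: nn_integral_Gamma[OF e c])
  also have "\<dots> = ennreal (F 0 * (Gamma e * c powr (- e)))"
    using F0[of 0] e by (simp add: ennreal_mult Gamma_real_nonneg)
  finally have g': "(\<integral>\<^sup>+u. g' u \<partial>lborel) = ennreal (F 0 * (Gamma e * c powr (- e)))" .
  have "eventually (\<lambda>n. (\<integral>\<^sup>+u. g n u \<partial>lborel) = ennreal (real n powr e) *
     (\<integral>\<^sup>+s. ennreal (s powr (e - 1) * F s * h s ^ (n - k)) * indicator {0<..} s \<partial>lborel)) sequentially"
    using eventually_gt_at_top[of 0]
  proof eventually_elim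
    case (elim n)
    let ?f = "\<lambda>s. ennreal (s powr (e - 1) * F s * h s ^ (n - k)) * indicator {0<..} s"
    have "(\<integral>\<^sup>+s. ?f s \<partial>lborel) = ennreal \<bar>1 / real n\<bar> * (\<integral>\<^sup>+u. ?f (0 + 1 / real n * u) \<partial>lborel)"
      using elim by (intro nn_integral_real_affine) auto
    also have "(\<integral>\<^sup>+u. ?f (0 + 1 / real n * u) \<partial>lborel) = (\<integral>\<^sup>+u. ennreal (real n powr (1 - e)) * g n u \<partial>lborel)"
    proof (rule nn_integral_cong)
      fix u :: real
      show "?f (0 + 1 / real n * u) = ennreal (real n powr (1 - e)) * g n u"
      proof (cases "u > 0")
        case True
        have "(u / n) powr (e - 1) = real n powr (1 - e) * u powr (e - 1)"
          using True elim by (simp add: powr_divide powr_diff)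
        then have eq: "(u / n) powr (e - 1) * F (u / n) * h (u / n) ^ (n - k) =
          real n powr (1 - e) * (u powr (e - 1) * F (u / n) * h (u / n) ^ (n - k))" by (simp only: mult.assoc)
        have "?f (0 + 1 / real n * u) = ennreal ((u / n) powr (e - 1) * F (u / n) * h (u / n) ^ (n - k))"
          using True elim by simp
        also have "\<dots> = ennreal (real n powr (1 - e)) * g n u"
          unfolding eq g_def using True by (simp add: ennreal_mult')
        finally show ?thesis .
      qed (use elim in \<open>simp add: g_def zero_less_divide_iff\<close>)
    qed
    also have "\<dots> = ennreal (real n powr (1 - e)) * (\<integral>\<^sup>+u. g n u \<partial>lborel)" by (rule nn_integral_cmult) measurable
    finally have "ennreal (real n powr e) * (\<integral>\<^sup>+s. ?f s \<partial>lborel) =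
      ennreal (real n powr e) * (ennreal \<bar>1 / real n\<bar> * ennreal (real n powr (1 - e))) * (\<integral>\<^sup>+u. g n u \<partial>lborel)"
      by (simp only: mult.assoc)
    also have "ennreal (real n powr e) * (ennreal \<bar>1 / real n\<bar> * ennreal (real n powr (1 - e))) = 1"
      using elim by (simp add: ennreal_mult[symmetric] powr_diff)
    finally show ?case by simp
  qed
  from Lim_transform_eventually[OF lim this] show ?thesis unfolding g' .
qed

context prob_space
begin

text \<open>The chord bound is convexity of the exponential, the slope at \<open>0\<close> follows
  by dominated convergence with majorant \<open>u * V\<close>, and \<open>h 1 = 1\<close> would
  force \<open>V = 0\<close> almost everywhere. These facts are inputs of
  \<open>laplace_power\<close>.\<close>

lemma laplace_transform:
  fixes V :: "'a \<Rightarrow> real"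
  assumes [measurable]: "V \<in> borel_measurable M" and V0: "\<And>x. V x \<ge> 0" and int: "integrable M V"
  defines "h \<equiv> \<lambda>s. expectation (\<lambda>x. exp (- (s * V x)))"
  shows "\<And>s. s \<ge> 0 \<Longrightarrow> integrable M (\<lambda>x. exp (- (s * V x)))"
    and "\<And>s. s \<ge> 0 \<Longrightarrow> 0 \<le> h s" "\<And>s. s \<ge> 0 \<Longrightarrow> h s \<le> 1"
    and "\<And>s t. 0 \<le> s \<Longrightarrow> s \<le> t \<Longrightarrow> h t \<le> h s"
    and "\<And>s. 0 \<le> s \<Longrightarrow> s \<le> 1 \<Longrightarrow> h s \<le> 1 - s * (1 - h 1)"
    and "\<And>u. u > 0 \<Longrightarrow> (\<lambda>n. real n * (1 - h (u / real n))) \<longlonglongrightarrow> expectation V * u"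
    and "expectation V > 0 \<Longrightarrow> h 1 < 1"
proof -
  show I: "integrable M (\<lambda>x. exp (- (s * V x)))" if "s \<ge> 0" for s
    by (rule integrable_const_bound[where B=1]) (use that V0 in auto)
  show "0 \<le> h s" for s unfolding h_def by (rule integral_nonneg_AE) simp
  show anti: "h t \<le> h s" if "0 \<le> s" "s \<le> t" for s t
    unfolding h_def using that V0 by (intro integral_mono I) (auto intro: mult_right_mono)
  have h0: "h 0 = 1" by (simp add: h_def prob_space)
  show "h s \<le> 1" if "s \<ge> 0" for s using anti[of 0 s] that h0 by simp
  show "h s \<le> 1 - s * (1 - h 1)" if s: "0 \<le> s" "s \<le> 1" for s
  proof -
    have "h s \<le> expectation (\<lambda>x. (1 - s) + s * exp (- (1 * V x)))"
      unfolding h_def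
    proof (intro integral_mono I)
      show "integrable M (\<lambda>x. (1 - s) + s * exp (- (1 * V x)))" using I[of 1] by simp
      fix x
      have "exp ((1 - s) *\<^sub>R 0 + s *\<^sub>R (- V x)) \<le> (1 - s) * exp 0 + s * exp (- V x)"
        by (rule convex_onD[OF exp_convex]) (use s in auto)
      then show "exp (- (s * V x)) \<le> (1 - s) + s * exp (- (1 * V x))" by simp
    qed (use s in auto)
    also have "\<dots> = 1 - s * (1 - h 1)" using I[of 1] by (simp add: h_def prob_space algebra_simps)
    finally show ?thesis .
  qed
  show "(\<lambda>n. real n * (1 - h (u / real n))) \<longlonglongrightarrow> expectation V * u" if u: "u > 0" for u
  proof -
    have "(\<lambda>n. expectation (\<lambda>x. real n * (1 - exp (- (u / real n * V x))))) \<longlonglongrightarrow> expectation (\<lambda>x. u * V x)"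
    proof (rule integral_dominated_convergence[where w="\<lambda>x. u * V x"])
      show "AE x in M. (\<lambda>n. real n * (1 - exp (- (u / real n * V x)))) \<longlonglongrightarrow> u * V x"
      proof (rule AE_I2)
        fix x
        have "((\<lambda>y. 1 - exp (- (u * V x * y))) has_real_derivative u * V x) (at 0)"
          by (auto intro!: derivative_eq_intros)
        then have "((\<lambda>y. (1 - exp (- (u * V x * y))) / y) \<longlongrightarrow> u * V x) (at 0)"
          by (simp add: has_field_derivative_iff)
        moreover have "filterlim (\<lambda>n. 1 / real n) (at 0) sequentially"
          unfolding filterlim_at by (auto simp: lim_1_over_n eventually_sequentially intro!: exI[of _ 1])
        ultimately have "(\<lambda>n. (1 - exp (- (u * V x * (1 / real n)))) / (1 / real n)) \<longlonglongrightarrow> u * V x"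
          by (rule filterlim_compose)
        then show "(\<lambda>n. real n * (1 - exp (- (u / real n * V x)))) \<longlonglongrightarrow> u * V x"
          by (simp add: mult.commute)
      qed
      show "AE x in M. norm (real n * (1 - exp (- (u / real n * V x)))) \<le> u * V x" for n
      proof (rule AE_I2)
        fix x
        show "norm (real n * (1 - exp (- (u / real n * V x)))) \<le> u * V x"
        proof (cases "n = 0")
          case False
          have "1 - exp (- (u / real n * V x)) \<le> u / real n * V x" using exp_ge_add_one_self[of "- (u / real n * V x)"] by simp
          then have "real n * (1 - exp (- (u / real n * V x))) \<le> real n * (u / real n * V x)" by (rule mult_left_mono) simp
          moreover have "1 - exp (- (u / real n * V x)) \<ge> 0" using u V0[of x] by simp
          ultimately show ?thesis using False by simp
        qed (use u V0 in simp)
      qed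
    qed (use int in auto)
    moreover have "expectation (\<lambda>x. real n * (1 - exp (- (u / real n * V x)))) = real n * (1 - h (u / real n))" for n
      using I[of "u / real n"] u by (simp add: h_def prob_space)
    ultimately show ?thesis by (simp only: integral_mult_right_zero integral_mult_left_zero mult.commute[of u])
  qed
  show "h 1 < 1" if pos: "expectation V > 0"
  proof (rule ccontr)
    assume "\<not> h 1 < 1"
    then have h1: "h 1 = 1" using anti[of 0 1] h0 by simp
    have i1: "integrable M (\<lambda>x. 1 - exp (- V x))" using I[of 1] by simp
    have "expectation (\<lambda>x. 1 - exp (- V x)) = 0" using I[of 1] h1 by (simp add: h_def prob_space)
    then have "AE x in M. 1 - exp (- V x) = 0"
      by (subst (asm) integral_nonneg_eq_0_iff_AE[OF i1]) (use V0 in auto)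
    then have "AE x in M. V x = 0" by eventually_elim simp
    then have "expectation V = 0" using integral_cong_AE[of V M "\<lambda>_. 0"] by simp
    then show False using pos by simp
  qed
qed

end

context lp_mixture
begin

lemma base_mass_tendsto:
  assumes [measurable]: "f \<in> borel_measurable borel" and f0: "\<And>x. f x \<ge> 0"
    and fin: "(\<integral>\<^sup>+x. ennreal (f x * base 0 x) \<partial>lborel) < \<infinity>" and t: "\<And>m. t m \<ge> 0" "t \<longlonglongrightarrow> \<theta>"
  shows "(\<lambda>m. \<integral>\<^sup>+x. ennreal (f x * base (t m) x) \<partial>lborel) \<longlonglongrightarrow> (\<integral>\<^sup>+x. ennreal (f x * base \<theta> x) \<partial>lborel)"
proof (rule nn_integral_dominated_convergence[where w="\<lambda>x. ennreal (f x * base 0 x)"])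
  show "AE x in lborel. ennreal (f x * base (t m) x) \<le> ennreal (f x * base 0 x)" for m
    using f0 base_antimono[OF t(1)] by (intro AE_I2 ennreal_leI mult_left_mono)
  show "AE x in lborel. (\<lambda>m. ennreal (f x * base (t m) x)) \<longlonglongrightarrow> ennreal (f x * base \<theta> x)"
    unfolding base_def by (intro AE_I2 tendsto_intros t)
qed (use fin in auto)

definition rQ :: "real \<Rightarrow> real" where "rQ t = enn2real (Qmass t)"

lemma rQ: "t \<ge> 0 \<Longrightarrow> rQ t > 0" "t \<ge> 0 \<Longrightarrow> Qmass t = ennreal (rQ t)"
  using Qmass_finite[of t] Qmass_pos[of t] by (auto simp: rQ_def enn2real_positive_iff less_top)

lemma rQ_rI_le: "t \<ge> 0 \<Longrightarrow> rQ t \<le> rQ 0" "t \<ge> 0 \<Longrightarrow> rI t \<le> rI 0"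
  unfolding rQ_def rI_def using Qmass_finite[of 0] Imass_finite[of 0]
  by (auto intro!: enn2real_mono Qmass_antimono Imass_antimono)

lemma rQ_tendsto: "(\<And>m. t m \<ge> 0) \<Longrightarrow> t \<longlonglongrightarrow> 0 \<Longrightarrow> (\<lambda>m. rQ (t m)) \<longlonglongrightarrow> rQ 0"
  unfolding rQ_def
  by (rule tendsto_enn2real) (use base_mass_tendsto[of "\<lambda>x. (phi x)\<^sup>2" t 0] Qmass_finite[of 0] in \<open>auto simp: Qmass_def less_top[symmetric]\<close>)

end

section \<open>The exchanged mixture and its Laplace transform\<close>

context lp_exponent
begin

text \<open>
  For bounded \<open>j\<close> the mixing parameter of the bulk representation escapes to infinity. Exchanging
  the roles of the two exponents makes it concentrate at \<open>0\<close> instead, on the scale \<open>1 / n\<close>.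
\<close>

sublocale left: lp_mixture p bexp p
  by unfold_locales (use p_gt_1 in \<open>auto simp: bexp_def\<close>)

text \<open>The mean of \<open>\<bar>x\<bar> powr p\<close> under
  \<open>left_measure\<close>.\<close>

definition left_mean :: real where "left_mean = Gamma ((2 * p - 1) / (2 * p - 2)) / sqrt pi"

text \<open>The law of \<open>x\<close> when \<open>phi x\<close> has the Gaussian density
  proportional to \<open>exp (- z\<^sup>2)\<close>, which explains the normalization by
  \<open>sqrt pi\<close>.\<close>

definition left_measure :: "real measure" where
  "left_measure = density lborel (\<lambda>x. ennreal (dphi x * left.base 0 x / sqrt pi))"

definition left_transform :: "real \<Rightarrow> real" where
  "left_transform s = (LINT x|left_measure. exp (- (s * \<bar>x\<bar> powr p)))"

lemma left_mean_pos: "left_mean > 0"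
  unfolding left_mean_def using p_gt_1 by (intro divide_pos_pos Gamma_real_pos) auto

lemma nn_integral_left_measure:
  assumes [measurable]: "f \<in> borel_measurable borel"
  shows "(\<integral>\<^sup>+x. f x \<partial>left_measure) = (\<integral>\<^sup>+x. ennreal (dphi x * left.base 0 x / sqrt pi) * f x \<partial>lborel)"
  unfolding left_measure_def by (rule nn_integral_density) auto

lemma nn_integral_dphi_abs_powr:
  assumes "m > 1 - p"
  shows "(\<integral>\<^sup>+x. ennreal (\<bar>x\<bar> powr m * (dphi x * left.base 0 x)) \<partial>lborel) = ennreal (Gamma ((p - 1 + m) / (2 * p - 2)))"
proof -
  have "(\<integral>\<^sup>+x. ennreal (\<bar>x\<bar> powr m * (dphi x * left.base 0 x)) \<partial>lborel) =
    (\<integral>\<^sup>+x. ennreal (p - 1) * ennreal (\<bar>x\<bar> powr (p - 2 + m) * exp (- (1 * \<bar>x\<bar> powr bexp))) \<partial>lborel)"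
  proof (rule nn_integral_cong)
    fix x :: real
    show "ennreal (\<bar>x\<bar> powr m * (dphi x * left.base 0 x)) = ennreal (p - 1) * ennreal (\<bar>x\<bar> powr (p - 2 + m) * exp (- (1 * \<bar>x\<bar> powr bexp)))"
      unfolding dphi_def left.base_def powr_add using p_gt_1 by (simp add: ennreal_mult[symmetric] mult_ac)
  qed
  also have "\<dots> = ennreal (p - 1) * ennreal (2 / bexp * Gamma ((p - 2 + m + 1) / bexp) * 1 powr (- ((p - 2 + m + 1) / bexp)))"
    by (subst nn_integral_cmult, measurable, subst nn_integral_abs_powr_exp) (use assms p_gt_1 in \<open>auto simp: bexp_def\<close>)
  also have "\<dots> = ennreal (Gamma ((p - 1 + m) / (2 * p - 2)))"
  proof -
    have "(p - 1) * (2 / bexp) = 1" using p_gt_1 by (simp add: bexp_def)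
    then have "(p - 1) * (2 / bexp * G) = G" for G by (metis mult.assoc mult_1)
    moreover have e1: "p - 2 + m + 1 = p - 1 + m" by simp
    ultimately show ?thesis unfolding e1 using p_gt_1 assms by (simp add: ennreal_mult'[symmetric] bexp_def)
  qed
  finally show ?thesis .
qed

lemma left_Jmass_0: "left.Jmass 0 = ennreal (sqrt pi)"
proof -
  have "left.Jmass 0 = (\<integral>\<^sup>+x. ennreal (\<bar>x\<bar> powr 0 * (dphi x * left.base 0 x)) \<partial>lborel)"
    unfolding left.Jmass_def by (rule nn_integral_cong_AE, use AE_lborel_singleton[of 0] in eventually_elim) auto
  also have "\<dots> = ennreal (Gamma ((p - 1 + 0) / (2 * p - 2)))" by (rule nn_integral_dphi_abs_powr) (use p_gt_1 in simp)
  also have "(p - 1 + 0) / (2 * p - 2) = 1 / 2" using p_gt_1 by (simp add: field_simps)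
  finally show ?thesis by (simp add: Gamma_one_half_real)
qed

lemma left_rJ_0: "left.rJ 0 = sqrt pi" by (simp add: left.rJ_def left_Jmass_0)

lemma prob_space_left_measure: "prob_space left_measure"
proof
  have "emeasure left_measure (space left_measure) = (\<integral>\<^sup>+x. 1 \<partial>left_measure)" by simp
  also have "\<dots> = (\<integral>\<^sup>+x. ennreal (1 / sqrt pi) * ennreal (dphi x * left.base 0 x) \<partial>lborel)"
    by (subst nn_integral_left_measure) (auto simp: ennreal_mult'[symmetric])
  also have "\<dots> = ennreal (1 / sqrt pi) * left.Jmass 0" unfolding left.Jmass_def by (rule nn_integral_cmult) measurable
  also have "\<dots> = 1" by (simp add: left_Jmass_0 ennreal_mult'[symmetric])
  finally show "emeasure left_measure (space left_measure) = 1" .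
qed

lemma sets_left_measure [measurable_cong]: "sets left_measure = sets borel" by (simp add: left_measure_def)

lemma left_measure_abs_powr: "integrable left_measure (\<lambda>x. \<bar>x\<bar> powr p)" "(LINT x|left_measure. \<bar>x\<bar> powr p) = left_mean"
proof -
  have "(\<integral>\<^sup>+x. ennreal (\<bar>x\<bar> powr p) \<partial>left_measure) = (\<integral>\<^sup>+x. ennreal (1 / sqrt pi) * ennreal (\<bar>x\<bar> powr p * (dphi x * left.base 0 x)) \<partial>lborel)"
    by (subst nn_integral_left_measure, measurable) (simp add: ennreal_mult'[symmetric] mult_ac)
  also have "\<dots> = ennreal (1 / sqrt pi) * ennreal (Gamma ((p - 1 + p) / (2 * p - 2)))"
    by (subst nn_integral_cmult, measurable, subst nn_integral_dphi_abs_powr) (use p_gt_1 in auto)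
  also have "\<dots> = ennreal left_mean" by (simp add: left_mean_def ennreal_mult'[symmetric])
  finally have n: "(\<integral>\<^sup>+x. ennreal (\<bar>x\<bar> powr p) \<partial>left_measure) = ennreal left_mean" .
  show "integrable left_measure (\<lambda>x. \<bar>x\<bar> powr p)" by (rule integrableI_nonneg) (auto simp: n)
  show "(LINT x|left_measure. \<bar>x\<bar> powr p) = left_mean"
    by (subst integral_eq_nn_integral) (use left_mean_pos in \<open>auto simp: n\<close>)
qed

lemmas left_transform_facts = prob_space.laplace_transform[OF prob_space_left_measure _ _ left_measure_abs_powr(1), folded left_transform_def, unfolded left_measure_abs_powr(2)]

text \<open>Up to \<open>sqrt pi\<close> the mass is the Laplace transform of
  \<open>\<bar>x\<bar> powr p\<close> under a probability measure, so its high powers are accessible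
  to \<open>laplace_power\<close>.\<close>

lemma left_Jmass: "s \<ge> 0 \<Longrightarrow> left.Jmass s = ennreal (sqrt pi * left_transform s)"
proof -
  assume s: "s \<ge> 0"
  have "ennreal (sqrt pi * left_transform s) = ennreal (sqrt pi) * (\<integral>\<^sup>+x. ennreal (exp (- (s * \<bar>x\<bar> powr p))) \<partial>left_measure)"
    unfolding left_transform_def by (subst nn_integral_eq_integral) (use s left_transform_facts(1) in \<open>auto simp: ennreal_mult'\<close>)
  also have "\<dots> = (\<integral>\<^sup>+x. ennreal (sqrt pi) * (ennreal (dphi x * left.base 0 x / sqrt pi) * ennreal (exp (- (s * \<bar>x\<bar> powr p)))) \<partial>lborel)"
    by (subst nn_integral_left_measure, measurable, subst nn_integral_cmult) auto
  also have "\<dots> = left.Jmass s"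
    unfolding left.Jmass_def
  proof (rule nn_integral_cong)
    fix x :: real
    have "left.base s x = left.base 0 x * exp (- (s * \<bar>x\<bar> powr p))" by (simp add: left.base_def exp_diff exp_minus divide_inverse)
    then show "ennreal (sqrt pi) * (ennreal (dphi x * left.base 0 x / sqrt pi) * ennreal (exp (- (s * \<bar>x\<bar> powr p)))) = ennreal (dphi x * left.base s x)"
      by (simp add: ennreal_mult[symmetric])
  qed
  finally show ?thesis ..
qed

end

text \<open>The factor \<open>b ^ r\<close> from the densities cancels the Jacobian of the dilation
  by \<open>b\<close>, and the dilation itself is absorbed into the scale.\<close>

lemma scaled_iid_law_rescale:
  fixes f :: "real \<Rightarrow> real"
  assumes [measurable]: "f \<in> borel_measurable borel" and f0: "\<And>x. f x \<ge> 0"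
    and pr: "prob_space (density lborel (\<lambda>u. ennreal (f u)))" and b: "b > 0"
  shows "scaled_iid_law r s (\<lambda>u. b * f (b * u)) = scaled_iid_law r (s / b) f"
proof -
  let ?g = "\<lambda>u. b * f (b * u)"
  have "(\<integral>\<^sup>+u. ennreal (?g u) \<partial>lborel) = (\<integral>\<^sup>+u. ennreal (f u) \<partial>lborel)"
    using nn_integral_real_affine[of "\<lambda>u. ennreal (f u)" b 0] b f0
    by (simp add: ennreal_mult nn_integral_cmult)
  also have "\<dots> = 1" using prob_space.emeasure_space_1[OF pr] by (simp add: emeasure_density)
  finally have prg: "prob_space (density lborel (\<lambda>u. ennreal (?g u)))"
    by (intro prob_spaceI) (simp add: emeasure_density)
  have sets: "sets (Pi\<^sub>M {..<r} (\<lambda>_. density lborel (\<lambda>u. ennreal (h u)))) = sets (lborel_n r)" for h :: "real \<Rightarrow> real"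
    by (intro sets_PiM_cong) auto
  have sp: "space (Pi\<^sub>M {..<r} (\<lambda>_. density lborel (\<lambda>u. ennreal (h u)))) = space (lborel_n r)" for h :: "real \<Rightarrow> real"
    by (rule sets_eq_imp_space_eq[OF sets])
  have sc [measurable]: "scale_n r c \<in> measurable (lborel_n r) (lborel_n r)" for c
    unfolding scale_n_def[abs_def] by measurable
  have em: "emeasure (scaled_iid_law r c h) A = (\<integral>\<^sup>+x. indicator A (scale_n r c x) * (\<Prod>k<r. ennreal (h (x k))) \<partial>lborel_n r)"
    if [measurable]: "h \<in> borel_measurable borel" and h: "\<And>x. h x \<ge> 0" "prob_space (density lborel (\<lambda>u. ennreal (h u)))"
      and A [measurable]: "A \<in> sets (lborel_n r)" for h c A
  proof -
    let ?P = "Pi\<^sub>M {..<r} (\<lambda>_. density lborel (\<lambda>u. ennreal (h u)))"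
    have m: "scale_n r c \<in> measurable ?P (lborel_n r)" using sc by (simp cong: measurable_cong_sets add: measurable_cong_sets[OF sets refl])
    have "emeasure (scaled_iid_law r c h) A = (\<integral>\<^sup>+y. indicator A y \<partial>distr ?P (lborel_n r) (scale_n r c))"
      unfolding scaled_iid_law_def by simp
    also have "\<dots> = (\<integral>\<^sup>+x. indicator A (scale_n r c x) \<partial>?P)" by (rule nn_integral_distr[OF m]) simp
    also have "\<dots> = (\<integral>\<^sup>+x. indicator A (scale_n r c x) * (\<Prod>k<r. ennreal (h (x k))) \<partial>lborel_n r)"
      by (rule nn_integral_PiM_density) (use h in auto)
    finally show ?thesis .
  qed
  show ?thesis
  proof (rule measure_eqI)
    fix A assume "A \<in> sets (scaled_iid_law r s ?g)"
    then have A [measurable]: "A \<in> sets (lborel_n r)" by (simp add: scaled_iid_law_def)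
    define G where "G y = indicator A (scale_n r (s / b) y) * (\<Prod>k<r. ennreal (f (y k)))" for y
    have co: "(\<lambda>y. f (y k)) \<in> borel_measurable (lborel_n r)" if "k < r" for k
      using measurable_compose[OF measurable_coord[of "\<lambda>x. x" "lborel_n r" r k] assms(1)] that by simp
    have "(\<lambda>y. indicator A (scale_n r (s / b) y) :: ennreal) \<in> borel_measurable (lborel_n r)" by measurable
    moreover have "(\<lambda>y. \<Prod>k<r. ennreal (f (y k))) \<in> borel_measurable (lborel_n r)"
      by (rule borel_measurable_prod_ennreal, rule measurable_compose[OF co measurable_ennreal]) simp
    ultimately
    have Gm [measurable]: "G \<in> borel_measurable (lborel_n r)"
      unfolding G_def by (rule borel_measurable_times_ennreal)
    have "indicator A (scale_n r s x) * (\<Prod>k<r. ennreal (?g (x k))) = ennreal (b ^ r) * G (scale_n r b x)" for x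
    proof -
      have "scale_n r (s / b) (scale_n r b x) = scale_n r s x" using b by (auto simp: scale_n_def fun_eq_iff restrict_def)
      moreover have "(\<Prod>k<r. ennreal (?g (x k))) = ennreal (b ^ r) * (\<Prod>k<r. ennreal (f (b * x k)))"
        using b f0 by (simp add: ennreal_mult prod.distrib ennreal_power)
      ultimately show ?thesis by (simp add: G_def scale_n_def mult_ac)
    qed
    then have "emeasure (scaled_iid_law r s ?g) A = (\<integral>\<^sup>+x. ennreal (b ^ r) * G (scale_n r b x) \<partial>lborel_n r)"
      using b f0 prg by (subst em) auto
    also have "\<dots> = ennreal (b ^ r) * (\<integral>\<^sup>+x. G (scale_n r b x) \<partial>lborel_n r)" by (rule nn_integral_cmult) measurable
    also have "\<dots> = ennreal (b ^ r * (1 / b) ^ r) * (\<integral>\<^sup>+x. G x \<partial>lborel_n r)"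
      using b by (simp add: nn_integral_scale_n[OF b Gm] ennreal_mult mult.assoc)
    also have "b ^ r * (1 / b) ^ r = 1" using b by (simp add: power_mult_distrib[symmetric])
    also have "ennreal 1 * (\<integral>\<^sup>+x. G x \<partial>lborel_n r) = emeasure (scaled_iid_law r (s / b) f) A"
      using f0 pr by (subst em) (auto simp: G_def[abs_def])
    finally show "emeasure (scaled_iid_law r s ?g) A = emeasure (scaled_iid_law r (s / b) f) A" .
  qed (simp add: scaled_iid_law_def)
qed

section \<open>Left-edge mixing masses, radial moments and the limit\<close>

context lp_exponent
begin

text \<open>Dropping the exponential of \<open>\<bar>x\<bar> powr (2 * p - 2)\<close> leaves a power
  integral that is homogeneous in \<open>s\<close>.\<close>

lemma left_transform_decay:
  obtains C where "C \<ge> 0" "\<And>s. s > 0 \<Longrightarrow> left_transform s \<le> C * s powr (- ((p - 1) / p))"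
proof -
  define C where "C = (p - 1) * (2 / p * Gamma ((p - 1) / p)) / sqrt pi"
  have G: "Gamma ((p - 1) / p) \<ge> 0" using p_gt_1 by (intro Gamma_real_nonneg) simp
  have C: "C \<ge> 0" using p_gt_1 G by (simp add: C_def)
  have "left_transform s \<le> C * s powr (- ((p - 1) / p))" if s: "s > 0" for s
  proof -
    have "left.Jmass s \<le> (\<integral>\<^sup>+x. ennreal (p - 1) * ennreal (\<bar>x\<bar> powr (p - 2) * exp (- (s * \<bar>x\<bar> powr p))) \<partial>lborel)"
      unfolding left.Jmass_def
    proof (rule nn_integral_mono)
      fix x :: real
      have "left.base s x \<le> exp (- (s * \<bar>x\<bar> powr p))" by (simp add: left.base_def)
      then have "dphi x * left.base s x \<le> (p - 1) * (\<bar>x\<bar> powr (p - 2) * exp (- (s * \<bar>x\<bar> powr p)))"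
        unfolding dphi_def using p_gt_1 by (simp add: mult.assoc mult_left_mono)
      then show "ennreal (dphi x * left.base s x) \<le> ennreal (p - 1) * ennreal (\<bar>x\<bar> powr (p - 2) * exp (- (s * \<bar>x\<bar> powr p)))"
        using p_gt_1 by (simp add: ennreal_mult'[symmetric] ennreal_leI)
    qed
    also have "\<dots> = ennreal (p - 1) * ennreal (2 / p * Gamma ((p - 2 + 1) / p) * s powr (- ((p - 2 + 1) / p)))"
      by (subst nn_integral_cmult, measurable, subst nn_integral_abs_powr_exp) (use s p_gt_1 in auto)
    also have "p - 2 + 1 = p - 1" by simp
    also have "ennreal (p - 1) * ennreal (2 / p * Gamma ((p - 1) / p) * s powr (- ((p - 1) / p))) = ennreal (sqrt pi * (C * s powr (- ((p - 1) / p))))"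
      using p_gt_1 by (simp add: C_def ennreal_mult'[symmetric] mult.assoc)
    finally have "sqrt pi * left_transform s \<le> sqrt pi * (C * s powr (- ((p - 1) / p)))"
      using s C by (simp add: left_Jmass ennreal_le_iff)
    then show ?thesis by simp
  qed
  with C show ?thesis by (rule that)
qed

text \<open>The part of the mixing density whose exponents do not grow with \<open>n\<close>; only
  its value at \<open>0\<close> survives in the limit.\<close>

definition left_factor :: "nat \<Rightarrow> real \<Rightarrow> real" where "left_factor j s = left.rQ s * left.rI s ^ j"

lemma left_factor_pos: "s \<ge> 0 \<Longrightarrow> left_factor j s > 0"
  unfolding left_factor_def using left.rQ(1)[of s] left.rI(1)[of s] by simp

lemma left_wgt_eq:
  assumes "j < n"
  shows "left.wgt n (n - j) e t =
    ennreal (sqrt pi ^ (n - (j + 1))) * (ennreal (t powr (e - 1) * left_factor j t * left_transform t ^ (n - (j + 1))) * indicator {0<..} t)"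
proof (cases "t > 0")
  case True
  have e: "n - j - 1 = n - (j + 1)" "n - (n - j) = j" using assms by auto
  have l: "left_transform t \<ge> 0" using left_transform_facts(2)[of t] True by simp
  have Q: "left.rQ t \<ge> 0" "left.rI t \<ge> 0" using left.rQ(1)[of t] left.rI(1)[of t] True by auto
  have "ennreal (t powr (e - 1)) * (ennreal (left.rQ t) * ennreal (sqrt pi * left_transform t) ^ (n - (j + 1)) * ennreal (left.rI t) ^ j) =
    ennreal (t powr (e - 1) * (left.rQ t * (sqrt pi * left_transform t) ^ (n - (j + 1)) * left.rI t ^ j))"
  proof -
    have "sqrt pi * left_transform t \<ge> 0" using l by simp
    then show ?thesis using Q
      by (simp only: ennreal_power ennreal_mult[symmetric] powr_ge_zero zero_le_power mult_nonneg_nonneg)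
  qed
  also have "t powr (e - 1) * (left.rQ t * (sqrt pi * left_transform t) ^ (n - (j + 1)) * left.rI t ^ j) =
    sqrt pi ^ (n - (j + 1)) * (t powr (e - 1) * left_factor j t * left_transform t ^ (n - (j + 1)))"
    by (simp add: left_factor_def power_mult_distrib mult_ac)
  finally show ?thesis
    unfolding left.wgt_def e using True
    by (simp add: left_Jmass left.rQ(2) left.rI(2) ennreal_mult')
qed (simp add: left.wgt_def)

definition left_total :: "nat \<Rightarrow> real \<Rightarrow> nat \<Rightarrow> ennreal" where
  "left_total j e n = (\<integral>\<^sup>+t. left.wgt n (n - j) e t \<partial>lborel)"

text \<open>This is \<open>laplace_power\<close> for \<open>left_transform\<close>, whose slope at
  \<open>0\<close> is \<open>- left_mean\<close>. The factor \<open>sqrt pi ^ (n - (j + 1))\<close>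
  is the same for all \<open>e\<close> and is divided out.\<close>

lemma left_total_asymp:
  assumes e: "e > 0"
  shows "eventually (\<lambda>n. left_total j e n < \<infinity>) sequentially"
    "(\<lambda>n. real n powr e / sqrt pi ^ (n - (j + 1)) * enn2real (left_total j e n)) \<longlonglongrightarrow> left_factor j 0 * (Gamma e * left_mean powr (- e))"
proof -
  obtain C where C: "C \<ge> 0" "\<And>s. s > 0 \<Longrightarrow> left_transform s \<le> C * s powr (- ((p - 1) / p))" using left_transform_decay by blast
  have [measurable]: "left_transform \<in> borel_measurable borel"
    unfolding left_transform_def[abs_def]
    by (rule sigma_finite_measure.borel_measurable_lebesgue_integral)
      (use prob_space_left_measure in \<open>auto intro!: prob_space_imp_sigma_finite simp: sets_left_measure\<close>)
  have [measurable]: "left_factor j \<in> borel_measurable borel"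
    unfolding left_factor_def[abs_def] left.rQ_def left.rI_def by measurable
  define K where "K n = (\<integral>\<^sup>+t. ennreal (t powr (e - 1) * left_factor j t * left_transform t ^ (n - (j + 1))) * indicator {0<..} t \<partial>lborel)" for n
  \<comment> \<open>Minus the slope of the chord of \<open>left_transform\<close> over
    \<open>[0, 1]\<close>, positive because \<open>left_mean > 0\<close>.\<close>
  define \<kappa> where "\<kappa> = 1 - left_transform 1"
  have \<kappa>: "\<kappa> > 0" using left_transform_facts(7) left_mean_pos by (simp add: \<kappa>_def)
  have chord: "left_transform s \<le> exp (- (\<kappa> * s))" if "0 \<le> s" "s \<le> 1" for s
    using left_transform_facts(5)[of s] that exp_ge_add_one_self[of "- (\<kappa> * s)"] by (simp add: \<kappa>_def mult.commute)
  have lim: "(\<lambda>n. ennreal (real n powr e) * K n) \<longlonglongrightarrow> ennreal (left_factor j 0 * (Gamma e * left_mean powr (- e)))"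
    unfolding K_def
  proof (rule laplace_power[where \<kappa>=\<kappa> and C=C and \<gamma>="(p - 1) / p" and B="left_factor j 0"])
    show "0 \<le> left_factor j s" if "s \<ge> 0" for s using left_factor_pos[OF that, of j] by simp
    show "left_factor j s \<le> left_factor j 0" if "s \<ge> 0" for s
      unfolding left_factor_def using left.rQ_rI_le[OF that] left.rQ(1)[of s] left.rQ(1)[of 0] left.rI(1)[of s] that
      by (intro mult_mono power_mono) auto
    show "(\<lambda>n. left_factor j (u / real n)) \<longlonglongrightarrow> left_factor j 0" if "u > 0" for u
    proof -
      have "(\<lambda>n. u * (1 / real n)) \<longlonglongrightarrow> u * 0" by (intro tendsto_intros lim_1_over_n)
      then have "(\<lambda>n. u / real n) \<longlonglongrightarrow> 0" by simp
      then show ?thesis unfolding left_factor_def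
        using that by (intro tendsto_intros left.rQ_tendsto left.rI_rJ_tendsto(1)) auto
    qed
    show "left_transform s \<le> exp (- \<kappa>)" if "s \<ge> 1" for s
      using left_transform_facts(4)[of 1 s] chord[of 1] that by simp
    show "(\<lambda>n. real n * (1 - left_transform (u / real n))) \<longlonglongrightarrow> left_mean * u" if "u > 0" for u
      using left_transform_facts(6)[OF _ _ that] by simp
    show "0 \<le> left_transform s" "left_transform s \<le> 1" if "s \<ge> 0" for s using left_transform_facts(2,3)[OF _ _ that] by auto
  qed (use e \<kappa> C left_mean_pos p_gt_1 chord in auto)
  have WK: "left_total j e n = ennreal (sqrt pi ^ (n - (j + 1))) * K n" if "j < n" for n
    unfolding left_total_def K_def left_wgt_eq[OF that] by (rule nn_integral_cmult) measurable
  have fin: "eventually (\<lambda>n. K n < \<infinity>) sequentially"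
    using order_tendstoD(2)[OF lim ennreal_less_top] eventually_gt_at_top[of 0]
  proof eventually_elim
    case (elim n)
    then have "ennreal (real n powr e) \<noteq> 0" by simp
    then show ?case using elim(1) by (auto simp: ennreal_mult_less_top)
  qed
  show "eventually (\<lambda>n. left_total j e n < \<infinity>) sequentially"
    using fin eventually_gt_at_top[of j] by eventually_elim (simp add: WK ennreal_mult_less_top)
  have L: "left_factor j 0 * (Gamma e * left_mean powr (- e)) \<ge> 0"
    using left_factor_pos[of 0 j] e by (simp add: Gamma_real_nonneg)
  have "(\<lambda>n. enn2real (ennreal (real n powr e) * K n)) \<longlonglongrightarrow> left_factor j 0 * (Gamma e * left_mean powr (- e))"
    by (rule tendsto_enn2real[OF lim L])
  moreover have "eventually (\<lambda>n. enn2real (ennreal (real n powr e) * K n) = real n powr e / sqrt pi ^ (n - (j + 1)) * enn2real (left_total j e n)) sequentially"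
    using eventually_gt_at_top[of j] by eventually_elim (simp add: WK enn2real_mult)
  ultimately show "(\<lambda>n. real n powr e / sqrt pi ^ (n - (j + 1)) * enn2real (left_total j e n)) \<longlonglongrightarrow> left_factor j 0 * (Gamma e * left_mean powr (- e))"
    by (rule Lim_transform_eventually)
qed

lemma left_total_pos:
  assumes e: "e > 0"
  shows "eventually (\<lambda>n. enn2real (left_total j e n) > 0) sequentially"
proof -
  have "left_factor j 0 * (Gamma e * left_mean powr (- e)) > 0"
    using left_factor_pos[of 0 j] e left_mean_pos by (intro mult_pos_pos Gamma_real_pos) auto
  from order_tendstoD(1)[OF left_total_asymp(2)[OF e] this]
  show ?thesis
  proof eventually_elim
    case (elim n)
    then have "enn2real (left_total j e n) \<noteq> 0" by auto
    then show ?case using enn2real_nonneg[of "left_total j e n"] by linarith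
  qed
qed

text \<open>The factor \<open>left_factor j 0\<close> and the powers of \<open>sqrt pi\<close> do
  not depend on the exponent and cancel in the quotient.\<close>

lemma left_total_ratio:
  assumes a: "a > 0" and b: "b > 0"
  shows "(\<lambda>n. real n powr b * (enn2real (left_total j (a + b) n) / enn2real (left_total j a n))) \<longlonglongrightarrow> Gamma (a + b) / Gamma a * left_mean powr (- b)"
proof -
  have G: "Gamma a > 0" using a by (rule Gamma_real_pos)
  have "(\<lambda>n. (real n powr (a + b) / sqrt pi ^ (n - (j + 1)) * enn2real (left_total j (a + b) n)) / (real n powr a / sqrt pi ^ (n - (j + 1)) * enn2real (left_total j a n)))
    \<longlonglongrightarrow> (left_factor j 0 * (Gamma (a + b) * left_mean powr (- (a + b)))) / (left_factor j 0 * (Gamma a * left_mean powr (- a)))"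
    using a b G left_factor_pos[of 0 j] left_mean_pos by (intro tendsto_divide left_total_asymp) (auto simp: less_imp_neq[OF G, symmetric])
  moreover have "(left_factor j 0 * (Gamma (a + b) * left_mean powr (- (a + b)))) / (left_factor j 0 * (Gamma a * left_mean powr (- a))) = Gamma (a + b) / Gamma a * left_mean powr (- b)"
  proof -
    have "left_mean powr (- (a + b)) = left_mean powr (- a) * left_mean powr (- b)" by (simp add: powr_add[symmetric])
    then show ?thesis using left_factor_pos[of 0 j] left_mean_pos by simp
  qed
  moreover have "eventually (\<lambda>n. (real n powr (a + b) / sqrt pi ^ (n - (j + 1)) * enn2real (left_total j (a + b) n)) / (real n powr a / sqrt pi ^ (n - (j + 1)) * enn2real (left_total j a n))
      = real n powr b * (enn2real (left_total j (a + b) n) / enn2real (left_total j a n))) sequentially"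
    using eventually_gt_at_top[of 0] by eventually_elim (simp add: powr_add)
  ultimately show ?thesis by (auto elim: Lim_transform_eventually)
qed

text \<open>Markov's inequality: the mean of the mixing parameter is the quotient of the total
  masses for \<open>a + 1\<close> and \<open>a\<close>, which is of order
  \<open>1 / n\<close>.\<close>

lemma left_conc:
  assumes a: "a > 0" and \<delta>: "\<delta> > 0" and \<eta>: "0 < \<eta>" "\<eta> < 1"
  shows "eventually (\<lambda>n. ennreal \<eta> * (\<integral>\<^sup>+t. left.wgt n (n - j) a t \<partial>lborel) \<le>
        (\<integral>\<^sup>+t. left.wgt n (n - j) a t * indicator {t. \<bar>t - 0\<bar> \<le> \<delta>} t \<partial>lborel)) sequentially"
proof -
  have "(\<lambda>n. (real n powr 1 * (enn2real (left_total j (a + 1) n) / enn2real (left_total j a n))) * (1 / real n)) \<longlonglongrightarrow> (Gamma (a + 1) / Gamma a * left_mean powr (- 1)) * 0"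
    by (intro tendsto_mult left_total_ratio lim_1_over_n a) simp
  moreover have "eventually (\<lambda>n. (real n powr 1 * (enn2real (left_total j (a + 1) n) / enn2real (left_total j a n))) * (1 / real n) = enn2real (left_total j (a + 1) n) / enn2real (left_total j a n)) sequentially"
    using eventually_gt_at_top[of 0] by eventually_elim simp
  ultimately have "(\<lambda>n. enn2real (left_total j (a + 1) n) / enn2real (left_total j a n)) \<longlonglongrightarrow> 0"
    by (auto elim: Lim_transform_eventually)
  then have "eventually (\<lambda>n. enn2real (left_total j (a + 1) n) / enn2real (left_total j a n) < (1 - \<eta>) * \<delta>) sequentially"
    using \<delta> \<eta> by (intro order_tendstoD(2)[where y=0]) auto
  then show ?thesis using left_total_pos[OF a, of j] left_total_asymp(1)[OF a, of j] left_total_asymp(1)[of "a + 1" j, OF add_pos_pos[OF a zero_less_one]]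
  proof eventually_elim
    case (elim n)
    let ?w = "left.wgt n (n - j) a"
    show ?case
    proof (rule ennreal_conc_of_far[where far="\<integral>\<^sup>+t. ?w t * indicator {\<delta><..} t \<partial>lborel"])
      have "(\<integral>\<^sup>+t. ?w t * indicator {\<delta><..} t \<partial>lborel) \<le> (\<integral>\<^sup>+t. ennreal (1 / \<delta>) * left.wgt n (n - j) (a + 1) t \<partial>lborel)"
      proof (rule nn_integral_mono)
        fix t :: real
        show "?w t * indicator {\<delta><..} t \<le> ennreal (1 / \<delta>) * left.wgt n (n - j) (a + 1) t"
        proof (cases "t > \<delta>")
          case True
          have "t powr (a - 1) * 1 \<le> t powr (a - 1) * (1 / \<delta> * t)"
            using True \<delta> by (intro mult_left_mono) (auto simp: field_simps)
          also have "\<dots> = 1 / \<delta> * t powr (a + 1 - 1)" using True \<delta> by (simp add: powr_diff)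
          finally have "ennreal (t powr (a - 1)) \<le> ennreal (1 / \<delta>) * ennreal (t powr (a + 1 - 1))"
            using \<delta> by (simp add: ennreal_mult'[symmetric] ennreal_leI)
          then show ?thesis using True \<delta> unfolding left.wgt_def
            by (simp add: mult.assoc[symmetric] mult_right_mono)
        qed simp
      qed
      also have "\<dots> = ennreal (1 / \<delta>) * left_total j (a + 1) n" unfolding left_total_def by (rule nn_integral_cmult) measurable
      also have "\<dots> = ennreal (1 / \<delta> * enn2real (left_total j (a + 1) n))"
        using elim(4) \<delta> by (subst ennreal_mult) (auto simp: less_top)
      also have "\<dots> \<le> ennreal ((1 - \<eta>) * enn2real (left_total j a n))"
        using elim(1,2) \<delta> by (intro ennreal_leI) (simp add: field_simps)
      also have "\<dots> = ennreal (1 - \<eta>) * (\<integral>\<^sup>+t. ?w t \<partial>lborel)"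
        using elim(3) \<eta> unfolding left_total_def by (simp add: ennreal_mult less_top)
      finally show "(\<integral>\<^sup>+t. ?w t * indicator {\<delta><..} t \<partial>lborel) \<le> ennreal (1 - \<eta>) * (\<integral>\<^sup>+t. ?w t \<partial>lborel)" .
      have "(\<integral>\<^sup>+t. ?w t \<partial>lborel) \<le> (\<integral>\<^sup>+t. ?w t * indicator {t. \<bar>t - 0\<bar> \<le> \<delta>} t + ?w t * indicator {\<delta><..} t \<partial>lborel)"
      proof (rule nn_integral_mono)
        fix t :: real
        show "?w t \<le> ?w t * indicator {t. \<bar>t - 0\<bar> \<le> \<delta>} t + ?w t * indicator {\<delta><..} t"
          by (cases "t > 0"; cases "t > \<delta>") (auto simp: left.wgt_def)
      qed
      also have "\<dots> = (\<integral>\<^sup>+t. ?w t * indicator {t. \<bar>t - 0\<bar> \<le> \<delta>} t \<partial>lborel) + (\<integral>\<^sup>+t. ?w t * indicator {\<delta><..} t \<partial>lborel)"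
        by (rule nn_integral_add) measurable
      finally show "(\<integral>\<^sup>+t. ?w t \<partial>lborel) \<le> (\<integral>\<^sup>+t. ?w t * indicator {t. \<bar>t - 0\<bar> \<le> \<delta>} t \<partial>lborel) + (\<integral>\<^sup>+t. ?w t * indicator {\<delta><..} t \<partial>lborel)" .
      show "(\<integral>\<^sup>+t. ?w t \<partial>lborel) < \<infinity>" using elim(3) by (simp add: left_total_def)
    qed (use \<eta> in auto)
  qed
qed

lemma left_Asum: "left.Asum n x = Upow n x" unfolding left.Asum_def Upow_def unfolding bexp_def ..
lemma left_Bsum: "left.Bsum n x = Spow n x" by (simp add: left.Bsum_def Spow_def)

lemma nn_integral_left_mix_weight:
  assumes c: "c > 0" and j: "j < n" and fin: "left_total j c n < \<infinity>"
  shows "(\<integral>\<^sup>+x. left.mix_weight n (n - j) c x \<partial>lborel_n n) = ennreal (real (card (idx n (n - j))) * enn2real (left_total j c n) / Gamma c)"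
proof -
  have G: "Gamma c > 0" using c by (rule Gamma_real_pos)
  have "ennreal (Gamma c) * (\<integral>\<^sup>+x. left.mix_weight n (n - j) c x \<partial>lborel_n n) = ennreal (real (card (idx n (n - j)))) * left_total j c n"
    using left.mix_eq[OF c, of "\<lambda>_. 1" n "n - j"] left.mix_one[of "n - j" n c] j
    by (simp add: left_total_def left.mix_weight_def)
  also have "\<dots> = ennreal (real (card (idx n (n - j))) * enn2real (left_total j c n))"
    using fin by (simp add: ennreal_mult less_top)
  finally have e: "ennreal (Gamma c) * (\<integral>\<^sup>+x. left.mix_weight n (n - j) c x \<partial>lborel_n n) = ennreal (real (card (idx n (n - j))) * enn2real (left_total j c n))" .
  have "(\<integral>\<^sup>+x. left.mix_weight n (n - j) c x \<partial>lborel_n n) = ennreal (1 / Gamma c) * (ennreal (Gamma c) * (\<integral>\<^sup>+x. left.mix_weight n (n - j) c x \<partial>lborel_n n))"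
    using G by (simp add: mult.assoc[symmetric] ennreal_mult[symmetric])
  also have "\<dots> = ennreal (real (card (idx n (n - j))) * enn2real (left_total j c n) / Gamma c)"
    unfolding e using G by (simp add: ennreal_mult[symmetric])
  finally show ?thesis .
qed

text \<open>Multiplying the weight by \<open>Spow n x powr (- b)\<close> only shifts its exponent
  from \<open>a\<close> to \<open>a + b\<close>, so negative moments of \<open>Spow\<close> are
  quotients of total masses.\<close>

lemma left_mix_law_moment:
  assumes a: "a > 0" and b: "b \<ge> 0" and j: "j < n" and fin: "left_total j a n < \<infinity>" "left_total j (a + b) n < \<infinity>" and pos: "enn2real (left_total j a n) > 0"
  shows "(\<integral>\<^sup>+x. ennreal (real n powr b * Spow n x powr (- b)) \<partial>left.mix_law n (n - j) a) =
    ennreal (real n powr b * (enn2real (left_total j (a + b) n) / enn2real (left_total j a n)) * (Gamma a / Gamma (a + b)))"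
proof -
  have ab: "a + b > 0" using a b by simp
  have G: "Gamma a > 0" "Gamma (a + b) > 0" using a ab by (auto intro: Gamma_real_pos)
  have cd: "real (card (idx n (n - j))) > 0" using j by (simp add: card_idx)
  have "ennreal (real n powr b * Spow n x powr (- b)) * left.mix_weight n (n - j) a x = ennreal (real n powr b) * left.mix_weight n (n - j) (a + b) x" for x
  proof (cases "Spow n x = 0")
    case False
    have "Spow n x powr (- b) * Spow n x powr (- a) = Spow n x powr (- (a + b))" by (simp add: powr_add[symmetric] add.commute)
    then have "real n powr b * Spow n x powr (- b) * (exp (- Upow n x) * Spow n x powr (- a) * hsym n (n - j) x) =
      real n powr b * (exp (- Upow n x) * Spow n x powr (- (a + b)) * hsym n (n - j) x)" by simp
    then show ?thesis unfolding left.mix_weight_def left_Asum left_Bsum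
      by (subst (1 2) ennreal_mult[symmetric]) auto
  qed (simp add: left.mix_weight_def hsym_zero)
  then have "(\<integral>\<^sup>+x. ennreal (real n powr b * Spow n x powr (- b)) \<partial>left.mix_law n (n - j) a) =
    (\<integral>\<^sup>+x. ennreal (real n powr b) * left.mix_weight n (n - j) (a + b) x \<partial>lborel_n n) / (\<integral>\<^sup>+x. left.mix_weight n (n - j) a x \<partial>lborel_n n)"
    by (subst left.nn_integral_mix_law) auto
  also have "(\<integral>\<^sup>+x. ennreal (real n powr b) * left.mix_weight n (n - j) (a + b) x \<partial>lborel_n n) =
     ennreal (real n powr b * (real (card (idx n (n - j))) * enn2real (left_total j (a + b) n) / Gamma (a + b)))"
    by (subst nn_integral_cmult) (use G in \<open>auto simp only: nn_integral_left_mix_weight[OF ab j fin(2)] ennreal_mult'[symmetric] powr_ge_zero measurable_lborel1 left.measurable_mix_weight\<close>)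
  also have "\<dots> / (\<integral>\<^sup>+x. left.mix_weight n (n - j) a x \<partial>lborel_n n) =
    ennreal (real n powr b * (real (card (idx n (n - j))) * enn2real (left_total j (a + b) n) / Gamma (a + b)) /
      (real (card (idx n (n - j))) * enn2real (left_total j a n) / Gamma a))"
    unfolding nn_integral_left_mix_weight[OF a j fin(1)] using G cd pos by (intro divide_ennreal) auto
  also have "real n powr b * (real (card (idx n (n - j))) * enn2real (left_total j (a + b) n) / Gamma (a + b)) /
      (real (card (idx n (n - j))) * enn2real (left_total j a n) / Gamma a) =
    real n powr b * (enn2real (left_total j (a + b) n) / enn2real (left_total j a n)) * (Gamma a / Gamma (a + b))"
  proof -
    have "x * (N * T' / g') / (N * T / g) = x * (T' / T) * (g / g')" if "N > 0" "T > 0" "g > 0" "g' > 0" for x N T T' g g' :: real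
      using that by (simp add: field_simps)
    then show ?thesis using G cd pos by blast
  qed
  finally show ?thesis .
qed

text \<open>The accessible moments are those of \<open>n / Spow n x\<close>, so the deviation
  estimate is applied to this reciprocal, which concentrates at
  \<open>1 / left_mean\<close>.\<close>

lemma left_dev:
  assumes a: "a > 0" and e: "\<epsilon> > 0"
  shows "(\<lambda>n. measure (left.mix_law n (n - j) a)
      {x \<in> space (lborel_n n). \<epsilon> \<le> \<bar>real n powr (1 / p) * Spow n x powr (- 1 / p) - left_mean powr (- 1 / p)\<bar>}) \<longlonglongrightarrow> 0"
proof -
  let ?P = "\<lambda>n. left.mix_law n (n - j) a"
  define m where "m b n = real n powr b * (enn2real (left_total j (a + b) n) / enn2real (left_total j a n)) * (Gamma a / Gamma (a + b))" for b n
  have mlim: "m b \<longlonglongrightarrow> left_mean powr (- b)" if b: "b > 0" for b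
  proof -
    have G: "Gamma a > 0" "Gamma (a + b) > 0" using a b by (auto intro: Gamma_real_pos)
    have "m b \<longlonglongrightarrow> Gamma (a + b) / Gamma a * left_mean powr (- b) * (Gamma a / Gamma (a + b))"
      unfolding m_def by (intro tendsto_mult left_total_ratio a b tendsto_const)
    then show ?thesis using G by (simp add: field_simps)
  qed
  have ev: "eventually (\<lambda>n. j < n \<and> enn2real (left_total j a n) > 0 \<and> left_total j a n < \<infinity> \<and> left_total j (a + 1) n < \<infinity> \<and> left_total j (a + 2) n < \<infinity>) sequentially"
    using a by (intro eventually_conj eventually_gt_at_top left_total_pos left_total_asymp(1)) auto
  have g: "isCont (\<lambda>v. v powr (1 / p)) (1 / left_mean)" using left_mean_pos by (intro continuous_intros) auto
  have "(\<lambda>n. measure (?P n) {x \<in> space (?P n). \<epsilon> \<le> \<bar>(real n / Spow n x) powr (1 / p) - (1 / left_mean) powr (1 / p)\<bar>}) \<longlonglongrightarrow> 0"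
  proof (rule prob_dev_tendsto[where ?a1.0="m 1" and ?a2.0="m 2", OF _ _ _ _ _ g e])
    show "eventually (\<lambda>n. prob_space (?P n) \<and> (\<integral>\<^sup>+x. ennreal (real n / Spow n x) \<partial>?P n) = ennreal (m 1 n) \<and>
      (\<integral>\<^sup>+x. ennreal ((real n / Spow n x)\<^sup>2) \<partial>?P n) = ennreal (m 2 n) \<and> 0 \<le> m 1 n \<and> 0 \<le> m 2 n) sequentially"
      using ev
    proof eventually_elim
      case (elim n)
      have G: "Gamma a > 0" "Gamma (a + 1) > 0" "Gamma (a + 2) > 0" using a by (auto intro: Gamma_real_pos)
      have "prob_space (?P n)"
      proof
        have "emeasure (?P n) (space (?P n)) = (\<integral>\<^sup>+x. 1 \<partial>?P n)" by simp
        also have "\<dots> = (\<integral>\<^sup>+x. left.mix_weight n (n - j) a x \<partial>lborel_n n) / (\<integral>\<^sup>+x. left.mix_weight n (n - j) a x \<partial>lborel_n n)"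
          by (subst left.nn_integral_mix_law) auto
        also have "\<dots> = 1"
        proof (rule ennreal_divide_self)
          have "real (card (idx n (n - j))) > 0" using elim by (simp add: card_idx)
          then show "(\<integral>\<^sup>+x. left.mix_weight n (n - j) a x \<partial>lborel_n n) \<noteq> 0"
            using elim a by (subst nn_integral_left_mix_weight) (auto simp: mult_le_0_iff divide_le_0_iff dest: Gamma_real_pos)
          show "(\<integral>\<^sup>+x. left.mix_weight n (n - j) a x \<partial>lborel_n n) < \<top>"
            using elim a by (subst nn_integral_left_mix_weight) auto
        qed
        finally show "emeasure (?P n) (space (?P n)) = 1" .
      qed
      moreover have "real n / Spow n x = real n powr 1 * Spow n x powr (- 1)" for x
        using Spow_nonneg[of n x] by (simp add: powr_minus_divide)
      moreover have "(real n / Spow n x)\<^sup>2 = real n powr 2 * Spow n x powr (- 2)" for x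
        using Spow_nonneg[of n x] by (simp add: powr_minus_divide power_divide)
      moreover have "0 \<le> m 1 n" "0 \<le> m 2 n" unfolding m_def using G by auto
      ultimately show ?case
        using left_mix_law_moment[OF a, of 1 j n] left_mix_law_moment[OF a, of 2 j n] elim by (simp only: m_def)
    qed
    show "m 1 \<longlonglongrightarrow> 1 / left_mean" using mlim[of 1] left_mean_pos by (simp add: powr_minus_divide)
    show "m 2 \<longlonglongrightarrow> (1 / left_mean)\<^sup>2" using mlim[of 2] left_mean_pos by (simp add: powr_minus_divide power_divide)
  qed auto
  moreover have "(1 / left_mean) powr (1 / p) = left_mean powr (- 1 / p)" using left_mean_pos by (simp add: powr_divide powr_minus_divide)
  moreover have "(real n / Spow n x) powr (1 / p) = real n powr (1 / p) * Spow n x powr (- 1 / p)" for n x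
    by (simp add: powr_divide powr_minus_divide)
  moreover have "space (?P n) = space (lborel_n n)" for n by (simp add: left.mix_law_def)
  ultimately show ?thesis by (simp only:)
qed

text \<open>Here \<open>\<alpha> = 0\<close>, so all coordinates are asymptotically of
  \<open>dphi\<close> type, and \<open>\<theta> = 0\<close>. The limit consists of independent
  coordinates with law \<open>left_measure\<close>, rescaled by the limiting radius.\<close>

lemma left_limit:
  fixes M :: "nat \<Rightarrow> 'a measure" and X :: "nat \<Rightarrow> 'a \<Rightarrow> nat \<Rightarrow> real" and j :: "nat \<Rightarrow> nat"
  assumes j: "\<And>n. n \<ge> 2 \<Longrightarrow> j n < n"
    and M: "\<And>n. n \<ge> 2 \<Longrightarrow> prob_space (M n)"
    and X: "\<And>n. n \<ge> 2 \<Longrightarrow> X n \<in> measurable (M n) (bdry_space n (lp_ball p n))"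
    and law: "\<And>n A. n \<ge> 2 \<Longrightarrow> A \<in> sets (bdry_space n (lp_ball p n)) \<Longrightarrow>
       measure (M n) (X n -` A \<inter> space (M n)) =
         measure (curvature_measure n (lp_ball p n) (j n)) A / intrinsic_volume n (lp_ball p n) (j n)"
    and j0: "eventually (\<lambda>n. j n = j0) sequentially"
  shows "weakly_conv_n r (\<lambda>n. scaled_marginal_law p r (M n) n (X n)) (scaled_iid_law r (left_mean powr (- 1 / p)) (left.limit_density 0 0))"
proof (rule left.weak_limit[where j=j and k="\<lambda>n. kernel2 n (n - j n)" and C="\<lambda>n. p / (2 * p - 2) * Gamma (real (n - j n) / 2)" and c="\<lambda>n. j n / p + 1"])
  have a: "real j0 / p + 1 > 0" using p_gt_1 by (simp add: add_nonneg_pos)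
  show "(\<lambda>n. real (j n) / real n) \<longlonglongrightarrow> 0"
  proof -
    have "(\<lambda>n. real j0 * (1 / real n)) \<longlonglongrightarrow> real j0 * 0" by (intro tendsto_intros lim_1_over_n)
    moreover have "eventually (\<lambda>n. real j0 * (1 / real n) = real (j n) / real n) sequentially" using j0 by eventually_elim simp
    ultimately show ?thesis by (auto elim: Lim_transform_eventually)
  qed
  show "eventually (\<lambda>n. ennreal \<eta> * (\<integral>\<^sup>+t. left.wgt n (n - j n) (j n / p + 1) t \<partial>lborel) \<le>
        (\<integral>\<^sup>+t. left.wgt n (n - j n) (j n / p + 1) t * indicator {t. \<bar>t - 0\<bar> \<le> \<delta>} t \<partial>lborel)) sequentially"
    if "\<delta> > 0" "0 < \<eta>" "\<eta> < 1" for \<delta> \<eta>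
    using j0 left_conc[OF a that, of j0] by eventually_elim simp
  show "(\<lambda>n. measure (left.mix_law n (n - j n) (j n / p + 1))
      {x \<in> space (lborel_n n). \<epsilon> \<le> \<bar>real n powr (1 / p) * Spow n x powr (- 1 / p) - left_mean powr (- 1 / p)\<bar>}) \<longlonglongrightarrow> 0" if "\<epsilon> > 0" for \<epsilon>
  proof (rule Lim_transform_eventually[OF left_dev[OF a that, of j0]])
    show "eventually (\<lambda>n. measure (left.mix_law n (n - j0) (j0 / p + 1))
      {x \<in> space (lborel_n n). \<epsilon> \<le> \<bar>real n powr (1 / p) * Spow n x powr (- 1 / p) - left_mean powr (- 1 / p)\<bar>} =
      measure (left.mix_law n (n - j n) (j n / p + 1))
      {x \<in> space (lborel_n n). \<epsilon> \<le> \<bar>real n powr (1 / p) * Spow n x powr (- 1 / p) - left_mean powr (- 1 / p)\<bar>}) sequentially"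
      using j0 by eventually_elim simp
  qed
next
  fix n :: nat assume n: "2 \<le> n"
  show "0 < p / (2 * p - 2) * Gamma (real (n - j n) / 2)"
    using p_gt_1 j[OF n] by (intro mult_pos_pos Gamma_real_pos) auto
  show "0 < real (j n) / p + 1" using p_gt_1 by (simp add: add_nonneg_pos)
  fix x
  show "kernel2 n (n - j n) x * ennreal ((Spow n x powr (1 / p) / sqrt (Upow n x)) ^ (n - j n) * hsym n (n - j n) x) =
      left.mix_weight n (n - j n) (real (j n) / p + 1) x"
    unfolding left.mix_weight_def left_Asum left_Bsum by (rule kernel2_weight[OF j[OF n]])
next
  fix n w assume n: "2 \<le> (n::nat)" and w: "Spow n w = 1"
  show "(\<integral>\<^sup>+N. ennreal (N powr (n / p)) * kernel2 n (n - j n) (scale_n n (N powr (1 / p)) w) * indicator {0<..} N \<partial>lborel) =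
     ennreal (p / (2 * p - 2) * Gamma (real (n - j n) / 2))"
    by (rule kernel2_admissible[OF _ w]) (use j[OF n] in simp)
qed (use j M X law in auto)

text \<open>The limit found above has coefficient \<open>1\<close> in the exponent and scale
  \<open>left_mean powr (- 1 / p)\<close>, whereas the statement prescribes the scale
  \<open>p powr (1 / p)\<close>. The dilation \<open>b\<close> between the two satisfies
  \<open>b powr (2 * p - 2) = lambda0 p\<close>, which is where \<open>lambda0\<close> comes
  from.\<close>

lemma left_density_rescale:
  defines "b \<equiv> lambda0 p powr (1 / (2 * p - 2))"
  shows "b > 0" "left_density p = (\<lambda>u. b * left.limit_density 0 0 (b * u))" "p powr (1 / p) / b = left_mean powr (- 1 / p)"
proof -
  have l: "lambda0 p = (p * left_mean) powr (2 * (p - 1) / p)" by (simp add: lambda0_def left_mean_def)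
  have pl: "p * left_mean > 0" using p_gt_1 left_mean_pos by simp
  have l0: "lambda0 p > 0" using pl unfolding l by (simp only: powr_gt_zero)
  show b: "b > 0" using l0 by (simp add: b_def)
  have "b = (p * left_mean) powr (1 / p)"
    unfolding b_def l powr_powr by (rule arg_cong[where f="\<lambda>z. (p * left_mean) powr z"]) (use p_gt_1 in \<open>simp add: field_simps\<close>)
  also have "\<dots> = p powr (1 / p) * left_mean powr (1 / p)" using p_gt_1 left_mean_pos by (simp add: powr_mult)
  finally show "p powr (1 / p) / b = left_mean powr (- 1 / p)"
    using p_gt_1 left_mean_pos by (simp add: powr_minus_divide)
  have b1: "b powr (p - 1) = sqrt (lambda0 p)"
  proof -
    have "b powr (p - 1) = lambda0 p powr (1 / 2)"
      unfolding b_def powr_powr by (rule arg_cong[where f="\<lambda>z. lambda0 p powr z"]) (use p_gt_1 in \<open>simp add: field_simps\<close>)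
    then show ?thesis using l0 by (simp add: powr_half_sqrt)
  qed
  have b2: "b powr bexp = lambda0 p"
    unfolding b_def powr_powr using p_gt_1 l0 by (simp add: bexp_def)
  have b3: "b * b powr (p - 2) = sqrt (lambda0 p)"
  proof -
    have "b powr 1 * b powr (p - 2) = b powr (1 + (p - 2))" by (simp only: powr_add)
    also have "1 + (p - 2) = p - 1" by simp
    finally show ?thesis using b b1 by simp
  qed
  show "left_density p = (\<lambda>u. b * left.limit_density 0 0 (b * u))"
  proof
    fix u
    have "\<bar>b * u\<bar> powr bexp = lambda0 p * \<bar>u\<bar> powr bexp"
      using b b2 by (simp add: abs_mult powr_mult)
    then have base: "left.base 0 (b * u) = exp (- lambda0 p * \<bar>u\<bar> powr bexp)" unfolding left.base_def by simp
    have "b * dphi (b * u) = (p - 1) * (b * b powr (p - 2)) * \<bar>u\<bar> powr (p - 2)"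
      using b unfolding dphi_def by (simp add: abs_mult powr_mult)
    then have d: "b * dphi (b * u) = (p - 1) * sqrt (lambda0 p) * \<bar>u\<bar> powr (p - 2)" unfolding b3 .
    have "b * left.limit_density 0 0 (b * u) = (b * dphi (b * u)) * exp (- lambda0 p * \<bar>u\<bar> powr bexp) / sqrt pi"
      by (simp add: left.limit_density_def base left_rJ_0)
    also have "\<dots> = left_density p u" unfolding d left_density_def unfolding bexp_def by simp
    finally show "left_density p u = b * left.limit_density 0 0 (b * u)" ..
  qed
qed

lemma left_law_eq: "scaled_iid_law r (p powr (1 / p)) (left_density p) = scaled_iid_law r (left_mean powr (- 1 / p)) (left.limit_density 0 0)"
proof -
  have "prob_space (density lborel (\<lambda>u. ennreal (left.limit_density 0 0 u)))" by (rule left.prob_space_limit_density) auto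
  then show ?thesis
    unfolding left_density_rescale(2)
    by (subst scaled_iid_law_rescale) (use left_density_rescale(1,3) in \<open>auto intro: left.limit_density_nonneg\<close>)
qed

text \<open>At \<open>\<alpha> = 1\<close> the second summand of the bulk density disappears, and at
  \<open>\<theta> = 0\<close> the normalization is an explicit Gamma value.\<close>

lemma bulk_density_right: "bulk_density p 1 0 = p_gaussian_density p"
proof -
  have "(\<integral>\<^sup>+x. ennreal (exp (- (\<bar>x\<bar> powr p) - 0 * \<bar>x\<bar> powr (2 * p - 2))) \<partial>lborel) = (\<integral>\<^sup>+x. ennreal (\<bar>x\<bar> powr 0 * exp (- (1 * \<bar>x\<bar> powr p))) \<partial>lborel)"
    by (rule nn_integral_cong_AE, use AE_lborel_singleton[of 0] in eventually_elim) auto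
  also have "\<dots> = ennreal (2 / p * Gamma ((0 + 1) / p) * 1 powr (- ((0 + 1) / p)))"
    by (rule nn_integral_abs_powr_exp) (use p_gt_1 in auto)
  also have "\<dots> = ennreal (2 * Gamma (1 + 1 / p))"
  proof -
    have "Gamma (1 / p + 1) = 1 / p * Gamma (1 / p)"
      by (rule Gamma_plus1) (use p_gt_1 nonpos_Ints_nonpos[of "1 / p"] in \<open>auto simp: divide_le_0_iff\<close>)
    then show ?thesis by (simp add: add.commute)
  qed
  finally have n: "(\<integral>\<^sup>+x. ennreal (exp (- (\<bar>x\<bar> powr p) - 0 * \<bar>x\<bar> powr (2 * p - 2))) \<partial>lborel) = ennreal (2 * Gamma (1 + 1 / p))" .
  have "Gamma (1 + 1 / p) > 0" using p_gt_1 by (intro Gamma_real_pos) (simp add: add_pos_pos)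
  then have "I_int p 0 = 2 * Gamma (1 + 1 / p)"
    unfolding I_int_def by (subst integral_eq_nn_integral) (measurable, auto simp only: n enn2real_ennreal exp_ge_zero intro!: AE_I2 mult_nonneg_nonneg)
  then show ?thesis by (simp add: fun_eq_iff bulk_density_def p_gaussian_density_def)
qed

end

theorem theorem3p1:
  fixes p :: real and j :: "nat \<Rightarrow> nat"
    and M :: "nat \<Rightarrow> 'a measure" and X :: "nat \<Rightarrow> 'a \<Rightarrow> nat \<Rightarrow> real"
  assumes p: "1 < p"
    and j: "\<And>n. n \<ge> 2 \<Longrightarrow> j n < n"
    and M: "\<And>n. n \<ge> 2 \<Longrightarrow> prob_space (M n)"
    and X: "\<And>n. n \<ge> 2 \<Longrightarrow> X n \<in> measurable (M n) (bdry_space n (lp_ball p n))"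
    and law: "\<And>n A. n \<ge> 2 \<Longrightarrow> A \<in> sets (bdry_space n (lp_ball p n)) \<Longrightarrow>
       measure (M n) (X n -` A \<inter> space (M n)) =
         measure (curvature_measure n (lp_ball p n) (j n)) A / intrinsic_volume n (lp_ball p n) (j n)"
  shows
    "(\<forall>\<alpha>. 0 < \<alpha> \<and> \<alpha> < 1 \<and> (\<lambda>n. real (j n) / real n) \<longlonglongrightarrow> \<alpha> \<longrightarrow>
        (\<exists>!\<theta>. is_theta p \<alpha> \<theta>) \<and>
        (\<forall>r\<ge>1. weakly_conv_n r (\<lambda>n. scaled_marginal_law p r (M n) n (X n))
          (scaled_iid_law r ((p / \<alpha>) powr (1 / p)) (bulk_density p \<alpha> (THE \<theta>. is_theta p \<alpha> \<theta>))))) \<and>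
     (\<forall>j0. (\<forall>\<^sub>F n in sequentially. j n = j0) \<longrightarrow>
        (\<forall>r\<ge>1. weakly_conv_n r (\<lambda>n. scaled_marginal_law p r (M n) n (X n))
          (scaled_iid_law r (p powr (1 / p)) (left_density p)))) \<and>
     (\<forall>m\<ge>1. (\<forall>\<^sub>F n in sequentially. j n = n - m) \<longrightarrow>
        (\<forall>r\<ge>1. weakly_conv_n r (\<lambda>n. scaled_marginal_law p r (M n) n (X n))
          (scaled_iid_law r (p powr (1 / p)) (p_gaussian_density p))))"
proof -
  interpret lp_exponent p by unfold_locales (rule p)
  show ?thesis
  proof (intro conjI allI impI; (elim conjE)?)
    fix \<alpha> assume \<alpha>: "0 < \<alpha>" "\<alpha> < 1" and lim: "(\<lambda>n. real (j n) / real n) \<longlonglongrightarrow> \<alpha>"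
    have y: "(1 - \<alpha>) * p / (2 * \<alpha>) > 0" using \<alpha> p by simp
    show ex: "\<exists>!\<theta>. is_theta p \<alpha> \<theta>" using Gfun_unique_solution[OF y] by (simp only: is_theta_iff[OF \<alpha>(1)])
    fix r :: nat
    define \<theta> where "\<theta> = (THE \<theta>. is_theta p \<alpha> \<theta>)"
    have "is_theta p \<alpha> \<theta>" unfolding \<theta>_def by (rule theI'[OF ex])
    then have \<theta>: "\<theta> > 0" "Gfun \<theta> = (1 - \<alpha>) * p / (2 * \<alpha>)" by (auto simp: is_theta_iff[OF \<alpha>(1)])
    have "weakly_conv_n r (\<lambda>n. scaled_marginal_law p r (M n) n (X n)) (scaled_iid_law r ((p / \<alpha>) powr (1 / p)) (bulk_density p \<alpha> \<theta>))"
      by (rule bulk_limit[OF j M X law lim]) (use \<alpha> \<theta> in auto)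
    then show "weakly_conv_n r (\<lambda>n. scaled_marginal_law p r (M n) n (X n))
          (scaled_iid_law r ((p / \<alpha>) powr (1 / p)) (bulk_density p \<alpha> (THE \<theta>. is_theta p \<alpha> \<theta>)))" by (simp only: \<theta>_def)
  next
    fix j0 r :: nat assume "\<forall>\<^sub>F n in sequentially. j n = j0"
    then show "weakly_conv_n r (\<lambda>n. scaled_marginal_law p r (M n) n (X n)) (scaled_iid_law r (p powr (1 / p)) (left_density p))"
      unfolding left_law_eq by (intro left_limit[OF j M X law])
  next
    fix m r :: nat assume e: "\<forall>\<^sub>F n in sequentially. j n = n - m"
    have "(\<lambda>n. 1 - real m * (1 / real n)) \<longlonglongrightarrow> 1 - real m * 0" by (intro tendsto_intros lim_1_over_n)
    moreover have "\<forall>\<^sub>F n in sequentially. 1 - real m * (1 / real n) = real (j n) / real n"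
      using e eventually_ge_at_top[of "m + 1"] by eventually_elim (simp add: of_nat_diff diff_divide_distrib)
    ultimately have lim: "(\<lambda>n. real (j n) / real n) \<longlonglongrightarrow> 1" by (auto elim: Lim_transform_eventually)
    have "weakly_conv_n r (\<lambda>n. scaled_marginal_law p r (M n) n (X n)) (scaled_iid_law r ((p / 1) powr (1 / p)) (bulk_density p 1 0))"
      by (rule bulk_limit[OF j M X law lim]) (auto simp: Gfun_def)
    then show "weakly_conv_n r (\<lambda>n. scaled_marginal_law p r (M n) n (X n)) (scaled_iid_law r (p powr (1 / p)) (p_gaussian_density p))"
      by (simp add: bulk_density_right)
  qed
qed

end
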